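(* Let $m\ge1$, let $\mathfrak m$ be any maximal ideal in $\mathbf K\mathcal P_m^{\Sigma_m}$, and let $d$ be the degree of the field extension $\mathbf K\mathcal P_m^{\Sigma_m}/\mathfrak m$ of $\mathbf K$. Then $$\dim_{\mathbf K}\frac{W_q(m)}{W_q(m)\mathfrak m}=2^md.$$
   Context: **The algebra.** Let $q$ be an indeterminate, $\mathbf K=\mathbb C(q)$, $[k]=\frac{q^k-q^{-k}}{q-q^{-1}}$. $\mathbf U_q$ is the $\mathbf K$-algebra with generators $\mathbf x_r^\pm$ ($r\in\mathbb Z$), $\mathbf h_r$ ($r\in\mathbb Z\setminus\{0\}$), $K^{\pm1}$ and relations: $KK^{-1}=K^{-1}K=1$; $K\mathbf h_r=\mathbf h_rK$; $K\mathbf x_r^\pm K^{-1}=q^{\pm2}\mathbf x_r^\pm$; $[\mathbf h_r,\mathbf h_s]=0$; $[\mathbf h_r,\mathbf x_s^\pm]=\pm\frac1r[2r]\mathbf x_{r+s}^\pm$; $\mathbf x_{r+1}^\pm\mathbf x_s^\pm-q^{\pm2}\mathbf x_s^\pm\mathbf x_{r+1}^\pm=q^{\pm2}\mathbf x_r^\pm\mathbf x_{s+1}^\pm-\mathbf x_{s+1}^\pm\mathbf x_r^\pm$; $[\mathbf x_r^+,\mathbf x_s^-]=\frac{\psi^+_{r+s}-\psi^-_{r+s}}{q-q^{-1}}$, where $\sum_{r\ge0}\psi^\pm_{\pm r}u^{\pm r}=K^{\pm1}\exp\big(\pm(q-q^{-1})\sum_{s\ge1}\mathbf h_{\pm s}u^{\pm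 s}\big)$ (and $\psi^+_r=0$ for $r<0$, $\psi^-_r=0$ for $r>0$). $\mathbf U_q(0)$ is the subalgebra generated by the $\mathbf h_r$. Define $\mathbf\Lambda_{\pm r}\in\mathbf U_q(0)$ ($r\ge0$) by $\mathbf\Lambda^\pm(u)=\sum_{r\ge0}\mathbf\Lambda_{\pm r}u^r=\exp\big(-\sum_{k\ge1}\frac{\mathbf h_{\pm k}}{[k]}u^k\big)$. **The module $W_q(m)$.** Put $\tilde{\mathbf X}^-(u)=\sum_{k\in\mathbb Z}\mathbf x_k^-u^{k+1}$ and $\mathbf X_0^-(u)=\sum_{k\ge0}\mathbf x_k^-u^{k+1}$; $f_s$ denotes the coefficient of $u^s$ in a series $f$. $I_q(m)$ is the left ideal of $\mathbf U_q$ generated by: $\mathbf x_k^+$ ($k\in\mathbb Z$); $K-q^m$; $\mathbf\Lambda_r$ ($|r|>m$); $\mathbf\Lambda_m\mathbf\Lambda_{-r}-\mathbf\Lambda_{m-r}$ ($1\le r\le m$); all elements of $(\tilde{\mathbf X}^-(u)\mathbf\Lambda^+(u))_r\,\mathbf U_q(0)$ ($r\in\mathbb Z$); all elements of $(\mathbf X_0^-(u)^r\mathbf\Lambda^+(u))_s\,\mathbf U_q(0)$ ($r\ge1$, $|s|>m$). Set $W_q(m)=\mathbf U_q/I_q(m)$ and let $w_m$ be the image of $1$. $W_q(m)$ is a left $\mathbf U_q$-module and a right $\mathbf U_q(0)$-module (by right multiplication). Let $I_q(m,0)$ be the left ideal of the commutative algebra $\mathbf U_q(0)$ generated by $\mathbf\Lambda_r$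 ($|r|>m$) and $\mathbf\Lambda_m\mathbf\Lambda_{-r}-\mathbf\Lambda_{m-r}$ ($1\le r\le m$); then $\mathbf U_q(0).w_m\cong\mathbf U_q(0)/I_q(m,0)\cong\mathbf K[\mathbf\Lambda_1,\dots,\mathbf\Lambda_m,\mathbf\Lambda_m^{-1}]$. Let $\mathcal P_m=\mathbb C[t_1^{\pm1},\dots,t_m^{\pm1}]$, $\mathcal P_m^{\Sigma_m}$ the ring of symmetric Laurent polynomials ($\Sigma_m$ the symmetric group), and $\mathbf K\mathcal P_m^{\Sigma_m}=\mathcal P_m^{\Sigma_m}\otimes_{\mathbb C}\mathbf K$. One identifies $\mathbf U_q(0)/I_q(m,0)$ with $\mathbf K\mathcal P_m^{\Sigma_m}$, $\mathbf\Lambda_r$ corresponding to $(-1)^re_r(t_1,\dots,t_m)$ ($1\le r\le m$, $e_r$ the elementary symmetric polynomial); this makes $W_q(m)$ a right $\mathbf K\mathcal P_m^{\Sigma_m}$-module.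
   Formalization: In the two families of generators of I_q(m) that involve X̃^-(u) and X_0^-(u)^r, Λ^+(u) is replaced by Λ^+(qu); with Λ^+(u) as printed, W_q(m)=0 (for m=1, applying x_0^+ to x_1^-+x_0^-Λ_1 gives Λ_1 w_m=0), so the claim would be false. *)

theory Defs
  imports
    "HOL-Library.Poly_Mapping"
    "HOL-Library.Extended_Nat"
    "HOL-Computational_Algebra.Fraction_Field"
    "HOL-Computational_Algebra.Formal_Power_Series"
    "HOL-Combinatorics.Permutations"
    "HOL-Algebra.QuotRing"
    "Jordan_Normal_Form.VS_Connect"
begin

section \<open>The base field\<close>

type_synonym K = "complex poly fract"

definition qK :: K where
  "qK = Fract [:0, 1:] 1"

definition q_int :: "int \<Rightarrow> K" where
  "q_int k = (qK powi k - qK powi (- k)) / (qK - inverse qK)"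

lemma qK_nonzero: "qK \<noteq> 0"
  by (simp add: qK_def Zero_fract_def eq_fract)

lemma qK_neq_1: "qK \<noteq> 1"
  by (simp add: qK_def One_fract_def eq_fract one_pCons)

lemma qK_sq_neq_1: "qK * qK \<noteq> 1"
  by (simp add: qK_def One_fract_def eq_fract one_pCons)

lemma qK_neq_inverse: "qK - inverse qK \<noteq> 0"
proof
  assume "qK - inverse qK = 0"
  then have "qK * qK = qK * inverse qK" by simp
  also have "\<dots> = 1" using qK_nonzero by (rule right_inverse)
  finally show False using qK_sq_neq_1 by contradiction
qed

lemma q_int_1 [simp]: "q_int 1 = 1"
proof -
  have "q_int 1 = (qK - inverse qK) / (qK - inverse qK)"
    unfolding q_int_def by (simp only: power_int_minus power_int_1_right)
  also have "\<dots> = 1" using qK_neq_inverse by (rule divide_self)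
  finally show ?thesis .
qed


section \<open>The free algebra on the Drinfeld generators\<close>

datatype pm = Plus | Minus

fun pm_sign :: "pm \<Rightarrow> int" where
  "pm_sign Plus = 1"
| "pm_sign Minus = - 1"

text \<open>
  \<open>GX e r\<close> stands for $x_r^e$, \<open>GH r\<close> for $h_r$, \<open>GK e\<close> for $K^{\pm 1}$. The letter \<open>GH 0\<close>
  is superfluous and is killed by a defining relation below.
\<close>

datatype gen = GX pm int | GH int | GK pm

datatype gword = Word (letters: "gen list")

instantiation gword :: monoid_add
begin

definition "0 = Word []"

definition "v + w = Word (letters v @ letters w)"

instance
  by standard (simp_all add: zero_gword_def plus_gword_def)

end

text \<open>The monoid algebra over \<open>K\<close> of the free monoid on \<^typ>\<open>gen\<close>.\<close>

type_synonym falg = "gword \<Rightarrow>\<^sub>0 K"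

definition scal_f :: "K \<Rightarrow> falg" where
  "scal_f c = Poly_Mapping.single 0 c"

definition gen_f :: "gen \<Rightarrow> falg" where
  "gen_f g = Poly_Mapping.single (Word [g]) 1"

abbreviation "x_f e r \<equiv> gen_f (GX e r)"
abbreviation "h_f r \<equiv> gen_f (GH r)"
abbreviation "K_f e \<equiv> gen_f (GK e)"

text \<open>
  The exponential of a power series \<open>f\<close> without constant term and with coefficients in a (not
  necessarily commutative) \<open>K\<close>-algebra with structure map \<open>\<iota>\<close>; the coefficient of $u^n$ in
  $f^i$ vanishes for $i > n$.
\<close>

definition alg_exp :: "(K \<Rightarrow> 'a::ring_1) \<Rightarrow> 'a fps \<Rightarrow> 'a fps" where
  "alg_exp \<iota> f = Abs_fps (\<lambda>n. \<Sum>i\<le>n. \<iota> (1 / of_nat (fact i)) * fps_nth (f ^ i) n)"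

definition coeff_int :: "'a::zero fps \<Rightarrow> int \<Rightarrow> 'a" where
  "coeff_int f s = (if s < 0 then 0 else fps_nth f (nat s))"

text \<open>
  The series $\sum_{r \ge 0} \psi^\pm_{\pm r} v^r$, with $v = u^{\pm 1}$. It is formed in the free
  algebra, where the $h_r$ do not commute yet; only its image in $U_q$ matters.
\<close>

definition psi_series :: "pm \<Rightarrow> falg fps" where
  "psi_series e = fps_const (K_f e) *
     alg_exp scal_f (fps_const (scal_f (of_int (pm_sign e) * (qK - inverse qK))) *
       Abs_fps (\<lambda>s. if s = 0 then 0 else h_f (pm_sign e * int s)))"

definition psi_f :: "pm \<Rightarrow> int \<Rightarrow> falg" where
  "psi_f e r = coeff_int (psi_series e) (pm_sign e * r)"


section \<open>The algebra \<open>U\<^sub>q\<close>\<close>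

inductive_set Uq_rels :: "falg set" where
  K_inv: "K_f Plus * K_f Minus - 1 \<in> Uq_rels"
| inv_K: "K_f Minus * K_f Plus - 1 \<in> Uq_rels"
| K_h: "r \<noteq> 0 \<Longrightarrow> K_f Plus * h_f r - h_f r * K_f Plus \<in> Uq_rels"
| K_x: "K_f Plus * x_f e r * K_f Minus - scal_f (qK powi (2 * pm_sign e)) * x_f e r \<in> Uq_rels"
| h_h: "r \<noteq> 0 \<Longrightarrow> s \<noteq> 0 \<Longrightarrow> h_f r * h_f s - h_f s * h_f r \<in> Uq_rels"
| h_x: "r \<noteq> 0 \<Longrightarrow>
    h_f r * x_f e s - x_f e s * h_f r
      - scal_f (of_int (pm_sign e) * (1 / of_int r) * q_int (2 * r)) * x_f e (r + s) \<in> Uq_rels"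
| x_x: "(x_f e (r + 1) * x_f e s - scal_f (qK powi (2 * pm_sign e)) * x_f e s * x_f e (r + 1))
      - (scal_f (qK powi (2 * pm_sign e)) * x_f e r * x_f e (s + 1) - x_f e (s + 1) * x_f e r)
      \<in> Uq_rels"
| xp_xm: "(x_f Plus r * x_f Minus s - x_f Minus s * x_f Plus r)
      - scal_f (1 / (qK - inverse qK)) * (psi_f Plus (r + s) - psi_f Minus (r + s)) \<in> Uq_rels"
| h_0: "h_f 0 \<in> Uq_rels"

definition left_ideal :: "'a::ring_1 set \<Rightarrow> bool" where
  "left_ideal I \<longleftrightarrow> 0 \<in> I \<and> (\<forall>a\<in>I. \<forall>b\<in>I. a + b \<in> I) \<and> (\<forall>c. \<forall>a\<in>I. c * a \<in> I)"

definition two_sided_ideal :: "'a::ring_1 set \<Rightarrow> bool" where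
  "two_sided_ideal I \<longleftrightarrow> left_ideal I \<and> (\<forall>c. \<forall>a\<in>I. a * c \<in> I)"

definition Uq_ideal :: "falg set" where
  "Uq_ideal = two_sided_ideal hull Uq_rels"

lemma two_sided_Uq_ideal: "two_sided_ideal Uq_ideal"
  unfolding Uq_ideal_def
  by (rule hull_in) (auto simp: two_sided_ideal_def left_ideal_def)

lemma Uq_ideal_0: "0 \<in> Uq_ideal"
  and Uq_ideal_add: "a \<in> Uq_ideal \<Longrightarrow> b \<in> Uq_ideal \<Longrightarrow> a + b \<in> Uq_ideal"
  and Uq_ideal_lmult: "a \<in> Uq_ideal \<Longrightarrow> c * a \<in> Uq_ideal"
  and Uq_ideal_rmult: "a \<in> Uq_ideal \<Longrightarrow> a * c \<in> Uq_ideal"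
  using two_sided_Uq_ideal by (auto simp: two_sided_ideal_def left_ideal_def)

lemma Uq_ideal_uminus: "a \<in> Uq_ideal \<Longrightarrow> - a \<in> Uq_ideal"
  using Uq_ideal_lmult[of a "- 1"] by simp

lemma Uq_ideal_diff: "a \<in> Uq_ideal \<Longrightarrow> b \<in> Uq_ideal \<Longrightarrow> a - b \<in> Uq_ideal"
  using Uq_ideal_add[of a "- b"] Uq_ideal_uminus[of b] by simp

text \<open>
  The counit ($x_r^\pm, h_r \mapsto 0$, $K^{\pm 1} \mapsto 1$) is an algebra character; it shows
  that the quotient is not the zero ring, as the type class of unital rings demands.
\<close>

definition counit_word :: "gword \<Rightarrow> K" where
  "counit_word w = (if set (letters w) \<subseteq> range GK then 1 else 0)"

definition counit :: "falg \<Rightarrow> K" where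
  "counit p = (\<Sum>w\<in>Poly_Mapping.keys p. Poly_Mapping.lookup p w * counit_word w)"

lemma counit_superset:
  "finite A \<Longrightarrow> Poly_Mapping.keys p \<subseteq> A \<Longrightarrow>
     counit p = (\<Sum>w\<in>A. Poly_Mapping.lookup p w * counit_word w)"
  unfolding counit_def by (rule sum.mono_neutral_left) (auto simp: in_keys_iff)

lemma counit_0 [simp]: "counit 0 = 0"
  by (simp add: counit_def)

lemma counit_add [simp]: "counit (a + b) = counit a + counit b"
proof -
  let ?A = "Poly_Mapping.keys a \<union> Poly_Mapping.keys b"
  have "counit (a + b) = (\<Sum>w\<in>?A. Poly_Mapping.lookup (a + b) w * counit_word w)"
    by (rule counit_superset) (auto simp: Poly_Mapping.keys_add)
  also have "\<dots> = (\<Sum>w\<in>?A. Poly_Mapping.lookup a w * counit_word w)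
      + (\<Sum>w\<in>?A. Poly_Mapping.lookup b w * counit_word w)"
    by (simp add: lookup_add algebra_simps sum.distrib)
  also have "\<dots> = counit a + counit b"
    by (simp add: counit_superset[symmetric])
  finally show ?thesis .
qed

lemma counit_single [simp]: "counit (Poly_Mapping.single w c) = c * counit_word w"
  by (simp add: counit_def)

lemma counit_word_add: "counit_word (v + w) = counit_word v * counit_word w"
  by (simp add: counit_word_def plus_gword_def)

lemma counit_mult [simp]: "counit (a * b) = counit a * counit b"
proof -
  have single: "counit (Poly_Mapping.single v c * b) = c * counit_word v * counit b" for v c b
  proof (induction b rule: update_induct)
    case const
    then show ?case by simp
  next
    case (update p w d)
    have "Poly_Mapping.update w d p = p + Poly_Mapping.single w d"
      using update(1)
      by (intro poly_mapping_eqI)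
        (auto simp: lookup_update lookup_add lookup_single when_def in_keys_iff)
    then show ?case
      using update(3) by (simp add: distrib_left mult_single counit_word_add algebra_simps)
  qed
  show ?thesis
  proof (induction a rule: update_induct)
    case const
    then show ?case by simp
  next
    case (update p w d)
    have "Poly_Mapping.update w d p = p + Poly_Mapping.single w d"
      using update(1)
      by (intro poly_mapping_eqI)
        (auto simp: lookup_update lookup_add lookup_single when_def in_keys_iff)
    then show ?case
      using update(3) by (simp add: distrib_right single algebra_simps)
  qed
qed

lemma counit_scal_f [simp]: "counit (scal_f c) = c"
  by (simp add: scal_f_def counit_word_def zero_gword_def)

lemma counit_1 [simp]: "counit 1 = 1"
  using counit_scal_f[of 1] by (simp add: scal_f_def)

lemma counit_uminus [simp]: "counit (- a) = - counit a"
  using counit_add[of a "- a"] by (simp del: counit_add add: eq_neg_iff_add_eq_0 add.commute)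

lemma counit_diff [simp]: "counit (a - b) = counit a - counit b"
  using counit_add[of a "- b"] by (simp del: counit_add)

lemma counit_sum: "counit (sum f A) = (\<Sum>i\<in>A. counit (f i))"
  by (induction A rule: infinite_finite_induct) auto

lemma counit_gen [simp]:
  "counit (x_f e r) = 0" "counit (h_f r) = 0" "counit (K_f e) = 1"
  by (auto simp: gen_f_def counit_word_def)

lemma counit_alg_exp:
  assumes "\<And>n. counit (fps_nth f n) = 0"
  shows "counit (fps_nth (alg_exp scal_f f) n) = (if n = 0 then 1 else 0)"
proof -
  have pow: "counit (fps_nth (f ^ i) n) = (if i = 0 \<and> n = 0 then 1 else 0)" for i n
    by (cases i) (auto simp: fps_mult_nth counit_sum assms)
  have "counit (fps_nth (alg_exp scal_f f) n)
      = (\<Sum>i\<le>n. (1 / of_nat (fact i)) * (if i = 0 \<and> n = 0 then 1 else 0))"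
    by (simp add: alg_exp_def counit_sum pow del: of_nat_fact)
  also have "\<dots> = (if n = 0 then 1 else 0)"
    by (cases "n = 0") simp_all
  finally show ?thesis .
qed

lemma counit_psi: "counit (psi_f e r) = (if r = 0 then 1 else 0)"
proof -
  have "counit (fps_nth (psi_series e) n) = (if n = 0 then 1 else 0)" for n
    unfolding psi_series_def by (simp add: counit_alg_exp)
  then show ?thesis
    by (cases e) (auto simp: psi_f_def coeff_int_def)
qed

lemma counit_Uq_ideal: "a \<in> Uq_ideal \<Longrightarrow> counit a = 0"
proof -
  have "counit a = 0" if "a \<in> Uq_rels" for a
    using that by cases (simp_all add: counit_psi)
  moreover have "two_sided_ideal {a. counit a = 0}"
    by (auto simp: two_sided_ideal_def left_ideal_def)
  ultimately have "Uq_ideal \<subseteq> {a. counit a = 0}"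
    unfolding Uq_ideal_def by (intro hull_minimal) auto
  then show "a \<in> Uq_ideal \<Longrightarrow> counit a = 0" by auto
qed

definition Uq_cong :: "falg \<Rightarrow> falg \<Rightarrow> bool" where
  "Uq_cong a b \<longleftrightarrow> a - b \<in> Uq_ideal"

lemma equivp_Uq_cong: "equivp Uq_cong"
proof (rule equivpI)
  show "reflp Uq_cong"
    by (auto simp: reflp_def Uq_cong_def Uq_ideal_0)
  show "symp Uq_cong"
    by (auto simp: symp_def Uq_cong_def dest: Uq_ideal_uminus)
  show "transp Uq_cong"
  proof (rule transpI)
    fix a b c
    assume "Uq_cong a b" "Uq_cong b c"
    then have "(a - b) + (b - c) \<in> Uq_ideal"
      unfolding Uq_cong_def by (rule Uq_ideal_add)
    then show "Uq_cong a c"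
      by (simp add: Uq_cong_def)
  qed
qed

quotient_type uq = falg / Uq_cong
  by (rule equivp_Uq_cong)

instantiation uq :: ring_1
begin

lift_definition zero_uq :: uq is 0 .

lift_definition one_uq :: uq is 1 .

lift_definition plus_uq :: "uq \<Rightarrow> uq \<Rightarrow> uq" is "(+)"
proof -
  fix a b c d :: falg
  assume "Uq_cong a b" "Uq_cong c d"
  then have "(a - b) + (c - d) \<in> Uq_ideal"
    by (simp add: Uq_cong_def Uq_ideal_add)
  then show "Uq_cong (a + c) (b + d)"
    by (simp add: Uq_cong_def algebra_simps)
qed

lift_definition minus_uq :: "uq \<Rightarrow> uq \<Rightarrow> uq" is "(-)"
proof -
  fix a b c d :: falg
  assume "Uq_cong a b" "Uq_cong c d"
  then have "(a - b) - (c - d) \<in> Uq_ideal"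
    by (simp add: Uq_cong_def Uq_ideal_diff)
  then show "Uq_cong (a - c) (b - d)"
    by (simp add: Uq_cong_def algebra_simps)
qed

lift_definition uminus_uq :: "uq \<Rightarrow> uq" is "uminus"
proof -
  fix a b :: falg
  assume "Uq_cong a b"
  then have "- (a - b) \<in> Uq_ideal"
    unfolding Uq_cong_def by (rule Uq_ideal_uminus)
  then show "Uq_cong (- a) (- b)"
    by (simp add: Uq_cong_def)
qed

lift_definition times_uq :: "uq \<Rightarrow> uq \<Rightarrow> uq" is "(*)"
proof -
  fix a b c d :: falg
  assume "Uq_cong a b" "Uq_cong c d"
  then have "(a - b) * c + b * (c - d) \<in> Uq_ideal"
    by (simp add: Uq_cong_def Uq_ideal_add Uq_ideal_lmult Uq_ideal_rmult)
  then show "Uq_cong (a * c) (b * d)"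
    by (simp add: Uq_cong_def algebra_simps)
qed

instance
proof
  show "(0::uq) \<noteq> 1"
  proof (transfer, rule notI)
    assume "Uq_cong 0 1"
    then have "counit (0 - 1) = 0"
      unfolding Uq_cong_def by (rule counit_Uq_ideal)
    then show False by simp
  qed
qed (transfer, simp add: Uq_cong_def Uq_ideal_0 algebra_simps)+

end

definition scal :: "K \<Rightarrow> uq" where
  "scal c = abs_uq (scal_f c)"

definition x_el :: "pm \<Rightarrow> int \<Rightarrow> uq" where
  "x_el e r = abs_uq (x_f e r)"

definition h_el :: "int \<Rightarrow> uq" where
  "h_el r = abs_uq (h_f r)"

definition K_el :: "pm \<Rightarrow> uq" where
  "K_el e = abs_uq (K_f e)"

definition Uq_alg :: "(K, uq) module" where
  "Uq_alg = \<lparr>carrier = UNIV, mult = (*), one = 1, zero = 0, add = (+),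
     smult = (\<lambda>c a. scal c * a)\<rparr>"

definition Uq_subalgebra :: "uq set \<Rightarrow> bool" where
  "Uq_subalgebra S \<longleftrightarrow> range scal \<subseteq> S \<and> (\<forall>a\<in>S. \<forall>b\<in>S. a + b \<in> S \<and> a * b \<in> S)"

definition U0 :: "uq set" where
  "U0 = Uq_subalgebra hull {h_el r | r. r \<noteq> 0}"

definition U0_alg :: "(K, uq) module" where
  "U0_alg = Uq_alg\<lparr>carrier := U0\<rparr>"

definition Lambda_series :: "pm \<Rightarrow> uq fps" where
  "Lambda_series e = alg_exp scal
     (- Abs_fps (\<lambda>k. if k = 0 then 0
          else scal (1 / q_int (int k)) * h_el (pm_sign e * int k)))"

definition Lambda :: "int \<Rightarrow> uq" where
  "Lambda r = (if r \<ge> 0 then fps_nth (Lambda_series Plus) (nat r)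
               else fps_nth (Lambda_series Minus) (nat (- r)))"


section \<open>Quotients and dimensions\<close>

text \<open>
  The quotient of a \<open>K\<close>-module \<open>M\<close> by a submodule \<open>N\<close>, on the carrier of the library's quotient
  ring. The ring multiplication and unit of the result are meaningful only if \<open>M\<close> is an algebra
  and \<open>N\<close> a two-sided ideal.
\<close>

definition quot_mod :: "('k, 'v) module \<Rightarrow> 'v set \<Rightarrow> ('k, 'v set) module"  (infixl \<open>'/'/\<^sub>m\<close> 65) where
  "M //\<^sub>m N = ring.extend (M Quot N)
     (module.fields (\<lambda>c X. \<Union>v\<in>X. N +>\<^bsub>M\<^esub> (c \<odot>\<^bsub>M\<^esub> v)))"

definition vdim :: "('k::field, 'v) module \<Rightarrow> enat" where
  "vdim V = (if vectorspace.fin_dim class_ring V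
             then enat (vectorspace.dim class_ring V) else \<infinity>)"


section \<open>The module \<open>W\<^sub>q(m)\<close>\<close>

definition Lambda_gens :: "nat \<Rightarrow> uq set" where
  "Lambda_gens m = {Lambda r | r. \<bar>r\<bar> > int m}
     \<union> {Lambda (int m) * Lambda (- r) - Lambda (int m - r) | r. 1 \<le> r \<and> r \<le> int m}"

definition X0_series :: "uq fps" where
  "X0_series = Abs_fps (\<lambda>n. if n = 0 then 0 else x_el Minus (int n - 1))"

text \<open>
  Normalisation: the relations coupling $\tilde X^-(u)$ and $X_0^-(u)$ to $\Lambda^+$ are usually
  printed with $\Lambda^+(u)$; here they are imposed with $\Lambda^+(qu)$. In the presentation of
  $U_q$ above, $\sum_r \psi^+_r u^r = K \Lambda^+(q^{-1}u) / \Lambda^+(qu)$, so that on a highest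
  weight vector it is $\tilde X^-(u) \Lambda^+(qu)$ that can vanish. With $\Lambda^+(u)$ the left
  ideal is all of $U_q$ and the module is zero: lemma \<open>unscaled_relation_degenerate\<close>, at the
  end of this theory, proves this for \<open>m = 1\<close>.
\<close>

definition Lambda_scaled :: "uq fps" where
  "Lambda_scaled = Abs_fps (\<lambda>n. scal (qK ^ n) * Lambda (int n))"

text \<open>
  The coefficient of $u^r$ in $\tilde X^-(u) \Lambda^+(qu)$, where
  $\tilde X^-(u) = \sum_{k \in \mathbb{Z}} x_k^- u^{k+1}$, is the infinite sum
  $\sum_{n \ge 0} q^n x^-_{r-1-n} \Lambda_n$. The terms with $n > m$, and their products with
  elements of $U_q(0)$, lie in the left ideal generated by the $\Lambda_n$ with $n > m$, hence are
  dropped.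
\<close>

definition Xtilde_coeff :: "nat \<Rightarrow> int \<Rightarrow> uq" where
  "Xtilde_coeff m r = (\<Sum>n\<le>m. x_el Minus (r - 1 - int n) * fps_nth Lambda_scaled n)"

definition Iq :: "nat \<Rightarrow> uq set" where
  "Iq m = left_ideal hull
     (range (x_el Plus)
      \<union> {K_el Plus - scal (qK ^ m)}
      \<union> Lambda_gens m
      \<union> {Xtilde_coeff m r * y | r y. y \<in> U0}
      \<union> {coeff_int (X0_series ^ r * Lambda_scaled) s * y | r s y. r \<ge> 1 \<and> \<bar>s\<bar> > int m \<and> y \<in> U0})"

definition Wq :: "nat \<Rightarrow> (K, uq set) module" where
  "Wq m = Uq_alg //\<^sub>m Iq m"

definition Iq0 :: "nat \<Rightarrow> uq set" where
  "Iq0 m = Idl\<^bsub>U0_alg\<^esub> (Lambda_gens m)"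


section \<open>Symmetric Laurent polynomials\<close>

text \<open>
  Laurent polynomials over \<open>K\<close> in variables indexed by the natural numbers; an exponent
  \<open>a\<close> stands for the monomial $\prod_i t_i^{a_i}$. The extension of scalars of
  $\mathbb{C}[t_1^{\pm 1}, \dots, t_m^{\pm 1}]^{\Sigma_m}$ to \<open>K\<close> is the ring of symmetric
  Laurent polynomials in $t_1, \dots, t_m$ with coefficients in \<open>K\<close>.
\<close>

type_synonym laurent = "(nat \<Rightarrow>\<^sub>0 int) \<Rightarrow>\<^sub>0 K"

definition sym_laurent :: "nat \<Rightarrow> laurent set" where
  "sym_laurent m = {f. (\<forall>a\<in>Poly_Mapping.keys f. Poly_Mapping.keys a \<subseteq> {1..m}) \<and>
     (\<forall>\<pi> a. \<pi> permutes {1..m} \<longrightarrow>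
        Poly_Mapping.lookup f (Poly_Mapping.map_key \<pi> a) = Poly_Mapping.lookup f a)}"

definition KP_sym :: "nat \<Rightarrow> (K, laurent) module" where
  "KP_sym m = \<lparr>carrier = sym_laurent m, mult = (*), one = 1, zero = 0, add = (+),
     smult = (\<lambda>c f. Poly_Mapping.single 0 c * f)\<rparr>"

definition elem_sym :: "nat \<Rightarrow> nat \<Rightarrow> laurent" where
  "elem_sym m r = (\<Sum>S | S \<subseteq> {1..m} \<and> card S = r.
     \<Prod>i\<in>S. Poly_Mapping.single (Poly_Mapping.single i 1) 1)"

text \<open>
  The identification of $U_q(0)/I_q(m,0)$ with $\mathbf{K}\mathcal{P}_m^{\Sigma_m}$. It is unique
  on the carrier, since the classes of $\Lambda_1, \dots, \Lambda_m$ and of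
  $\Lambda_{-m} = \Lambda_m^{-1}$ generate the quotient.
\<close>

definition Lambda_iso :: "nat \<Rightarrow> uq set \<Rightarrow> laurent" where
  "Lambda_iso m = (SOME \<phi>.
     \<phi> \<in> ring_iso (U0_alg //\<^sub>m Iq0 m) (KP_sym m) \<and>
     \<phi> \<in> module_hom class_ring (U0_alg //\<^sub>m Iq0 m) (KP_sym m) \<and>
     (\<forall>r\<in>{1..m}. \<phi> (Iq0 m +>\<^bsub>U0_alg\<^esub> Lambda (int r)) = (- 1) ^ r * elem_sym m r))"

text \<open>
  The right action of \<^term>\<open>KP_sym m\<close> on \<^term>\<open>Wq m\<close>, by right multiplication with
  representatives in $U_q(0)$ of the corresponding class.
\<close>

definition W_act :: "nat \<Rightarrow> uq set \<Rightarrow> laurent \<Rightarrow> uq set" where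
  "W_act m X f = (\<Union>a\<in>X. \<Union>u\<in>inv_into (carrier (U0_alg //\<^sub>m Iq0 m)) (Lambda_iso m) f.
     Iq m +>\<^bsub>Uq_alg\<^esub> (a * u))"

definition W_times :: "nat \<Rightarrow> laurent set \<Rightarrow> uq set set" where
  "W_times m J = LinearCombinations.module.span class_ring (Wq m)
     {W_act m X f | X f. X \<in> carrier (Wq m) \<and> f \<in> J}"

section \<open>The relations without the scaling\<close>

lemma abs_uq_eqI: "a - b \<in> Uq_rels \<Longrightarrow> abs_uq a = abs_uq b"
  using hull_subset[of Uq_rels two_sided_ideal]
  by (auto simp: uq.abs_eq_iff Uq_cong_def Uq_ideal_def)

lemmas abs_uq_simps = plus_uq.abs_eq minus_uq.abs_eq times_uq.abs_eq one_uq.abs_eq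
  uminus_uq.abs_eq zero_uq.abs_eq

lemma scal_add: "scal (c + d) = scal c + scal d"
  by (simp add: scal_def scal_f_def abs_uq_simps single_add)

lemma scal_mult: "scal (c * d) = scal c * scal d"
  by (simp add: scal_def scal_f_def abs_uq_simps mult_single)

lemma scal_1 [simp]: "scal 1 = 1"
  by (simp add: scal_def scal_f_def abs_uq_simps)

lemma scal_0 [simp]: "scal 0 = 0"
  by (simp add: scal_def scal_f_def abs_uq_simps)

lemma scal_uminus: "scal (- c) = - scal c"
  using scal_add[of c "- c"] by (simp add: eq_neg_iff_add_eq_0 add.commute)

lemma scal_f_commute: "scal_f c * p = p * scal_f c"
proof (induction p rule: update_induct)
  case const
  then show ?case by simp
next
  case (update p w d)
  have "Poly_Mapping.update w d p = p + Poly_Mapping.single w d"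
    using update(1)
    by (intro poly_mapping_eqI)
      (auto simp: lookup_update lookup_add lookup_single when_def in_keys_iff)
  then show ?case
    using update(3)
    by (simp add: distrib_left distrib_right scal_f_def mult_single mult.commute)
qed

lemma scal_commute: "scal c * a = a * scal c"
  by (induction a rule: uq.abs_induct) (simp add: scal_def abs_uq_simps scal_f_commute)

lemma psi_f_values:
  "psi_f Plus 0 = K_f Plus" "psi_f Minus 0 = K_f Minus"
  "psi_f Plus 1 = K_f Plus * (scal_f (qK - inverse qK) * h_f 1)" "psi_f Minus 1 = 0"
  by (simp_all add: psi_f_def coeff_int_def psi_series_def alg_exp_def
      fps_mult_nth atMost_Suc scal_f_def)

lemma Lambda_values:
  "Lambda 0 = 1" "Lambda 1 = - h_el 1" "Lambda (- 1) = - h_el (- 1)"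
  by (simp_all add: Lambda_def Lambda_series_def alg_exp_def atMost_Suc)

lemma Uq_relations:
  "K_el Plus * K_el Minus = 1"
  "K_el Minus * K_el Plus = 1"
  "r \<noteq> 0 \<Longrightarrow> K_el Plus * h_el r = h_el r * K_el Plus"
  "r \<noteq> 0 \<Longrightarrow> s \<noteq> 0 \<Longrightarrow> h_el r * h_el s = h_el s * h_el r"
  "r \<noteq> 0 \<Longrightarrow> h_el r * x_el e s - x_el e s * h_el r
     = scal (of_int (pm_sign e) * (1 / of_int r) * q_int (2 * r)) * x_el e (r + s)"
  "x_el Plus r * x_el Minus s - x_el Minus s * x_el Plus r
     = scal (1 / (qK - inverse qK)) * (abs_uq (psi_f Plus (r + s)) - abs_uq (psi_f Minus (r + s)))"
  using Uq_rels.K_inv[THEN abs_uq_eqI] Uq_rels.inv_K[THEN abs_uq_eqI]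
    Uq_rels.K_h[THEN abs_uq_eqI] Uq_rels.h_h[THEN abs_uq_eqI]
    Uq_rels.h_x[THEN abs_uq_eqI] Uq_rels.xp_xm[THEN abs_uq_eqI]
  by (simp_all only: K_el_def h_el_def x_el_def abs_uq_simps scal_def)

text \<open>
  For \<open>m = 1\<close> the coefficient of $u^2$ in $X_0^-(u) \Lambda^+(u)$ is
  $x_1^- + x_0^- \Lambda_1$. Together with the other generators of the left ideal that are
  assumed here it generates the unit ideal.
\<close>

lemma unscaled_relation_degenerate:
  assumes I: "left_ideal I"
    and x: "range (x_el Plus) \<subseteq> I"
    and K: "K_el Plus - scal qK \<in> I"
    and L: "Lambda 1 * Lambda (- 1) - Lambda 0 \<in> I"
    and X: "coeff_int (X0_series * Lambda_series Plus) 2 \<in> I"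
  shows "I = UNIV"
proof -
  have add: "a + b \<in> I" if "a \<in> I" "b \<in> I" for a b
    using I that by (simp add: left_ideal_def)
  have mult: "c * a \<in> I" if "a \<in> I" for a c
    using I that by (simp add: left_ideal_def)
  have diff: "a - b \<in> I" if "a \<in> I" "b \<in> I" for a b
    using add[OF that(1) mult[OF that(2), of "- 1"]] by simp
  have xI: "x_el Plus k \<in> I" for k
    using x by blast
  define d where "d = qK - inverse qK"
  have d: "d \<noteq> 0" using qK_neq_inverse by (simp add: d_def)
  define c where "c = q_int 2"
  let ?h = "h_el 1" and ?K = "K_el Plus" and ?L = "K_el Minus"
  have hx: "x_el Plus 0 * ?h = ?h * x_el Plus 0 - scal c * x_el Plus 1"
    using Uq_relations(5)[of 1 Plus 0] by (simp add: c_def algebra_simps)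
  have xx0: "x_el Plus 0 * x_el Minus 0 = x_el Minus 0 * x_el Plus 0 + scal (1 / d) * (?K - ?L)"
    using Uq_relations(6)[of 0 0] by (simp add: d_def psi_f_values K_el_def algebra_simps)
  have "scal (1 / d) * (?K * (scal d * ?h)) = (scal (1 / d) * scal d) * (?K * ?h)"
    by (simp only: mult.assoc scal_commute[of d])
  also have "\<dots> = ?K * ?h"
    unfolding scal_mult[symmetric] using d by simp
  finally have "scal (1 / d) * (?K * (scal d * ?h)) = ?K * ?h" .
  then have xx1: "x_el Plus 0 * x_el Minus 1 = x_el Minus 1 * x_el Plus 0 + ?K * ?h"
    using Uq_relations(6)[of 0 1]
    by (simp add: d_def psi_f_values K_el_def h_el_def scal_def abs_uq_simps algebra_simps)
  have Lh: "?L * ?h = ?h * ?L"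
  proof -
    have "?L * ?h = ?L * (?h * ?K) * ?L"
      by (simp add: mult.assoc Uq_relations(1))
    also have "\<dots> = (?L * ?K) * ?h * ?L"
      by (simp add: Uq_relations(3)[symmetric] mult.assoc)
    finally show ?thesis by (simp add: Uq_relations(2))
  qed
  have "fps_nth (X0_series * Lambda_series Plus) 2
      = x_el Minus 1 + x_el Minus 0 * Lambda 1"
    by (simp add: fps_mult_nth numeral_2_eq_2 X0_series_def Lambda_def
        Lambda_series_def alg_exp_def)
  then have "x_el Minus 1 - x_el Minus 0 * ?h \<in> I"
    using X by (simp add: coeff_int_def Lambda_values)
  then have "x_el Plus 0 * (x_el Minus 1 - x_el Minus 0 * ?h) \<in> I"
    by (rule mult)
  also have "x_el Plus 0 * (x_el Minus 1 - x_el Minus 0 * ?h)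
      = x_el Minus 1 * x_el Plus 0 + ?K * ?h
        - (x_el Minus 0 * (x_el Plus 0 * ?h) + scal (1 / d) * (?K - ?L) * ?h)"
    unfolding right_diff_distrib mult.assoc[symmetric] xx0 xx1 by (simp add: distrib_right)
  also have "\<dots> = (x_el Minus 1 - x_el Minus 0 * ?h) * x_el Plus 0
      + x_el Minus 0 * scal c * x_el Plus 1 + ?h * (?K - scal (1 / d) * (?K - ?L))"
  proof -
    have "?K * ?h - scal (1 / d) * (?K - ?L) * ?h = ?h * (?K - scal (1 / d) * (?K - ?L))"
    proof -
      have "scal (1 / d) * (?K - ?L) * ?h = scal (1 / d) * (?h * (?K - ?L))"
        by (simp add: mult.assoc left_diff_distrib right_diff_distrib Lh Uq_relations(3))
      also have "\<dots> = ?h * (scal (1 / d) * (?K - ?L))"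
        by (simp only: scal_commute[of "1 / d"] mult.assoc)
      finally have "scal (1 / d) * (?K - ?L) * ?h = ?h * (scal (1 / d) * (?K - ?L))" .
      then show ?thesis
        by (simp add: right_diff_distrib Uq_relations(3))
    qed
    then show ?thesis
      unfolding hx by (simp add: algebra_simps)
  qed
  finally have "(x_el Minus 1 - x_el Minus 0 * ?h) * x_el Plus 0
      + x_el Minus 0 * scal c * x_el Plus 1 + ?h * (?K - scal (1 / d) * (?K - ?L)) \<in> I" .
  from diff[OF this add[OF
      mult[OF xI[of 0], of "x_el Minus 1 - x_el Minus 0 * ?h"]
      mult[OF xI[of 1], of "x_el Minus 0 * scal c"]]]
  have Z: "?h * (?K - scal (1 / d) * (?K - ?L)) \<in> I"
    by simp
  have KL: "?L - scal (inverse qK) \<in> I"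
  proof -
    have "scal (- inverse qK) * ?L * (?K - scal qK) \<in> I"
      using K by (rule mult)
    also have "scal (- inverse qK) * ?L * (?K - scal qK)
        = scal (- inverse qK) * (?L * ?K) - scal (- inverse qK) * scal qK * ?L"
      by (simp only: right_diff_distrib mult.assoc scal_commute[of qK])
    also have "\<dots> = ?L - scal (inverse qK)"
      unfolding scal_mult[symmetric]
      using qK_nonzero by (simp add: Uq_relations(2) scal_uminus)
    finally show ?thesis .
  qed
  have "?h * (?K - scal (1 / d) * (?K - ?L))
      - (?h * (?K - scal qK) - ?h * scal (1 / d) * ((?K - scal qK) - (?L - scal (inverse qK)))) \<in> I"
    by (intro diff mult Z K KL)
  also have "?h * (?K - scal (1 / d) * (?K - ?L))
      - (?h * (?K - scal qK) - ?h * scal (1 / d) * ((?K - scal qK) - (?L - scal (inverse qK))))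
      = ?h * (scal qK - scal (1 / d) * (scal qK - scal (inverse qK)))"
    by (simp add: algebra_simps)
  also have "scal (1 / d) * (scal qK - scal (inverse qK)) = 1"
  proof -
    have "scal qK - scal (inverse qK) = scal d"
      using scal_add[of qK "- inverse qK"] by (simp add: d_def scal_uminus)
    then show ?thesis using d by (simp add: scal_mult[symmetric])
  qed
  also have "scal qK - 1 = scal (qK - 1)"
    using scal_add[of qK "- 1"] by (simp add: scal_uminus)
  finally have "scal (1 / (qK - 1)) * (?h * scal (qK - 1)) \<in> I"
    by (rule mult)
  also have "scal (1 / (qK - 1)) * (?h * scal (qK - 1)) = scal (1 / (qK - 1) * (qK - 1)) * ?h"
    by (simp only: scal_mult mult.assoc scal_commute[of "qK - 1"])
  also have "\<dots> = ?h"
    using qK_neq_1 by simp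
  finally have "?h \<in> I" .
  then have "h_el (- 1) * ?h \<in> I"
    by (rule mult)
  moreover have "?h * h_el (- 1) - 1 \<in> I"
    using L by (simp add: Lambda_values)
  ultimately have "h_el (- 1) * ?h - (?h * h_el (- 1) - 1) \<in> I"
    by (rule diff)
  then have "1 \<in> I"
    by (simp add: Uq_relations(4)[of 1 "- 1"])
  then show ?thesis
    using mult[of 1] by auto
qed

end

theory Submission
  imports Defs "Jordan_Normal_Form.Determinant"
begin

text \<open>
  Modulo the left ideal, \<open>W\<^sub>q(m)\<close> is spanned over \<open>U\<^sub>q(0)\<close> by words in the \<open>x\<^sup>-\<close>. Up to words of
  smaller norm a word may be symmetrised, and a symmetric function \<open>f\<close> of \<open>r\<close> variables then stands
  for a combination of words of length \<open>r\<close>. The relations for \<open>X\<^sub>0\<^sup>-(u)\<^sup>r \<Lambda>\<^sup>+(qu)\<close> express the complete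
  symmetric functions of degree greater than \<open>m - r\<close> through smaller ones, so that as in the
  cohomology of a Grassmannian \<open>m choose r\<close> functions \<open>f\<close> suffice: \<open>2\<^sup>m\<close> generators in total.

  They are independent over \<open>U\<^sub>q(0)/I\<^sub>q(m, 0)\<close>: the algebra acts on a generic tensor product of \<open>m\<close>
  evaluation representations, of dimension \<open>2\<^sup>m\<close> over the field of fractions of the Laurent
  polynomials. Its highest weight vector is annihilated by the left ideal and generates everything,
  and \<open>\<Lambda>\<^sub>r\<close> acts on it by \<open>(-1)\<^sup>r e\<^sub>r(t\<^sub>1, \<dots>, t\<^sub>m)\<close>. Hence the images of the \<open>2\<^sup>m\<close> generators form a
  basis of the representation, \<open>W\<^sub>q(m)\<close> is free of rank \<open>2\<^sup>m\<close>, and its fibre at a maximal ideal is a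
  sum of \<open>2\<^sup>m\<close> copies of the residue field.
\<close>

section \<open>The base field and exponential series\<close>

text \<open>The relations in the left ideal give only the complete symmetric functions themselves,
  not their multiples. What makes them usable is the right action of \<open>U0\<close>: moving
  \<open>h_l\<close> across a relation multiplies its word part by the power sum of degree
  \<open>l\<close>, and the power sums with nonzero \<open>l\<close> generate all symmetric Laurent
  polynomials in characteristic 0. So words are symmetrised first, and the left ideal must be stable
  under right multiplication by \<open>U0\<close>. Symmetrising loses nothing: up to words of
  smaller norm, reordering multiplies a word by a power of \<open>q\<close>, and a nonempty sum of
  powers of \<open>q\<close> never vanishes. Independence needs no determinant: a spanning family of
  \<open>2 ^ m\<close> vectors in dimension \<open>2 ^ m\<close> is independent. It shows only that
  the highest weight characters of the coefficients vanish, so the kernel of this character has to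
  be identified with \<open>Iq0 m\<close>; the same fact gives the existence of
  \<open>Lambda_iso\<close>. Residue fields of infinite degree are not excluded beforehand: a
  finite-dimensional fibre is shown to force a finite degree.\<close>

instance fract :: ("{idom, ring_char_0}") field_char_0
proof
  show "inj (of_nat :: nat \<Rightarrow> 'a fract)"
    by (auto simp: inj_def of_nat_fract eq_fract)
qed

lemma qK_power: "qK ^ n = Fract (monom 1 n) 1"
  by (induction n) (simp_all add: qK_def One_fract_def monom_Suc mult_pCons_left one_pCons monom_0)

lemma Fract_sum: "(\<Sum>i\<in>I. Fract (f i) 1) = Fract (\<Sum>i\<in>I. f i) (1 :: 'a :: idom)"
  by (induction I rule: infinite_finite_induct) (simp_all add: Zero_fract_def)

text \<open>After multiplication by a high power of \<open>q\<close> this is a polynomial in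
  \<open>q\<close> whose value at \<open>q = 1\<close> is the number of terms. It allows division by
  the sum of the powers of \<open>q\<close> that the permutations of a word produce.\<close>

lemma sum_powi_qK_nonzero:
  assumes "finite I" "I \<noteq> {}"
  shows "(\<Sum>i\<in>I. qK powi f i) \<noteq> 0"
proof
  assume z: "(\<Sum>i\<in>I. qK powi f i) = 0"
  define N where "N = (\<Sum>i\<in>I. \<bar>f i\<bar>)"
  have N: "0 \<le> f i + N" if "i \<in> I" for i
    using member_le_sum[of i I "\<lambda>i. \<bar>f i\<bar>"] that assms by (simp add: N_def)
  have "0 = (\<Sum>i\<in>I. qK powi f i) * qK powi N"
    by (simp add: z)
  also have "\<dots> = (\<Sum>i\<in>I. qK powi (f i + N))"
    using qK_nonzero by (simp add: sum_distrib_right power_int_add)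
  also have "\<dots> = (\<Sum>i\<in>I. qK ^ nat (f i + N))"
    using N by (intro sum.cong) (auto simp: power_int_def)
  also have "\<dots> = Fract (\<Sum>i\<in>I. monom 1 (nat (f i + N))) 1"
    by (simp add: qK_power Fract_sum)
  finally have "(\<Sum>i\<in>I. monom (1 :: complex) (nat (f i + N))) = 0"
    by (simp add: Zero_fract_def eq_fract)
  then have "poly (\<Sum>i\<in>I. monom (1 :: complex) (nat (f i + N))) 1 = 0"
    by simp
  then have "card I = 0"
    by (simp add: poly_sum poly_monom)
  with assms show False by simp
qed

lemma qK_powi_eq_1_iff: "qK powi n = 1 \<longleftrightarrow> n = 0"
proof
  assume n: "qK powi n = 1"
  have "qK ^ nat \<bar>n\<bar> = 1"
    using n by (cases "n \<ge> 0") (auto simp: power_int_def power_inverse)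
  then have "monom (1 :: complex) (nat \<bar>n\<bar>) = monom 1 0"
    by (simp add: qK_power One_fract_def eq_fract monom_0 one_pCons)
  then have "degree (monom (1 :: complex) (nat \<bar>n\<bar>)) = degree (monom (1 :: complex) 0)"
    by simp
  then show "n = 0"
    by (simp add: degree_monom_eq)
qed simp

lemma q_int_nonzero: "k \<noteq> 0 \<Longrightarrow> q_int k \<noteq> 0"
proof
  assume k: "k \<noteq> 0" and "q_int k = 0"
  then have "qK powi k * qK powi k = qK powi (- k) * qK powi k"
    using qK_neq_inverse by (simp add: q_int_def)
  then have "qK powi (2 * k) = 1"
    using qK_nonzero by (simp add: power_int_add[symmetric])
  then show False using k by (simp add: qK_powi_eq_1_iff)
qed

lemma q_int_minus: "q_int (- k) = - q_int k"
  unfolding q_int_def minus_divide_left by simp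

lemma q_int_double: "q_int (2 * k) = (qK powi k + qK powi (- k)) * q_int k"
proof -
  have "qK powi (2 * k) - qK powi (- (2 * k))
      = (qK powi k + qK powi (- k)) * (qK powi k - qK powi (- k))"
    using qK_nonzero by (simp add: algebra_simps power_int_add[symmetric])
  then show ?thesis by (simp add: q_int_def)
qed

section \<open>Exponentials of series with commuting coefficients\<close>

lemma fps_power_nth_eq_0:
  fixes f :: "'a::ring_1 fps"
  assumes "fps_nth f 0 = 0" "n < i"
  shows "fps_nth (f ^ i) n = 0"
  using assms(2)
proof (induction i arbitrary: n)
  case (Suc i)
  have "fps_nth f j * fps_nth (f ^ i) (n - j) = 0" if "j \<le> n" for j
    using Suc that assms(1) by (cases "j = 0") auto
  then show ?case by (simp add: fps_mult_nth)
qed simp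

text \<open>The ring need not be commutative, so the power rule rests on \<open>f\<close> commuting
  with its derivative. That follows coefficientwise, after reversing the convolution sum.\<close>

lemma fps_power_commute_deriv:
  fixes f :: "'a::ring_1 fps"
  assumes comm: "\<And>i j. fps_nth f i * fps_nth f j = fps_nth f j * fps_nth f i"
  shows "fps_deriv (f ^ Suc i) = of_nat (Suc i) * (fps_deriv f * f ^ i)"
proof -
  have fd: "f * fps_deriv f = fps_deriv f * f"
  proof (rule fps_ext)
    fix n
    have "fps_nth (f * fps_deriv f) n
        = (\<Sum>i=0..n. of_nat (n - i + 1) * (fps_nth f i * fps_nth f (n - i + 1)))"
      unfolding fps_mult_nth fps_deriv_nth
      by (intro sum.cong refl) (metis mult.assoc mult_of_nat_commute)
    also have "\<dots> = (\<Sum>i=0..n. of_nat (n - i + 1) * (fps_nth f (n - i + 1) * fps_nth f i))"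
      by (simp add: comm)
    also have "\<dots> = (\<Sum>i=0..n. of_nat (i + 1) * (fps_nth f (i + 1) * fps_nth f (n - i)))"
      by (subst sum.atLeastAtMost_rev) (auto intro!: sum.cong)
    finally show "fps_nth (f * fps_deriv f) n = fps_nth (fps_deriv f * f) n"
      by (simp add: fps_mult_nth mult.assoc)
  qed
  show ?thesis
  proof (induction i)
    case (Suc i)
    have "fps_deriv (f ^ Suc (Suc i)) = f * fps_deriv (f ^ Suc i) + fps_deriv f * f ^ Suc i"
      by (subst power_Suc) simp
    also have "f * fps_deriv (f ^ Suc i) = of_nat (Suc i) * ((f * fps_deriv f) * f ^ i)"
      unfolding Suc by (metis mult.assoc mult_of_nat_commute)
    also have "\<dots> = of_nat (Suc i) * (fps_deriv f * f ^ Suc i)"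
      unfolding fd by (simp add: mult.assoc)
    finally show ?case
      unfolding of_nat_Suc[of "Suc i"] distrib_right by simp
  qed simp
qed

text \<open>The coefficientwise form of \<open>E' = f' E\<close>. It determines the exponential
  without logarithms, and serves both to solve for the \<open>h_k\<close> in terms of the
  \<open>Lambda\<close> and to compare exponentials with explicit products.\<close>

lemma alg_exp_recursion:
  fixes f :: "'a::ring_1 fps" and \<iota> :: "K \<Rightarrow> 'a"
  assumes f0: "fps_nth f 0 = 0"
    and comm: "\<And>i j. fps_nth f i * fps_nth f j = fps_nth f j * fps_nth f i"
    and central: "\<And>c a. \<iota> c * a = a * \<iota> c"
    and hom: "\<And>c d. \<iota> (c * d) = \<iota> c * \<iota> d" "\<And>n. \<iota> (of_nat n) = of_nat n"
  shows "of_nat n * fps_nth (alg_exp \<iota> f) n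
    = (\<Sum>i=1..n. of_nat i * fps_nth f i * fps_nth (alg_exp \<iota> f) (n - i))"
proof (cases n)
  case (Suc N)
  have pw: "of_nat (Suc N) * fps_nth (f ^ Suc i) (Suc N)
      = of_nat (Suc i) * (\<Sum>j=0..N. of_nat (Suc j) * fps_nth f (Suc j) * fps_nth (f ^ i) (N - j))"
    for i
  proof -
    have "of_nat (Suc N) * fps_nth (f ^ Suc i) (Suc N) = fps_nth (fps_deriv (f ^ Suc i)) N"
      by (simp only: fps_deriv_nth Suc_eq_plus1)
    also have "\<dots> = fps_nth (of_nat (Suc i) * (fps_deriv f * f ^ i)) N"
      by (simp only: fps_power_commute_deriv[OF comm])
    also have "\<dots> = of_nat (Suc i) * fps_nth (fps_deriv f * f ^ i) N"
      by (simp only: fps_of_nat[symmetric] fps_mult_left_const_nth)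
    finally show ?thesis
      by (simp add: fps_mult_nth del: of_nat_Suc power_Suc)
  qed
  have fact: "\<iota> (1 / of_nat (fact (Suc i))) * of_nat (Suc i) = \<iota> (1 / of_nat (fact i))" for i
  proof -
    have "(1 :: K) / of_nat (fact (Suc i)) * of_nat (Suc i) = 1 / of_nat (fact i)"
      unfolding fact_Suc of_nat_mult of_nat_id using of_nat_neq_0[where 'a = K, of i]
      by (simp del: of_nat_Suc of_nat_fact)
    then show ?thesis
      unfolding hom(2)[symmetric] hom(1)[symmetric] by simp
  qed
  have lc: "\<iota> c * (a * b) = a * (\<iota> c * b)" for c a b
    by (simp only: mult.assoc[symmetric] central[of c a])
  have "of_nat n * fps_nth (alg_exp \<iota> f) n
      = (\<Sum>i\<le>Suc N. \<iota> (1 / of_nat (fact i)) * (of_nat (Suc N) * fps_nth (f ^ i) (Suc N)))"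
    unfolding alg_exp_def Suc fps_nth_Abs_fps sum_distrib_left
    by (intro sum.cong refl) (metis mult.assoc mult_of_nat_commute)
  also have "\<dots> = (\<Sum>i\<le>N. \<iota> (1 / of_nat (fact (Suc i)))
      * (of_nat (Suc N) * fps_nth (f ^ Suc i) (Suc N)))"
    by (subst sum.atMost_Suc_shift) simp
  also have "\<dots> = (\<Sum>i\<le>N. \<iota> (1 / of_nat (fact i))
      * (\<Sum>j=0..N. of_nat (Suc j) * fps_nth f (Suc j) * fps_nth (f ^ i) (N - j)))"
    by (simp only: pw mult.assoc[symmetric] fact)
  also have "\<dots> = (\<Sum>j=0..N. \<Sum>i\<le>N. of_nat (Suc j) * fps_nth f (Suc j)
      * (\<iota> (1 / of_nat (fact i)) * fps_nth (f ^ i) (N - j)))"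
    unfolding sum_distrib_left by (subst sum.swap) (simp only: lc)
  also have "\<dots> = (\<Sum>j=0..N. of_nat (Suc j) * fps_nth f (Suc j) * fps_nth (alg_exp \<iota> f) (N - j))"
  proof (rule sum.cong[OF refl])
    fix j assume "j \<in> {0..N}"
    \<comment> \<open>The range of \<open>i\<close> shrinks because \<open>f ^ i\<close> has no
      terms below degree \<open>i\<close>.\<close>
    have "(\<Sum>i\<le>N. \<iota> (1 / of_nat (fact i)) * fps_nth (f ^ i) (N - j))
        = (\<Sum>i\<le>N - j. \<iota> (1 / of_nat (fact i)) * fps_nth (f ^ i) (N - j))"
      by (rule sum.mono_neutral_right) (auto simp: fps_power_nth_eq_0[OF f0])
    then show "(\<Sum>i\<le>N. of_nat (Suc j) * fps_nth f (Suc j)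
        * (\<iota> (1 / of_nat (fact i)) * fps_nth (f ^ i) (N - j)))
      = of_nat (Suc j) * fps_nth f (Suc j) * fps_nth (alg_exp \<iota> f) (N - j)"
      unfolding alg_exp_def fps_nth_Abs_fps sum_distrib_left[symmetric] by simp
  qed
  also have "\<dots> = (\<Sum>i=1..n. of_nat i * fps_nth f i * fps_nth (alg_exp \<iota> f) (n - i))"
    unfolding Suc One_nat_def sum.atLeast_Suc_atMost_Suc_shift by simp
  finally show ?thesis .
qed simp

lemma alg_exp_0 [simp]: "\<iota> 1 = 1 \<Longrightarrow> fps_nth (alg_exp \<iota> f) 0 = 1"
  by (simp add: alg_exp_def)

section \<open>Symmetric Laurent polynomials\<close>

abbreviation cst :: "K \<Rightarrow> laurent" where
  "cst c \<equiv> Poly_Mapping.single 0 c"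

abbreviation mon :: "(nat \<Rightarrow>\<^sub>0 int) \<Rightarrow> laurent" where
  "mon a \<equiv> Poly_Mapping.single a 1"

abbreviation var :: "nat \<Rightarrow> int \<Rightarrow> laurent" where
  "var i k \<equiv> mon (Poly_Mapping.single i k)"

lemma poly_mapping_single_induct [case_names zero single add]:
  fixes f :: "'a \<Rightarrow>\<^sub>0 'b::monoid_add"
  assumes "P 0" "\<And>a c. P (Poly_Mapping.single a c)" "\<And>f g. P f \<Longrightarrow> P g \<Longrightarrow> P (f + g)"
  shows "P f"
proof (induction f rule: update_induct)
  case const
  show ?case by (rule assms)
next
  case (update p w d)
  have "Poly_Mapping.update w d p = p + Poly_Mapping.single w d"
    using update(1)
    by (intro poly_mapping_eqI)
      (auto simp: lookup_update lookup_add lookup_single when_def in_keys_iff)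
  then show ?case using update(3) assms by simp
qed

lemma poly_mapping_sum_single:
  fixes f :: "'a \<Rightarrow>\<^sub>0 'b::comm_monoid_add"
  assumes "finite A" "Poly_Mapping.keys f \<subseteq> A"
  shows "f = (\<Sum>a\<in>A. Poly_Mapping.single a (Poly_Mapping.lookup f a))"
  using assms
  by (intro poly_mapping_eqI)
    (auto simp: lookup_sum lookup_single when_def if_distrib sum.delta in_keys_iff cong: if_cong)

lemma keys_mult_subset:
  fixes f g :: laurent
  assumes "\<And>a. a \<in> Poly_Mapping.keys f \<Longrightarrow> a \<in> A" "\<And>b. b \<in> Poly_Mapping.keys g \<Longrightarrow> b \<in> B"
    and "\<And>a b. a \<in> A \<Longrightarrow> b \<in> B \<Longrightarrow> a + b \<in> C"
  shows "c \<in> Poly_Mapping.keys (f * g) \<Longrightarrow> c \<in> C"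
proof -
  assume "c \<in> Poly_Mapping.keys (f * g)"
  then obtain a b where "c = a + b" "a \<in> Poly_Mapping.keys f" "b \<in> Poly_Mapping.keys g"
    using keys_mult[of f g] by blast
  then show ?thesis using assms by blast
qed

subsection \<open>The action of permutations\<close>

text \<open>Both layers are pullbacks, so this is the substitution sending \<open>t_i\<close> to
  \<open>t_(\<pi> i)\<close>. Once invariance means being fixed by ring endomorphisms, the closure
  of \<open>sym_laurent\<close> under the ring operations is formal.\<close>

definition perm_laurent :: "(nat \<Rightarrow> nat) \<Rightarrow> laurent \<Rightarrow> laurent" where
  "perm_laurent \<pi> = Poly_Mapping.map_key (Poly_Mapping.map_key \<pi>)"

lemma lookup_map_key_inj: "inj f \<Longrightarrow> Poly_Mapping.lookup (Poly_Mapping.map_key f p) a = Poly_Mapping.lookup p (f a)"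
  by (simp add: map_key.rep_eq)

context
  fixes \<pi> :: "nat \<Rightarrow> nat"
  assumes bij: "bij \<pi>"
begin

lemma map_key_inv:
  "Poly_Mapping.map_key (inv_into UNIV \<pi>) (Poly_Mapping.map_key \<pi> a) = a"
  "Poly_Mapping.map_key \<pi> (Poly_Mapping.map_key (inv_into UNIV \<pi>) a) = a"
  using bij
  by (auto intro!: poly_mapping_eqI
      simp: lookup_map_key_inj bij_is_inj bij_imp_bij_inv surj_f_inv_f bij_is_surj)

lemma inj_map_key: "inj (Poly_Mapping.map_key \<pi> :: (nat \<Rightarrow>\<^sub>0 'b::zero) \<Rightarrow> _)"
  by (metis injI map_key_inv(1))

lemma perm_laurent_lookup:
  "Poly_Mapping.lookup (perm_laurent \<pi> f) a = Poly_Mapping.lookup f (Poly_Mapping.map_key \<pi> a)"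
  by (simp add: perm_laurent_def lookup_map_key_inj inj_map_key)

lemma perm_laurent_single:
  "perm_laurent \<pi> (Poly_Mapping.single a c) = Poly_Mapping.single (Poly_Mapping.map_key (inv_into UNIV \<pi>) a) c"
  by (intro poly_mapping_eqI)
    (auto simp: perm_laurent_lookup lookup_single when_def map_key_inv)

lemma perm_laurent_add: "perm_laurent \<pi> (f + g) = perm_laurent \<pi> f + perm_laurent \<pi> g"
  by (intro poly_mapping_eqI) (simp add: perm_laurent_lookup lookup_add)

lemma perm_laurent_0: "perm_laurent \<pi> 0 = 0"
  by (intro poly_mapping_eqI) (simp add: perm_laurent_lookup)

lemma perm_laurent_sum: "perm_laurent \<pi> (sum f A) = (\<Sum>a\<in>A. perm_laurent \<pi> (f a))"
  by (induction A rule: infinite_finite_induct) (simp_all add: perm_laurent_add perm_laurent_0)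

lemma map_key_add:
  "Poly_Mapping.map_key (inv_into UNIV \<pi>) (a + b)
    = Poly_Mapping.map_key (inv_into UNIV \<pi>) a + (Poly_Mapping.map_key (inv_into UNIV \<pi>) b :: nat \<Rightarrow>\<^sub>0 int)"
  using bij by (intro poly_mapping_eqI)
    (simp add: lookup_map_key_inj bij_is_inj bij_imp_bij_inv lookup_add)

lemma perm_laurent_mult: "perm_laurent \<pi> (f * g) = perm_laurent \<pi> f * perm_laurent \<pi> g"
proof (induction f rule: poly_mapping_single_induct)
  case (single a c)
  show ?case
    by (induction g rule: poly_mapping_single_induct)
      (simp_all add: perm_laurent_0 perm_laurent_single perm_laurent_add mult_single map_key_add
        distrib_left)
qed (simp_all add: perm_laurent_0 perm_laurent_add distrib_right)

lemma perm_laurent_cst: "perm_laurent \<pi> (cst c) = cst c"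
proof -
  have "Poly_Mapping.map_key (inv_into UNIV \<pi>) 0 = (0 :: nat \<Rightarrow>\<^sub>0 int)"
    by (intro poly_mapping_eqI) (simp add: lookup_map_key_inj bij bij_is_inj bij_imp_bij_inv)
  then show ?thesis by (simp add: perm_laurent_single)
qed

lemma perm_laurent_var: "perm_laurent \<pi> (var i k) = var (\<pi> i) k"
proof -
  have "Poly_Mapping.map_key (inv_into UNIV \<pi>) (Poly_Mapping.single i k) = Poly_Mapping.single (\<pi> i) k"
    using bij
    by (intro poly_mapping_eqI)
      (auto simp: lookup_map_key_inj bij_is_inj bij_imp_bij_inv lookup_single when_def
        bij_inv_eq_iff)
  then show ?thesis by (simp add: perm_laurent_single)
qed

lemma perm_laurent_1: "perm_laurent \<pi> 1 = 1"
  using perm_laurent_cst[of 1] by simp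

lemma perm_laurent_prod: "perm_laurent \<pi> (prod f A) = (\<Prod>a\<in>A. perm_laurent \<pi> (f a))"
  by (induction A rule: infinite_finite_induct) (simp_all add: perm_laurent_mult perm_laurent_1)

end

definition supp_le :: "nat \<Rightarrow> laurent set" where
  "supp_le m = {f. \<forall>a\<in>Poly_Mapping.keys f. Poly_Mapping.keys a \<subseteq> {1..m}}"

lemma sym_laurent_alt:
  "f \<in> sym_laurent m \<longleftrightarrow> f \<in> supp_le m \<and> (\<forall>\<pi>. \<pi> permutes {1..m} \<longrightarrow> perm_laurent \<pi> f = f)"
proof -
  have "perm_laurent \<pi> f = f
    \<longleftrightarrow> (\<forall>a. Poly_Mapping.lookup f (Poly_Mapping.map_key \<pi> a) = Poly_Mapping.lookup f a)"
    if "\<pi> permutes {1..m}" for \<pi>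
    using permutes_bij[OF that] by (auto simp: poly_mapping_eq_iff perm_laurent_lookup fun_eq_iff)
  then show ?thesis by (auto simp: sym_laurent_def supp_le_def)
qed

lemma supp_le_single: "Poly_Mapping.keys a \<subseteq> {1..m} \<Longrightarrow> Poly_Mapping.single a c \<in> supp_le m"
  by (simp add: supp_le_def)

lemma supp_le_0: "0 \<in> supp_le m"
  by (simp add: supp_le_def)

lemma supp_le_cst: "cst c \<in> supp_le m"
  by (rule supp_le_single) simp

lemma supp_le_1: "1 \<in> supp_le m"
  using supp_le_cst[of 1] by simp

lemma supp_le_add: "f \<in> supp_le m \<Longrightarrow> g \<in> supp_le m \<Longrightarrow> f + g \<in> supp_le m"
  using Poly_Mapping.keys_add[of f g] by (auto simp: supp_le_def)

lemma supp_le_mult: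
  assumes "f \<in> supp_le m" "g \<in> supp_le m"
  shows "f * g \<in> supp_le m"
proof -
  have "c \<in> {a. Poly_Mapping.keys a \<subseteq> {1..m}}" if "c \<in> Poly_Mapping.keys (f * g)" for c
    using that
    by (rule keys_mult_subset[where A = "{a. Poly_Mapping.keys a \<subseteq> {1..m}}"
          and B = "{a. Poly_Mapping.keys a \<subseteq> {1..m}}", rotated -1])
      (use assms Poly_Mapping.keys_add in \<open>fastforce simp: supp_le_def\<close>)+
  then show ?thesis by (auto simp: supp_le_def)
qed

lemma supp_le_sum: "(\<And>i. i \<in> A \<Longrightarrow> f i \<in> supp_le m) \<Longrightarrow> sum f A \<in> supp_le m"
  by (induction A rule: infinite_finite_induct) (auto intro: supp_le_0 supp_le_add)

lemma supp_le_prod: "(\<And>i. i \<in> A \<Longrightarrow> f i \<in> supp_le m) \<Longrightarrow> prod f A \<in> supp_le m"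
  by (induction A rule: infinite_finite_induct) (auto intro: supp_le_1 supp_le_mult)

lemma supp_le_var: "i \<in> {1..m} \<Longrightarrow> var i k \<in> supp_le m"
  by (rule supp_le_single) simp

lemma sym_laurent_0: "0 \<in> sym_laurent m"
  and sym_laurent_cst: "cst c \<in> sym_laurent m"
  and sym_laurent_add: "f \<in> sym_laurent m \<Longrightarrow> g \<in> sym_laurent m \<Longrightarrow> f + g \<in> sym_laurent m"
  and sym_laurent_mult: "f \<in> sym_laurent m \<Longrightarrow> g \<in> sym_laurent m \<Longrightarrow> f * g \<in> sym_laurent m"
  by (auto simp: sym_laurent_alt permutes_bij perm_laurent_0 perm_laurent_cst perm_laurent_add
      perm_laurent_mult intro: supp_le_0 supp_le_cst supp_le_add supp_le_mult)

lemma sym_laurent_1: "1 \<in> sym_laurent m"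
  using sym_laurent_cst[of 1] by simp

lemma sym_laurent_uminus: "f \<in> sym_laurent m \<Longrightarrow> - f \<in> sym_laurent m"
  using sym_laurent_mult[OF sym_laurent_cst[of "- 1"], of f] by (simp add: single_uminus)

lemma sym_laurent_diff: "f \<in> sym_laurent m \<Longrightarrow> g \<in> sym_laurent m \<Longrightarrow> f - g \<in> sym_laurent m"
  using sym_laurent_add[of f m "- g"] by (simp add: sym_laurent_uminus)

lemma sym_laurent_sum: "(\<And>i. i \<in> A \<Longrightarrow> f i \<in> sym_laurent m) \<Longrightarrow> sum f A \<in> sym_laurent m"
  by (induction A rule: infinite_finite_induct) (auto intro: sym_laurent_0 sym_laurent_add)

lemma sym_laurent_power: "f \<in> sym_laurent m \<Longrightarrow> f ^ n \<in> sym_laurent m"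
  by (induction n) (auto intro: sym_laurent_1 sym_laurent_mult)

lemma sym_laurent_prod: "(\<And>i. i \<in> A \<Longrightarrow> f i \<in> sym_laurent m) \<Longrightarrow> prod f A \<in> sym_laurent m"
  by (induction A rule: infinite_finite_induct) (auto intro: sym_laurent_1 sym_laurent_mult)

text \<open>The exponent \<open>s\<close> covers \<open>e_r(t)\<close> for \<open>s = 1\<close> and
  \<open>e_r\<close> of the inverse variables for \<open>s = -1\<close>; up to sign these are the
  values of \<open>Lambda r\<close> and \<open>Lambda (- r)\<close>. The case \<open>r = m\<close>
  gives the powers of \<open>e_m\<close>.\<close>

definition esym :: "int \<Rightarrow> nat \<Rightarrow> nat \<Rightarrow> laurent" where
  "esym s m r = (\<Sum>S | S \<subseteq> {1..m} \<and> card S = r. \<Prod>i\<in>S. var i s)"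

definition psum :: "nat \<Rightarrow> int \<Rightarrow> laurent" where
  "psum m l = (\<Sum>i=1..m. var i l)"

definition epow :: "nat \<Rightarrow> int \<Rightarrow> laurent" where
  "epow m k = (\<Prod>i=1..m. var i k)"

lemma elem_sym_esym: "elem_sym m r = esym 1 m r"
  by (simp add: elem_sym_def esym_def)

lemma psum_in_sym: "psum m l \<in> sym_laurent m"
proof -
  have "(\<Sum>i=1..m. var (\<pi> i) l) = (\<Sum>i=1..m. var i l)" if "\<pi> permutes {1..m}" for \<pi>
    by (rule sum.reindex_bij_betw) (rule permutes_imp_bij[OF that])
  then show ?thesis
    by (auto simp: sym_laurent_alt psum_def perm_laurent_sum permutes_bij perm_laurent_var
        intro!: supp_le_sum supp_le_var)
qed

lemma esym_in_sym: "esym s m r \<in> sym_laurent m"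
proof -
  let ?A = "{S. S \<subseteq> {1..m} \<and> card S = r}"
  have "(\<Sum>S\<in>?A. \<Prod>i\<in>S. var (\<pi> i) s) = (\<Sum>S\<in>?A. \<Prod>i\<in>S. var i s)" if p: "\<pi> permutes {1..m}" for \<pi>
  proof -
    have inj: "inj \<pi>" using p by (rule permutes_inj)
    have "(\<Sum>S\<in>?A. \<Prod>i\<in>S. var (\<pi> i) s) = (\<Sum>S\<in>?A. \<Prod>i\<in>\<pi> ` S. var i s)"
      using inj by (simp add: prod.reindex inj_on_subset)
    also have "\<dots> = (\<Sum>S\<in>?A. \<Prod>i\<in>S. var i s)"
    proof (rule sum.reindex_bij_witness[where i = "\<lambda>S. inv_into UNIV \<pi> ` S" and j = "\<lambda>S. \<pi> ` S"])
      fix S assume S: "S \<in> ?A"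
      show "inv_into UNIV \<pi> ` \<pi> ` S = S" "\<pi> ` inv_into UNIV \<pi> ` S = S"
        using p inj by (auto simp: image_image permutes_inverses)
      show "\<pi> ` S \<in> ?A"
        using S p inj permutes_image[OF p] by (auto simp: card_image inj_on_subset)
      have "inv_into UNIV \<pi> permutes {1..m}" using p by (rule permutes_inv)
      then show "inv_into UNIV \<pi> ` S \<in> ?A"
        using S permutes_image[of "inv_into UNIV \<pi>" "{1..m}"]
          permutes_inj[of "inv_into UNIV \<pi>" "{1..m}"]
        by (auto simp: card_image inj_on_subset)
    qed simp
    finally show ?thesis .
  qed
  then show ?thesis
    by (auto simp: sym_laurent_alt esym_def perm_laurent_sum permutes_bij perm_laurent_var
        perm_laurent_prod intro!: supp_le_sum supp_le_prod supp_le_var)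
qed

lemma epow_esym: "epow m s = esym s m m"
proof -
  have "{S. S \<subseteq> {1..m} \<and> card S = m} = {{1..m}}"
    using card_subset_eq[of "{1..m}"] by auto
  then show ?thesis by (simp add: esym_def epow_def)
qed

lemma var_add: "var i (k + l) = var i k * var i l"
  by (simp add: mult_single single_add)

lemma epow_add: "epow m (k + l) = epow m k * epow m l"
  by (simp only: epow_def var_add prod.distrib)

lemma epow_0 [simp]: "epow m 0 = 1"
  by (simp add: epow_def)

lemma epow_in_sym: "epow m k \<in> sym_laurent m"
  by (simp add: epow_esym esym_in_sym)

lemma esym_0 [simp]: "esym s m 0 = 1"
proof -
  have "{S. S \<subseteq> {1..m} \<and> card S = 0} = {{}}"
    by (auto dest: finite_subset)
  then show ?thesis by (simp add: esym_def)
qed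

lemma esym_gt: "r > m \<Longrightarrow> esym s m r = 0"
proof -
  assume "r > m"
  have "card S \<le> m" if "S \<subseteq> {1..m}" for S
    using card_mono[OF _ that] by simp
  then have "{S. S \<subseteq> {1..m} \<and> card S = r} = {}"
    using \<open>r > m\<close> by (intro equals0I) (auto simp: not_less[symmetric])
  then show ?thesis unfolding esym_def by (simp only: sum.empty)
qed

text \<open>The product of all variables times the inverse variables over \<open>S\<close> is the
  product over the complement of \<open>S\<close>. This makes the generators
  \<open>Lambda m * Lambda (- r) - Lambda (m - r)\<close> vanish on the highest weight
  vector.\<close>

lemma esym_complement:
  assumes "r \<le> m"
  shows "epow m 1 * esym (- 1) m r = esym 1 m (m - r)"
proof -
  have "epow m 1 * esym (- 1) m r
      = (\<Sum>S | S \<subseteq> {1..m} \<and> card S = r. \<Prod>i\<in>{1..m} - S. var i 1)"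
    unfolding esym_def sum_distrib_left
  proof (rule sum.cong[OF refl])
    fix S assume "S \<in> {S. S \<subseteq> {1..m} \<and> card S = r}"
    then have S: "S \<subseteq> {1..m}" by simp
    have "epow m 1 = (\<Prod>i\<in>{1..m} - S. var i 1) * (\<Prod>i\<in>S. var i 1)"
      unfolding epow_def by (rule prod.subset_diff) (use S in auto)
    moreover have "(\<Prod>i\<in>S. var i 1) * (\<Prod>i\<in>S. var i (- 1)) = 1"
      unfolding prod.distrib[symmetric] var_add[symmetric] by simp
    ultimately show "epow m 1 * (\<Prod>i\<in>S. var i (- 1)) = (\<Prod>i\<in>{1..m} - S. var i 1)"
      by (simp add: mult.assoc)
  qed
  also have "\<dots> = esym 1 m (m - r)"
    unfolding esym_def
    by (rule sum.reindex_bij_witness[where i = "\<lambda>S. {1..m} - S" and j = "\<lambda>S. {1..m} - S"])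
      (use assms in \<open>auto simp: card_Diff_subset finite_subset[of _ "{1..m}"] double_diff\<close>)
  finally show ?thesis .
qed

subsection \<open>Generating functions\<close>

lemma prod_one_plus_fps_nth:
  fixes y :: "'i \<Rightarrow> 'a::comm_ring_1"
  assumes "finite I"
  shows "fps_nth (\<Prod>i\<in>I. 1 + fps_const (y i) * fps_X) n = (\<Sum>S | S \<subseteq> I \<and> card S = n. \<Prod>i\<in>S. y i)"
proof -
  have "(\<Prod>i\<in>I. fps_const (y i) * fps_X + 1)
      = (\<Sum>S\<in>Pow I. fps_const (\<Prod>i\<in>S. y i) * fps_X ^ card S)"
  proof (subst prod_add[OF assms], rule sum.cong[OF refl])
    fix S assume "S \<in> Pow I"
    have "(\<Prod>i\<in>S. fps_const (y i)) = fps_const (\<Prod>i\<in>S. y i)"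
      by (induction S rule: infinite_finite_induct) simp_all
    then show "(\<Prod>i\<in>S. fps_const (y i) * fps_X) * (\<Prod>i\<in>I - S. 1)
        = fps_const (\<Prod>i\<in>S. y i) * fps_X ^ card S"
      by (simp add: prod.distrib)
  qed
  then have "fps_nth (\<Prod>i\<in>I. 1 + fps_const (y i) * fps_X) n
      = (\<Sum>S\<in>Pow I. if card S = n then \<Prod>i\<in>S. y i else 0)"
    by (auto simp: add.commute fps_sum_nth intro!: sum.cong)
  also have "\<dots> = (\<Sum>S | S \<subseteq> I \<and> card S = n. \<Prod>i\<in>S. y i)"
    using assms by (intro sum.mono_neutral_cong_right) auto
  finally show ?thesis .
qed

text \<open>The inverse of \<open>1 - y X\<close>, given explicitly because the coefficient ring
  need not be a field.\<close>

definition geo_fps :: "'a::comm_ring_1 \<Rightarrow> 'a fps" where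
  "geo_fps y = Abs_fps (\<lambda>n. y ^ n)"

lemma geo_fps_inverse: "(1 - fps_const y * fps_X) * geo_fps y = 1"
proof (rule fps_ext)
  fix n
  show "fps_nth ((1 - fps_const y * fps_X) * geo_fps y) n = fps_nth 1 n"
    by (cases n) (simp_all add: geo_fps_def left_diff_distrib mult.assoc)
qed

text \<open>The generating series \<open>E\<close>, the product of the \<open>1 + y_i X\<close>,
  satisfies \<open>E' = P E\<close> where \<open>P\<close> is the sum of the
  \<open>y_i / (1 + y_i X)\<close>; the identity compares coefficients of
  \<open>X^n\<close>.\<close>

lemma Newton:
  fixes y :: "'i \<Rightarrow> 'a::comm_ring_1"
  assumes "finite I"
  defines "e \<equiv> \<lambda>n. \<Sum>S | S \<subseteq> I \<and> card S = n. \<Prod>i\<in>S. y i"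
  shows "of_nat (Suc n) * e (Suc n) = (\<Sum>l\<le>n. (- 1) ^ l * (\<Sum>i\<in>I. y i ^ Suc l) * e (n - l))"
proof -
  define E where "E = (\<Prod>i\<in>I. 1 + fps_const (y i) * fps_X)"
  have E: "fps_nth E n = e n" for n
    unfolding E_def e_def using assms(1) by (rule prod_one_plus_fps_nth)
  define P where "P = (\<Sum>i\<in>I. fps_const (y i) * geo_fps (- y i))"
  have P: "fps_nth P l = (- 1) ^ l * (\<Sum>i\<in>I. y i ^ Suc l)" for l
    by (simp add: P_def fps_sum_nth geo_fps_def sum_distrib_left power_minus[of "y _"] mult_ac)
  have "fps_deriv E = P * E"
    unfolding E_def P_def using assms(1)
  proof (induction I)
    case (insert j I)
    have "(1 + fps_const (y j) * fps_X) * geo_fps (- y j) = 1"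
      using geo_fps_inverse[of "- y j"] by (simp flip: fps_const_neg)
    then have g: "geo_fps (- y j) * ((1 + fps_const (y j) * fps_X) * Z) = Z" for Z
      by (metis mult.assoc mult.commute mult.left_neutral)
    let ?B = "1 + fps_const (y j) * fps_X" and ?Q = "\<Prod>i\<in>I. 1 + fps_const (y i) * fps_X"
    have "fps_deriv (\<Prod>i\<in>insert j I. 1 + fps_const (y i) * fps_X)
        = ?B * ((\<Sum>i\<in>I. fps_const (y i) * geo_fps (- y i)) * ?Q) + fps_const (y j) * ?Q"
      using insert(1,2) by (simp add: insert(3))
    also have "fps_const (y j) * ?Q = fps_const (y j) * (geo_fps (- y j) * (?B * ?Q))"
      by (simp only: g)
    also have "?B * ((\<Sum>i\<in>I. fps_const (y i) * geo_fps (- y i)) * ?Q) + \<dots>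
        = (\<Sum>i\<in>insert j I. fps_const (y i) * geo_fps (- y i)) * (?B * ?Q)"
      unfolding sum.insert[OF insert(1,2)] distrib_right[of "fps_const (y j) * geo_fps (- y j)"]
      by (simp only: mult_ac add.commute)
    finally show ?case using insert(1,2) by simp
  qed simp
  then have "fps_nth (fps_deriv E) n = fps_nth (P * E) n"
    by simp
  then show ?thesis
    by (simp add: E P fps_mult_nth atLeast0AtMost del: of_nat_Suc power_Suc)
qed

lemma var_power: "var i s ^ n = var i (of_nat n * s)"
  by (induction n) (simp_all add: mult_single single_add[symmetric] algebra_simps)

lemma esym_Newton:
  "of_nat (Suc n) * esym s m (Suc n) = (\<Sum>l\<le>n. (- 1) ^ l * psum m (of_nat (Suc l) * s) * esym s m (n - l))"
  using Newton[of "{1..m}" n "\<lambda>i. var i s"] unfolding esym_def psum_def var_power by simp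

subsection \<open>Leading monomials\<close>

lemma less_poly_mapping_iff:
  "a < b \<longleftrightarrow> (\<exists>k. Poly_Mapping.lookup a k < Poly_Mapping.lookup b k
      \<and> (\<forall>j<k. Poly_Mapping.lookup a j = Poly_Mapping.lookup b j))"
  for a b :: "nat \<Rightarrow>\<^sub>0 int"
  by (simp add: less_poly_mapping.rep_eq less_fun_def)

definition monic_lead :: "laurent \<Rightarrow> (nat \<Rightarrow>\<^sub>0 int) \<Rightarrow> bool" where
  "monic_lead f a \<longleftrightarrow> (\<forall>b\<in>Poly_Mapping.keys (f - mon a). b < a)"

lemma monic_leadD:
  assumes "monic_lead f a"
  shows "Poly_Mapping.lookup f a = 1" "\<And>b. b \<in> Poly_Mapping.keys f \<Longrightarrow> b \<le> a"
proof -
  have "a \<notin> Poly_Mapping.keys (f - mon a)"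
    using assms by (auto simp: monic_lead_def)
  then show "Poly_Mapping.lookup f a = 1"
    by (simp add: in_keys_iff lookup_minus)
  show "b \<le> a" if "b \<in> Poly_Mapping.keys f" for b
  proof (cases "b = a")
    case False
    then have "b \<in> Poly_Mapping.keys (f - mon a)"
      using that by (simp add: in_keys_iff lookup_minus lookup_single)
    then show ?thesis using assms by (auto simp: monic_lead_def)
  qed simp
qed

lemma monic_lead_mult:
  assumes "monic_lead f a" "monic_lead g b"
  shows "monic_lead (f * g) (a + b)"
  unfolding monic_lead_def
proof
  fix c assume c: "c \<in> Poly_Mapping.keys (f * g - mon (a + b))"
  have "f * g - mon (a + b) = mon a * (g - mon b) + (f - mon a) * g"
    by (simp add: algebra_simps mult_single)
  then consider "c \<in> Poly_Mapping.keys (mon a * (g - mon b))" | "c \<in> Poly_Mapping.keys ((f - mon a) * g)"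
    using c Poly_Mapping.keys_add[of "mon a * (g - mon b)" "(f - mon a) * g"] by auto
  then show "c < a + b"
  proof cases
    case 1
    then obtain d where "c = a + d" "d \<in> Poly_Mapping.keys (g - mon b)"
      using keys_mult[of "mon a" "g - mon b"] by auto
    then show ?thesis using assms(2) by (auto simp: monic_lead_def)
  next
    case 2
    then obtain d e where "c = d + e" "d \<in> Poly_Mapping.keys (f - mon a)" "e \<in> Poly_Mapping.keys g"
      using keys_mult[of "f - mon a" g] by blast
    then show ?thesis
      using assms(1) monic_leadD(2)[OF assms(2), of e]
      by (auto simp: monic_lead_def intro: add_less_le_mono)
  qed
qed

lemma monic_lead_mon: "monic_lead (mon a) a"
  by (simp add: monic_lead_def)

lemma monic_lead_1: "monic_lead 1 0"
  using monic_lead_mon[of 0] by simp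

definition ind_exp :: "nat set \<Rightarrow> int \<Rightarrow> (nat \<Rightarrow>\<^sub>0 int)" where
  "ind_exp S k = (\<Sum>i\<in>S. Poly_Mapping.single i k)"

lemma lookup_ind_exp: "finite S \<Longrightarrow> Poly_Mapping.lookup (ind_exp S k) i = (if i \<in> S then k else 0)"
  by (simp add: ind_exp_def lookup_sum lookup_single when_def)

lemma prod_var_mon: "(\<Prod>i\<in>S. var i k) = mon (ind_exp S k)"
  by (induction S rule: infinite_finite_induct) (simp_all add: ind_exp_def mult_single)

lemma monic_lead_power: "monic_lead f a \<Longrightarrow> monic_lead (f ^ n) (\<Sum>_<n. a)"
  by (induction n) (simp_all add: monic_lead_1 monic_lead_mult add.commute del: sum_constant)

lemma monic_lead_prod:
  "(\<And>i. i \<in> A \<Longrightarrow> monic_lead (f i) (a i)) \<Longrightarrow> monic_lead (prod f A) (sum a A)"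
  by (induction A rule: infinite_finite_induct) (simp_all add: monic_lead_1 monic_lead_mult)

text \<open>The comparison is decided at the least element of \<open>{1..j}\<close> missing from
  \<open>S\<close>, which exists because the two sets differ and have the same size. Below it, both
  contain every positive index.\<close>

lemma ind_exp_less:
  assumes S: "S \<subseteq> {1..m}" "card S = j" "j \<le> m" "S \<noteq> {1..j}"
  shows "ind_exp S 1 < ind_exp {1..j} 1"
proof -
  have fin: "finite S" using S(1) by (rule finite_subset) simp
  have "\<not> {1..j} \<subseteq> S"
    using card_subset_eq[OF fin, of "{1..j}"] S by auto
  then obtain k0 where "k0 \<in> {1..j}" "k0 \<notin> S" by blast
  then have ex: "\<exists>k. k \<in> {1..j} \<and> k \<notin> S" by blast
  define k where "k = (LEAST k. k \<in> {1..j} \<and> k \<notin> S)"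
  have k: "k \<in> {1..j}" "k \<notin> S"
    using LeastI_ex[OF ex] by (simp_all add: k_def)
  have less: "l \<in> S" if "l < k" "1 \<le> l" for l
    using not_less_Least[of l "\<lambda>k. k \<in> {1..j} \<and> k \<notin> S"] that k by (auto simp: k_def)
  show ?thesis
    unfolding less_poly_mapping_iff
  proof (intro exI[of _ k] conjI allI impI)
    show "Poly_Mapping.lookup (ind_exp S 1) k < Poly_Mapping.lookup (ind_exp {1..j} 1) k"
      using k fin by (simp add: lookup_ind_exp)
    fix l assume l: "l < k"
    show "Poly_Mapping.lookup (ind_exp S 1) l = Poly_Mapping.lookup (ind_exp {1..j} 1) l"
    proof (cases "l = 0")
      case True
      then show ?thesis using S(1) fin by (auto simp: lookup_ind_exp)
    next
      case False
      then show ?thesis using less[OF l] l k fin by (auto simp: lookup_ind_exp)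
    qed
  qed
qed

lemma esym_mon: "esym s m j = (\<Sum>S | S \<subseteq> {1..m} \<and> card S = j. mon (ind_exp S s))"
  by (simp add: esym_def prod_var_mon)

lemma monic_lead_esym:
  assumes "j \<le> m"
  shows "monic_lead (esym 1 m j) (ind_exp {1..j} 1)"
proof -
  let ?A = "{S. S \<subseteq> {1..m} \<and> card S = j}"
  have A: "finite ?A" "{1..j} \<in> ?A" using assms by auto
  have eq: "esym 1 m j - mon (ind_exp {1..j} 1) = (\<Sum>S\<in>?A - {{1..j}}. mon (ind_exp S 1))"
    unfolding esym_mon using A by (subst sum.remove[OF A]) simp
  then have "b < ind_exp {1..j} 1" if "b \<in> Poly_Mapping.keys (esym 1 m j - mon (ind_exp {1..j} 1))" for b
  proof -
    have "b \<in> Poly_Mapping.keys (\<Sum>S\<in>?A - {{1..j}}. mon (ind_exp S 1))"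
      using that unfolding eq .
    then have "b \<in> (\<Union>S\<in>?A - {{1..j}}. Poly_Mapping.keys (mon (ind_exp S 1)))"
      by (rule subsetD[OF Poly_Mapping.keys_sum])
    then obtain S where "S \<in> ?A - {{1..j}}" "b \<in> Poly_Mapping.keys (mon (ind_exp S 1))"
      by (rule UN_E)
    then show ?thesis using ind_exp_less[of S m j] assms by auto
  qed
  then show ?thesis by (simp add: monic_lead_def)
qed

text \<open>The product from Gauss's proof of the fundamental theorem: for dominant \<open>a\<close>
  its leading exponent is \<open>a\<close>. Only the exponent of \<open>e_m\<close> may be negative,
  hence \<open>epow\<close>.\<close>

definition esym_mono :: "nat \<Rightarrow> (nat \<Rightarrow>\<^sub>0 int) \<Rightarrow> laurent" where
  "esym_mono m a = (\<Prod>j=1..<m. esym 1 m j ^ nat (Poly_Mapping.lookup a j - Poly_Mapping.lookup a (Suc j)))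
     * epow m (Poly_Mapping.lookup a m)"

definition dominant :: "nat \<Rightarrow> (nat \<Rightarrow>\<^sub>0 int) \<Rightarrow> bool" where
  "dominant m a \<longleftrightarrow> Poly_Mapping.keys a \<subseteq> {1..m}
     \<and> (\<forall>j\<in>{1..<m}. Poly_Mapping.lookup a (Suc j) \<le> Poly_Mapping.lookup a j)"

lemma epow_mon: "epow m k = mon (ind_exp {1..m} k)"
  by (simp add: epow_def prod_var_mon)

lemma telescope_int:
  fixes f :: "nat \<Rightarrow> int"
  shows "i \<le> m \<Longrightarrow> (\<Sum>j=i..<m. f j - f (Suc j)) = f i - f m"
  by (induction m) (auto simp: le_Suc_eq)

text \<open>The leading monomial of \<open>e_j\<close> is \<open>t_1 ... t_j\<close>, so the
  exponent of \<open>t_i\<close> collects the differences with \<open>j \<ge> i\<close>. They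
  telescope to \<open>a_i - a_m\<close>, and \<open>epow\<close> supplies
  \<open>a_m\<close>.\<close>

lemma monic_lead_esym_mono:
  assumes "dominant m a"
  shows "monic_lead (esym_mono m a) a"
proof -
  let ?n = "\<lambda>j. nat (Poly_Mapping.lookup a j - Poly_Mapping.lookup a (Suc j))"
  have "monic_lead (esym_mono m a)
      ((\<Sum>j=1..<m. \<Sum>_<?n j. ind_exp {1..j} 1) + ind_exp {1..m} (Poly_Mapping.lookup a m))"
    unfolding esym_mono_def epow_mon
    by (intro monic_lead_mult monic_lead_prod monic_lead_power monic_lead_esym monic_lead_mon) auto
  also have "(\<Sum>j=1..<m. \<Sum>_<?n j. ind_exp {1..j} 1) + ind_exp {1..m} (Poly_Mapping.lookup a m) = a"
  proof (rule poly_mapping_eqI)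
    fix i
    have lk: "Poly_Mapping.lookup ((\<Sum>j=1..<m. \<Sum>_<?n j. ind_exp {1..j} 1)
        + ind_exp {1..m} (Poly_Mapping.lookup a m)) i
      = (\<Sum>j=1..<m. int (?n j) * (if i \<in> {1..j} then 1 else 0))
        + (if i \<in> {1..m} then Poly_Mapping.lookup a m else 0)"
      unfolding lookup_add lookup_sum lookup_ind_exp[OF finite_atLeastAtMost] by simp
    show "Poly_Mapping.lookup ((\<Sum>j=1..<m. \<Sum>_<?n j. ind_exp {1..j} 1)
        + ind_exp {1..m} (Poly_Mapping.lookup a m)) i = Poly_Mapping.lookup a i"
    proof (cases "i \<in> {1..m}")
      case True
      have "(\<Sum>j=1..<m. int (?n j) * (if i \<le> j then 1 else 0)) = (\<Sum>j=i..<m. int (?n j))"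
        by (rule sum.mono_neutral_cong_right) (use True in auto)
      also have "\<dots> = (\<Sum>j=i..<m. Poly_Mapping.lookup a j - Poly_Mapping.lookup a (Suc j))"
        using assms True by (intro sum.cong) (auto simp: dominant_def)
      also have "\<dots> = Poly_Mapping.lookup a i - Poly_Mapping.lookup a m"
        using True by (intro telescope_int) auto
      finally show ?thesis using True unfolding lk by simp
    next
      case False
      moreover have "Poly_Mapping.lookup a i = 0"
        using assms False by (auto simp: dominant_def in_keys_iff)
      moreover have "(\<Sum>j=1..<m. int (?n j) * (if i \<in> {1..j} then 1 else 0)) = 0"
        using False by (intro sum.neutral) auto
      ultimately show ?thesis using False unfolding lk by (simp only: if_False add_0)
    qed
  qed
  finally show ?thesis .
qed

lemma esym_mono_in_sym: "esym_mono m a \<in> sym_laurent m"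
  unfolding esym_mono_def
  by (intro sym_laurent_mult sym_laurent_prod sym_laurent_power esym_in_sym epow_in_sym)

lemma lookup_cst_mult: "Poly_Mapping.lookup (cst c * f) b = c * Poly_Mapping.lookup f b"
  by (simp add: mult_map_scale_conv_mult[symmetric] map.rep_eq when_def)

text \<open>The leading exponents are distinct: at the largest \<open>a\<close> with nonzero
  coefficient no other term of the sum contributes.\<close>

lemma esym_mono_independent:
  assumes fin: "finite A" and dom: "\<And>a. a \<in> A \<Longrightarrow> dominant m a"
    and zero: "(\<Sum>a\<in>A. cst (c a) * esym_mono m a) = 0" and a: "a \<in> A"
  shows "c a = 0"
proof (rule ccontr)
  assume "c a \<noteq> 0"
  define B where "B = {a\<in>A. c a \<noteq> 0}"
  have B: "finite B" "B \<noteq> {}" using fin a \<open>c a \<noteq> 0\<close> by (auto simp: B_def)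
  define b where "b = Max B"
  have b: "b \<in> B" "\<And>a. a \<in> B \<Longrightarrow> a \<le> b" using B by (auto simp: b_def)
  have lk: "Poly_Mapping.lookup (cst (c a) * esym_mono m a) b = (if a = b then c a else 0)" if "a \<in> A" for a
  proof -
    have lead: "monic_lead (esym_mono m a) a" using dom[OF that] by (rule monic_lead_esym_mono)
    have "Poly_Mapping.lookup (cst (c a) * esym_mono m a) b = c a * Poly_Mapping.lookup (esym_mono m a) b"
      by (rule lookup_cst_mult)
    moreover have "c a * Poly_Mapping.lookup (esym_mono m a) b = (if a = b then c a else 0)"
    proof (cases "a \<in> B \<and> a \<noteq> b")
      case True
      then have "a < b" using b(2)[of a] by (simp add: order.strict_iff_order)
      then have "b \<notin> Poly_Mapping.keys (esym_mono m a)"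
        using monic_leadD(2)[OF lead, of b] by auto
      then show ?thesis using True by (simp add: in_keys_iff)
    next
      case False
      then show ?thesis using that monic_leadD(1)[OF lead] by (auto simp: B_def)
    qed
    ultimately show ?thesis by simp
  qed
  have "0 = (\<Sum>a\<in>A. Poly_Mapping.lookup (cst (c a) * esym_mono m a) b)"
    using arg_cong[OF zero, of "\<lambda>f. Poly_Mapping.lookup f b"] by (simp add: lookup_sum)
  also have "\<dots> = (\<Sum>a\<in>A. if a = b then c a else 0)" by (intro sum.cong refl lk)
  also have "\<dots> = c b" using b(1) fin by (auto simp: B_def)
  finally show False using b(1) by (simp add: B_def)
qed


text \<open>The lexicographic order on integer vectors is not well-founded, so the reduction by
  leading terms needs a bound that it preserves: with all exponents in a fixed interval only
  finitely many vectors can occur.\<close>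

definition exps_between :: "nat \<Rightarrow> int \<Rightarrow> int \<Rightarrow> laurent \<Rightarrow> bool" where
  "exps_between m lo hi f \<longleftrightarrow> (\<forall>b\<in>Poly_Mapping.keys f. \<forall>i\<in>{1..m}.
     lo \<le> Poly_Mapping.lookup b i \<and> Poly_Mapping.lookup b i \<le> hi)"

lemma exps_between_mult:
  assumes "exps_between m a b f" "exps_between m c d g"
  shows "exps_between m (a + c) (b + d) (f * g)"
  unfolding exps_between_def
proof (intro ballI)
  fix x i assume x: "x \<in> Poly_Mapping.keys (f * g)" and i: "i \<in> {1..m}"
  then obtain y z where "x = y + z" "y \<in> Poly_Mapping.keys f" "z \<in> Poly_Mapping.keys g"
    using keys_mult[of f g] by blast
  then show "a + c \<le> Poly_Mapping.lookup x i \<and> Poly_Mapping.lookup x i \<le> b + d"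
    using assms i by (auto simp: exps_between_def lookup_add intro: add_mono)
qed

lemma exps_between_1: "exps_between m 0 0 1"
  by (simp add: exps_between_def)

lemma exps_between_power: "exps_between m 0 h f \<Longrightarrow> exps_between m 0 (int n * h) (f ^ n)"
proof (induction n)
  case (Suc n)
  then show ?case using exps_between_mult[of m 0 h f 0 "int n * h" "f ^ n"] by (simp add: algebra_simps)
qed (simp add: exps_between_1)

lemma exps_between_prod:
  "(\<And>i. i \<in> A \<Longrightarrow> exps_between m 0 (h i) (f i)) \<Longrightarrow> exps_between m 0 (sum h A) (prod f A)"
proof (induction A rule: infinite_finite_induct)
  case (insert x F)
  then show ?case using exps_between_mult[of m 0 "h x" "f x" 0 "sum h F" "prod f F"] by simp
qed (simp_all add: exps_between_1)

lemma exps_between_esym: "exps_between m 0 1 (esym 1 m j)"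
  unfolding exps_between_def
proof (intro ballI)
  fix b i assume "b \<in> Poly_Mapping.keys (esym 1 m j)"
  then have "b \<in> (\<Union>S\<in>{S. S \<subseteq> {1..m} \<and> card S = j}. Poly_Mapping.keys (mon (ind_exp S 1)))"
    unfolding esym_mon by (rule subsetD[OF Poly_Mapping.keys_sum])
  then obtain S where "S \<in> {S. S \<subseteq> {1..m} \<and> card S = j}" "b \<in> Poly_Mapping.keys (mon (ind_exp S 1))"
    by (rule UN_E)
  then show "0 \<le> Poly_Mapping.lookup b i \<and> Poly_Mapping.lookup b i \<le> 1"
    by (auto simp: lookup_ind_exp finite_subset[of _ "{1..m}"])
qed

text \<open>Each factor \<open>e_j\<close> has exponents 0 and 1, and the number of these factors
  telescopes to \<open>a_1 - a_m\<close>; \<open>epow\<close> then shifts by \<open>a_m\<close>. So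
  subtracting a multiple of this product never leaves an interval that contains \<open>a_1\<close>
  and \<open>a_m\<close>.\<close>

lemma exps_between_esym_mono:
  assumes "dominant m a" "m \<ge> 1"
  shows "exps_between m (Poly_Mapping.lookup a m) (Poly_Mapping.lookup a 1) (esym_mono m a)"
proof -
  let ?n = "\<lambda>j. nat (Poly_Mapping.lookup a j - Poly_Mapping.lookup a (Suc j))"
  have "exps_between m 0 (int (?n j) * 1) (esym 1 m j ^ ?n j)" for j
    by (intro exps_between_power exps_between_esym)
  then have 1: "exps_between m 0 (\<Sum>j=1..<m. int (?n j) * 1) (\<Prod>j=1..<m. esym 1 m j ^ ?n j)"
    by (intro exps_between_prod)
  have "(\<Sum>j=1..<m. int (?n j) * 1) = (\<Sum>j=1..<m. Poly_Mapping.lookup a j - Poly_Mapping.lookup a (Suc j))"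
    using assms by (intro sum.cong) (auto simp: dominant_def)
  also have "\<dots> = Poly_Mapping.lookup a 1 - Poly_Mapping.lookup a m"
    using assms by (intro telescope_int) auto
  finally have 2: "(\<Sum>j=1..<m. int (?n j) * 1) = Poly_Mapping.lookup a 1 - Poly_Mapping.lookup a m" .
  have 3: "exps_between m (Poly_Mapping.lookup a m) (Poly_Mapping.lookup a m) (epow m (Poly_Mapping.lookup a m))"
    by (simp add: exps_between_def epow_mon lookup_ind_exp)
  show ?thesis
    using exps_between_mult[OF 1[unfolded 2] 3] by (simp add: esym_mono_def)
qed

text \<open>If the exponent increased from \<open>j\<close> to \<open>j + 1\<close>, swapping these
  two variables would give a larger exponent vector of \<open>f\<close>.\<close>

lemma dominant_Max_keys:
  assumes f: "f \<in> sym_laurent m" "f \<noteq> 0"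
  shows "dominant m (Max (Poly_Mapping.keys f))"
proof -
  define a where "a = Max (Poly_Mapping.keys f)"
  have a: "a \<in> Poly_Mapping.keys f" "\<And>b. b \<in> Poly_Mapping.keys f \<Longrightarrow> b \<le> a"
    using f(2) by (auto simp: a_def)
  have "Poly_Mapping.lookup a (Suc j) \<le> Poly_Mapping.lookup a j" if j: "j \<in> {1..<m}" for j
  proof (rule ccontr)
    assume less: "\<not> ?thesis"
    let ?t = "Transposition.transpose j (Suc j)"
    define b where "b = Poly_Mapping.map_key ?t a"
    have "?t permutes {1..m}" using j by (intro permutes_swap_id) auto
    then have "Poly_Mapping.lookup f b = Poly_Mapping.lookup f a"
      using f(1) by (auto simp: sym_laurent_def b_def)
    then have "b \<le> a" using a by (auto simp: in_keys_iff)
    have lb: "Poly_Mapping.lookup b i = Poly_Mapping.lookup a (?t i)" for i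
      by (simp add: b_def lookup_map_key_inj)
    have "a < b"
      unfolding less_poly_mapping_iff
      by (rule exI[of _ j]) (use less in \<open>auto simp: lb Transposition.transpose_def\<close>)
    with \<open>b \<le> a\<close> show False by simp
  qed
  moreover have "Poly_Mapping.keys a \<subseteq> {1..m}"
    using f(1) a(1) by (auto simp: sym_laurent_def)
  ultimately show ?thesis unfolding a_def[symmetric] by (simp add: dominant_def)
qed

lemma finite_exps_box:
  "finite {b :: nat \<Rightarrow>\<^sub>0 int. Poly_Mapping.keys b \<subseteq> {1..m}
     \<and> (\<forall>i\<in>{1..m}. lo \<le> Poly_Mapping.lookup b i \<and> Poly_Mapping.lookup b i \<le> hi)}" (is "finite ?B")
proof -
  have "inj_on (\<lambda>b. restrict (Poly_Mapping.lookup b) {1..m}) ?B"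
  proof (rule inj_onI)
    fix b c assume b: "b \<in> ?B" and c: "c \<in> ?B"
      and eq: "restrict (Poly_Mapping.lookup b) {1..m} = restrict (Poly_Mapping.lookup c) {1..m}"
    show "b = c"
    proof (rule poly_mapping_eqI)
      fix i
      show "Poly_Mapping.lookup b i = Poly_Mapping.lookup c i"
      proof (cases "i \<in> {1..m}")
        case True
        then show ?thesis using fun_cong[OF eq, of i] by simp
      next
        case False
        then have "i \<notin> Poly_Mapping.keys b" "i \<notin> Poly_Mapping.keys c" using b c by blast+
        then show ?thesis by (simp add: in_keys_iff)
      qed
    qed
  qed
  moreover have "(\<lambda>b. restrict (Poly_Mapping.lookup b) {1..m}) ` ?B \<subseteq> {1..m} \<rightarrow>\<^sub>E {lo..hi}"
    by auto
  ultimately show ?thesis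
    by (meson finite_PiE finite_atLeastAtMost finite_atLeastAtMost_int finite_imageD finite_subset)
qed

text \<open>Subtract multiples of the \<open>esym_mono m a\<close> to cancel the leading monomial, keeping all exponents
  in a fixed box.\<close>

lemma sym_laurent_subset:
  assumes zero: "0 \<in> Y" and add: "\<And>f g. f \<in> Y \<Longrightarrow> g \<in> Y \<Longrightarrow> f + g \<in> Y"
    and mono: "\<And>c a. dominant m a \<Longrightarrow> cst c * esym_mono m a \<in> Y"
  shows "sym_laurent m \<subseteq> Y"
proof
  fix f assume f: "f \<in> sym_laurent m"
  define V where "V = (\<Union>b\<in>Poly_Mapping.keys f. Poly_Mapping.lookup b ` {1..m})"
  have finV: "finite V" by (simp add: V_def)
  define lo hi where "lo = Min V" and "hi = Max V"
  have "exps_between m lo hi f"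
    using finV by (auto simp: exps_between_def lo_def hi_def V_def intro!: Min_le Max_ge)
  define B where "B = {b :: nat \<Rightarrow>\<^sub>0 int. Poly_Mapping.keys b \<subseteq> {1..m}
     \<and> (\<forall>i\<in>{1..m}. lo \<le> Poly_Mapping.lookup b i \<and> Poly_Mapping.lookup b i \<le> hi)}"
  have finB: "finite B" unfolding B_def by (rule finite_exps_box)
  have keysB: "Poly_Mapping.keys g \<subseteq> B" if "g \<in> sym_laurent m" "exps_between m lo hi g" for g
    using that by (auto simp: B_def sym_laurent_def exps_between_def)
  have "g \<in> Y" if "g \<in> sym_laurent m" "exps_between m lo hi g" for g
    using that
  \<comment> \<open>The measure counts the vectors of the box that lie below some exponent of
    \<open>g\<close>. Cancelling the leading exponent \<open>a\<close> removes at least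
    \<open>a\<close> from this set.\<close>
  proof (induction "card {b\<in>B. \<exists>a\<in>Poly_Mapping.keys g. b \<le> a}" arbitrary: g rule: less_induct)
    case less
    show ?case
    proof (cases "g = 0")
      case False
      define a where "a = Max (Poly_Mapping.keys g)"
      have a: "a \<in> Poly_Mapping.keys g" "\<And>b. b \<in> Poly_Mapping.keys g \<Longrightarrow> b \<le> a"
        using False by (auto simp: a_def)
      have dom: "dominant m a"
        unfolding a_def by (rule dominant_Max_keys[OF less.prems(1) False])
      define c where "c = Poly_Mapping.lookup g a"
      define g' where "g' = g - cst c * esym_mono m a"
      have lead: "monic_lead (esym_mono m a) a" using dom by (rule monic_lead_esym_mono)
      have g'_sym: "g' \<in> sym_laurent m"
        unfolding g'_def
        by (intro sym_laurent_diff less.prems sym_laurent_mult sym_laurent_cst esym_mono_in_sym)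
      have keys': "b \<in> Poly_Mapping.keys g \<or> b \<in> Poly_Mapping.keys (esym_mono m a)"
        if "b \<in> Poly_Mapping.keys g'" for b
        using that by (auto simp: g'_def in_keys_iff lookup_minus lookup_cst_mult)
      have lt: "b < a" if b: "b \<in> Poly_Mapping.keys g'" for b
      proof -
        have "b \<le> a" using keys'[OF b] a(2) monic_leadD(2)[OF lead] by auto
        moreover have "b \<noteq> a"
          using b monic_leadD(1)[OF lead] by (auto simp: g'_def in_keys_iff lookup_minus lookup_cst_mult c_def)
        ultimately show ?thesis by simp
      qed
      have "exps_between m lo hi g'"
      proof (cases "m \<ge> 1")
        case True
        have "lo \<le> Poly_Mapping.lookup a m" "Poly_Mapping.lookup a 1 \<le> hi"
          using less.prems(2) a(1) True by (auto simp: exps_between_def)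
        then have "exps_between m lo hi (esym_mono m a)"
          using exps_between_esym_mono[OF dom True] by (force simp: exps_between_def)
        then show ?thesis
          using less.prems(2) keys' by (auto simp: exps_between_def)
      qed (simp add: exps_between_def)
      moreover have "card {b\<in>B. \<exists>a\<in>Poly_Mapping.keys g'. b \<le> a} < card {b\<in>B. \<exists>a\<in>Poly_Mapping.keys g. b \<le> a}"
      proof (rule psubset_card_mono)
        show "finite {b\<in>B. \<exists>a\<in>Poly_Mapping.keys g. b \<le> a}" using finB by simp
        have "a \<in> {b\<in>B. \<exists>a\<in>Poly_Mapping.keys g. b \<le> a}"
          using a(1) keysB[OF less.prems] by auto
        moreover have "a \<notin> {b\<in>B. \<exists>a\<in>Poly_Mapping.keys g'. b \<le> a}"
          using lt by (auto simp: not_le[symmetric])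
        moreover have "{b\<in>B. \<exists>a\<in>Poly_Mapping.keys g'. b \<le> a} \<subseteq> {b\<in>B. \<exists>a\<in>Poly_Mapping.keys g. b \<le> a}"
          using a(1) lt by (auto intro!: bexI[of _ a] dest: order.strict_implies_order intro: order.trans)
        ultimately show "{b\<in>B. \<exists>a\<in>Poly_Mapping.keys g'. b \<le> a} \<subset> {b\<in>B. \<exists>a\<in>Poly_Mapping.keys g. b \<le> a}"
          by blast
      qed
      ultimately have "g' \<in> Y" using less.hyps g'_sym by blast
      then have "g' + cst c * esym_mono m a \<in> Y" by (intro add mono dom)
      then show ?thesis by (simp add: g'_def)
    qed (simp add: zero)
  qed
  then show "f \<in> Y" using f \<open>exps_between m lo hi f\<close> by blast
qed

text \<open>The multipliers that preserve \<open>Y\<close> form an algebra. Newton's identities,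
  with division by \<open>n\<close> in characteristic 0, put \<open>esym s m j\<close> into it for
  \<open>s \<noteq> 0\<close>, and \<open>epow m k\<close> is \<open>esym k m m\<close>. The
  hypothesis on power sums is what commutators with the \<open>h_l\<close> provide.\<close>

lemma sym_laurent_mult_closed:
  assumes add: "\<And>f g. f \<in> Y \<Longrightarrow> g \<in> Y \<Longrightarrow> f + g \<in> Y"
    and scale: "\<And>c f. f \<in> Y \<Longrightarrow> cst c * f \<in> Y"
    and psum: "\<And>l f. l \<noteq> 0 \<Longrightarrow> f \<in> Y \<Longrightarrow> psum m l * f \<in> Y"
    and g: "g \<in> sym_laurent m" and f: "f \<in> Y"
  shows "g * f \<in> Y"
proof -
  define Z where "Z = {g. \<forall>f\<in>Y. g * f \<in> Y}"
  have Z_cst: "cst c \<in> Z" for c using scale by (auto simp: Z_def)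
  have Z_1: "1 \<in> Z" by (auto simp: Z_def)
  have Z_0: "0 \<in> Z" using Z_cst[of 0] by simp
  have Z_add: "a + b \<in> Z" if "a \<in> Z" "b \<in> Z" for a b
    using that add by (auto simp: Z_def distrib_right)
  have Z_mult: "a * b \<in> Z" if "a \<in> Z" "b \<in> Z" for a b
    using that by (auto simp: Z_def mult.assoc)
  have Z_sum: "sum h A \<in> Z" if "\<And>i. i \<in> A \<Longrightarrow> h i \<in> Z" for h :: "nat \<Rightarrow> laurent" and A
    using that by (induction A rule: infinite_finite_induct) (auto intro: Z_0 Z_add)
  have Z_prod: "prod h A \<in> Z" if "\<And>i. i \<in> A \<Longrightarrow> h i \<in> Z" for h :: "nat \<Rightarrow> laurent" and A
    using that by (induction A rule: infinite_finite_induct) (auto intro: Z_1 Z_mult)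
  have Z_pow: "a ^ n \<in> Z" if "a \<in> Z" for a n
    using that by (induction n) (auto intro: Z_1 Z_mult)
  have Z_psum: "psum m l \<in> Z" if "l \<noteq> 0" for l using psum[OF that] by (auto simp: Z_def)
  have Z_esym: "esym s m j \<in> Z" if s: "s \<noteq> 0" for s j
  proof (induction j rule: less_induct)
    case (less j)
    show ?case
    proof (cases j)
      case (Suc n)
      have m1: "(- 1 :: laurent) ^ l \<in> Z" for l
        using Z_pow[OF Z_cst[of "- 1"]] by (simp add: single_uminus)
      have "(\<Sum>l\<le>n. (- 1) ^ l * psum m (of_nat (Suc l) * s) * esym s m (n - l)) \<in> Z"
        using s by (intro Z_sum Z_mult Z_psum m1 less) (auto simp: Suc simp del: of_nat_Suc)
      then have "of_nat (Suc n) * esym s m (Suc n) \<in> Z"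
        unfolding esym_Newton .
      then have "cst (1 / of_nat (Suc n)) * (of_nat (Suc n) * esym s m (Suc n)) \<in> Z"
        by (rule Z_mult[OF Z_cst])
      also have "cst (1 / of_nat (Suc n)) * (of_nat (Suc n) * esym s m (Suc n)) = esym s m (Suc n)"
      proof -
        have "cst (1 / of_nat (Suc n)) * of_nat (Suc n) = (cst (1 / of_nat (Suc n) * of_nat (Suc n)))"
          by (subst of_nat_single) (simp only: o_apply mult_single add_0)
        also have "\<dots> = 1"
          using of_nat_neq_0[where 'a = K, of n] by (simp del: of_nat_Suc)
        finally show ?thesis by (simp only: mult.assoc[symmetric] mult_1_left)
      qed
      finally show ?thesis by (simp add: Suc)
    qed (simp add: Z_1)
  qed
  have Z_epow: "epow m k \<in> Z" for k
    using Z_esym[of k m] Z_1 by (cases "k = 0") (simp_all flip: epow_esym)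
  have "sym_laurent m \<subseteq> Z"
    unfolding One_nat_def[symmetric]
    by (rule sym_laurent_subset)
      (auto simp: esym_mono_def intro!: Z_0 Z_add Z_mult Z_cst Z_prod Z_pow Z_esym Z_epow)
  then show ?thesis using g f by (auto simp: Z_def)
qed

section \<open>Monomials in elementary symmetric functions\<close>

text \<open>The words in \<open>1, \<dots>, r\<close> of length less than \<open>n\<close>, up to order.\<close>

fun short_words :: "nat \<Rightarrow> nat \<Rightarrow> nat list list" where
  "short_words r 0 = []"
| "short_words 0 (Suc n) = [[]]"
| "short_words (Suc r) (Suc n) = short_words r (Suc n) @ map (Cons (Suc r)) (short_words (Suc r) n)"

text \<open>The lists represent multisets with the largest letter first. The last clause splits them
  by whether \<open>Suc r\<close> occurs, which is Pascal's rule.\<close>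

lemma length_short_words: "length (short_words r (Suc n)) = (n + r) choose r"
proof (induction r "Suc n" arbitrary: n rule: short_words.induct)
  case (3 r n)
  then show ?case by (cases n) simp_all
qed simp

text \<open>The sequence \<open>\<epsilon>\<close> is arbitrary and only the truncation
  \<open>r\<close> varies: the induction on \<open>r\<close> must keep the letters fixed, whereas
  the elementary symmetric functions of \<open>r\<close> variables change with \<open>r\<close>. In
  the application \<open>\<epsilon>\<close> is \<open>esym 1 r\<close>, truncated at the same
  \<open>r\<close>.\<close>

locale truncated_series =
  fixes \<epsilon> :: "nat \<Rightarrow> laurent"
begin

definition E :: "nat \<Rightarrow> laurent fps" where
  "E r = Abs_fps (\<lambda>i. if i = 0 then 1 else if i \<le> r then (- 1) ^ i * \<epsilon> i else 0)"

definition H :: "nat \<Rightarrow> laurent fps" where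
  "H r = fps_right_inverse (E r) 1"

lemma E_H: "E r * H r = 1"
  unfolding H_def by (rule fps_right_inverse) (simp add: E_def)

lemma H_nth_0 [simp]: "fps_nth (H r) 0 = 1"
  by (simp add: H_def)

lemma E_Suc: "E (Suc r) = E r + fps_const ((- 1) ^ Suc r * \<epsilon> (Suc r)) * fps_X ^ Suc r"
  by (rule fps_ext) (auto simp: E_def fps_X_power_iff le_Suc_eq simp del: power_Suc)

text \<open>A filtration in which \<open>\<epsilon> j\<close> has weight \<open>j\<close>. The bound
  is carried along because the relations in \<open>U_q\<close> hold only up to terms of smaller
  weight, which are treated by induction on \<open>D\<close>.\<close>

inductive_set wt_le :: "nat \<Rightarrow> nat \<Rightarrow> laurent set" for r D where
  zero: "0 \<in> wt_le r D"
| word: "set w \<subseteq> {1..r} \<Longrightarrow> sum_list w \<le> D \<Longrightarrow> f \<in> wt_le r D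
     \<Longrightarrow> f + cst c * (\<Prod>j\<leftarrow>w. \<epsilon> j) \<in> wt_le r D"

lemma wt_le_word: "set w \<subseteq> {1..r} \<Longrightarrow> sum_list w \<le> D \<Longrightarrow> cst c * (\<Prod>j\<leftarrow>w. \<epsilon> j) \<in> wt_le r D"
  using wt_le.word[OF _ _ wt_le.zero, of w r D c] by simp

lemma wt_le_add: "g \<in> wt_le r D \<Longrightarrow> f \<in> wt_le r D \<Longrightarrow> f + g \<in> wt_le r D"
proof (induction rule: wt_le.induct)
  case (word w g c)
  then show ?case using wt_le.word[of w r D "f + g" c] by (simp add: add.assoc)
qed simp

lemma wt_le_mono: "f \<in> wt_le r D \<Longrightarrow> D \<le> D' \<Longrightarrow> r \<le> r' \<Longrightarrow> f \<in> wt_le r' D'"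
proof (induction rule: wt_le.induct)
  case (word w f c)
  then have "set w \<subseteq> {1..r'}" by force
  then show ?case using word by (intro wt_le.word) auto
qed (rule wt_le.zero)

lemma wt_le_cst_mult: "f \<in> wt_le r D \<Longrightarrow> cst c * f \<in> wt_le r D"
proof (induction rule: wt_le.induct)
  case (word w f d)
  have "cst c * (f + cst d * (\<Prod>j\<leftarrow>w. \<epsilon> j)) = cst c * f + cst (c * d) * (\<Prod>j\<leftarrow>w. \<epsilon> j)"
    by (simp add: distrib_left mult.assoc[symmetric] mult_single)
  then show ?case using word by (simp add: wt_le.word)
qed (simp add: wt_le.zero)

lemma wt_le_mult_word:
  assumes "f \<in> wt_le r D" "set v \<subseteq> {1..r}"
  shows "f * (\<Prod>j\<leftarrow>v. \<epsilon> j) \<in> wt_le r (D + sum_list v)"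
  using assms
proof (induction rule: wt_le.induct)
  case (word w f d)
  have "(f + cst d * (\<Prod>j\<leftarrow>w. \<epsilon> j)) * (\<Prod>j\<leftarrow>v. \<epsilon> j)
      = f * (\<Prod>j\<leftarrow>v. \<epsilon> j) + cst d * (\<Prod>j\<leftarrow>w @ v. \<epsilon> j)"
    by (simp add: distrib_right mult.assoc)
  then show ?case using word by (simp only:) (intro wt_le.word, auto)
qed (simp add: wt_le.zero)

lemma wt_le_mult:
  assumes "g \<in> wt_le r D'" "f \<in> wt_le r D"
  shows "f * g \<in> wt_le r (D + D')"
  using assms
proof (induction rule: wt_le.induct)
  case (word w g d)
  have "f * (g + cst d * (\<Prod>j\<leftarrow>w. \<epsilon> j)) = f * g + (cst d * f) * (\<Prod>j\<leftarrow>w. \<epsilon> j)"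
    by (simp add: distrib_left mult_ac)
  moreover have "(cst d * f) * (\<Prod>j\<leftarrow>w. \<epsilon> j) \<in> wt_le r (D + D')"
    by (rule wt_le_mono[OF wt_le_mult_word[OF wt_le_cst_mult]]) (use word in auto)
  ultimately show ?case using word by (simp add: wt_le_add)
qed (simp add: wt_le.zero)

lemma wt_le_sum: "(\<And>i. i \<in> A \<Longrightarrow> f i \<in> wt_le r D) \<Longrightarrow> sum f A \<in> wt_le r D"
  by (induction A rule: infinite_finite_induct) (auto intro: wt_le.zero wt_le_add)

lemma wt_le_1: "1 \<in> wt_le r D"
  using wt_le_word[of "[]" r D 1] by simp

lemma wt_le_uminus: "f \<in> wt_le r D \<Longrightarrow> - f \<in> wt_le r D"
  using wt_le_cst_mult[of f r D "- 1"] by (simp add: single_uminus)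

lemma wt_le_power_m1: "f \<in> wt_le r D \<Longrightarrow> (- 1) ^ n * f \<in> wt_le r D"
  by (cases "even n") (simp_all add: wt_le_uminus)

lemma wt_le_gen: "1 \<le> j \<Longrightarrow> j \<le> r \<Longrightarrow> \<epsilon> j \<in> wt_le r j"
  using wt_le_word[of "[j]" r j 1] by simp

lemma E_nth_wt: "fps_nth (E r) i \<in> wt_le r i"
  by (cases "i = 0 \<or> r < i") (auto simp: E_def intro!: wt_le.zero wt_le_1 wt_le_power_m1 wt_le_gen)

lemma H_recursion: "n > 0 \<Longrightarrow> fps_nth (H r) n = - (\<Sum>i=1..n. fps_nth (E r) i * fps_nth (H r) (n - i))"
proof -
  assume n: "n > 0"
  have "0 = (\<Sum>i=0..n. fps_nth (E r) i * fps_nth (H r) (n - i))"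
    using arg_cong[OF E_H[of r], of "\<lambda>f. fps_nth f n"] n by (simp add: fps_mult_nth)
  also have "\<dots> = fps_nth (H r) n + (\<Sum>i=1..n. fps_nth (E r) i * fps_nth (H r) (n - i))"
    by (subst sum.atLeast_Suc_atMost) (simp_all add: E_def)
  finally show ?thesis by (simp add: eq_neg_iff_add_eq_0)
qed

lemma H_nth_wt: "fps_nth (H r) n \<in> wt_le r n"
proof (induction n rule: less_induct)
  case (less n)
  show ?case
  proof (cases "n = 0")
    case False
    have "fps_nth (E r) i * fps_nth (H r) (n - i) \<in> wt_le r n" if "i \<in> {1..n}" for i
      using wt_le_mult[OF less E_nth_wt, of "n - i" i] that by simp
    then show ?thesis
      using False by (subst H_recursion) (auto intro!: wt_le_uminus wt_le_sum)
  qed (simp add: wt_le_1)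
qed

lemma H_Suc: "H r = H (Suc r) + fps_const ((- 1) ^ Suc r * \<epsilon> (Suc r)) * fps_X ^ Suc r * (H (Suc r) * H r)"
proof -
  have "H r = H r * (E (Suc r) * H (Suc r))" by (simp add: E_H)
  also have "\<dots> = (E r * H r) * H (Suc r)
      + fps_const ((- 1) ^ Suc r * \<epsilon> (Suc r)) * fps_X ^ Suc r * (H (Suc r) * H r)"
    unfolding E_Suc by (simp only: algebra_simps)
  finally show ?thesis by (simp only: E_H mult_1_left)
qed

text \<open>\<open>E (Suc r)\<close> and \<open>E r\<close> differ by a single term, so their
  inverses differ by a multiple of \<open>\<epsilon> (Suc r)\<close>. The clause for
  \<open>p < Suc r\<close> records that the multiple is then 0, which the truncated weight
  \<open>p - Suc r\<close> cannot express.\<close>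

lemma H_nth_Suc:
  obtains g where "g \<in> wt_le (Suc r) (p - Suc r)" "p < Suc r \<longrightarrow> g = 0"
    "fps_nth (H r) p = fps_nth (H (Suc r)) p + \<epsilon> (Suc r) * g"
proof -
  define g where "g = (if p < Suc r then 0 else (- 1) ^ Suc r * fps_nth (H (Suc r) * H r) (p - Suc r))"
  have wt: "fps_nth (H (Suc r) * H r) k \<in> wt_le (Suc r) k" for k
  proof -
    have "fps_nth (H (Suc r)) i * fps_nth (H r) (k - i) \<in> wt_le (Suc r) k" if "i \<le> k" for i
      using wt_le_mult[OF wt_le_mono[OF H_nth_wt[of r "k - i"], of "k - i" "Suc r"] H_nth_wt[of "Suc r" i]] that
      by simp
    then show ?thesis by (auto simp: fps_mult_nth intro: wt_le_sum)
  qed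
  show ?thesis
  proof
    show "g \<in> wt_le (Suc r) (p - Suc r)"
      unfolding g_def by (cases "p < Suc r") (simp_all add: wt_le.zero wt_le_power_m1 wt_le_uminus wt)
    show "p < Suc r \<longrightarrow> g = 0" by (simp add: g_def)
    have "fps_nth (H r) p = fps_nth (H (Suc r) + fps_const ((- 1) ^ Suc r * \<epsilon> (Suc r))
        * fps_X ^ Suc r * (H (Suc r) * H r)) p"
      by (simp only: H_Suc[symmetric])
    also have "\<dots> = fps_nth (H (Suc r)) p + (- 1) ^ Suc r * \<epsilon> (Suc r)
        * (if p < Suc r then 0 else fps_nth (H (Suc r) * H r) (p - Suc r))"
      by (simp only: fps_add_nth mult.assoc[of "fps_const _"] fps_mult_left_const_nth fps_X_power_mult_nth)
    also have "\<dots> = fps_nth (H (Suc r)) p + \<epsilon> (Suc r) * g"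
      unfolding g_def by (cases "p < Suc r") (simp_all only: if_True if_False mult_ac mult_zero_left mult_zero_right)
    finally show "fps_nth (H r) p = fps_nth (H (Suc r)) p + \<epsilon> (Suc r) * g" .
  qed
qed

text \<open>Modulo the \<open>fps_nth (H r) p\<close> with \<open>p \<ge> n\<close>, the short words span. As for the cohomology of
  Grassmannians, the proof splits off the multiples of \<open>\<epsilon> r\<close>, which satisfy Pascal's rule.\<close>

inductive_set reducible :: "nat \<Rightarrow> nat \<Rightarrow> nat \<Rightarrow> laurent set" for r n D where
  zero: "0 \<in> reducible r n D"
| short: "f \<in> reducible r n D \<Longrightarrow> w \<in> set (short_words r n) \<Longrightarrow> f + cst c * (\<Prod>j\<leftarrow>w. \<epsilon> j) \<in> reducible r n D"
| rel: "f \<in> reducible r n D \<Longrightarrow> n \<le> p \<Longrightarrow> p \<le> D \<Longrightarrow> a \<in> wt_le r (D - p)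
     \<Longrightarrow> f + a * fps_nth (H r) p \<in> reducible r n D"

lemma reducible_add: "g \<in> reducible r n D \<Longrightarrow> f \<in> reducible r n D \<Longrightarrow> f + g \<in> reducible r n D"
proof (induction rule: reducible.induct)
  case (short g w c)
  then show ?case using reducible.short[of "f + g" r n D w c] by (simp add: add.assoc)
next
  case (rel g p a)
  then show ?case using reducible.rel[of "f + g" r n D p a] by (simp add: add.assoc)
qed simp

lemma reducible_rel: "n \<le> p \<Longrightarrow> p \<le> D \<Longrightarrow> a \<in> wt_le r (D - p) \<Longrightarrow> a * fps_nth (H r) p \<in> reducible r n D"
  using reducible.rel[OF reducible.zero, of n p D a r] by simp

lemma reducible_sum: "(\<And>i. i \<in> A \<Longrightarrow> f i \<in> reducible r n D) \<Longrightarrow> sum f A \<in> reducible r n D"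
  by (induction A rule: infinite_finite_induct) (auto intro: reducible.zero reducible_add)

text \<open>Both bounds move together: short words gain one letter, and relations starting at
  \<open>n\<close> become relations starting at \<open>n + 1\<close>.\<close>

lemma reducible_gen_mult:
  assumes "f \<in> reducible (Suc r) n D"
  shows "\<epsilon> (Suc r) * f \<in> reducible (Suc r) (Suc n) (D + Suc r)"
  using assms
proof (induction rule: reducible.induct)
  case zero
  then show ?case by (simp add: reducible.zero)
next
  case (short f w c)
  have "\<epsilon> (Suc r) * (f + cst c * (\<Prod>j\<leftarrow>w. \<epsilon> j)) = \<epsilon> (Suc r) * f + cst c * (\<Prod>j\<leftarrow>Suc r # w. \<epsilon> j)"
    by (simp add: algebra_simps)
  moreover have "Suc r # w \<in> set (short_words (Suc r) (Suc n))"
    using short by simp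
  ultimately show ?case using short.IH by (simp only: reducible.short)
next
  case (rel f p a)
  have a: "\<epsilon> (Suc r) * a \<in> wt_le (Suc r) (D - p + Suc r)"
    using wt_le_mult[OF wt_le_gen[of "Suc r" "Suc r"] rel(4)] by (simp add: mult.commute)
  have "\<epsilon> (Suc r) * a * fps_nth (H (Suc r)) p \<in> reducible (Suc r) (Suc n) (D + Suc r)"
  proof (cases "p = n")
    case False
    then show ?thesis using rel a by (intro reducible_rel) (auto simp: Suc_diff_le)
  next
    case True
    text \<open>The relation for \<open>p = n\<close> is lost, but its multiple by \<open>\<epsilon> (Suc r)\<close> is a combination of those
      for \<open>p = n + 1, \<dots>, n + r + 1\<close>.\<close>
    let ?N = "n + Suc r"
    have "0 = (\<Sum>i=0..?N. fps_nth (E (Suc r)) i * fps_nth (H (Suc r)) (?N - i))"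
      using arg_cong[OF E_H[of "Suc r"], of "\<lambda>f. fps_nth f ?N"] by (simp add: fps_mult_nth)
    also have "\<dots> = (\<Sum>i=0..Suc r. fps_nth (E (Suc r)) i * fps_nth (H (Suc r)) (?N - i))"
      by (rule sum.mono_neutral_right) (auto simp: E_def)
    also have "\<dots> = (\<Sum>i=0..r. fps_nth (E (Suc r)) i * fps_nth (H (Suc r)) (?N - i))
        + (- 1) ^ Suc r * (\<epsilon> (Suc r) * fps_nth (H (Suc r)) n)" (is "_ = ?S + ?s * ?X")
      by (simp add: E_def)
    finally have "?s * ?X = - ?S"
      by (simp only: eq_neg_iff_add_eq_0 add.commute)
    then have "?s * (?s * ?X) = - (?s * ?S)"
      by (simp only: mult_minus_right)
    moreover have "?s * ?s = (1 :: laurent)"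
      by (cases "even r") simp_all
    ultimately have "?X = - (?s * ?S)"
      by (simp only: mult.assoc[symmetric] mult_1_left)
    then have e: "?X = (\<Sum>i=0..r. - (?s * fps_nth (E (Suc r)) i) * fps_nth (H (Suc r)) (?N - i))"
      by (simp only: sum_distrib_left sum_negf[symmetric] mult.assoc minus_mult_left[symmetric])
    have "\<epsilon> (Suc r) * a * fps_nth (H (Suc r)) p = a * (\<epsilon> (Suc r) * fps_nth (H (Suc r)) n)"
      using True by (simp add: mult_ac)
    also have "\<dots> = (\<Sum>i=0..r. (a * - ((- 1) ^ Suc r * fps_nth (E (Suc r)) i)) * fps_nth (H (Suc r)) (?N - i))"
      unfolding e sum_distrib_left by (simp only: mult.assoc)
    also have "\<dots> \<in> reducible (Suc r) (Suc n) (D + Suc r)"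
    proof (intro reducible_sum reducible_rel)
      fix i assume i: "i \<in> {0..r}"
      show "Suc n \<le> ?N - i" "?N - i \<le> D + Suc r" using i rel True by auto
      have "a * - ((- 1) ^ Suc r * fps_nth (E (Suc r)) i) \<in> wt_le (Suc r) (D - n + i)"
        using rel True by (intro wt_le_mult wt_le_uminus wt_le_power_m1 E_nth_wt) auto
      then show "a * - ((- 1) ^ Suc r * fps_nth (E (Suc r)) i) \<in> wt_le (Suc r) (D + Suc r - (?N - i))"
        by (rule wt_le_mono) (use i rel True in auto)
    qed
    finally show ?thesis .
  qed
  then show ?case using reducible_add[OF _ rel.IH] by (simp add: distrib_left mult.assoc)
qed

text \<open>A relation for \<open>r\<close> is one for \<open>Suc r\<close> plus a multiple of
  \<open>\<epsilon> (Suc r)\<close>. The cofactor is reducible with bound \<open>n\<close> by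
  hypothesis, and multiplication by \<open>\<epsilon> (Suc r)\<close> raises the bound to
  \<open>Suc n\<close>.\<close>

lemma reducible_Suc:
  assumes f: "f \<in> reducible r (Suc n) D"
    and IH: "\<And>g D'. g \<in> wt_le (Suc r) D' \<Longrightarrow> g \<in> reducible (Suc r) n D'"
  shows "f \<in> reducible (Suc r) (Suc n) D"
  using f
proof (induction rule: reducible.induct)
  case zero
  then show ?case by (rule reducible.zero)
next
  case (short f w c)
  then show ?case by (intro reducible.short) auto
next
  case (rel f p a)
  obtain g where g: "g \<in> wt_le (Suc r) (p - Suc r)" "p < Suc r \<longrightarrow> g = 0"
    "fps_nth (H r) p = fps_nth (H (Suc r)) p + \<epsilon> (Suc r) * g"
    by (rule H_nth_Suc[of r p])
  have a: "a \<in> wt_le (Suc r) (D - p)" using rel by (auto intro: wt_le_mono)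
  have "\<epsilon> (Suc r) * (a * g) \<in> reducible (Suc r) (Suc n) D"
  proof (cases "p < Suc r")
    case False
    have "a * g \<in> wt_le (Suc r) (D - Suc r)"
      using wt_le_mult[OF g(1) a] False rel by simp
    then have "\<epsilon> (Suc r) * (a * g) \<in> reducible (Suc r) (Suc n) (D - Suc r + Suc r)"
      by (intro reducible_gen_mult IH)
    then show ?thesis using False rel by simp
  qed (simp add: g reducible.zero)
  moreover have "a * fps_nth (H (Suc r)) p \<in> reducible (Suc r) (Suc n) D"
    using rel a by (intro reducible_rel)
  ultimately show ?case
    using rel.IH by (simp only: g(3)) (simp add: distrib_left reducible_add mult_ac)
qed

lemma wt_le_split_word:
  assumes w: "set w \<subseteq> {1..Suc r}" "sum_list w \<le> D"
  shows "set w \<subseteq> {1..r}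
    \<or> (\<exists>v. set v \<subseteq> {1..Suc r} \<and> sum_list v + Suc r \<le> D \<and> (\<Prod>j\<leftarrow>w. \<epsilon> j) = \<epsilon> (Suc r) * (\<Prod>j\<leftarrow>v. \<epsilon> j))"
proof (cases "Suc r \<in> set w")
  case True
  then obtain u v where uv: "w = u @ Suc r # v" by (meson split_list)
  then have "set (u @ v) \<subseteq> {1..Suc r} \<and> sum_list (u @ v) + Suc r \<le> D
      \<and> (\<Prod>j\<leftarrow>w. \<epsilon> j) = \<epsilon> (Suc r) * (\<Prod>j\<leftarrow>u @ v. \<epsilon> j)"
    using w by (simp add: mult_ac)
  then show ?thesis by blast
next
  case False
  then have "set w \<subseteq> {1..r}" using w(1) by (auto simp: le_Suc_eq)
  then show ?thesis ..
qed

lemma wt_le_reducible: "f \<in> wt_le r D \<Longrightarrow> f \<in> reducible r n D"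
proof (induction r n arbitrary: f D rule: short_words.induct)
  case (1 r)
  \<comment> \<open>For \<open>n = 0\<close> there are no short words, but the relation of degree 0
    is 1 itself.\<close>
  show ?case using reducible_rel[of 0 0 D f r] 1 by simp
next
  case (2 n)
  from 2 show ?case
  proof (induction rule: wt_le.induct)
    case (word w f c)
    then show ?case by (intro reducible.short) auto
  qed (rule reducible.zero)
next
  case (3 r n)
  from "3.prems" show ?case
  proof (induction rule: wt_le.induct)
    case (word w f c)
    have "cst c * (\<Prod>j\<leftarrow>w. \<epsilon> j) \<in> reducible (Suc r) (Suc n) D"
      using wt_le_split_word[OF word(1,2)]
    proof (elim disjE exE conjE)
      assume "set w \<subseteq> {1..r}"
      then show ?thesis using word by (intro reducible_Suc 3 wt_le_word) auto
    next
      fix v assume v: "set v \<subseteq> {1..Suc r}" "sum_list v + Suc r \<le> D"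
        "(\<Prod>j\<leftarrow>w. \<epsilon> j) = \<epsilon> (Suc r) * (\<Prod>j\<leftarrow>v. \<epsilon> j)"
      have "\<epsilon> (Suc r) * (cst c * (\<Prod>j\<leftarrow>v. \<epsilon> j)) \<in> reducible (Suc r) (Suc n) (D - Suc r + Suc r)"
        using v by (intro reducible_gen_mult 3 wt_le_word) auto
      then show ?thesis using v by (simp add: mult_ac)
    qed
    then show ?case using word by (simp add: reducible_add)
  qed (rule reducible.zero)
qed

end

section \<open>Spanning sets of \<open>U\<^sub>q\<close>\<close>

subsection \<open>The subalgebra \<open>U\<^sub>q(0)\<close> and the left ideal\<close>

text \<open>Additive closure already gives a linear span here: the generating sets used below absorb
  scalars.\<close>

inductive_set add_span :: "'a::ab_group_add set \<Rightarrow> 'a set" for B where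
  zero: "0 \<in> add_span B"
| step: "a \<in> add_span B \<Longrightarrow> b \<in> B \<Longrightarrow> a + b \<in> add_span B"

lemma add_span_base: "b \<in> B \<Longrightarrow> b \<in> add_span B"
  using add_span.step[OF add_span.zero] by simp

lemma add_span_add: "b \<in> add_span B \<Longrightarrow> a \<in> add_span B \<Longrightarrow> a + b \<in> add_span B"
proof (induction rule: add_span.induct)
  case (step b c)
  then have "(a + b) + c \<in> add_span B" using add_span.step by blast
  then show ?case by (simp add: add.assoc)
qed simp

lemma add_span_image:
  assumes "a \<in> add_span B" "T 0 = 0" "\<And>a b. T (a + b) = T a + T b" "\<And>b. b \<in> B \<Longrightarrow> T b \<in> add_span C"
  shows "T a \<in> add_span C"
  using assms(1) by induction (auto simp: assms intro: add_span.zero add_span_add)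

lemma scal_of_nat: "scal (of_nat n) = of_nat n"
  by (induction n) (simp_all add: scal_add)

lemma scal_sum: "scal (sum f A) = (\<Sum>i\<in>A. scal (f i))"
  by (induction A rule: infinite_finite_induct) (simp_all add: scal_add)

lemma scal_left_commute: "a * (scal c * b) = scal c * (a * b)"
  by (metis mult.assoc scal_commute)

lemma scal_scal: "scal c * (scal d * a) = scal (c * d) * a"
  by (simp add: scal_mult mult.assoc)

lemma scal_cancel: "c \<noteq> 0 \<Longrightarrow> scal (1 / c) * (scal c * a) = a"
  by (simp add: scal_scal)

lemma K_x_relation:
  "K_el Plus * x_el e r * K_el Minus = scal (qK powi (2 * pm_sign e)) * x_el e r"
  using Uq_rels.K_x[THEN abs_uq_eqI] by (simp only: K_el_def x_el_def abs_uq_simps scal_def)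

lemma x_x_relation:
  "x_el e (r + 1) * x_el e s - scal (qK powi (2 * pm_sign e)) * x_el e s * x_el e (r + 1)
   = scal (qK powi (2 * pm_sign e)) * x_el e r * x_el e (s + 1) - x_el e (s + 1) * x_el e r"
  using Uq_rels.x_x[THEN abs_uq_eqI] by (simp only: x_el_def abs_uq_simps scal_def)

lemma h_el_0 [simp]: "h_el 0 = 0"
  using Uq_rels.h_0 hull_subset[of Uq_rels two_sided_ideal]
  by (auto simp: h_el_def zero_uq.abs_eq uq.abs_eq_iff Uq_cong_def Uq_ideal_def)

abbreviation "xm \<equiv> x_el Minus"
abbreviation "xp \<equiv> x_el Plus"

definition hx_coeff :: "int \<Rightarrow> K" where
  "hx_coeff l = - (1 / of_int l) * q_int (2 * l)"

lemma hx_coeff_nonzero: "l \<noteq> 0 \<Longrightarrow> hx_coeff l \<noteq> 0"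
  by (simp add: hx_coeff_def q_int_nonzero)

lemma h_xm: "l \<noteq> 0 \<Longrightarrow> h_el l * xm k = xm k * h_el l + scal (hx_coeff l) * xm (k + l)"
  using Uq_relations(5)[of l Minus k] by (simp add: hx_coeff_def algebra_simps)

lemma h_xp: "l \<noteq> 0 \<Longrightarrow> xp k * h_el l = h_el l * xp k - scal (1 / of_int l * q_int (2 * l)) * xp (k + l)"
  using Uq_relations(5)[of l Plus k] by (simp add: algebra_simps)

definition xm_xm_coeff :: K where
  "xm_xm_coeff = qK powi (- 2)"

text \<open>The quadratic relation solved for a product in one order. For
  \<open>c - b \<ge> 2\<close> the indices of the correction terms are closer together than
  \<open>b\<close> and \<open>c\<close>.\<close>

lemma xm_xm: "xm c * xm b = scal xm_xm_coeff * (xm b * xm c)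
    + (scal xm_xm_coeff * (xm (c - 1) * xm (b + 1)) - xm (b + 1) * xm (c - 1))"
  using x_x_relation[of Minus "c - 1" b] by (simp add: xm_xm_coeff_def algebra_simps)

lemma K_xm: "K_el Plus * xm k = scal (qK powi (- 2)) * (xm k * K_el Plus)"
  using arg_cong[OF K_x_relation[of Minus k], of "\<lambda>a. a * K_el Plus"]
  by (simp add: mult.assoc Uq_relations)

lemma Kinv_xm: "K_el Minus * xm k = scal (qK powi 2) * (xm k * K_el Minus)"
proof -
  have "scal (qK powi (- 2)) * (K_el Minus * xm k) = K_el Minus * (K_el Plus * xm k * K_el Minus)"
    using K_x_relation[of Minus k] by (simp add: scal_left_commute)
  also have "\<dots> = xm k * K_el Minus"
    by (simp add: mult.assoc[symmetric] Uq_relations)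
  finally have e: "scal (qK powi (- 2)) * (K_el Minus * xm k) = xm k * K_el Minus" .
  have "K_el Minus * xm k = scal (1 / qK powi (- 2)) * (scal (qK powi (- 2)) * (K_el Minus * xm k))"
    using qK_nonzero by (intro scal_cancel[symmetric]) simp
  also have "1 / qK powi (- 2) = qK powi 2"
    by (simp add: power_int_minus field_simps)
  finally show ?thesis unfolding e .
qed

lemma Uq_subalgebra_hull: "Uq_subalgebra (Uq_subalgebra hull S)"
  by (rule hull_in) (auto simp: Uq_subalgebra_def)

lemma Uq_subalgebraD:
  assumes "Uq_subalgebra S"
  shows "scal c \<in> S" "a \<in> S \<Longrightarrow> b \<in> S \<Longrightarrow> a + b \<in> S" "a \<in> S \<Longrightarrow> b \<in> S \<Longrightarrow> a * b \<in> S"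
    "0 \<in> S" "1 \<in> S" "a \<in> S \<Longrightarrow> - a \<in> S" "a \<in> S \<Longrightarrow> b \<in> S \<Longrightarrow> a - b \<in> S"
proof -
  show s: "scal c \<in> S" "a \<in> S \<Longrightarrow> b \<in> S \<Longrightarrow> a + b \<in> S" "a \<in> S \<Longrightarrow> b \<in> S \<Longrightarrow> a * b \<in> S" for c a b
    using assms by (auto simp: Uq_subalgebra_def)
  show "0 \<in> S" "1 \<in> S" using s(1)[of 0] s(1)[of 1] by auto
  show u: "a \<in> S \<Longrightarrow> - a \<in> S" for a using s(3)[OF s(1)[of "- 1"], of a] by (simp add: scal_uminus)
  show "a \<in> S \<Longrightarrow> b \<in> S \<Longrightarrow> a - b \<in> S" using s(2)[of a "- b"] u[of b] by simp
qed

lemma Uq_subalgebra_sum: "Uq_subalgebra S \<Longrightarrow> (\<And>i. i \<in> A \<Longrightarrow> f i \<in> S) \<Longrightarrow> sum f A \<in> S"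
  by (induction A rule: infinite_finite_induct) (auto intro: Uq_subalgebraD)

lemma Uq_subalgebra_alg_exp:
  assumes S: "Uq_subalgebra S" and f: "\<And>n. fps_nth f n \<in> S"
  shows "fps_nth (alg_exp scal f) n \<in> S"
proof -
  have "fps_nth (f ^ i) n \<in> S" for i n
  proof (induction i arbitrary: n)
    case (Suc i)
    then show ?case by (auto simp: fps_mult_nth intro!: Uq_subalgebra_sum[OF S] Uq_subalgebraD[OF S] f)
  qed (auto intro: Uq_subalgebraD[OF S])
  then show ?thesis
    by (auto simp: alg_exp_def intro!: Uq_subalgebra_sum[OF S] Uq_subalgebraD[OF S])
qed

lemma U0_subalgebra: "Uq_subalgebra U0"
  unfolding U0_def by (rule Uq_subalgebra_hull)

lemmas U0_closed = Uq_subalgebraD[OF U0_subalgebra]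

lemma h_el_U0: "h_el r \<in> U0"
proof (cases "r = 0")
  case False
  then have "h_el r \<in> {h_el r |r. r \<noteq> 0}" by blast
  then show ?thesis unfolding U0_def by (rule hull_inc)
qed (simp add: U0_closed)

lemma U0_minimal: "Uq_subalgebra S \<Longrightarrow> (\<And>r. r \<noteq> 0 \<Longrightarrow> h_el r \<in> S) \<Longrightarrow> U0 \<subseteq> S"
  unfolding U0_def by (rule hull_minimal) auto

lemma Lambda_U0: "Lambda r \<in> U0"
proof -
  have "fps_nth (Lambda_series e) n \<in> U0" for e n
    unfolding Lambda_series_def
    by (rule Uq_subalgebra_alg_exp[OF U0_subalgebra]) (auto intro!: U0_closed h_el_U0)
  then show ?thesis by (simp add: Lambda_def)
qed

lemma Uq_subalgebra_centralizer: "Uq_subalgebra {a. \<forall>b\<in>B. a * b = b * a}"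
  by (auto simp: Uq_subalgebra_def scal_commute distrib_left distrib_right) (metis mult.assoc)

text \<open>Two applications of the centraliser argument: first against the generators, then against
  all of \<open>U0\<close>.\<close>

lemma U0_commute: "a \<in> U0 \<Longrightarrow> b \<in> U0 \<Longrightarrow> a * b = b * a"
proof -
  have h: "U0 \<subseteq> {a. \<forall>b\<in>{h_el r |r. r \<noteq> 0}. a * b = b * a}"
    by (rule U0_minimal[OF Uq_subalgebra_centralizer]) (auto intro: Uq_relations)
  have "U0 \<subseteq> {a. \<forall>b\<in>U0. a * b = b * a}"
  proof (rule U0_minimal[OF Uq_subalgebra_centralizer], intro CollectI ballI)
    fix r :: int and b assume "r \<noteq> 0" "b \<in> U0"
    then have "b * h_el r = h_el r * b" using h by blast
    then show "h_el r * b = b * h_el r" by simp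
  qed
  then show "a \<in> U0 \<Longrightarrow> b \<in> U0 \<Longrightarrow> a * b = b * a" by blast
qed

lemma K_U0_commute: "y \<in> U0 \<Longrightarrow> K_el e * y = y * K_el e"
proof -
  have Kh: "K_el Minus * h_el r = h_el r * K_el Minus" if "r \<noteq> 0" for r
  proof -
    have "K_el Minus * h_el r = K_el Minus * (h_el r * K_el Plus) * K_el Minus"
      by (simp add: mult.assoc Uq_relations(1))
    also have "\<dots> = (K_el Minus * K_el Plus) * h_el r * K_el Minus"
      by (simp add: Uq_relations(3)[OF that, symmetric] mult.assoc)
    finally show ?thesis by (simp add: Uq_relations(2))
  qed
  have "U0 \<subseteq> {a. \<forall>b\<in>{K_el Plus, K_el Minus}. a * b = b * a}"
    by (rule U0_minimal[OF Uq_subalgebra_centralizer]) (auto simp: Kh Uq_relations(3))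
  then show "y \<in> U0 \<Longrightarrow> K_el e * y = y * K_el e" by (cases e) auto
qed

lemma left_ideal_hull: "left_ideal (left_ideal hull S)"
  by (rule hull_in) (auto simp: left_ideal_def)

lemma left_idealD:
  assumes "left_ideal I"
  shows "0 \<in> I" "a \<in> I \<Longrightarrow> b \<in> I \<Longrightarrow> a + b \<in> I" "a \<in> I \<Longrightarrow> c * a \<in> I"
    "a \<in> I \<Longrightarrow> - a \<in> I" "a \<in> I \<Longrightarrow> b \<in> I \<Longrightarrow> a - b \<in> I"
proof -
  show s: "0 \<in> I" "a \<in> I \<Longrightarrow> b \<in> I \<Longrightarrow> a + b \<in> I" "a \<in> I \<Longrightarrow> c * a \<in> I" for a b c
    using assms by (auto simp: left_ideal_def)
  show u: "a \<in> I \<Longrightarrow> - a \<in> I" for a using s(3)[of a "- 1"] by simp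
  show "a \<in> I \<Longrightarrow> b \<in> I \<Longrightarrow> a - b \<in> I" using s(2)[of a "- b"] u[of b] by simp
qed

lemma Iq_left_ideal: "left_ideal (Iq m)"
  unfolding Iq_def by (rule left_ideal_hull)

lemmas Iq_closed = left_idealD[OF Iq_left_ideal]

lemma Iq_gens:
  "xp k \<in> Iq m" "K_el Plus - scal (qK ^ m) \<in> Iq m" "g \<in> Lambda_gens m \<Longrightarrow> g \<in> Iq m"
  "y \<in> U0 \<Longrightarrow> Xtilde_coeff m s * y \<in> Iq m"
  "r \<ge> 1 \<Longrightarrow> \<bar>s\<bar> > int m \<Longrightarrow> y \<in> U0 \<Longrightarrow> coeff_int (X0_series ^ r * Lambda_scaled) s * y \<in> Iq m"
  unfolding Iq_def by (rule hull_inc, force)+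

text \<open>Moving \<open>h_l\<close> across \<open>x+_k\<close> only shifts the index, so nothing
  outside the left ideal of the \<open>x+\<close> appears.\<close>

lemma xp_U0:
  assumes "y \<in> U0"
  shows "xp k * y \<in> left_ideal hull (range xp)"
proof -
  let ?L = "left_ideal hull (range xp)"
  note L = left_idealD[OF left_ideal_hull[of "range xp"]]
  have mult: "a * y \<in> ?L" if a: "a \<in> ?L" and y: "\<forall>k. xp k * y \<in> ?L" for a y
  proof -
    have "?L \<subseteq> {a. a * y \<in> ?L}"
      by (rule hull_minimal) (use y L in \<open>auto simp: left_ideal_def distrib_right mult.assoc\<close>)
    then show ?thesis using a by auto
  qed
  have xp: "xp k \<in> ?L" for k by (rule hull_inc) simp
  have "U0 \<subseteq> {y. \<forall>k. xp k * y \<in> ?L}"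
  proof (intro U0_minimal)
    show "Uq_subalgebra {y. \<forall>k. xp k * y \<in> ?L}"
      unfolding Uq_subalgebra_def
    proof (intro conjI ballI)
      show "range scal \<subseteq> {y. \<forall>k. xp k * y \<in> ?L}"
      proof safe
        fix c k
        show "xp k * scal c \<in> ?L"
          unfolding scal_commute[symmetric] by (rule L(3)[OF xp])
      qed
      fix a b assume a: "a \<in> {y. \<forall>k. xp k * y \<in> ?L}" and b: "b \<in> {y. \<forall>k. xp k * y \<in> ?L}"
      then show "a + b \<in> {y. \<forall>k. xp k * y \<in> ?L}"
        by (auto simp: distrib_left intro: L(2))
      have "xp k * a * b \<in> ?L" for k
        by (rule mult) (use a b in auto)
      then show "a * b \<in> {y. \<forall>k. xp k * y \<in> ?L}" by (simp add: mult.assoc)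
    qed
    fix r :: int assume r: "r \<noteq> 0"
    show "h_el r \<in> {y. \<forall>k. xp k * y \<in> ?L}"
      by (simp only: h_xp[OF r] mem_Collect_eq) (intro allI L(5) L(3) xp)
  qed
  then show ?thesis using assms by auto
qed

lemma xp_U0_Iq: "y \<in> U0 \<Longrightarrow> xp k * y \<in> Iq m"
proof -
  have "left_ideal hull (range xp) \<subseteq> Iq m"
    by (rule hull_minimal) (auto simp: Iq_gens Iq_left_ideal)
  then show "y \<in> U0 \<Longrightarrow> xp k * y \<in> Iq m" using xp_U0 by blast
qed

lemma Lambda_gens_U0: "g \<in> Lambda_gens m \<Longrightarrow> g \<in> U0"
  by (auto simp: Lambda_gens_def intro!: U0_closed Lambda_U0)

text \<open>Makes \<open>W_q(m)\<close> a right \<open>U0\<close>-module. \<open>K - q^m\<close> and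
  the generators in \<open>U0\<close> commute with \<open>y\<close>, the \<open>x+\<close> are
  covered by \<open>xp_U0_Iq\<close>, and the remaining generators carry a factor from
  \<open>U0\<close> by definition.\<close>

lemma Iq_mult_U0: "a \<in> Iq m \<Longrightarrow> y \<in> U0 \<Longrightarrow> a * y \<in> Iq m"
proof -
  assume a: "a \<in> Iq m" and y: "y \<in> U0"
  have "Iq m \<subseteq> {a. a * y \<in> Iq m}"
    unfolding Iq_def[of m]
  proof (rule hull_minimal, unfold Iq_def[of m, symmetric])
    show "left_ideal {a. a * y \<in> Iq m}"
      using Iq_closed by (auto simp: left_ideal_def distrib_right mult.assoc)
    have "(K_el Plus - scal (qK ^ m)) * y = y * (K_el Plus - scal (qK ^ m))"
      by (simp add: left_diff_distrib right_diff_distrib K_U0_commute[OF y] scal_commute)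
    then have K: "(K_el Plus - scal (qK ^ m)) * y \<in> Iq m"
      by (simp only:) (intro Iq_closed(3) Iq_gens)
    have "g * y = y * g" if "g \<in> Lambda_gens m" for g
      using U0_commute[OF Lambda_gens_U0[OF that] y] .
    then have L: "g * y \<in> Iq m" if "g \<in> Lambda_gens m" for g
      using that by (simp only:) (intro Iq_closed(3) Iq_gens)
    have X: "Xtilde_coeff m r * (z * y) \<in> Iq m" if "z \<in> U0" for r z
      using that y by (intro Iq_gens U0_closed)
    have XX: "coeff_int (X0_series ^ r * Lambda_scaled) s * (z * y) \<in> Iq m"
      if "z \<in> U0" "Suc 0 \<le> r" "\<bar>s\<bar> > int m" for r s z
      using that y by (intro Iq_gens U0_closed) auto
    show "range xp \<union> {K_el Plus - scal (qK ^ m)} \<union> Lambda_gens m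
      \<union> {Xtilde_coeff m r * y | r y. y \<in> U0}
      \<union> {coeff_int (X0_series ^ r * Lambda_scaled) s * y | r s y. r \<ge> 1 \<and> \<bar>s\<bar> > int m \<and> y \<in> U0}
      \<subseteq> {a. a * y \<in> Iq m}"
      using K by (auto simp: mult.assoc intro: xp_U0_Iq y L X XX)
  qed
  then show ?thesis using a by auto
qed

lemma Kinv_Iq: "K_el Minus - scal (qK powi (- int m)) \<in> Iq m"
proof -
  let ?c = "qK powi (- int m)"
  have c: "?c * qK ^ m = 1"
    using qK_nonzero by (simp add: power_int_minus)
  have "scal (- ?c) * (K_el Minus * (K_el Plus - scal (qK ^ m))) \<in> Iq m"
    by (intro Iq_closed(3) Iq_gens)
  also have "K_el Minus * (K_el Plus - scal (qK ^ m)) = 1 - scal (qK ^ m) * K_el Minus"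
    by (simp add: right_diff_distrib Uq_relations scal_commute[of "qK ^ m" "K_el Minus"])
  also have "scal (- ?c) * (1 - scal (qK ^ m) * K_el Minus) = K_el Minus - scal ?c"
    unfolding right_diff_distrib scal_scal using c by (simp add: scal_uminus)
  finally show ?thesis .
qed

lemma U0_K_Iq: "y \<in> U0 \<Longrightarrow> \<exists>c. K_el e * y - scal c * y \<in> Iq m"
proof -
  assume y: "y \<in> U0"
  obtain c where "K_el e - scal c \<in> Iq m"
    by (cases e) (use Iq_gens(2) Kinv_Iq in blast)+
  then have "y * (K_el e - scal c) \<in> Iq m" by (rule Iq_closed)
  then show ?thesis
    by (auto simp: right_diff_distrib K_U0_commute[OF y] scal_commute[symmetric] intro: exI[of _ c])
qed

subsection \<open>Triangular decomposition\<close>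

lemma Uq_generated:
  assumes S: "Uq_subalgebra S" and gens: "\<And>e r. x_el e r \<in> S" "\<And>r. h_el r \<in> S" "\<And>e. K_el e \<in> S"
  shows "a \<in> S"
proof (induction a rule: uq.abs_induct)
  case (1 p)
  have g: "abs_uq (gen_f g) \<in> S" for g
    using gens by (cases g) (auto simp: x_el_def h_el_def K_el_def)
  have w: "abs_uq (Poly_Mapping.single (Word ws) 1) \<in> S" for ws
  proof (induction ws)
    case Nil
    have "abs_uq (Poly_Mapping.single (Word []) 1) = 1"
      by (simp add: zero_gword_def[symmetric] one_uq.abs_eq)
    then show ?case by (simp add: Uq_subalgebraD[OF S])
  next
    case (Cons g ws)
    have "Poly_Mapping.single (Word (g # ws)) 1 = gen_f g * Poly_Mapping.single (Word ws) 1"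
      by (simp add: gen_f_def mult_single plus_gword_def)
    then show ?case using Cons g by (simp add: times_uq.abs_eq[symmetric] Uq_subalgebraD[OF S])
  qed
  show ?case
  proof (induction p rule: poly_mapping_single_induct)
    case (single v c)
    have "Poly_Mapping.single v c = scal_f c * Poly_Mapping.single (Word (letters v)) 1"
      by (simp add: scal_f_def mult_single)
    then show ?case
      using w[of "letters v"] Uq_subalgebraD(1)[OF S, of c]
      by (simp add: times_uq.abs_eq[symmetric] Uq_subalgebraD(3)[OF S] scal_def)
  qed (auto simp: zero_uq.abs_eq[symmetric] plus_uq.abs_eq[symmetric] intro: Uq_subalgebraD[OF S])
qed

lemma abs_uq_sum: "abs_uq (sum f A) = (\<Sum>i\<in>A. abs_uq (f i))"
  by (induction A rule: infinite_finite_induct) (simp_all add: abs_uq_simps[symmetric])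

text \<open>The series for \<psi> are formed in the free algebra. Passing to \<open>U_q\<close>
  coefficientwise is multiplicative on series, hence compatible with \<open>alg_exp\<close>.\<close>

definition abs_fps :: "falg fps \<Rightarrow> uq fps" where
  "abs_fps f = Abs_fps (\<lambda>n. abs_uq (fps_nth f n))"

lemma abs_fps_mult: "abs_fps (f * g) = abs_fps f * abs_fps g"
  by (rule fps_ext) (simp add: abs_fps_def fps_mult_nth abs_uq_sum abs_uq_simps)

lemma abs_fps_power: "abs_fps (f ^ n) = abs_fps f ^ n"
proof (induction n)
  case 0
  show ?case by (rule fps_ext) (simp add: abs_fps_def abs_uq_simps)
qed (simp add: abs_fps_mult)

lemma abs_fps_alg_exp: "abs_fps (alg_exp scal_f f) = alg_exp scal (abs_fps f)"
proof (rule fps_ext)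
  fix n
  have pow: "fps_nth (abs_fps f ^ i) n = abs_uq (fps_nth (f ^ i) n)" for i
    unfolding abs_fps_power[symmetric] by (simp add: abs_fps_def)
  show "fps_nth (abs_fps (alg_exp scal_f f)) n = fps_nth (alg_exp scal (abs_fps f)) n"
    unfolding alg_exp_def fps_nth_Abs_fps pow
    by (simp add: abs_fps_def abs_uq_sum abs_uq_simps[symmetric] scal_def del: of_nat_fact)
qed

lemma abs_psi_subalgebra:
  assumes S: "Uq_subalgebra S" and h: "\<And>r. h_el r \<in> S" and K: "\<And>e. K_el e \<in> S"
  shows "abs_uq (psi_f e r) \<in> S"
proof -
  have "fps_nth (abs_fps (psi_series e)) n \<in> S" for n
  proof -
    have "fps_nth (abs_fps (alg_exp scal_f (fps_const (scal_f (of_int (pm_sign e) * (qK - inverse qK)))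
        * Abs_fps (\<lambda>s. if s = 0 then 0 else h_f (pm_sign e * int s))))) n \<in> S" for n
      unfolding abs_fps_alg_exp
      by (rule Uq_subalgebra_alg_exp[OF S])
        (auto simp: abs_fps_def abs_uq_simps[symmetric] scal_def[symmetric] h_el_def[symmetric]
          intro!: Uq_subalgebraD[OF S] h)
    then show ?thesis
      unfolding psi_series_def abs_fps_mult
      using K[of e] by (auto simp: fps_mult_nth abs_fps_def K_el_def abs_uq_simps[symmetric]
        intro!: Uq_subalgebra_sum[OF S] Uq_subalgebraD[OF S])
  qed
  then show ?thesis
    by (auto simp: psi_f_def coeff_int_def abs_fps_def abs_uq_simps[symmetric] Uq_subalgebraD[OF S])
qed

definition xprod :: "int list \<Rightarrow> uq" where
  "xprod ks = prod_list (map xm ks)"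

lemma xprod_simps [simp]:
  "xprod [] = 1" "xprod (k # ks) = xm k * xprod ks" "xprod (ks @ ls) = xprod ks * xprod ls"
  by (simp_all add: xprod_def)

definition triangular :: "nat \<Rightarrow> uq set" where
  "triangular m = add_span ({xprod ks * y | ks y. y \<in> U0} \<union> Iq m)"

text \<open>The elements that map the triangular set into itself by left multiplication form a
  subalgebra, so only the generators of \<open>U_q\<close> need checking; applying its elements to 1
  finishes.\<close>

lemma triangular_UNIV: "a \<in> triangular m"
proof -
  let ?B = "{xprod ks * y | ks y. y \<in> U0} \<union> Iq m"
  define S where "S = {u. \<forall>t\<in>triangular m. u * t \<in> triangular m}"
  have add: "a + b \<in> triangular m" if "a \<in> triangular m" "b \<in> triangular m" for a b
    using that unfolding triangular_def by (blast intro: add_span_add)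
  have zero: "0 \<in> triangular m" unfolding triangular_def by (rule add_span.zero)
  have Iq: "a \<in> triangular m" if "a \<in> Iq m" for a
    using that unfolding triangular_def by (intro add_span_base) blast
  have word: "xprod ks * y \<in> triangular m" if "y \<in> U0" for ks y
    using that unfolding triangular_def by (intro add_span_base) blast
  have S_I: "u \<in> S" if "\<And>ks y. y \<in> U0 \<Longrightarrow> u * (xprod ks * y) \<in> triangular m" for u
    unfolding S_def triangular_def
  proof (intro CollectI ballI)
    fix t assume "t \<in> add_span ?B"
    then show "u * t \<in> add_span ?B"
      by (rule add_span_image)
        (use that Iq_closed in \<open>auto simp: distrib_left triangular_def[symmetric] intro: Iq\<close>)
  qed
  have S: "Uq_subalgebra S"
    unfolding Uq_subalgebra_def
  proof (intro conjI ballI)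
    show "range scal \<subseteq> S"
    proof safe
      fix c show "scal c \<in> S"
      proof (rule S_I)
        fix ks y assume "y \<in> U0"
        then have "xprod ks * (scal c * y) \<in> triangular m" by (intro word U0_closed)
        then show "scal c * (xprod ks * y) \<in> triangular m" by (simp add: scal_left_commute)
      qed
    qed
  qed (auto simp: S_def distrib_right mult.assoc intro: add)
  have SD: "u * t \<in> triangular m" if "u \<in> S" "t \<in> triangular m" for u t
    using that by (auto simp: S_def)
  have scal: "scal c * t \<in> triangular m" if "t \<in> triangular m" for c t
    by (rule SD[OF Uq_subalgebraD(1)[OF S] that])
  have xm: "xm k \<in> S" for k
  proof (rule S_I)
    fix ks y assume "y \<in> U0"
    then show "xm k * (xprod ks * y) \<in> triangular m"
      using word[of y "k # ks"] by (simp add: mult.assoc)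
  qed
  have h: "h_el l \<in> S" for l
  proof (cases "l = 0")
    case False
    have "h_el l * (xprod ks * y) \<in> triangular m" if y: "y \<in> U0" for ks y
    proof (induction ks)
      case Nil
      show ?case using word[of "h_el l * y" "[]"] y by (simp add: U0_closed h_el_U0)
    next
      case (Cons k ks)
      have "h_el l * (xprod (k # ks) * y)
          = xm k * (h_el l * (xprod ks * y)) + scal (hx_coeff l) * (xm (k + l) * (xprod ks * y))"
        by (simp add: mult.assoc[symmetric] h_xm[OF False] distrib_right)
      then show ?case using Cons y by (simp only:) (intro add scal SD[OF xm] word)
    qed
    then show ?thesis by (rule S_I)
  qed (use Uq_subalgebraD(4)[OF S] in simp)
  have K: "K_el e \<in> S" for e
  proof (rule S_I)
    fix ks y assume y: "y \<in> U0"
    show "K_el e * (xprod ks * y) \<in> triangular m"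
    proof (induction ks)
      case Nil
      obtain c where c: "K_el e * y - scal c * y \<in> Iq m" using U0_K_Iq[OF y] by blast
      have "scal c * y \<in> triangular m"
        using word[of "scal c * y" "[]"] y by (simp add: U0_closed)
      from add[OF Iq[OF c] this] show ?case by simp
    next
      case (Cons k ks)
      obtain c where "K_el e * xm k = scal c * (xm k * K_el e)"
        by (cases e) (use K_xm Kinv_xm in blast)+
      then have "K_el e * (xprod (k # ks) * y) = scal c * (xm k * (K_el e * (xprod ks * y)))"
        by (simp add: mult.assoc[symmetric])
      then show ?case using Cons by (simp only:) (intro scal SD[OF xm])
    qed
  qed
  \<comment> \<open>Commuting \<open>x+\<close> past a letter leaves such elements, which are built
    from the \<open>h\<close> and \<open>K\<close> treated before.\<close>
  have psi: "abs_uq (psi_f e r) \<in> S" for e r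
    using h K by (rule abs_psi_subalgebra[OF S])
  have xp: "xp l \<in> S" for l
  proof (rule S_I)
    fix ks y assume y: "y \<in> U0"
    show "xp l * (xprod ks * y) \<in> triangular m"
    proof (induction ks)
      case Nil
      show ?case using xp_U0_Iq[OF y] by (simp add: Iq)
    next
      case (Cons k ks)
      have "xp l * xm k = xm k * xp l
          + scal (1 / (qK - inverse qK)) * (abs_uq (psi_f Plus (l + k)) - abs_uq (psi_f Minus (l + k)))"
        using Uq_relations(6)[of l k] by (simp add: algebra_simps)
      then have "xp l * (xprod (k # ks) * y) = xm k * (xp l * (xprod ks * y))
          + scal (1 / (qK - inverse qK)) * ((abs_uq (psi_f Plus (l + k)) - abs_uq (psi_f Minus (l + k)))
            * (xprod ks * y))"
        by (simp only: xprod_simps mult.assoc[symmetric]) (simp only: distrib_right mult.assoc)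
      then show ?case using Cons y
        by (simp only:) (intro add scal SD[OF xm] SD[OF Uq_subalgebraD(7)[OF S psi psi]] word)
    qed
  qed
  have "a \<in> S"
    by (rule Uq_generated[OF S]) (use xm xp h K in \<open>metis pm.exhaust\<close>)+
  moreover have "1 \<in> triangular m" using word[of 1 "[]"] by (simp add: U0_closed)
  ultimately show ?thesis using SD[of a 1] by simp
qed

subsection \<open>Words in the \<open>x\<^sup>-\<close> as values of symmetric functions\<close>

definition expo :: "int list \<Rightarrow> (nat \<Rightarrow>\<^sub>0 int)" where
  "expo ks = (\<Sum>i<length ks. Poly_Mapping.single (Suc i) (ks ! i))"

definition exps_list :: "nat \<Rightarrow> (nat \<Rightarrow>\<^sub>0 int) \<Rightarrow> int list" where
  "exps_list r a = map (Poly_Mapping.lookup a) [1..<Suc r]"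

lemma length_exps_list [simp]: "length (exps_list r a) = r"
  by (simp add: exps_list_def)

lemma nth_exps_list: "i < r \<Longrightarrow> exps_list r a ! i = Poly_Mapping.lookup a (Suc i)"
  by (simp add: exps_list_def del: upt_Suc)

lemma lookup_expo: "Poly_Mapping.lookup (expo ks) i = (if 1 \<le> i \<and> i \<le> length ks then ks ! (i - 1) else 0)"
proof -
  have "(\<Sum>j<length ks. Poly_Mapping.lookup (Poly_Mapping.single (Suc j) (ks ! j)) i)
      = (\<Sum>j<length ks. if j = i - 1 \<and> i \<ge> 1 then ks ! j else 0)"
    by (intro sum.cong) (auto simp: lookup_single when_def)
  then show ?thesis by (cases i) (auto simp: expo_def lookup_sum Suc_le_eq)
qed

lemma exps_list_expo [simp]: "exps_list (length ks) (expo ks) = ks"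
  by (rule nth_equalityI) (simp_all add: nth_exps_list lookup_expo)

lemma keys_expo: "Poly_Mapping.keys (expo ks) \<subseteq> {1..length ks}"
  by (auto simp: in_keys_iff lookup_expo split: if_splits)

text \<open>Under this map, multiplication by a power sum becomes the commutator with an \<open>h\<close>.\<close>

definition xval :: "nat \<Rightarrow> laurent \<Rightarrow> uq" where
  "xval r f = (\<Sum>a\<in>Poly_Mapping.keys f. scal (Poly_Mapping.lookup f a) * xprod (exps_list r a))"

lemma xval_superset:
  assumes "finite A" "Poly_Mapping.keys f \<subseteq> A"
  shows "xval r f = (\<Sum>a\<in>A. scal (Poly_Mapping.lookup f a) * xprod (exps_list r a))"
  unfolding xval_def using assms by (intro sum.mono_neutral_left) (auto simp: in_keys_iff)

lemma xval_0 [simp]: "xval r 0 = 0"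
  by (simp add: xval_def)

lemma xval_single: "xval r (Poly_Mapping.single a c) = scal c * xprod (exps_list r a)"
  by (simp add: xval_def)

lemma xval_add: "xval r (f + g) = xval r f + xval r g"
proof -
  let ?A = "Poly_Mapping.keys f \<union> Poly_Mapping.keys g"
  have "xval r (f + g) = (\<Sum>a\<in>?A. scal (Poly_Mapping.lookup (f + g) a) * xprod (exps_list r a))"
    by (rule xval_superset) (auto simp: Poly_Mapping.keys_add)
  also have "\<dots> = (\<Sum>a\<in>?A. scal (Poly_Mapping.lookup f a) * xprod (exps_list r a))
      + (\<Sum>a\<in>?A. scal (Poly_Mapping.lookup g a) * xprod (exps_list r a))"
    by (simp add: lookup_add scal_add distrib_right sum.distrib)
  also have "\<dots> = xval r f + xval r g"
    by (simp add: xval_superset[of ?A])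
  finally show ?thesis .
qed

lemma xval_sum: "xval r (sum f A) = (\<Sum>i\<in>A. xval r (f i))"
  by (induction A rule: infinite_finite_induct) (simp_all add: xval_add)

lemma xval_cst_mult: "xval r (cst c * f) = scal c * xval r f"
  by (induction f rule: poly_mapping_single_induct)
    (simp_all add: mult_single xval_single xval_add distrib_left scal_scal)

lemma h_xprod:
  assumes "l \<noteq> 0"
  shows "h_el l * xprod ks = xprod ks * h_el l
    + scal (hx_coeff l) * (\<Sum>i<length ks. xprod (ks[i := ks ! i + l]))"
proof (induction ks)
  case (Cons k ks)
  let ?c = "scal (hx_coeff l)" and ?S = "\<Sum>i<length ks. xprod (ks[i := ks ! i + l])"
  have "h_el l * xprod (k # ks) = (h_el l * xm k) * xprod ks"
    by (simp add: mult.assoc)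
  also have "\<dots> = xm k * (h_el l * xprod ks) + ?c * (xm (k + l) * xprod ks)"
    by (simp add: h_xm[OF assms] distrib_right mult.assoc)
  also have "xm k * (h_el l * xprod ks) = xprod (k # ks) * h_el l + ?c * (xm k * ?S)"
    by (simp add: Cons distrib_left mult.assoc scal_left_commute)
  also have "xm k * ?S = (\<Sum>i<length ks. xprod ((k # ks)[Suc i := (k # ks) ! Suc i + l]))"
    by (simp add: sum_distrib_left)
  finally show ?case
    by (simp add: sum.lessThan_Suc_shift distrib_left add_ac del: sum.lessThan_Suc)
qed simp

lemma h_xval:
  assumes "l \<noteq> 0"
  shows "h_el l * xval r f = xval r f * h_el l + scal (hx_coeff l) * xval r (psum r l * f)"
proof (induction f rule: poly_mapping_single_induct)
  case (single a c)
  have upd: "(exps_list r a)[i := exps_list r a ! i + l] = exps_list r (Poly_Mapping.single (Suc i) l + a)"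
    if "i < r" for i
    using that by (intro nth_equalityI) (auto simp: nth_exps_list nth_list_update lookup_add lookup_single when_def)
  have "psum r l * Poly_Mapping.single a c = (\<Sum>i<r. Poly_Mapping.single (Poly_Mapping.single (Suc i) l + a) c)"
    by (simp add: psum_def sum_distrib_right mult_single sum.atLeast1_atMost_eq)
  then have "xval r (psum r l * Poly_Mapping.single a c)
      = scal c * (\<Sum>i<r. xprod (exps_list r (Poly_Mapping.single (Suc i) l + a)))"
    by (simp add: xval_sum xval_single sum_distrib_left)
  also have "\<dots> = scal c * (\<Sum>i<r. xprod ((exps_list r a)[i := exps_list r a ! i + l]))"
    by (simp add: upd)
  finally have p: "xval r (psum r l * Poly_Mapping.single a c)
      = scal c * (\<Sum>i<r. xprod ((exps_list r a)[i := exps_list r a ! i + l]))" .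
  have "h_el l * xval r (Poly_Mapping.single a c) = scal c * (h_el l * xprod (exps_list r a))"
    by (simp only: xval_single scal_left_commute[of "h_el l"])
  also have "\<dots> = scal c * xprod (exps_list r a) * h_el l
      + scal c * (scal (hx_coeff l) * (\<Sum>i<r. xprod ((exps_list r a)[i := exps_list r a ! i + l])))"
    unfolding h_xprod[OF assms] length_exps_list distrib_left mult.assoc ..
  finally show ?case
    unfolding p xval_single scal_left_commute[of "scal c"] .
qed (simp_all add: xval_add distrib_left distrib_right add_ac)

definition sym_vals :: "nat \<Rightarrow> uq set" where
  "sym_vals r = xval r ` sym_laurent r"

lemma sym_vals_closed:
  "0 \<in> sym_vals r" "a \<in> sym_vals r \<Longrightarrow> b \<in> sym_vals r \<Longrightarrow> a + b \<in> sym_vals r"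
  "a \<in> sym_vals r \<Longrightarrow> scal c * a \<in> sym_vals r"
proof -
  show "0 \<in> sym_vals r" unfolding sym_vals_def using sym_laurent_0 by (force intro: image_eqI[of _ _ 0])
  show "a + b \<in> sym_vals r" if "a \<in> sym_vals r" "b \<in> sym_vals r"
    using that unfolding sym_vals_def by (auto simp flip: xval_add intro: sym_laurent_add)
  show "scal c * a \<in> sym_vals r" if "a \<in> sym_vals r"
    using that unfolding sym_vals_def
    by (auto simp flip: xval_cst_mult intro!: imageI sym_laurent_mult sym_laurent_cst)
qed

lemma sym_vals_diff: "a \<in> sym_vals r \<Longrightarrow> b \<in> sym_vals r \<Longrightarrow> a - b \<in> sym_vals r"
  using sym_vals_closed(2)[of a r "scal (- 1) * b"] sym_vals_closed(3)[of b r "- 1"]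
  by (simp add: scal_uminus)

lemma sym_vals_sum: "(\<And>i. i \<in> A \<Longrightarrow> f i \<in> sym_vals r) \<Longrightarrow> sum f A \<in> sym_vals r"
  by (induction A rule: infinite_finite_induct) (auto intro: sym_vals_closed)

section \<open>Reordering words up to powers of q\<close>

lemma adjacent_swaps_connect:
  assumes refl: "\<And>x. R x x" and trans: "\<And>x y z. R x y \<Longrightarrow> R y z \<Longrightarrow> R x z"
    and swap: "\<And>us b c vs. R (us @ c # b # vs) (us @ b # c # vs)"
  shows "mset ks = mset ls \<Longrightarrow> R (ps @ ks) (ps @ ls)"
proof (induction ks arbitrary: ls ps)
  case Nil
  then show ?case by (simp add: refl)
next
  case (Cons k ks)
  then have "k \<in> set ls" by (metis list.set_intros(1) set_mset_mset)
  then obtain us vs where ls: "ls = us @ k # vs" by (meson split_list)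
  have move: "R (qs @ k # us @ vs) (qs @ us @ k # vs)" for qs us
  proof (induction us arbitrary: qs)
    case (Cons u us)
    have "R (qs @ k # u # us @ vs) (qs @ u # k # us @ vs)" by (rule swap)
    moreover have "R ((qs @ [u]) @ k # us @ vs) ((qs @ [u]) @ us @ k # vs)" by (rule Cons)
    ultimately show ?case by (auto intro: trans)
  qed (simp add: refl)
  have "mset ks = mset (us @ vs)" using Cons.prems ls by simp
  then have "R ((ps @ [k]) @ ks) ((ps @ [k]) @ us @ vs)" by (rule Cons.IH)
  then show ?case using move[of ps us] ls by (auto intro: trans)
qed

text \<open>The measure for reordering: replacing \<open>c, b\<close> by \<open>c - 1, b + 1\<close>
  changes the sum of squares by \<open>-2 (c - b - 1)\<close>, which is negative once
  \<open>c - b \<ge> 2\<close>.\<close>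

definition sq_norm :: "int list \<Rightarrow> nat" where
  "sq_norm ks = (\<Sum>k\<leftarrow>ks. nat (k\<^sup>2))"

lemma sq_norm_simps [simp]:
  "sq_norm [] = 0" "sq_norm (k # ks) = nat (k\<^sup>2) + sq_norm ks" "sq_norm (ks @ ls) = sq_norm ks + sq_norm ls"
  by (simp_all add: sq_norm_def)

lemma sq_norm_mset: "mset ks = mset ls \<Longrightarrow> sq_norm ks = sq_norm ls"
  unfolding sq_norm_def by (metis mset_map sum_mset_sum_list)

text \<open>A descent of at least 2 is exchanged with factor \<open>q^(-2)\<close> up to words of
  smaller norm. For a descent of 1 the correction terms repeat the two products and the exchange is
  exact. An ascent is the inverse of a descent, with factor \<open>q^2\<close>.\<close>

lemma swap_mod_sym_vals:
  assumes lower: "\<And>v. length v = r \<Longrightarrow> sq_norm v < N \<Longrightarrow> xprod v \<in> sym_vals r"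
    and len: "length (us @ c # b # vs) = r" and N: "sq_norm (us @ c # b # vs) = N"
  shows "\<exists>n. xprod (us @ c # b # vs) - scal (qK powi n) * xprod (us @ b # c # vs) \<in> sym_vals r"
proof -
  have desc: "xprod (us @ c # b # vs) - scal xm_xm_coeff * xprod (us @ b # c # vs) \<in> sym_vals r"
    if less: "b < c" and len: "length (us @ c # b # vs) = r" and N: "sq_norm (us @ c # b # vs) = N" for b c
  proof (cases "c = b + 1")
    case True
    have "xm c * xm b + xm c * xm b = scal xm_xm_coeff * (xm b * xm c) + scal xm_xm_coeff * (xm b * xm c)"
      using xm_xm[of c b] True by (simp add: algebra_simps)
    then have "2 * (xm c * xm b) = 2 * (scal xm_xm_coeff * (xm b * xm c))"
      by (simp only: mult_2)
    then have "scal 2 * (xm c * xm b) = scal 2 * (scal xm_xm_coeff * (xm b * xm c))"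
      using scal_of_nat[of 2] by simp
    then have "scal (1 / 2) * (scal 2 * (xm c * xm b)) = scal (1 / 2) * (scal 2 * (scal xm_xm_coeff * (xm b * xm c)))"
      by simp
    then have "xm c * xm b = scal xm_xm_coeff * (xm b * xm c)"
      by (subst (asm) (1 2) scal_cancel) simp_all
    then have "xprod (us @ c # b # vs) = scal xm_xm_coeff * xprod (us @ b # c # vs)"
      by (simp add: mult.assoc[symmetric]) (simp add: mult.assoc scal_left_commute)
    then show ?thesis by (simp add: sym_vals_closed)
  next
    case False
    then have "c - b \<ge> 2" using less by simp
    then have "(c - 1)\<^sup>2 + (b + 1)\<^sup>2 < c\<^sup>2 + b\<^sup>2"
      by (simp add: power2_eq_square algebra_simps)
    then have "nat ((c - 1)\<^sup>2 + (b + 1)\<^sup>2) < nat (c\<^sup>2 + b\<^sup>2)"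
      by (subst nat_less_eq_zless) simp_all
    then have "nat ((c - 1)\<^sup>2) + nat ((b + 1)\<^sup>2) < nat (c\<^sup>2) + nat (b\<^sup>2)"
      by (simp only: nat_add_distrib[OF zero_le_power2 zero_le_power2])
    then have "sq_norm (us @ (c - 1) # (b + 1) # vs) < N" "sq_norm (us @ (b + 1) # (c - 1) # vs) < N"
      using N by simp_all
    then have "scal xm_xm_coeff * xprod (us @ (c - 1) # (b + 1) # vs) - xprod (us @ (b + 1) # (c - 1) # vs)
        \<in> sym_vals r"
      using len by (intro sym_vals_diff sym_vals_closed lower) simp_all
    also have "scal xm_xm_coeff * xprod (us @ (c - 1) # (b + 1) # vs) - xprod (us @ (b + 1) # (c - 1) # vs)
      = xprod us * (scal xm_xm_coeff * (xm (c - 1) * xm (b + 1)) - xm (b + 1) * xm (c - 1)) * xprod vs"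
      by (simp add: left_diff_distrib right_diff_distrib mult.assoc scal_left_commute)
    also have "\<dots> = xprod us * (xm c * xm b - scal xm_xm_coeff * (xm b * xm c)) * xprod vs"
      using xm_xm[of c b] by simp
    also have "\<dots> = xprod (us @ c # b # vs) - scal xm_xm_coeff * xprod (us @ b # c # vs)"
      by (simp add: left_diff_distrib right_diff_distrib mult.assoc scal_left_commute)
    finally show ?thesis .
  qed
  consider "b < c" | "b = c" | "c < b" by linarith
  then show ?thesis
  proof cases
    case 1
    then show ?thesis using desc[OF 1 len N] unfolding xm_xm_coeff_def by blast
  next
    case 2
    then show ?thesis by (intro exI[of _ 0]) (simp add: sym_vals_closed)
  next
    case 3
    have "xprod (us @ b # c # vs) - scal xm_xm_coeff * xprod (us @ c # b # vs) \<in> sym_vals r"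
      using len N by (intro desc 3) simp_all
    then have "scal (- (qK powi 2)) * (xprod (us @ b # c # vs) - scal xm_xm_coeff * xprod (us @ c # b # vs))
        \<in> sym_vals r"
      by (rule sym_vals_closed)
    also have "scal (- (qK powi 2)) * (xprod (us @ b # c # vs) - scal xm_xm_coeff * xprod (us @ c # b # vs))
        = scal (qK powi 2 * xm_xm_coeff) * xprod (us @ c # b # vs) - scal (qK powi 2) * xprod (us @ b # c # vs)"
      unfolding right_diff_distrib scal_scal by (simp add: scal_uminus)
    also have "qK powi 2 * xm_xm_coeff = 1"
      using qK_nonzero by (simp add: xm_xm_coeff_def power_int_minus)
    finally show ?thesis by (intro exI[of _ 2]) simp
  qed
qed

text \<open>Equal monomials are counted with multiplicity, so that every permutation contributes one
  power of \<open>q\<close> to the coefficient that must be inverted.\<close>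

definition orbit_sum :: "nat \<Rightarrow> (nat \<Rightarrow>\<^sub>0 int) \<Rightarrow> laurent" where
  "orbit_sum r a = (\<Sum>\<pi> | \<pi> permutes {1..r}. mon (Poly_Mapping.map_key \<pi> a))"

lemma orbit_sum_in_sym:
  assumes "Poly_Mapping.keys a \<subseteq> {1..r}"
  shows "orbit_sum r a \<in> sym_laurent r"
proof -
  let ?P = "{\<pi>. \<pi> permutes {1..r}}"
  have "mon (Poly_Mapping.map_key \<pi> a) \<in> supp_le r" if "\<pi> \<in> ?P" for \<pi>
  proof (rule supp_le_single, rule subsetI)
    fix i assume "i \<in> Poly_Mapping.keys (Poly_Mapping.map_key \<pi> a)"
    then have "\<pi> i \<in> {1..r}"
      using that assms by (auto simp: in_keys_iff lookup_map_key_inj permutes_inj)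
    then show "i \<in> {1..r}"
      using that permutes_in_image[of \<pi> "{1..r}" i] by simp
  qed
  then have supp: "orbit_sum r a \<in> supp_le r"
    unfolding orbit_sum_def by (rule supp_le_sum)
  have "perm_laurent \<sigma> (orbit_sum r a) = orbit_sum r a" if \<sigma>: "\<sigma> permutes {1..r}" for \<sigma>
  proof -
    let ?i = "inv_into UNIV \<sigma>"
    have i: "?i permutes {1..r}" using \<sigma> by (rule permutes_inv)
    have "Poly_Mapping.map_key ?i (Poly_Mapping.map_key \<pi> a) = Poly_Mapping.map_key (\<pi> \<circ> ?i) a"
      if "\<pi> \<in> ?P" for \<pi>
      using that i by (intro poly_mapping_eqI) (simp add: lookup_map_key_inj permutes_inj inj_compose)
    then have "perm_laurent \<sigma> (orbit_sum r a) = (\<Sum>\<pi>\<in>?P. mon (Poly_Mapping.map_key (\<pi> \<circ> ?i) a))"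
      unfolding orbit_sum_def perm_laurent_sum[OF permutes_bij[OF \<sigma>]] perm_laurent_single[OF permutes_bij[OF \<sigma>]]
      by (intro sum.cong) auto
    also have "\<dots> = orbit_sum r a"
      unfolding orbit_sum_def by (rule sum_permutations_compose_right[OF i, symmetric])
    finally show ?thesis .
  qed
  then show ?thesis using supp by (simp add: sym_laurent_alt)
qed

lemma mset_exps_list_perm:
  assumes "\<pi> permutes {1..r}"
  shows "mset (exps_list r (Poly_Mapping.map_key \<pi> a)) = mset (exps_list r a)"
proof -
  have m: "mset [1..<Suc r] = mset_set {1..r}"
    by (metis atLeastLessThanSuc_atLeastAtMost mset_upt)
  have "mset (exps_list r (Poly_Mapping.map_key \<pi> a))
      = image_mset (Poly_Mapping.lookup a) (image_mset \<pi> (mset_set {1..r}))"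
    unfolding exps_list_def mset_map m multiset.map_comp
    using assms by (intro image_mset_cong) (simp add: lookup_map_key_inj permutes_inj)
  also have "image_mset \<pi> (mset_set {1..r}) = mset_set {1..r}"
    using assms by (simp add: image_mset_mset_set permutes_inj_on permutes_image)
  finally show ?thesis unfolding exps_list_def mset_map m .
qed

text \<open>Modulo words of smaller norm and \<open>sym_vals\<close>, permuting a word multiplies it by a power of
  \<open>q\<close>, so its orbit sum is a nonzero multiple of it.\<close>

lemma xprod_in_sym_vals: "xprod ks \<in> sym_vals (length ks)"
proof (induction "sq_norm ks" arbitrary: ks rule: less_induct)
  case less
  define r N where "r = length ks" and "N = sq_norm ks"
  have lower: "xprod v \<in> sym_vals r" if "length v = r" "sq_norm v < N" for v
    using less(1)[of v] that by (simp add: N_def)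
  \<comment> \<open>Stated as an implication so that length and norm travel along chains of swaps;
    the exponents \<open>n\<close> add up.\<close>
  define R where "R = (\<lambda>v w. length v = r \<and> sq_norm v = N \<longrightarrow>
    length w = r \<and> sq_norm w = N \<and> (\<exists>n. xprod v - scal (qK powi n) * xprod w \<in> sym_vals r))"
  have R: "R ([] @ v) ([] @ w)" if "mset v = mset w" for v w
    using that
  proof (rule adjacent_swaps_connect[rotated 3])
    show "R v v" for v
      by (auto simp: R_def sym_vals_closed intro!: exI[of _ 0])
    show "R (us @ c # b # vs) (us @ b # c # vs)" for us b c vs
      using swap_mod_sym_vals[OF lower, where us = us and c = c and b = b and vs = vs] by (auto simp: R_def)
    show "R u w" if uv: "R u v" and vw: "R v w" for u v w
      unfolding R_def
    proof
      assume u: "length u = r \<and> sq_norm u = N"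
      then obtain n where n: "xprod u - scal (qK powi n) * xprod v \<in> sym_vals r"
        and v: "length v = r \<and> sq_norm v = N" using uv by (auto simp: R_def)
      then obtain p where p: "xprod v - scal (qK powi p) * xprod w \<in> sym_vals r"
        and w: "length w = r \<and> sq_norm w = N" using vw by (auto simp: R_def)
      have "(xprod u - scal (qK powi n) * xprod v)
          + scal (qK powi n) * (xprod v - scal (qK powi p) * xprod w) \<in> sym_vals r"
        by (intro sym_vals_closed n p)
      then have "xprod u - scal (qK powi (n + p)) * xprod w \<in> sym_vals r"
        using qK_nonzero by (simp add: right_diff_distrib scal_scal power_int_add)
      then show "length w = r \<and> sq_norm w = N \<and> (\<exists>n. xprod u - scal (qK powi n) * xprod w \<in> sym_vals r)"
        using w by blast
    qed
  qed
  define a where "a = expo ks"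
  let ?P = "{\<pi>. \<pi> permutes {1..r}}" and ?w = "\<lambda>\<pi>. exps_list r (Poly_Mapping.map_key \<pi> a)"
  have "\<exists>n. xprod (?w \<pi>) - scal (qK powi n) * xprod ks \<in> sym_vals r" if "\<pi> \<in> ?P" for \<pi>
  proof -
    have ms: "mset (?w \<pi>) = mset ks"
      using mset_exps_list_perm[of \<pi> r a] that by (simp add: a_def r_def)
    have "sq_norm (?w \<pi>) = N" using sq_norm_mset[OF ms] by (simp add: N_def)
    then show ?thesis using R[OF ms] by (auto simp: R_def)
  qed
  then obtain n where n: "\<And>\<pi>. \<pi> \<in> ?P \<Longrightarrow> xprod (?w \<pi>) - scal (qK powi n \<pi>) * xprod ks \<in> sym_vals r"
    by metis
  define S where "S = (\<Sum>\<pi>\<in>?P. qK powi n \<pi>)"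
  have S: "S \<noteq> 0"
    unfolding S_def by (rule sum_powi_qK_nonzero) (auto simp: finite_permutations intro: permutes_id)
  have o: "xval r (orbit_sum r a) \<in> sym_vals r"
    unfolding sym_vals_def using keys_expo[of ks] by (intro imageI orbit_sum_in_sym) (simp add: a_def r_def)
  have "(\<Sum>\<pi>\<in>?P. xprod (?w \<pi>) - scal (qK powi n \<pi>) * xprod ks) \<in> sym_vals r"
    by (rule sym_vals_sum) (rule n)
  also have "(\<Sum>\<pi>\<in>?P. xprod (?w \<pi>) - scal (qK powi n \<pi>) * xprod ks)
      = xval r (orbit_sum r a) - scal S * xprod ks"
    by (simp add: sum_subtractf orbit_sum_def xval_sum xval_single S_def scal_sum sum_distrib_right)
  finally have m: "xval r (orbit_sum r a) - scal S * xprod ks \<in> sym_vals r" .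
  have "scal (1 / S) * (xval r (orbit_sum r a) - (xval r (orbit_sum r a) - scal S * xprod ks)) \<in> sym_vals r"
    by (intro sym_vals_closed sym_vals_diff o m)
  also have "xval r (orbit_sum r a) - (xval r (orbit_sum r a) - scal S * xprod ks) = scal S * xprod ks"
    by simp
  finally show ?case by (simp only: scal_cancel[OF S] r_def)
qed

subsection \<open>Finite generation over \<open>U\<^sub>q(0)\<close>\<close>

text \<open>The complete homogeneous symmetric polynomial of degree \<open>p\<close> in
  \<open>t_1, ..., t_r\<close>, through its generating series.\<close>

definition hsym :: "nat \<Rightarrow> nat \<Rightarrow> laurent" where
  "hsym r p = fps_nth (\<Prod>i=1..r. geo_fps (var i 1)) p"

lemma hsym_0 [simp]: "hsym r 0 = 1"
  by (induction r) (simp_all add: hsym_def geo_fps_def prod.nat_ivl_Suc')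

lemma hsym_Suc: "hsym (Suc r) p = (\<Sum>j\<le>p. hsym r j * var (Suc r) (int (p - j)))"
  by (simp add: hsym_def prod.nat_ivl_Suc' mult.commute[of "geo_fps _"] fps_mult_nth geo_fps_def
      var_power atLeast0AtMost)

lemma hsym_supp: "hsym r p \<in> supp_le r"
proof -
  have "fps_nth (\<Prod>i\<in>A. geo_fps (var i 1)) p \<in> supp_le r" if "A \<subseteq> {1..r}" "finite A" for A
    using that(2,1)
  proof (induction A arbitrary: p rule: finite_induct)
    case empty
    then show ?case by (simp add: supp_le_1 supp_le_0)
  next
    case (insert i A)
    then show ?case
      by (auto simp: fps_mult_nth geo_fps_def var_power intro!: supp_le_sum supp_le_mult supp_le_var)
  qed
  then show ?thesis by (simp add: hsym_def)
qed

text \<open>The parameter is the number of variables; the next argument of \<open>es.E\<close> and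
  \<open>es.H\<close> is the truncation. When the two agree, the series are the products over the
  variables.\<close>

interpretation es: truncated_series "esym 1 r" for r .

lemma E_esym: "es.E r r = (\<Prod>i=1..r. 1 - fps_const (var i 1) * fps_X)"
proof (rule fps_ext)
  fix n
  have "(\<Prod>i\<in>S. - var i 1) = (- 1) ^ card S * (\<Prod>i\<in>S. var i 1)" for S
    by (induction S rule: infinite_finite_induct) simp_all
  then have "fps_nth (\<Prod>i=1..r. 1 + fps_const (- var i 1) * fps_X) n = (- 1) ^ n * esym 1 r n"
    by (subst prod_one_plus_fps_nth) (simp_all add: esym_def sum_distrib_left)
  moreover have "(\<Prod>i=1..r. 1 - fps_const (var i 1) * fps_X) = (\<Prod>i=1..r. 1 + fps_const (- var i 1) * fps_X)"
    by (intro prod.cong refl) (simp flip: fps_const_neg)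
  moreover have "fps_nth (es.E r r) n = (- 1) ^ n * esym 1 r n"
    by (auto simp: es.E_def esym_gt)
  ultimately show "fps_nth (es.E r r) n = fps_nth (\<Prod>i=1..r. 1 - fps_const (var i 1) * fps_X) n"
    by simp
qed

lemma H_hsym: "fps_nth (es.H r r) p = hsym r p"
proof -
  let ?G = "\<Prod>i=1..r. geo_fps (var i 1)"
  have G: "es.E r r * ?G = 1"
    unfolding E_esym prod.distrib[symmetric] by (simp add: geo_fps_inverse)
  have "es.H r r = (es.E r r * ?G) * es.H r r" by (simp only: G mult_1_left)
  also have "\<dots> = ?G * (es.E r r * es.H r r)" by (simp only: mult_ac)
  finally show ?thesis by (simp add: es.E_H hsym_def)
qed

lemma esym_hsym:
  "(\<Sum>j\<le>min r N. (- 1) ^ j * esym 1 r j * hsym r (N - j)) = (if N = 0 then 1 else 0)"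
proof -
  have "(if N = 0 then 1 else 0) = (\<Sum>j\<le>N. fps_nth (es.E r r) j * hsym r (N - j))"
    using arg_cong[OF es.E_H[of r r], of "\<lambda>f. fps_nth f N"]
    by (simp add: fps_mult_nth H_hsym atLeast0AtMost)
  also have "\<dots> = (\<Sum>j\<le>min r N. fps_nth (es.E r r) j * hsym r (N - j))"
    by (rule sum.mono_neutral_right) (auto simp: es.E_def)
  also have "\<dots> = (\<Sum>j\<le>min r N. (- 1) ^ j * esym 1 r j * hsym r (N - j))"
    by (intro sum.cong) (auto simp: es.E_def)
  finally show ?thesis by simp
qed

lemma xval_mult_var:
  assumes "f \<in> supp_le r"
  shows "xval (Suc r) (f * var (Suc r) k) = xval r f * xm k"
proof -
  have "f * var (Suc r) k
      = (\<Sum>a\<in>Poly_Mapping.keys f. Poly_Mapping.single (a + Poly_Mapping.single (Suc r) k) (Poly_Mapping.lookup f a))"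
    by (subst poly_mapping_sum_single[of "Poly_Mapping.keys f" f])
      (simp_all add: sum_distrib_right mult_single)
  then have "xval (Suc r) (f * var (Suc r) k) = (\<Sum>a\<in>Poly_Mapping.keys f.
      scal (Poly_Mapping.lookup f a) * xprod (exps_list (Suc r) (a + Poly_Mapping.single (Suc r) k)))"
    by (simp add: xval_sum xval_single)
  also have "\<dots> = (\<Sum>a\<in>Poly_Mapping.keys f. scal (Poly_Mapping.lookup f a) * xprod (exps_list r a) * xm k)"
  proof (intro sum.cong refl)
    fix a assume "a \<in> Poly_Mapping.keys f"
    then have "Poly_Mapping.lookup a (Suc r) = 0"
      using assms by (force simp: supp_le_def in_keys_iff)
    moreover have "exps_list r (a + Poly_Mapping.single (Suc r) k) = exps_list r a"
      by (intro nth_equalityI) (simp_all add: nth_exps_list lookup_add lookup_single when_def)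
    ultimately have "exps_list (Suc r) (a + Poly_Mapping.single (Suc r) k) = exps_list r a @ [k]"
      by (simp add: exps_list_def lookup_add)
    then show "scal (Poly_Mapping.lookup f a) * xprod (exps_list (Suc r) (a + Poly_Mapping.single (Suc r) k))
        = scal (Poly_Mapping.lookup f a) * xprod (exps_list r a) * xm k"
      by (simp add: mult.assoc)
  qed
  also have "\<dots> = xval r f * xm k" by (simp add: xval_def sum_distrib_right)
  finally show ?thesis .
qed

lemma X0_series_0: "fps_nth X0_series 0 = 0"
  by (simp add: X0_series_def)

text \<open>The \<open>r\<close>-th power of \<open>X_0^-\<close> collects all words of
  \<open>r\<close> nonnegative letters, and those of sum \<open>p\<close> are the monomials of
  \<open>hsym r p\<close>. The shift by \<open>r\<close> comes from the exponent
  \<open>k + 1\<close> attached to \<open>x_k\<close>.\<close>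

lemma xval_hsym: "xval r (hsym r p) = fps_nth (X0_series ^ r) (p + r)"
proof (induction r arbitrary: p)
  case 0
  have "hsym 0 p = (if p = 0 then 1 else 0)" by (simp add: hsym_def)
  then show ?case using xval_single[of 0 0 1] by (simp add: exps_list_def)
next
  case (Suc r)
  have "xval (Suc r) (hsym (Suc r) p) = (\<Sum>j\<le>p. xval r (hsym r j) * xm (int (p - j)))"
    by (simp add: hsym_Suc xval_sum xval_mult_var hsym_supp)
  also have "\<dots> = (\<Sum>j\<le>p. fps_nth (X0_series ^ r) (j + r) * fps_nth X0_series (Suc (p - j)))"
    by (simp add: Suc X0_series_def)
  also have "\<dots> = (\<Sum>i\<in>{r..p + r}. fps_nth (X0_series ^ r) i * fps_nth X0_series (p + Suc r - i))"
    by (rule sum.reindex_bij_witness[where i = "\<lambda>i. i - r" and j = "\<lambda>j. j + r"])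
      (auto simp: Suc_diff_le)
  also have "\<dots> = (\<Sum>i=0..p + Suc r. fps_nth (X0_series ^ r) i * fps_nth X0_series (p + Suc r - i))"
  proof (rule sum.mono_neutral_left)
    show "\<forall>i\<in>{0..p + Suc r} - {r..p + r}. fps_nth (X0_series ^ r) i * fps_nth X0_series (p + Suc r - i) = 0"
    proof
      fix i assume i: "i \<in> {0..p + Suc r} - {r..p + r}"
      then consider "i < r" | "i = p + Suc r" by fastforce
      then show "fps_nth (X0_series ^ r) i * fps_nth X0_series (p + Suc r - i) = 0"
        by cases (simp_all add: fps_power_nth_eq_0 X0_series_0)
    qed
  qed auto
  also have "\<dots> = fps_nth (X0_series ^ Suc r) (p + Suc r)"
    by (simp add: power_Suc2 fps_mult_nth del: power_Suc)
  finally show ?case .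
qed

text \<open>The coefficient of \<open>u\<^sup>p\<^sup>+\<^sup>r\<close> in \<open>X\<^sub>0\<^sup>-(u)\<^sup>r \<Lambda>\<^sup>+(qu)\<close>, with the word part multiplied by \<open>a\<close>.\<close>

definition grel :: "nat \<Rightarrow> nat \<Rightarrow> laurent \<Rightarrow> uq \<Rightarrow> uq" where
  "grel r p a y = (\<Sum>n\<le>p. scal (qK ^ n) * (xval r (a * hsym r (p - n)) * (Lambda (int n) * y)))"

lemma grel_1:
  assumes "p + r > m" "y \<in> U0"
  shows "grel r p 1 y \<in> Iq m"
proof -
  have "fps_nth (X0_series ^ r * Lambda_scaled) (p + r)
      = (\<Sum>i=0..p + r. fps_nth (X0_series ^ r) i * fps_nth Lambda_scaled (p + r - i))"
    by (simp add: fps_mult_nth)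
  also have "\<dots> = (\<Sum>i\<in>{r..p + r}. fps_nth (X0_series ^ r) i * fps_nth Lambda_scaled (p + r - i))"
    by (rule sum.mono_neutral_right) (auto simp: fps_power_nth_eq_0 X0_series_0)
  also have "\<dots> = (\<Sum>n\<le>p. fps_nth (X0_series ^ r) (p - n + r) * fps_nth Lambda_scaled n)"
    by (rule sum.reindex_bij_witness[where i = "\<lambda>n. p - n + r" and j = "\<lambda>i. p + r - i"]) auto
  finally have f: "fps_nth (X0_series ^ r * Lambda_scaled) (p + r)
      = (\<Sum>n\<le>p. fps_nth (X0_series ^ r) (p - n + r) * fps_nth Lambda_scaled n)" .
  have e: "grel r p 1 y = fps_nth (X0_series ^ r * Lambda_scaled) (p + r) * y"
    unfolding grel_def f sum_distrib_right
    by (intro sum.cong refl)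
      (simp only: mult_1_left xval_hsym Lambda_scaled_def fps_nth_Abs_fps mult.assoc
        scal_left_commute[of "fps_nth (X0_series ^ r) (p - _ + r)"])
  show ?thesis
  \<comment> \<open>The generators of the left ideal require \<open>r \<ge> 1\<close>. For
    \<open>r = 0\<close> the coefficient is \<open>q^p\<close> times \<open>Lambda p\<close>, and
    \<open>p > m\<close> puts \<open>Lambda p\<close> among the other generators.\<close>
  proof (cases "r = 0")
    case True
    then have "\<bar>int p\<bar> > int m" using assms by simp
    then have "Lambda (int p) \<in> Lambda_gens m" unfolding Lambda_gens_def by blast
    then have "scal (qK ^ p) * (Lambda (int p) * y) \<in> Iq m"
      by (intro Iq_closed(3) Iq_mult_U0 Iq_gens assms)
    then show ?thesis using e True by (simp add: Lambda_scaled_def mult.assoc)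
  next
    case False
    have "coeff_int (X0_series ^ r * Lambda_scaled) (int (p + r)) * y \<in> Iq m"
      using assms False by (intro Iq_gens) auto
    then show ?thesis by (simp add: e coeff_int_def del: of_nat_add)
  qed
qed

lemma grel_add: "grel r p (a + b) y = grel r p a y + grel r p b y"
  by (simp add: grel_def distrib_left distrib_right xval_add sum.distrib)

lemma grel_cst_mult: "grel r p (cst c * a) y = scal c * grel r p a y"
  unfolding grel_def sum_distrib_left mult.assoc xval_cst_mult
  by (intro sum.cong refl) (simp only: mult.assoc scal_scal mult.commute[of c])

text \<open>The factors from \<open>U0\<close> commute with \<open>h_l\<close>, so only the word
  part reacts to it. On the right stand a left multiple of a relation and a relation with another
  \<open>y\<close>.\<close>

lemma grel_psum:
  assumes "l \<noteq> 0" "y \<in> U0"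
  shows "scal (hx_coeff l) * grel r p (psum r l * a) y = h_el l * grel r p a y - grel r p a (h_el l * y)"
proof -
  have "scal (hx_coeff l) * (scal (qK ^ n) * (xval r (psum r l * a * hsym r (p - n)) * (Lambda (int n) * y)))
      = h_el l * (scal (qK ^ n) * (xval r (a * hsym r (p - n)) * (Lambda (int n) * y)))
        - scal (qK ^ n) * (xval r (a * hsym r (p - n)) * (Lambda (int n) * (h_el l * y)))" for n
  proof -
    let ?v = "xval r (a * hsym r (p - n))" and ?z = "Lambda (int n) * y"
    have c: "Lambda (int n) * (h_el l * y) = h_el l * ?z"
      using U0_commute[OF Lambda_U0 h_el_U0] by (simp add: mult.assoc[symmetric])
    have "h_el l * (scal (qK ^ n) * (?v * ?z)) = scal (qK ^ n) * ((h_el l * ?v) * ?z)"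
      by (simp only: scal_left_commute[of "h_el l"] mult.assoc)
    also have "\<dots> = scal (qK ^ n) * (?v * (h_el l * ?z))
        + scal (qK ^ n) * (scal (hx_coeff l) * (xval r (psum r l * (a * hsym r (p - n))) * ?z))"
      unfolding h_xval[OF assms(1)] distrib_right distrib_left mult.assoc ..
    finally show ?thesis
      unfolding c mult.assoc[of "psum r l"] scal_left_commute[of "scal (hx_coeff l)"] by simp
  qed
  then show ?thesis
    by (simp add: grel_def sum_distrib_left sum_subtractf)
qed

text \<open>Starting from \<open>a = 1\<close>, commutators with the \<open>h_l\<close> multiply
  \<open>a\<close> by power sums and so reach every symmetric \<open>a\<close>. Each of them also
  replaces \<open>y\<close> by \<open>h_l y\<close>, hence the quantifier over \<open>y\<close> in
  \<open>Y\<close>.\<close>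

lemma grel_Iq:
  assumes "p + r > m" "a \<in> sym_laurent r" "y \<in> U0"
  shows "grel r p a y \<in> Iq m"
proof -
  define Y where "Y = {a. \<forall>y\<in>U0. grel r p a y \<in> Iq m}"
  have "a * 1 \<in> Y"
    using assms(2)
  proof (rule sym_laurent_mult_closed[rotated 3])
    show "1 \<in> Y" using grel_1[OF assms(1)] by (simp add: Y_def)
    show "f + g \<in> Y" if "f \<in> Y" "g \<in> Y" for f g
      using that by (auto simp: Y_def grel_add intro: Iq_closed)
    show "cst c * f \<in> Y" if "f \<in> Y" for c f
      using that by (auto simp: Y_def grel_cst_mult intro: Iq_closed)
    show "psum r l * f \<in> Y" if l: "l \<noteq> 0" and f: "f \<in> Y" for l f
      unfolding Y_def
    proof (intro CollectI ballI)
      fix y assume y: "y \<in> U0"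
      have "h_el l * grel r p f y - grel r p f (h_el l * y) \<in> Iq m"
        using f y by (auto simp: Y_def intro!: Iq_closed U0_closed h_el_U0)
      then have "scal (1 / hx_coeff l) * (scal (hx_coeff l) * grel r p (psum r l * f) y) \<in> Iq m"
        unfolding grel_psum[OF l y] by (rule Iq_closed(3))
      then show "grel r p (psum r l * f) y \<in> Iq m"
        using l by (simp add: scal_cancel hx_coeff_nonzero)
    qed
  qed
  then show ?thesis using assms(3) by (simp add: Y_def)
qed

text \<open>For each \<open>r\<close> the monomials of degree at most \<open>m - r\<close> in
  \<open>e_1, ..., e_r\<close>: as many as there are \<open>r\<close>-element subsets of an
  \<open>m\<close>-element set.\<close>

definition gen_words :: "nat \<Rightarrow> (nat \<times> nat list) list" where
  "gen_words m = concat (map (\<lambda>r. map (Pair r) (short_words r (Suc m - r))) [0..<Suc m])"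

definition gen_val :: "nat \<times> nat list \<Rightarrow> uq" where
  "gen_val rw = xval (fst rw) (\<Prod>j\<leftarrow>snd rw. esym 1 (fst rw) j)"

lemma length_gen_words: "length (gen_words m) = 2 ^ m"
proof -
  have "length (gen_words m) = (\<Sum>r\<leftarrow>[0..<Suc m]. length (short_words r (Suc m - r)))"
    by (simp add: gen_words_def length_concat o_def del: upt_Suc)
  also have "\<dots> = (\<Sum>r\<in>set [0..<Suc m]. length (short_words r (Suc m - r)))"
    by (rule interv_sum_list_conv_sum_set_nat)
  also have "\<dots> = (\<Sum>r\<le>m. m choose r)"
    by (rule sum.cong) (auto simp: Suc_diff_le length_short_words simp del: upt_Suc)
  finally have "length (gen_words m) = (\<Sum>r\<le>m. m choose r)" .
  then show ?thesis by (simp add: choose_row_sum)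
qed

definition gen_span :: "nat \<Rightarrow> uq set" where
  "gen_span m = add_span ({gen_val g * y | g y. g \<in> set (gen_words m) \<and> y \<in> U0} \<union> Iq m)"

lemma gen_span_closed:
  "0 \<in> gen_span m" "a \<in> gen_span m \<Longrightarrow> b \<in> gen_span m \<Longrightarrow> a + b \<in> gen_span m"
  "a \<in> Iq m \<Longrightarrow> a \<in> gen_span m"
  "g \<in> set (gen_words m) \<Longrightarrow> y \<in> U0 \<Longrightarrow> gen_val g * y \<in> gen_span m"
proof -
  show "0 \<in> gen_span m" by (simp add: gen_span_def add_span.zero)
  show "a \<in> gen_span m \<Longrightarrow> b \<in> gen_span m \<Longrightarrow> a + b \<in> gen_span m"
    unfolding gen_span_def by (rule add_span_add)
  show "a \<in> Iq m \<Longrightarrow> a \<in> gen_span m"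
    unfolding gen_span_def by (intro add_span_base) blast
  show "g \<in> set (gen_words m) \<Longrightarrow> y \<in> U0 \<Longrightarrow> gen_val g * y \<in> gen_span m"
    unfolding gen_span_def by (intro add_span_base) blast
qed

lemma gen_span_scal: "a \<in> gen_span m \<Longrightarrow> scal c * a \<in> gen_span m"
  unfolding gen_span_def
proof (erule add_span_image)
  fix b assume b: "b \<in> {gen_val g * y | g y. g \<in> set (gen_words m) \<and> y \<in> U0} \<union> Iq m"
  have "scal c * b \<in> gen_span m"
  proof (cases "b \<in> Iq m")
    case False
    then obtain g y where "b = gen_val g * y" "g \<in> set (gen_words m)" "y \<in> U0" using b by blast
    then show ?thesis
      using gen_span_closed(4)[of g m "scal c * y"] by (simp only: scal_left_commute[of "gen_val g"] U0_closed)
  qed (intro gen_span_closed(3) Iq_closed(3))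
  then show "scal c * b \<in> add_span ({gen_val g * y | g y. g \<in> set (gen_words m) \<and> y \<in> U0} \<union> Iq m)"
    unfolding gen_span_def .
qed (simp_all add: distrib_left)

lemma gen_span_sum: "(\<And>i. i \<in> A \<Longrightarrow> f i \<in> gen_span m) \<Longrightarrow> sum f A \<in> gen_span m"
  by (induction A rule: infinite_finite_induct) (auto intro: gen_span_closed)

lemma gen_span_diff: "a \<in> gen_span m \<Longrightarrow> b \<in> gen_span m \<Longrightarrow> a - b \<in> gen_span m"
  using gen_span_closed(2)[of a m "scal (- 1) * b"] gen_span_scal[of b m "- 1"] by (simp add: scal_uminus)

lemma wt_le_in_sym: "f \<in> es.wt_le r s D \<Longrightarrow> f \<in> sym_laurent r"
proof (induction rule: es.wt_le.induct)
  case (word w f c)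
  have "(\<Prod>j\<leftarrow>w. esym 1 r j) \<in> sym_laurent r"
    by (induction w) (auto intro: sym_laurent_1 sym_laurent_mult esym_in_sym)
  then show ?case using word by (intro sym_laurent_add sym_laurent_mult sym_laurent_cst)
qed (rule sym_laurent_0)

text \<open>The relation expresses the value of \<open>a * hsym r p\<close> through the terms with
  \<open>n \<ge> 1\<close>, whose weight is smaller by \<open>n\<close> and which have an extra
  factor \<open>Lambda n\<close> on the right. Hence the induction on \<open>D\<close> for all
  \<open>y\<close> at once.\<close>

lemma xval_wt_le_gen_span:
  assumes "f \<in> es.wt_le r r D" "y \<in> U0"
  shows "xval r f * y \<in> gen_span m"
  using assms
proof (induction D arbitrary: f y rule: less_induct)
  case (less D)
  let ?n = "Suc m - r"
  have "f \<in> es.reducible r r ?n D" using less.prems(1) by (rule es.wt_le_reducible)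
  then show ?case using less.prems(2)
  proof (induction rule: es.reducible.induct)
    case zero
    then show ?case by (simp add: gen_span_closed)
  next
    case (short f w c)
    have "r \<le> m"
    proof (rule ccontr)
      assume "\<not> r \<le> m"
      then have "?n = 0" by simp
      then show False using short(2) by simp
    qed
    then have "(r, w) \<in> set (gen_words m)"
      using short(2) unfolding gen_words_def by (auto intro!: bexI[of _ r] simp del: upt_Suc)
    then have "gen_val (r, w) * (scal c * y) \<in> gen_span m"
      using short by (intro gen_span_closed U0_closed) auto
    then have "xval r (cst c * (\<Prod>j\<leftarrow>w. esym 1 r j)) * y \<in> gen_span m"
      by (simp add: gen_val_def xval_cst_mult mult.assoc scal_left_commute)
    then show ?case using short by (simp add: xval_add distrib_right gen_span_closed)
  next
    case (rel f p a)
    have a: "a \<in> sym_laurent r" using rel(4) by (rule wt_le_in_sym)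
    have "grel r p a y \<in> Iq m" by (rule grel_Iq) (use rel a in auto)
    then have g: "grel r p a y \<in> gen_span m" by (rule gen_span_closed)
    have L0: "Lambda 0 = 1" by (rule Lambda_values)
    have e: "grel r p a y = xval r (a * hsym r p) * y
        + (\<Sum>n=1..p. scal (qK ^ n) * (xval r (a * hsym r (p - n)) * (Lambda (int n) * y)))"
      unfolding grel_def atMost_atLeast0 by (subst sum.atLeast_Suc_atMost) (simp_all add: L0)
    have s: "(\<Sum>n=1..p. scal (qK ^ n) * (xval r (a * hsym r (p - n)) * (Lambda (int n) * y))) \<in> gen_span m"
    proof (intro gen_span_sum gen_span_scal)
      fix n assume n: "n \<in> {1..p}"
      have "a * fps_nth (es.H r r) (p - n) \<in> es.wt_le r r (D - n)"
        using es.wt_le_mult[OF es.H_nth_wt[of r r "p - n"] rel(4)] rel n by simp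
      then have "a * hsym r (p - n) \<in> es.wt_le r r (D - n)" by (simp add: H_hsym)
      then show "xval r (a * hsym r (p - n)) * (Lambda (int n) * y) \<in> gen_span m"
        using n rel by (intro less.IH[of "D - n"] U0_closed Lambda_U0) auto
    qed
    have "xval r (a * hsym r p) * y \<in> gen_span m"
      using gen_span_diff[OF g s] unfolding e add_diff_cancel_right' .
    then show ?case using rel by (simp add: xval_add distrib_right gen_span_closed H_hsym)
  qed
qed

lemma Lambda_inverse_Iq: "m \<ge> 1 \<Longrightarrow> Lambda (int m) * Lambda (- int m) - 1 \<in> Lambda_gens m"
proof -
  assume "m \<ge> 1"
  then have "Lambda (int m) * Lambda (- int m) - Lambda (int m - int m) \<in> Lambda_gens m"
    unfolding Lambda_gens_def by (intro UnI2 CollectI exI[of _ "int m"]) simp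
  then show ?thesis by (simp add: Lambda_values)
qed

text \<open>Modulo the left ideal, the last relation \<open>grel r (m - r)\<close> inverts \<open>esym 1 r r\<close>.\<close>

lemma xval_epow_gen_span:
  assumes m: "m \<ge> 1"
  shows "f \<in> es.wt_le r r D \<Longrightarrow> y \<in> U0 \<Longrightarrow> xval r (f * epow r (- int k)) * y \<in> gen_span m"
proof (induction k arbitrary: f D y)
  case 0
  then show ?case using xval_wt_le_gen_span by simp
next
  case (Suc k)
  define a where "a = f * epow r (- int (Suc k))"
  have a: "a \<in> sym_laurent r"
    unfolding a_def using Suc.prems by (intro sym_laurent_mult epow_in_sym wt_le_in_sym)
  show ?case
  \<comment> \<open>For \<open>r > m\<close> already the relation of degree 0, which is
    \<open>xval r a * y\<close>, lies in the left ideal.\<close>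
  proof (cases "r \<le> m")
    case False
    have "grel r 0 a y \<in> Iq m" using False a Suc.prems by (intro grel_Iq) auto
    then show ?thesis by (simp add: grel_def Lambda_values a_def gen_span_closed)
  next
    case True
    let ?z = "Lambda (- int m) * y"
    have z: "?z \<in> U0" using Suc.prems by (intro U0_closed Lambda_U0)
    \<comment> \<open>The alternating sum of \<open>e_j\<close> times \<open>hsym r (N - j)\<close>
      vanishes for \<open>N > 0\<close>, so in \<open>T\<close> only \<open>n = m\<close> survives,
      with a \<open>Lambda m\<close> that the factor \<open>Lambda (- m)\<close> in
      \<open>?z\<close> cancels modulo the left ideal. The summands with \<open>j < r\<close> lie in
      the left ideal; in the one with \<open>j = r\<close> the factor \<open>e_r\<close> removes one
      inverse power.\<close>
    define T where "T = (\<Sum>j\<le>r. scal ((- 1) ^ j) * grel r (m - j) (a * esym 1 r j) ?z)"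
    have cstm1: "cst ((- 1) ^ j) = (- 1) ^ j" for j
      by (cases "even j") (simp_all add: single_uminus)
    have "T = (\<Sum>j\<le>r. \<Sum>n\<le>m - j. scal (qK ^ n) * (xval r (a * ((- 1) ^ j * esym 1 r j * hsym r (m - n - j))) * (Lambda (int n) * ?z)))"
      unfolding T_def grel_def sum_distrib_left
    proof (intro sum.cong refl)
      fix j n
      have "scal ((- 1) ^ j) * (scal (qK ^ n) * (xval r (a * esym 1 r j * hsym r (m - j - n)) * (Lambda (int n) * ?z)))
          = scal (qK ^ n) * ((scal ((- 1) ^ j) * xval r (a * esym 1 r j * hsym r (m - j - n))) * (Lambda (int n) * ?z))"
        by (simp only: scal_left_commute[of "scal ((- 1) ^ j)"] mult.assoc)
      also have "scal ((- 1) ^ j) * xval r (a * esym 1 r j * hsym r (m - j - n))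
          = xval r (a * ((- 1) ^ j * esym 1 r j * hsym r (m - n - j)))"
        by (simp add: xval_cst_mult[symmetric] cstm1 mult_ac add_ac)
      finally show "scal ((- 1) ^ j) * (scal (qK ^ n) * (xval r (a * esym 1 r j * hsym r (m - j - n)) * (Lambda (int n) * ?z)))
          = scal (qK ^ n) * (xval r (a * ((- 1) ^ j * esym 1 r j * hsym r (m - n - j))) * (Lambda (int n) * ?z))" .
    qed
    also have "\<dots> = (\<Sum>(j, n)\<in>(SIGMA j:{..r}. {..m - j}). scal (qK ^ n) * (xval r (a * ((- 1) ^ j * esym 1 r j * hsym r (m - n - j))) * (Lambda (int n) * ?z)))"
      by (rule sum.Sigma) auto
    also have "\<dots> = (\<Sum>(n, j)\<in>(SIGMA n:{..m}. {..min r (m - n)}). scal (qK ^ n) * (xval r (a * ((- 1) ^ j * esym 1 r j * hsym r (m - n - j))) * (Lambda (int n) * ?z)))"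
      by (rule sum.reindex_bij_witness[where i = "\<lambda>(n, j). (j, n)" and j = "\<lambda>(j, n). (n, j)"])
        (use True in auto)
    also have "\<dots> = (\<Sum>n\<le>m. \<Sum>j\<le>min r (m - n). scal (qK ^ n) * (xval r (a * ((- 1) ^ j * esym 1 r j * hsym r (m - n - j))) * (Lambda (int n) * ?z)))"
      by (rule sum.Sigma[symmetric]) auto
    also have "\<dots> = (\<Sum>n\<le>m. scal (qK ^ n) * (xval r (a * (if m - n = 0 then 1 else 0)) * (Lambda (int n) * ?z)))"
      unfolding esym_hsym[of r, symmetric] sum_distrib_left xval_sum sum_distrib_right ..
    also have "\<dots> = (\<Sum>n\<in>{m}. scal (qK ^ n) * (xval r (a * (if m - n = 0 then 1 else 0)) * (Lambda (int n) * ?z)))"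
      by (rule sum.mono_neutral_right) auto
    finally have T: "T = scal (qK ^ m) * (xval r a * (Lambda (int m) * ?z))" by simp
    have "grel r (m - j) (a * esym 1 r j) ?z \<in> gen_span m" if "j \<le> r" for j
    proof (cases "j = r")
      case False
      then show ?thesis
        using that True z a by (intro gen_span_closed(3) grel_Iq sym_laurent_mult esym_in_sym) auto
    next
      case jr: True
      have "a * esym 1 r r = f * epow r (- int k)"
        unfolding epow_esym[symmetric] a_def mult.assoc epow_add[symmetric] by simp
      then show ?thesis
        unfolding grel_def jr
      proof (intro gen_span_sum gen_span_scal)
        fix n
        have "f * fps_nth (es.H r r) (m - r - n) \<in> es.wt_le r r (D + (m - r - n))"
          by (rule es.wt_le_mult[OF es.H_nth_wt Suc.prems(1)])
        then have "xval r (f * hsym r (m - r - n) * epow r (- int k)) * (Lambda (int n) * ?z) \<in> gen_span m"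
          unfolding H_hsym by (rule Suc.IH[OF _ U0_closed(3)[OF Lambda_U0 z]])
        then show "xval r (a * esym 1 r r * hsym r (m - r - n)) * (Lambda (int n) * ?z) \<in> gen_span m"
          using \<open>a * esym 1 r r = _\<close> by (simp add: mult_ac)
      qed
    qed
    then have "T \<in> gen_span m"
      unfolding T_def by (intro gen_span_sum gen_span_scal) auto
    then have "scal (1 / qK ^ m) * T \<in> gen_span m" by (rule gen_span_scal)
    then have 1: "xval r a * (Lambda (int m) * ?z) \<in> gen_span m"
      unfolding T using qK_nonzero by (simp add: scal_cancel)
    have "xval r a * ((Lambda (int m) * Lambda (- int m) - 1) * y) \<in> Iq m"
      using m Suc.prems by (intro Iq_closed(3) Iq_mult_U0 Iq_gens Lambda_inverse_Iq)
    then have 2: "xval r a * ((Lambda (int m) * Lambda (- int m) - 1) * y) \<in> gen_span m"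
      by (rule gen_span_closed)
    have "xval r a * y = xval r a * (Lambda (int m) * ?z)
        - xval r a * ((Lambda (int m) * Lambda (- int m) - 1) * y)"
      by (simp add: left_diff_distrib right_diff_distrib mult.assoc)
    then show ?thesis using gen_span_diff[OF 1 2] by (simp add: a_def)
  qed
qed

lemma prod_power_wt:
  "finite A \<Longrightarrow> A \<subseteq> {1..r} \<Longrightarrow> \<exists>D. (\<Prod>j\<in>A. esym 1 r j ^ n j) \<in> es.wt_le r r D"
proof (induction A rule: finite_induct)
  case empty
  then show ?case using es.wt_le_1 by auto
next
  case (insert j A)
  then obtain D where D: "(\<Prod>j\<in>A. esym 1 r j ^ n j) \<in> es.wt_le r r D" by auto
  have "esym 1 r j ^ k * f \<in> es.wt_le r r (D + k * j)" if "f \<in> es.wt_le r r D" for f k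
  proof (induction k)
    case (Suc k)
    have "(esym 1 r j ^ k * f) * esym 1 r j \<in> es.wt_le r r (D + k * j + j)"
      using insert.prems by (intro es.wt_le_mult[OF es.wt_le_gen Suc]) auto
    then show ?case by (simp add: mult_ac add_ac)
  qed (use that in simp)
  from this[OF D, of "n j"] show ?case using insert(1,2) by auto
qed

lemma gen_span_UNIV:
  assumes "m \<ge> 1"
  shows "a \<in> gen_span m"
proof -
  have sym: "xval r f * y \<in> gen_span m" if "f \<in> sym_laurent r" "y \<in> U0" for r f y
  proof -
    have "sym_laurent r \<subseteq> {f. xval r f * y \<in> gen_span m}"
    proof (rule sym_laurent_subset, safe)
      show "xval r 0 * y \<in> gen_span m" by (simp add: gen_span_closed)
      show "xval r (f + g) * y \<in> gen_span m"
        if "xval r f * y \<in> gen_span m" "xval r g * y \<in> gen_span m" for f g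
        using that by (simp add: xval_add distrib_right gen_span_closed)
      fix c b assume "dominant r b"
      define k where "k = Poly_Mapping.lookup b r"
      obtain D where D: "(\<Prod>j=1..<r. esym 1 r j ^ nat (Poly_Mapping.lookup b j - Poly_Mapping.lookup b (Suc j)))
          \<in> es.wt_le r r D"
        using prod_power_wt[of "{1..<r}" r] by force
      \<comment> \<open>The intersection covers \<open>r = 0\<close>, where \<open>epow\<close> is
        the empty product.\<close>
      obtain E where E: "(\<Prod>j\<in>{r} \<inter> {1..r}. esym 1 r j ^ nat k) \<in> es.wt_le r r E"
        using prod_power_wt[of "{r} \<inter> {1..r}" r] by force
      have pw: "epow r (int n) = epow r 1 ^ n" for n
        by (induction n) (simp_all add: epow_add)
      have "epow r (int (nat k)) = (\<Prod>j\<in>{r} \<inter> {1..r}. esym 1 r j ^ nat k)"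
        unfolding pw by (cases "r = 0") (simp_all add: epow_def[of 0] epow_esym[of r 1, symmetric])
      then have E: "epow r (int (nat k)) \<in> es.wt_le r r E" using E by simp
      \<comment> \<open>At least one of the two factors is 1, according to the sign of
        \<open>k\<close>.\<close>
      have "epow r k = epow r (int (nat k)) * epow r (- int (nat (- k)))"
        unfolding epow_add[symmetric] by simp
      then have "esym_mono r b = ((\<Prod>j=1..<r. esym 1 r j ^ nat (Poly_Mapping.lookup b j - Poly_Mapping.lookup b (Suc j)))
          * epow r (int (nat k))) * epow r (- int (nat (- k)))"
        unfolding esym_mono_def k_def[symmetric] by (simp only: mult.assoc)
      then have "xval r (esym_mono r b) * y \<in> gen_span m"
        using xval_epow_gen_span[OF assms es.wt_le_mult[OF E D] that(2), of "nat (- k)"] by (simp only:)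
      then show "xval r (cst c * esym_mono r b) * y \<in> gen_span m"
        by (simp add: xval_cst_mult mult.assoc gen_span_scal)
    qed
    then show ?thesis using that by auto
  qed
  have "a \<in> triangular m" by (rule triangular_UNIV)
  then have "id a \<in> gen_span m"
    unfolding triangular_def gen_span_def
  proof (rule add_span_image, unfold gen_span_def[symmetric])
    fix b assume "b \<in> {xprod ks * y | ks y. y \<in> U0} \<union> Iq m"
    then show "id b \<in> gen_span m"
    proof
      assume "b \<in> {xprod ks * y | ks y. y \<in> U0}"
      then obtain ks y where b: "b = xprod ks * y" and y: "y \<in> U0" by blast
      obtain f where "f \<in> sym_laurent (length ks)" "xprod ks = xval (length ks) f"
        using xprod_in_sym_vals[of ks] unfolding sym_vals_def by blast
      then show ?thesis using sym[OF _ y] b by simp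
    next
      assume "b \<in> Iq m"
      then show ?thesis using gen_span_closed(3) by simp
    qed
  qed simp_all
  then show ?thesis by simp
qed

section \<open>Partial fractions and logarithmic derivatives\<close>

text \<open>The coefficient of \<open>w / (w - z_i)\<close> in the partial fraction expansion of the
  product of the \<open>(\<alpha>_j w - \<beta>_j z_j) / (w - z_j)\<close>.\<close>

definition pf_residue :: "('i \<Rightarrow> 'a::field) \<Rightarrow> ('i \<Rightarrow> 'a) \<Rightarrow> ('i \<Rightarrow> 'a) \<Rightarrow> 'i set \<Rightarrow> 'i \<Rightarrow> 'a" where
  "pf_residue z \<alpha> \<beta> J i = (\<alpha> i - \<beta> i) * (\<Prod>j\<in>J - {i}. (\<alpha> j * z i - \<beta> j * z j) / (z i - z j))"

lemma pf_residue_insert: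
  assumes "finite J" "l \<notin> J" "i \<in> J"
  shows "pf_residue z \<alpha> \<beta> (insert l J) i = pf_residue z \<alpha> \<beta> J i * ((\<alpha> l * z i - \<beta> l * z l) / (z i - z l))"
proof -
  have "insert l J - {i} = insert l (J - {i})" using assms by auto
  then show ?thesis using assms by (simp add: pf_residue_def)
qed

lemma pf_field_identity:
  fixes w :: "'a::field"
  assumes "w \<noteq> x" "w \<noteq> y" "x \<noteq> y"
  shows "(a * w - b * x) / (w - x) * (w / (w - y))
    = (a * y - b * x) / (y - x) * (w / (w - y)) + (a - b) * (x / (x - y)) * (w / (w - x))"
proof -
  have nz: "w - x \<noteq> 0" "w - y \<noteq> 0" "y - x \<noteq> 0" and s: "x / (x - y) = - (x / (y - x))"
    using assms by (auto simp: minus_divide_right)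
  show ?thesis unfolding s using nz by (simp add: divide_simps) (simp add: algebra_simps)
qed

text \<open>The constant term is the value at \<open>w = 0\<close>. In the induction, the residue at
  the new point \<open>z l\<close> comes from the hypothesis evaluated at
  \<open>w = z l\<close>.\<close>

lemma partial_fractions:
  assumes "finite J" "inj_on z J" "\<And>j. j \<in> J \<Longrightarrow> w \<noteq> z j"
  shows "(\<Prod>j\<in>J. (\<alpha> j * w - \<beta> j * z j) / (w - z j))
    = (\<Prod>j\<in>J. \<beta> j) + (\<Sum>i\<in>J. pf_residue z \<alpha> \<beta> J i * (w / (w - z i)))"
  using assms
proof (induction J arbitrary: w rule: finite_induct)
  case (insert l J)
  let ?B = "\<Prod>j\<in>J. \<beta> j" and ?R = "pf_residue z \<alpha> \<beta> J"
  have w: "w \<noteq> z l" "\<And>j. j \<in> J \<Longrightarrow> w \<noteq> z j" using insert.prems by auto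
  have zl: "z l \<noteq> z j" if "j \<in> J" for j using insert.prems(1) insert.hyps that by (auto simp: inj_on_def)
  have inj: "inj_on z J" using insert.prems by (simp add: inj_on_def)
  have Rl: "pf_residue z \<alpha> \<beta> (insert l J) l = (\<alpha> l - \<beta> l) * (?B + (\<Sum>i\<in>J. ?R i * (z l / (z l - z i))))"
    using insert.IH[OF inj, of "z l"] zl insert.hyps by (simp add: pf_residue_def)
  have B: "(\<alpha> l * w - \<beta> l * z l) / (w - z l) = \<beta> l + (\<alpha> l - \<beta> l) * (w / (w - z l))"
    using w(1) by (simp add: divide_simps) (simp add: algebra_simps)
  have "(\<Prod>j\<in>insert l J. (\<alpha> j * w - \<beta> j * z j) / (w - z j))
      = (\<alpha> l * w - \<beta> l * z l) / (w - z l) * (?B + (\<Sum>i\<in>J. ?R i * (w / (w - z i))))"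
    using insert.IH[OF inj w(2)] insert.hyps by simp
  also have "\<dots> = (\<alpha> l * w - \<beta> l * z l) / (w - z l) * ?B
      + (\<Sum>i\<in>J. ?R i * ((\<alpha> l * w - \<beta> l * z l) / (w - z l) * (w / (w - z i))))"
    by (simp add: distrib_left sum_distrib_left mult_ac)
  also have "(\<Sum>i\<in>J. ?R i * ((\<alpha> l * w - \<beta> l * z l) / (w - z l) * (w / (w - z i))))
      = (\<Sum>i\<in>J. pf_residue z \<alpha> \<beta> (insert l J) i * (w / (w - z i)))
        + (\<Sum>i\<in>J. ?R i * (z l / (z l - z i))) * ((\<alpha> l - \<beta> l) * (w / (w - z l)))"
    unfolding sum_distrib_right sum.distrib[symmetric]
  proof (intro sum.cong refl)
    fix i assume i: "i \<in> J"
    show "?R i * ((\<alpha> l * w - \<beta> l * z l) / (w - z l) * (w / (w - z i)))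
      = pf_residue z \<alpha> \<beta> (insert l J) i * (w / (w - z i))
        + ?R i * (z l / (z l - z i)) * ((\<alpha> l - \<beta> l) * (w / (w - z l)))"
      unfolding pf_residue_insert[OF insert.hyps(1,2) i] pf_field_identity[OF w(1) w(2)[OF i] zl[OF i]]
      by (simp only: distrib_left mult_ac)
  qed
  finally have e: "(\<Prod>j\<in>insert l J. (\<alpha> j * w - \<beta> j * z j) / (w - z j))
      = (\<alpha> l * w - \<beta> l * z l) / (w - z l) * ?B
        + ((\<Sum>i\<in>J. pf_residue z \<alpha> \<beta> (insert l J) i * (w / (w - z i)))
          + (\<Sum>i\<in>J. ?R i * (z l / (z l - z i))) * ((\<alpha> l - \<beta> l) * (w / (w - z l))))" .
  show ?case
    unfolding e B sum.insert[OF insert.hyps] prod.insert[OF insert.hyps] Rl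
    by (simp only: distrib_left distrib_right mult_ac add_ac)
qed simp

text \<open>The same expansion in powers of \<open>X = 1/w\<close>. The rational form gives the
  residue at the inserted point; the rest is the recurrence that the denominator
  \<open>1 - z_l X\<close> imposes on the coefficients.\<close>

lemma partial_fractions_fps:
  assumes "finite J" "inj_on z J"
  shows "fps_nth (\<Prod>j\<in>J. (fps_const (\<alpha> j) - fps_const (\<beta> j * z j) * fps_X) * geo_fps (z j)) n
    = (if n = 0 then (\<Prod>j\<in>J. \<beta> j) else 0) + (\<Sum>i\<in>J. pf_residue z \<alpha> \<beta> J i * z i ^ n)"
  using assms
proof (induction J arbitrary: n rule: finite_induct)
  case (insert l J)
  let ?B = "\<Prod>j\<in>J. \<beta> j" and ?R = "pf_residue z \<alpha> \<beta> J" and ?R' = "pf_residue z \<alpha> \<beta> (insert l J)"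
  define \<rho> where "\<rho> i = (\<alpha> l * z i - \<beta> l * z l) / (z i - z l)" for i
  have zl: "z l \<noteq> z j" if "j \<in> J" for j using insert.prems(1) insert.hyps that by (auto simp: inj_on_def)
  have inj: "inj_on z J" using insert.prems by (simp add: inj_on_def)
  have Rl: "?R' l = (\<alpha> l - \<beta> l) * (?B + (\<Sum>i\<in>J. ?R i * (z l / (z l - z i))))"
    using partial_fractions[OF insert.hyps(1) inj, of "z l" \<alpha> \<beta>] zl insert.hyps by (simp add: pf_residue_def)
  have R': "?R' i = ?R i * \<rho> i" if "i \<in> J" for i
    using pf_residue_insert[OF insert.hyps(1,2) that] by (simp add: \<rho>_def)
  have \<rho>: "\<rho> i * z i = \<rho> i * z l + (\<alpha> l * z i - \<beta> l * z l)" if "i \<in> J" for i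
    using zl[OF that] by (simp add: \<rho>_def divide_simps) (simp add: algebra_simps)
  define P where "P = (\<Prod>j\<in>J. (fps_const (\<alpha> j) - fps_const (\<beta> j * z j) * fps_X) * geo_fps (z j))"
  define Q where "Q = (fps_const (\<alpha> l) - fps_const (\<beta> l * z l) * fps_X) * geo_fps (z l) * P"
  have P: "fps_nth P n = (if n = 0 then ?B else 0) + (\<Sum>i\<in>J. ?R i * z i ^ n)" for n
    unfolding P_def using insert.IH[OF inj] .
  have "(1 - fps_const (z l) * fps_X) * Q
      = ((1 - fps_const (z l) * fps_X) * geo_fps (z l)) * ((fps_const (\<alpha> l) - fps_const (\<beta> l * z l) * fps_X) * P)"
    unfolding Q_def by (simp only: mult_ac)
  then have "(1 - fps_const (z l) * fps_X) * Q = (fps_const (\<alpha> l) - fps_const (\<beta> l * z l) * fps_X) * P"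
    by (simp only: geo_fps_inverse mult_1_left)
  then have Qeq: "Q = fps_const (z l) * (fps_X * Q) + fps_const (\<alpha> l) * P - fps_const (\<beta> l * z l) * (fps_X * P)"
    by (simp add: algebra_simps)
  have Q0: "fps_nth Q 0 = \<alpha> l * fps_nth P 0"
    by (subst Qeq) simp
  have QS: "fps_nth Q (Suc n) = z l * fps_nth Q n + \<alpha> l * fps_nth P (Suc n) - \<beta> l * z l * fps_nth P n" for n
    by (subst Qeq) simp
  have "fps_nth Q n = (if n = 0 then \<beta> l * ?B else 0) + (?R' l * z l ^ n + (\<Sum>i\<in>J. ?R i * \<rho> i * z i ^ n))"
  proof (induction n)
    case 0
    have "?R i * \<alpha> l = ?R i * \<rho> i + (\<alpha> l - \<beta> l) * (?R i * (z l / (z l - z i)))" if "i \<in> J" for i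
    proof -
      have "z l / (z l - z i) = - (z l / (z i - z l))"
        by (simp add: minus_divide_right)
      then have "\<alpha> l = \<rho> i + (\<alpha> l - \<beta> l) * (z l / (z l - z i))"
        using zl[OF that] by (simp add: \<rho>_def divide_simps) (simp add: algebra_simps)
      then have "?R i * \<alpha> l = ?R i * (\<rho> i + (\<alpha> l - \<beta> l) * (z l / (z l - z i)))" by simp
      then show ?thesis by (simp only: distrib_left mult_ac)
    qed
    then have "(\<Sum>i\<in>J. ?R i * \<alpha> l) = (\<Sum>i\<in>J. ?R i * \<rho> i + (\<alpha> l - \<beta> l) * (?R i * (z l / (z l - z i))))"
      by (intro sum.cong) auto
    then have "(\<Sum>i\<in>J. ?R i) * \<alpha> l = (\<Sum>i\<in>J. ?R i * \<rho> i) + (\<alpha> l - \<beta> l) * (\<Sum>i\<in>J. ?R i * (z l / (z l - z i)))"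
      by (simp only: sum.distrib sum_distrib_left sum_distrib_right)
    then show ?case by (simp add: Q0 P Rl algebra_simps)
  next
    case (Suc n)
    have "?R i * \<rho> i * z i ^ Suc n = z l * (?R i * \<rho> i * z i ^ n) + \<alpha> l * (?R i * z i ^ Suc n)
        - \<beta> l * z l * (?R i * z i ^ n)" if "i \<in> J" for i
    proof -
      have "?R i * \<rho> i * z i ^ Suc n = ?R i * z i ^ n * (\<rho> i * z i)" by simp
      also have "\<dots> = ?R i * z i ^ n * (\<rho> i * z l + (\<alpha> l * z i - \<beta> l * z l))"
        by (simp only: \<rho>[OF that])
      finally show ?thesis by (simp add: algebra_simps)
    qed
    then have "(\<Sum>i\<in>J. ?R i * \<rho> i * z i ^ Suc n) = (\<Sum>i\<in>J. z l * (?R i * \<rho> i * z i ^ n)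
        + \<alpha> l * (?R i * z i ^ Suc n) - \<beta> l * z l * (?R i * z i ^ n))"
      by (intro sum.cong) auto
    then have s: "(\<Sum>i\<in>J. ?R i * \<rho> i * z i ^ Suc n) = z l * (\<Sum>i\<in>J. ?R i * \<rho> i * z i ^ n)
        + \<alpha> l * (\<Sum>i\<in>J. ?R i * z i ^ Suc n) - \<beta> l * z l * (\<Sum>i\<in>J. ?R i * z i ^ n)"
      by (simp only: sum.distrib sum_subtractf sum_distrib_left)
    show ?case unfolding QS Suc P s by (simp add: algebra_simps)
  qed
  moreover have "(\<Prod>j\<in>insert l J. (fps_const (\<alpha> j) - fps_const (\<beta> j * z j) * fps_X) * geo_fps (z j)) = Q"
    using insert.hyps by (simp add: Q_def P_def)
  moreover have "(\<Sum>i\<in>J. ?R' i * z i ^ n) = (\<Sum>i\<in>J. ?R i * \<rho> i * z i ^ n)"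
    by (simp add: R')
  ultimately show ?case using insert.hyps by simp
qed simp

text \<open>The series of the \<open>s i\<close> with \<open>i \<ge> 1\<close> plays the role of
  \<open>X f' / f\<close>. Exponentials and products are compared through it: it turns products into
  sums and, together with a nonzero constant term, determines the series in characteristic
  0.\<close>

definition has_log_deriv :: "'a::comm_ring_1 fps \<Rightarrow> (nat \<Rightarrow> 'a) \<Rightarrow> bool" where
  "has_log_deriv f s \<longleftrightarrow> fps_X * fps_deriv f = Abs_fps (\<lambda>i. if i = 0 then 0 else s i) * f"

lemma has_log_deriv_iff:
  "has_log_deriv f s \<longleftrightarrow> (\<forall>n. of_nat n * fps_nth f n = (\<Sum>i=1..n. s i * fps_nth f (n - i)))"
proof -
  have "fps_nth (fps_X * fps_deriv f) n = of_nat n * fps_nth f n" for n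
    by (cases n) simp_all
  moreover have "fps_nth (Abs_fps (\<lambda>i. if i = 0 then 0 else s i) * f) n = (\<Sum>i=1..n. s i * fps_nth f (n - i))" for n
  proof -
    have "fps_nth (Abs_fps (\<lambda>i. if i = 0 then 0 else s i) * f) n
        = (\<Sum>i=0..n. (if i = 0 then 0 else s i) * fps_nth f (n - i))"
      by (simp add: fps_mult_nth)
    also have "\<dots> = (\<Sum>i=1..n. (if i = 0 then 0 else s i) * fps_nth f (n - i))"
      by (rule sum.mono_neutral_right) (auto simp: not_le)
    finally show ?thesis by simp
  qed
  ultimately show ?thesis by (simp add: has_log_deriv_def fps_eq_iff)
qed

lemma has_log_deriv_mult:
  assumes "has_log_deriv f s" "has_log_deriv g t"
  shows "has_log_deriv (f * g) (\<lambda>i. s i + t i)"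
proof -
  have "fps_X * fps_deriv (f * g) = f * (fps_X * fps_deriv g) + (fps_X * fps_deriv f) * g"
    by (simp add: algebra_simps)
  also have "\<dots> = (Abs_fps (\<lambda>i. if i = 0 then 0 else s i) + Abs_fps (\<lambda>i. if i = 0 then 0 else t i)) * (f * g)"
    using assms by (simp add: has_log_deriv_def algebra_simps)
  also have "Abs_fps (\<lambda>i. if i = 0 then 0 else s i) + Abs_fps (\<lambda>i. if i = 0 then 0 else t i)
      = Abs_fps (\<lambda>i. if i = 0 then 0 else s i + t i)"
    by (rule fps_ext) simp
  finally show ?thesis by (simp add: has_log_deriv_def)
qed

lemma has_log_deriv_const: "has_log_deriv (fps_const c) (\<lambda>i. 0)"
  by (auto simp: has_log_deriv_iff)

lemma has_log_deriv_prod: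
  assumes "finite A" "\<And>j. j \<in> A \<Longrightarrow> has_log_deriv (f j) (s j)"
  shows "has_log_deriv (prod f A) (\<lambda>i. \<Sum>j\<in>A. s j i)"
  using assms
proof (induction A rule: finite_induct)
  case empty
  show ?case using has_log_deriv_const[of 1] by simp
next
  case (insert j A)
  then show ?case using has_log_deriv_mult[of "f j" "s j" "prod f A"] by simp
qed

lemma has_log_deriv_geo: "has_log_deriv (geo_fps z) (\<lambda>i. z ^ i)"
  by (simp add: has_log_deriv_iff geo_fps_def power_add[symmetric])

lemma has_log_deriv_linear: "has_log_deriv (1 - fps_const y * fps_X) (\<lambda>i. - (y ^ i))"
proof -
  have "Abs_fps (\<lambda>i. if i = 0 then 0 else - (y ^ i)) = - (fps_const y * fps_X * geo_fps y)"
  proof (rule fps_ext)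
    fix n
    show "fps_nth (Abs_fps (\<lambda>i. if i = 0 then 0 else - (y ^ i))) n = fps_nth (- (fps_const y * fps_X * geo_fps y)) n"
      by (cases n) (simp_all add: geo_fps_def mult.assoc)
  qed
  then have "Abs_fps (\<lambda>i. if i = 0 then 0 else - (y ^ i)) * (1 - fps_const y * fps_X)
      = - (fps_const y * fps_X * ((1 - fps_const y * fps_X) * geo_fps y))"
    by (simp only: minus_mult_left[symmetric] minus_mult_right[symmetric] mult_ac)
  moreover have "fps_X * fps_deriv (1 - fps_const y * fps_X) = - (fps_const y * fps_X)"
  proof (rule fps_ext)
    fix n
    show "fps_nth (fps_X * fps_deriv (1 - fps_const y * fps_X)) n = fps_nth (- (fps_const y * fps_X)) n"
      by (cases n) (simp_all add: fps_X_nth)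
  qed
  ultimately show ?thesis unfolding has_log_deriv_def geo_fps_inverse by (simp only: mult_1_right)
qed

lemma has_log_deriv_factor:
  fixes a :: "'a::field"
  assumes "a \<noteq> 0"
  shows "has_log_deriv ((fps_const a - fps_const (b * z) * fps_X) * geo_fps z) (\<lambda>i. z ^ i * (1 - (b / a) ^ i))"
proof -
  have "(fps_const a - fps_const (b * z) * fps_X) = fps_const a * (1 - fps_const (b / a * z) * fps_X)"
    using assms by (simp add: right_diff_distrib mult.assoc[symmetric])
  moreover have "has_log_deriv (fps_const a * (1 - fps_const (b / a * z) * fps_X) * geo_fps z)
      (\<lambda>i. 0 + - ((b / a * z) ^ i) + z ^ i)"
    by (intro has_log_deriv_mult has_log_deriv_const has_log_deriv_linear has_log_deriv_geo)
  moreover have "(\<lambda>i. 0 + - ((b / a * z) ^ i) + z ^ i) = (\<lambda>i. z ^ i * (1 - (b / a) ^ i))"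
    by (rule ext) (simp add: algebra_simps power_mult_distrib power_divide)
  ultimately show ?thesis by simp
qed

lemma has_log_deriv_unique:
  fixes f g :: "'a::field_char_0 fps"
  assumes "has_log_deriv f s" "has_log_deriv g t" "\<And>i. i \<ge> 1 \<Longrightarrow> s i = t i"
  shows "fps_nth f n * fps_nth g 0 = fps_nth f 0 * fps_nth g n"
proof (induction n rule: less_induct)
  case (less n)
  show ?case
  proof (cases "n = 0")
    case False
    have "of_nat n * (fps_nth f n * fps_nth g 0) = (\<Sum>i=1..n. s i * (fps_nth f (n - i) * fps_nth g 0))"
      using assms(1) unfolding has_log_deriv_iff by (simp add: mult.assoc[symmetric] sum_distrib_right)
    also have "\<dots> = (\<Sum>i=1..n. t i * (fps_nth f 0 * fps_nth g (n - i)))"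
      using False by (intro sum.cong refl) (simp add: assms(3) less)
    also have "\<dots> = fps_nth f 0 * (of_nat n * fps_nth g n)"
      using assms(2) unfolding has_log_deriv_iff by (simp add: sum_distrib_left mult_ac)
    finally have "of_nat n * (fps_nth f n * fps_nth g 0) = of_nat n * (fps_nth f 0 * fps_nth g n)"
      by (simp only: mult_ac)
    then show ?thesis using False by simp
  qed simp
qed

section \<open>A representation on subsets\<close>

text \<open>
  A generic tensor product of \<open>m\<close> evaluation representations, in the basis of simultaneous
  eigenvectors of the \<open>h\<^sub>r\<close>, indexed by the subsets of \<open>{1..m}\<close> and normalised as for the Drinfeld
  coproduct. A vector is the family of its coefficients; \<open>z\<^sub>i = q t\<^sub>i\<close>.
\<close>

type_synonym lfrac = "laurent fract"

type_synonym vec = "nat set \<Rightarrow> lfrac"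

definition toF :: "laurent \<Rightarrow> lfrac" where
  "toF f = Fract f 1"

lemma toF_hom [simp]:
  "toF 0 = 0" "toF 1 = 1" "toF (f + g) = toF f + toF g" "toF (f * g) = toF f * toF g"
  "toF (- f) = - toF f" "toF (f - g) = toF f - toF g"
  by (simp_all add: toF_def Zero_fract_def One_fract_def)

lemma toF_inject [simp]: "toF f = toF g \<longleftrightarrow> f = g"
  by (simp add: toF_def eq_fract)

lemma toF_eq_0 [simp]: "toF f = 0 \<longleftrightarrow> f = 0"
  using toF_inject[of f 0] by (simp del: toF_inject)

lemma toF_sum: "toF (sum f A) = (\<Sum>i\<in>A. toF (f i))"
  by (induction A rule: infinite_finite_induct) simp_all

lemma toF_prod: "toF (prod f A) = (\<Prod>i\<in>A. toF (f i))"
  by (induction A rule: infinite_finite_induct) simp_all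

lemma toF_power: "toF (f ^ n) = toF f ^ n"
  by (induction n) simp_all

definition kF :: "K \<Rightarrow> lfrac" where
  "kF c = toF (cst c)"

lemma kF_hom [simp]:
  "kF 0 = 0" "kF 1 = 1" "kF (a + b) = kF a + kF b" "kF (- a) = - kF a" "kF (a - b) = kF a - kF b"
  by (simp_all add: kF_def single_add single_diff single_uminus)

lemma kF_mult [simp]: "kF (a * b) = kF a * kF b"
  by (simp add: kF_def mult_single flip: toF_hom(4))

lemma kF_eq_0 [simp]: "kF c = 0 \<longleftrightarrow> c = 0"
  by (simp add: kF_def) (metis lookup_single_eq lookup_zero single_zero)

lemma kF_inverse: "kF (inverse c) = inverse (kF c)"
proof (cases "c = 0")
  case False
  then have "kF c * kF (inverse c) = 1" by (simp flip: kF_mult)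
  then show ?thesis by (metis inverse_unique)
qed simp

lemma kF_divide: "kF (a / b) = kF a / kF b"
  by (simp add: divide_inverse kF_inverse)

lemma kF_power: "kF (a ^ n) = kF a ^ n"
  by (induction n) simp_all

lemma kF_powi: "kF (a powi k) = kF a powi k"
  by (simp add: power_int_def kF_power kF_inverse)

lemma kF_of_nat: "kF (of_nat n) = of_nat n"
  by (induction n) simp_all

lemma kF_of_int: "kF (of_int n) = of_int n"
  by (cases n) (simp_all add: kF_of_nat)

definition tF :: "nat \<Rightarrow> lfrac" where
  "tF i = toF (var i 1)"

lemma tF_nonzero [simp]: "tF i \<noteq> 0"
  by (simp add: tF_def) (metis lookup_single_eq lookup_zero zero_neq_one)

lemma toF_var_nat: "toF (var i (int n)) = tF i ^ n"
  by (simp add: tF_def toF_power[symmetric] var_power)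

lemma toF_var: "toF (var i k) = tF i powi k"
proof (cases "k \<ge> 0")
  case True
  then show ?thesis using toF_var_nat[of i "nat k"] by (simp add: power_int_def)
next
  case False
  have "toF (var i k) * toF (var i (- k)) = 1"
    unfolding toF_hom(4)[symmetric] var_add[symmetric] by simp
  moreover have "toF (var i (- k)) = tF i ^ nat (- k)"
    using toF_var_nat[of i "nat (- k)"] False by simp
  ultimately have "toF (var i k) = inverse (tF i ^ nat (- k))"
    by (metis inverse_unique mult.commute)
  then show ?thesis using False by (simp add: power_int_def power_inverse)
qed

definition qF :: lfrac where
  "qF = kF qK"

lemma qF_nonzero [simp]: "qF \<noteq> 0"
  by (simp add: qF_def qK_nonzero)

text \<open>The factor \<open>q\<close> is chosen so that \<open>Lambda r\<close> acts on the
  highest weight vector through the \<open>t_i\<close> without powers of \<open>q\<close>; the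
  series \<open>Lambda^+(qu)\<close> of the relations then acts by the product of the
  \<open>1 - z_i u\<close>.\<close>

definition zF :: "nat \<Rightarrow> lfrac" where
  "zF i = qF * tF i"

lemma zF_nonzero [simp]: "zF i \<noteq> 0"
  by (simp add: zF_def)

text \<open>Genericity: distinct \<open>t_i\<close> are not proportional over \<open>K\<close>, so
  the denominators \<open>z_i - z_j\<close> and the numerators of \<open>AF\<close> are
  nonzero.\<close>

lemma kF_tF_neq: "i \<noteq> j \<Longrightarrow> kF c * tF i \<noteq> tF j"
proof
  assume ij: "i \<noteq> j" and "kF c * tF i = tF j"
  then have "cst c * var i 1 = var j 1" by (simp add: kF_def tF_def flip: toF_hom(4))
  then have "Poly_Mapping.lookup (cst c * var i 1) (Poly_Mapping.single j 1) = 1" by simp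
  moreover have "Poly_Mapping.single i (1 :: int) \<noteq> Poly_Mapping.single j 1"
    using ij by (metis lookup_single_eq lookup_single_not_eq zero_neq_one)
  ultimately show False by (simp add: mult_single lookup_single_not_eq)
qed

lemma kF_zF_neq: "i \<noteq> j \<Longrightarrow> kF c * zF i \<noteq> zF j"
  using kF_tF_neq[of i j c] by (simp add: zF_def mult.left_commute)

lemma zF_inj: "inj zF"
  using kF_zF_neq[of _ _ 1] by (auto simp: inj_def)

definition AF :: "nat \<Rightarrow> nat \<Rightarrow> lfrac" where
  "AF i j = (qF powi (- 2) * zF i - zF j) / (zF i - zF j)"

lemma AF_nonzero: "i \<noteq> j \<Longrightarrow> AF i j \<noteq> 0"
  using kF_zF_neq[of i j "qK powi (- 2)"] zF_inj by (auto simp: AF_def qF_def kF_powi inj_def)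

text \<open>The ratio of \<open>AF i j\<close> to \<open>AF j i\<close>, cross-multiplied. It is the
  one that the quadratic relation between the \<open>x-\<close> forces when two elements are added
  in either order.\<close>

lemma AF_ratio:
  assumes "i \<noteq> j"
  shows "(zF i - qF powi (- 2) * zF j) * AF i j = (qF powi (- 2) * zF i - zF j) * AF j i"
proof -
  have nz: "zF i - zF j \<noteq> 0" "zF j - zF i \<noteq> 0" using assms zF_inj by (auto simp: inj_def)
  have "AF j i = (zF i - qF powi (- 2) * zF j) / (zF i - zF j)"
    unfolding AF_def using nz by (simp add: divide_simps) (simp add: algebra_simps)
  then show ?thesis by (simp add: AF_def)
qed

section \<open>The matrix coefficients of the generators\<close>

definition cminus :: "nat \<Rightarrow> nat \<Rightarrow> nat set \<Rightarrow> lfrac" where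
  "cminus m i S = (\<Prod>j\<in>{1..m} \<inter> S. AF i j)"

text \<open>Elements outside the set contribute here, elements inside it in \<open>cminus\<close>.
  The power of \<open>q\<close> makes the product of the two coefficients, up to the factor
  \<open>\<alpha>F - \<beta>F\<close>, the residue of the eigenvalue of \<psi> at
  \<open>z_i\<close>.\<close>

definition cplus :: "nat \<Rightarrow> nat \<Rightarrow> nat set \<Rightarrow> lfrac" where
  "cplus m i S = qF ^ (m - 1) * (\<Prod>j\<in>{1..m} - S. AF j i)"

text \<open>An \<open>i\<close> outside \<open>S\<close> contributes \<open>[k]/k\<close> times
  \<open>(z_i / q)^k\<close>, an \<open>i\<close> inside minus \<open>[k]/k\<close> times
  \<open>(q z_i)^k\<close>. Adding \<open>i\<close> to \<open>S\<close> thus subtracts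
  \<open>[2k]/k\<close> times \<open>z_i^k\<close>, as the relation of \<open>h_k\<close> with
  \<open>x-\<close> demands. At \<open>k = 0\<close> the value is 0, as for the letter
  \<open>GH 0\<close>.\<close>

definition hval :: "nat \<Rightarrow> int \<Rightarrow> nat set \<Rightarrow> lfrac" where
  "hval m k S = kF (q_int k / of_int k) * ((\<Sum>i\<in>{1..m} - S. qF powi (- k) * zF i powi k)
     - (\<Sum>i\<in>{1..m} \<inter> S. qF powi k * zF i powi k))"

definition Kval :: "nat \<Rightarrow> nat set \<Rightarrow> int" where
  "Kval m S = int m - 2 * int (card ({1..m} \<inter> S))"

text \<open>Since \<open>v S\<close> is the coefficient at \<open>S\<close>, the operator
  \<open>x-\<close>, which adds an element to basis sets, reads \<open>v\<close> at
  \<open>S - {i}\<close>. All sets of naturals occur as indices; elements outside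
  \<open>{1..m}\<close> are inert.\<close>

fun gact :: "nat \<Rightarrow> gen \<Rightarrow> vec \<Rightarrow> vec" where
  "gact m (GX Minus k) v = (\<lambda>S. \<Sum>i\<in>{1..m} \<inter> S. zF i powi k * cminus m i (S - {i}) * v (S - {i}))"
| "gact m (GX Plus k) v = (\<lambda>S. \<Sum>i\<in>{1..m} - S. zF i powi k * cplus m i (insert i S) * v (insert i S))"
| "gact m (GH k) v = (\<lambda>S. hval m k S * v S)"
| "gact m (GK e) v = (\<lambda>S. qF powi (pm_sign e * Kval m S) * v S)"

definition vadd :: "vec \<Rightarrow> vec \<Rightarrow> vec" where
  "vadd u v = (\<lambda>S. u S + v S)"

definition vscale :: "lfrac \<Rightarrow> vec \<Rightarrow> vec" where
  "vscale a v = (\<lambda>S. a * v S)"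

definition vlinear :: "(vec \<Rightarrow> vec) \<Rightarrow> bool" where
  "vlinear T \<longleftrightarrow> (\<forall>u v. T (vadd u v) = vadd (T u) (T v)) \<and> (\<forall>a v. T (vscale a v) = vscale a (T v))"

lemma gact_linear: "vlinear (gact m g)"
  by (cases "(m, g, undefined :: vec)" rule: gact.cases)
    (auto simp: vlinear_def vadd_def vscale_def fun_eq_iff algebra_simps sum.distrib sum_distrib_left)

definition wact :: "nat \<Rightarrow> gword \<Rightarrow> vec \<Rightarrow> vec" where
  "wact m w v = foldr (gact m) (letters w) v"

lemma wact_linear: "vlinear (wact m w)"
proof -
  have "vlinear (foldr (gact m) gs)" for gs
    by (induction gs) (use gact_linear in \<open>auto simp: vlinear_def\<close>)
  then show ?thesis by (simp add: vlinear_def wact_def)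
qed

lemma wact_add: "wact m (u + w) v = wact m u (wact m w v)"
  by (simp add: wact_def plus_gword_def)

definition fact_act :: "nat \<Rightarrow> falg \<Rightarrow> vec \<Rightarrow> vec" where
  "fact_act m p v = (\<lambda>S. \<Sum>w\<in>Poly_Mapping.keys p. kF (Poly_Mapping.lookup p w) * wact m w v S)"

lemma fact_act_superset:
  assumes "finite A" "Poly_Mapping.keys p \<subseteq> A"
  shows "fact_act m p v S = (\<Sum>w\<in>A. kF (Poly_Mapping.lookup p w) * wact m w v S)"
  unfolding fact_act_def using assms by (intro sum.mono_neutral_left) (auto simp: in_keys_iff)

lemma fact_act_0: "fact_act m 0 v = (\<lambda>S. 0)"
  by (simp add: fact_act_def)

lemma fact_act_add: "fact_act m (p + p') v = vadd (fact_act m p v) (fact_act m p' v)"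
proof
  fix S
  let ?A = "Poly_Mapping.keys p \<union> Poly_Mapping.keys p'"
  have "fact_act m (p + p') v S = (\<Sum>w\<in>?A. kF (Poly_Mapping.lookup (p + p') w) * wact m w v S)"
    by (rule fact_act_superset) (auto simp: Poly_Mapping.keys_add)
  then show "fact_act m (p + p') v S = vadd (fact_act m p v) (fact_act m p' v) S"
    by (simp add: vadd_def fact_act_superset[of ?A] lookup_add distrib_right sum.distrib)
qed

lemma fact_act_single: "fact_act m (Poly_Mapping.single w c) v = vscale (kF c) (wact m w v)"
  by (auto simp: fact_act_def vscale_def fun_eq_iff)

lemma fact_act_linear: "vlinear (fact_act m p)"
  using wact_linear
  by (auto simp: vlinear_def fact_act_def vadd_def vscale_def fun_eq_iff algebra_simps sum.distrib sum_distrib_left)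

lemma vlinearD:
  assumes "vlinear T"
  shows "T (vadd u v) = vadd (T u) (T v)" "T (vscale a v) = vscale a (T v)" "T (\<lambda>S. 0) = (\<lambda>S. 0)"
proof -
  show "T (vadd u v) = vadd (T u) (T v)" "T (vscale a v) = vscale a (T v)"
    using assms by (auto simp: vlinear_def)
  have "T (vscale 0 (\<lambda>S. 0)) = vscale 0 (T (\<lambda>S. 0))" using assms by (auto simp: vlinear_def)
  then show "T (\<lambda>S. 0) = (\<lambda>S. 0)" by (simp add: vscale_def)
qed

lemma fact_act_mult: "fact_act m (p * p') v = fact_act m p (fact_act m p' v)"
proof (induction p rule: poly_mapping_single_induct)
  case (single w c)
  show ?case
  proof (induction p' rule: poly_mapping_single_induct)
    case zero
    show ?case by (simp add: fact_act_0 vlinearD(3)[OF fact_act_linear])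
  next
    case (single w' c')
    show ?case
      by (simp add: mult_single fact_act_single wact_add vlinearD[OF wact_linear])
        (simp add: vscale_def mult.assoc)
  next
    case (add p p')
    then show ?case
      by (simp add: distrib_left fact_act_add vlinearD[OF fact_act_linear])
  qed
qed (simp_all add: fact_act_0 fact_act_add distrib_right)

lemma fact_act_sum: "fact_act m (sum f A) v S = (\<Sum>i\<in>A. fact_act m (f i) v S)"
  by (induction A rule: infinite_finite_induct) (simp_all add: fact_act_0 fact_act_add vadd_def)

lemma wact_0 [simp]: "wact m 0 v = v"
  by (simp add: wact_def zero_gword_def)

lemma fact_act_scal: "fact_act m (scal_f c) v = vscale (kF c) v"
  by (simp add: scal_f_def fact_act_single)

lemma fact_act_1: "fact_act m 1 v = v"
  using fact_act_scal[of m 1 v] by (simp add: scal_f_def vscale_def)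

lemma fact_act_gen: "fact_act m (gen_f g) v = gact m g v"
  by (simp add: gen_f_def fact_act_single wact_def vscale_def)

lemma fact_act_uminus: "fact_act m (- p) v = vscale (- 1) (fact_act m p v)"
proof -
  have "- p = scal_f (- 1) * p"
    by (simp add: scal_f_def single_uminus)
  then show ?thesis by (simp add: fact_act_mult fact_act_scal del: mult_minus_left)
qed

lemma fact_act_diff: "fact_act m (p - p') v S = fact_act m p v S - fact_act m p' v S"
  using fact_act_add[of m p "- p'" v] by (simp add: vadd_def vscale_def fact_act_uminus)

lemmas fact_act_simps = fact_act_mult fact_act_scal fact_act_1 fact_act_gen fact_act_diff fact_act_add

subsection \<open>The defining relations\<close>

lemma Kval_remove: "i \<in> {1..m} \<inter> S \<Longrightarrow> Kval m (S - {i}) = Kval m S + 2"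
proof -
  assume i: "i \<in> {1..m} \<inter> S"
  have "{1..m} \<inter> (S - {i}) = ({1..m} \<inter> S) - {i}" by blast
  moreover have "card ({1..m} \<inter> S) \<ge> 1" using i by (metis One_nat_def Suc_leI card_gt_0_iff empty_iff finite_Int finite_atLeastAtMost)
  ultimately show ?thesis using i by (simp add: Kval_def of_nat_diff)
qed

lemma Kval_insert: "i \<in> {1..m} - S \<Longrightarrow> Kval m (insert i S) = Kval m S - 2"
  using Kval_remove[of i m "insert i S"] by (simp add: insert_Diff_if)

lemma hval_remove:
  assumes i: "i \<in> {1..m} \<inter> S"
  shows "hval m k S = hval m k (S - {i}) - kF (q_int (2 * k) / of_int k) * zF i powi k"
proof -
  have 1: "{1..m} - (S - {i}) = insert i ({1..m} - S)" "i \<notin> {1..m} - S"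
    and 2: "{1..m} \<inter> S = insert i ({1..m} \<inter> (S - {i}))" "i \<notin> {1..m} \<inter> (S - {i})" using i by auto
  have "kF (q_int (2 * k) / of_int k) = kF (q_int k / of_int k) * (qF powi k + qF powi (- k))"
    unfolding q_int_double qF_def kF_powi[symmetric] kF_hom(3)[symmetric] kF_mult[symmetric]
    by (simp add: mult.commute)
  then show ?thesis
    unfolding hval_def 1(1) by (subst 2(1)) (use 1(2) 2(2) in \<open>simp add: algebra_simps\<close>)
qed

lemma hval_insert: "i \<in> {1..m} - S \<Longrightarrow> hval m k (insert i S) = hval m k S - kF (q_int (2 * k) / of_int k) * zF i powi k"
  using hval_remove[of i m "insert i S" k] by (simp add: insert_Diff_if)

lemma sum_pairs_antisym:
  fixes G :: "'i \<Rightarrow> 'i \<Rightarrow> 'a::field_char_0"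
  assumes "finite A" "\<And>i j. i \<in> A \<Longrightarrow> j \<in> A \<Longrightarrow> i \<noteq> j \<Longrightarrow> G i j + G j i = 0"
  shows "(\<Sum>i\<in>A. \<Sum>j\<in>A - {i}. G i j) = 0"
proof -
  let ?S = "\<Sum>i\<in>A. \<Sum>j\<in>A - {i}. G i j"
  have e: "?S = (\<Sum>i\<in>A. \<Sum>j\<in>A. if i = j then 0 else G i j)"
    using assms(1) by (intro sum.cong refl sum.mono_neutral_cong_left) auto
  have "?S = (\<Sum>i\<in>A. \<Sum>j\<in>A. if j = i then 0 else G j i)"
    unfolding e by (rule sum.swap)
  then have "?S + ?S = (\<Sum>i\<in>A. \<Sum>j\<in>A. (if i = j then 0 else G i j) + (if j = i then 0 else G j i))"
    unfolding sum.distrib using e by simp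
  also have "\<dots> = 0" using assms(2) by (intro sum.neutral ballI) auto
  finally show ?thesis by simp
qed

lemma xminus_xminus:
  "gact m (GX Minus k) (gact m (GX Minus l) v) S
    = (\<Sum>i\<in>{1..m} \<inter> S. \<Sum>j\<in>({1..m} \<inter> S) - {i}. zF i powi k * zF j powi l
        * (cminus m i (S - {i}) * cminus m j (S - {i} - {j}) * v (S - {i} - {j})))"
proof -
  have "{1..m} \<inter> (S - {i}) = ({1..m} \<inter> S) - {i}" for i by blast
  then show ?thesis by (simp add: sum_distrib_left mult_ac)
qed

lemma xplus_xplus:
  "gact m (GX Plus k) (gact m (GX Plus l) v) S
    = (\<Sum>i\<in>{1..m} - S. \<Sum>j\<in>({1..m} - S) - {i}. zF i powi k * zF j powi l
        * (cplus m i (insert i S) * cplus m j (insert j (insert i S)) * v (insert j (insert i S))))"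
proof -
  have "{1..m} - insert i S = ({1..m} - S) - {i}" for i by blast
  then show ?thesis by (simp add: sum_distrib_left mult_ac)
qed

lemma cminus_pair:
  assumes "i \<in> {1..m} \<inter> S" "j \<in> {1..m} \<inter> S" "i \<noteq> j"
  shows "cminus m i (S - {i}) * cminus m j (S - {i} - {j})
    = AF i j * (cminus m i (S - {i, j}) * cminus m j (S - {i, j}))"
proof -
  have "{1..m} \<inter> (S - {i}) = insert j ({1..m} \<inter> (S - {i, j}))" using assms by auto
  then have "cminus m i (S - {i}) = AF i j * cminus m i (S - {i, j})"
    by (simp add: cminus_def)
  moreover have "S - {i} - {j} = S - {i, j}" by auto
  ultimately show ?thesis by simp
qed

lemma cplus_pair:
  assumes "i \<in> {1..m} - S" "j \<in> {1..m} - S" "i \<noteq> j"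
  shows "cplus m i (insert i S) * cplus m j (insert j (insert i S))
    = AF j i * (cplus m i (insert i (insert j S)) * cplus m j (insert i (insert j S)))"
proof -
  have "{1..m} - insert i S = insert j ({1..m} - insert i (insert j S))" using assms by auto
  then have "cplus m i (insert i S) = AF j i * cplus m i (insert i (insert j S))"
    by (simp add: cplus_def)
  moreover have "insert j (insert i S) = insert i (insert j S)" by auto
  ultimately show ?thesis by simp
qed

text \<open>With \<open>y = z\<^sub>i\<close> and \<open>z = z\<^sub>j\<close>, the quadratic relation reduces to an identity in which \<open>k, l\<close>
  enter only through a common factor.\<close>

lemma quadratic_relation:
  fixes a b y z t :: "'a::field" and k l :: int
  assumes "(y - t * z) * a = (t * y - z) * b" "y \<noteq> 0" "z \<noteq> 0"
  shows "(y powi (k + 1) * z powi l - t * (y powi l * z powi (k + 1))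
      - (t * (y powi k * z powi (l + 1)) - y powi (l + 1) * z powi k)) * a
    + (z powi (k + 1) * y powi l - t * (z powi l * y powi (k + 1))
      - (t * (z powi k * y powi (l + 1)) - z powi (l + 1) * y powi k)) * b = 0" (is "?L = 0")
proof -
  have "?L = y powi k * z powi l * ((y - t * z) * a - (t * y - z) * b)
       + y powi l * z powi k * ((y - t * z) * a - (t * y - z) * b)"
    using assms(2,3) by (simp add: power_int_add algebra_simps)
  then show ?thesis using assms(1) by simp
qed

text \<open>Both signs give a sum over ordered pairs of distinct indices in which the terms for
  \<open>(i, j)\<close> and \<open>(j, i)\<close> cancel by
  \<open>quadratic_relation\<close>.\<close>

lemma x_x_act:
  "fact_act m ((x_f e (k + 1) * x_f e l - scal_f (qK powi (2 * pm_sign e)) * x_f e l * x_f e (k + 1))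
      - (scal_f (qK powi (2 * pm_sign e)) * x_f e k * x_f e (l + 1) - x_f e (l + 1) * x_f e k)) v = (\<lambda>S. 0)"
proof (rule ext)
  fix S
  show "fact_act m ((x_f e (k + 1) * x_f e l - scal_f (qK powi (2 * pm_sign e)) * x_f e l * x_f e (k + 1))
      - (scal_f (qK powi (2 * pm_sign e)) * x_f e k * x_f e (l + 1) - x_f e (l + 1) * x_f e k)) v S = 0"
  proof (cases e)
    case Minus
    let ?t = "qF powi (- 2)"
    define G where "G i j = (zF i powi (k + 1) * zF j powi l - ?t * (zF i powi l * zF j powi (k + 1))
      - (?t * (zF i powi k * zF j powi (l + 1)) - zF i powi (l + 1) * zF j powi k))
      * (cminus m i (S - {i}) * cminus m j (S - {i} - {j}) * v (S - {i} - {j}))" for i j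
    have "G i j + G j i = 0" if "i \<in> {1..m} \<inter> S" "j \<in> {1..m} \<inter> S" "i \<noteq> j" for i j
    proof -
      have s: "S - {i} - {j} = S - {i, j}" "S - {j} - {i} = S - {i, j}" "S - {j, i} = S - {i, j}" by auto
      define P where "P = cminus m i (S - {i, j}) * cminus m j (S - {i, j}) * v (S - {i, j})"
      have "cminus m i (S - {i}) * cminus m j (S - {i} - {j}) * v (S - {i} - {j}) = AF i j * P"
        "cminus m j (S - {j}) * cminus m i (S - {j} - {i}) * v (S - {j} - {i}) = AF j i * P"
        unfolding cminus_pair[OF that] cminus_pair[OF that(2,1) that(3)[symmetric]]
        by (simp_all only: s P_def mult_ac)
      then show ?thesis
        using quadratic_relation[OF AF_ratio[OF that(3)] zF_nonzero zF_nonzero, of k l]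
        unfolding G_def by (simp only: mult.assoc[symmetric] distrib_right[symmetric] mult_zero_left)
    qed
    then have "(\<Sum>i\<in>{1..m} \<inter> S. \<Sum>j\<in>({1..m} \<inter> S) - {i}. G i j) = 0"
      by (intro sum_pairs_antisym) auto
    then show ?thesis
      using Minus
      by (simp add: fact_act_simps vscale_def xminus_xminus G_def kF_powi qF_def[symmetric]
          left_diff_distrib sum_subtractf sum_distrib_left mult.assoc del: gact.simps)
  next
    case Plus
    let ?t = "qF powi 2"
    define G where "G i j = (zF i powi (k + 1) * zF j powi l - ?t * (zF i powi l * zF j powi (k + 1))
      - (?t * (zF i powi k * zF j powi (l + 1)) - zF i powi (l + 1) * zF j powi k))
      * (cplus m i (insert i S) * cplus m j (insert j (insert i S)) * v (insert j (insert i S)))" for i j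
    have "G i j + G j i = 0" if "i \<in> {1..m} - S" "j \<in> {1..m} - S" "i \<noteq> j" for i j
    proof -
      have s: "insert j (insert i S) = insert i (insert j S)" by auto
      define P where "P = cplus m i (insert i (insert j S)) * cplus m j (insert i (insert j S)) * v (insert i (insert j S))"
      have P: "cplus m i (insert i S) * cplus m j (insert j (insert i S)) * v (insert j (insert i S)) = AF j i * P"
        "cplus m j (insert j S) * cplus m i (insert i (insert j S)) * v (insert i (insert j S)) = AF i j * P"
        unfolding cplus_pair[OF that] cplus_pair[OF that(2,1) that(3)[symmetric]]
        by (simp_all only: s P_def mult_ac)
      \<comment> \<open>\<open>AF_ratio\<close> times \<open>q^2\<close> is the ratio required for
        \<open>x+\<close>, where the indices of \<open>AF\<close> are exchanged.\<close>
      have "qF powi 2 * qF powi (- 2) = 1" by (simp add: power_int_minus)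
      then have "(zF i - ?t * zF j) * AF j i = (?t * zF i - zF j) * AF i j"
        using arg_cong[OF AF_ratio[OF that(3)], of "\<lambda>x. qF powi 2 * x"]
        by (simp only: mult.assoc[symmetric] right_diff_distrib) simp
      from quadratic_relation[OF this zF_nonzero zF_nonzero, of k l] show ?thesis
        unfolding G_def P by (simp only: mult.assoc[symmetric] distrib_right[symmetric] mult_zero_left)
    qed
    then have "(\<Sum>i\<in>{1..m} - S. \<Sum>j\<in>({1..m} - S) - {i}. G i j) = 0"
      by (intro sum_pairs_antisym) auto
    then show ?thesis
      using Plus
      by (simp add: fact_act_simps vscale_def xplus_xplus G_def kF_powi kF_power qF_def[symmetric]
          left_diff_distrib sum_subtractf sum_distrib_left mult.assoc del: gact.simps)
  qed
qed

lemma h_x_act: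
  assumes "k \<noteq> 0"
  shows "fact_act m (h_f k * x_f e l - x_f e l * h_f k
      - scal_f (of_int (pm_sign e) * (1 / of_int k) * q_int (2 * k)) * x_f e (k + l)) v = (\<lambda>S. 0)"
proof (rule ext)
  fix S
  have c: "kF (of_int (pm_sign e) * (1 / of_int k) * q_int (2 * k)) = of_int (pm_sign e) * kF (q_int (2 * k) / of_int k)"
    by (simp add: kF_of_int kF_divide)
  show "fact_act m (h_f k * x_f e l - x_f e l * h_f k
      - scal_f (of_int (pm_sign e) * (1 / of_int k) * q_int (2 * k)) * x_f e (k + l)) v S = 0"
  proof (cases e)
    case Minus
    have "hval m k S * (zF i powi l * cminus m i (S - {i}) * v (S - {i}))
        - zF i powi l * cminus m i (S - {i}) * (hval m k (S - {i}) * v (S - {i}))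
        + kF (q_int (2 * k) / of_int k) * (zF i powi (k + l) * cminus m i (S - {i}) * v (S - {i})) = 0"
      if "i \<in> {1..m} \<inter> S" for i
      unfolding hval_remove[OF that] by (simp add: power_int_add algebra_simps)
    then have "(\<Sum>i\<in>{1..m} \<inter> S. hval m k S * (zF i powi l * cminus m i (S - {i}) * v (S - {i}))
        - zF i powi l * cminus m i (S - {i}) * (hval m k (S - {i}) * v (S - {i}))
        + kF (q_int (2 * k) / of_int k) * (zF i powi (k + l) * cminus m i (S - {i}) * v (S - {i}))) = 0"
      by (rule sum.neutral[OF ballI])
    then show ?thesis
      unfolding fact_act_simps vscale_def c
      by (simp add: Minus sum.distrib sum_subtractf sum_distrib_left sum_negf eq_neg_iff_add_eq_0)
  next
    case Plus
    have "hval m k S * (zF i powi l * cplus m i (insert i S) * v (insert i S))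
        - zF i powi l * cplus m i (insert i S) * (hval m k (insert i S) * v (insert i S))
        - kF (q_int (2 * k) / of_int k) * (zF i powi (k + l) * cplus m i (insert i S) * v (insert i S)) = 0"
      if "i \<in> {1..m} - S" for i
      unfolding hval_insert[OF that] by (simp add: power_int_add algebra_simps)
    then have "(\<Sum>i\<in>{1..m} - S. hval m k S * (zF i powi l * cplus m i (insert i S) * v (insert i S))
        - zF i powi l * cplus m i (insert i S) * (hval m k (insert i S) * v (insert i S))
        - kF (q_int (2 * k) / of_int k) * (zF i powi (k + l) * cplus m i (insert i S) * v (insert i S))) = 0"
      by (rule sum.neutral[OF ballI])
    then show ?thesis
      unfolding fact_act_simps vscale_def c
      by (simp add: Plus sum.distrib sum_subtractf sum_distrib_left)
  qed
qed

lemma K_x_act: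
  "fact_act m (K_f Plus * x_f e k * K_f Minus - scal_f (qK powi (2 * pm_sign e)) * x_f e k) v = (\<lambda>S. 0)"
proof (rule ext)
  fix S
  show "fact_act m (K_f Plus * x_f e k * K_f Minus - scal_f (qK powi (2 * pm_sign e)) * x_f e k) v S = 0"
  proof (cases e)
    case Minus
    have "qF powi Kval m S * (zF i powi k * cminus m i (S - {i}) * (qF powi (- Kval m (S - {i})) * v (S - {i})))
        - qF powi (- 2) * (zF i powi k * cminus m i (S - {i}) * v (S - {i})) = 0" if "i \<in> {1..m} \<inter> S" for i
    proof -
      have "qF powi Kval m S * qF powi (- Kval m (S - {i})) = qF powi (- 2)"
        unfolding Kval_remove[OF that] by (simp flip: power_int_add)
      then show ?thesis by (simp add: mult_ac)
    qed
    then have "(\<Sum>i\<in>{1..m} \<inter> S. qF powi Kval m S * (zF i powi k * cminus m i (S - {i}) * (qF powi (- Kval m (S - {i})) * v (S - {i})))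
        - qF powi (- 2) * (zF i powi k * cminus m i (S - {i}) * v (S - {i}))) = 0"
      by (rule sum.neutral[OF ballI])
    then show ?thesis
      by (simp add: Minus fact_act_simps vscale_def kF_powi qF_def[symmetric] sum_subtractf sum_distrib_left)
  next
    case Plus
    have "qF powi Kval m S * (zF i powi k * cplus m i (insert i S) * (qF powi (- Kval m (insert i S)) * v (insert i S)))
        - qF powi 2 * (zF i powi k * cplus m i (insert i S) * v (insert i S)) = 0" if "i \<in> {1..m} - S" for i
    proof -
      have "qF powi Kval m S * qF powi (- Kval m (insert i S)) = qF powi 2"
        unfolding Kval_insert[OF that] by (simp flip: power_int_add)
      then show ?thesis by (simp add: mult_ac)
    qed
    then have "(\<Sum>i\<in>{1..m} - S. qF powi Kval m S * (zF i powi k * cplus m i (insert i S) * (qF powi (- Kval m (insert i S)) * v (insert i S)))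
        - qF powi 2 * (zF i powi k * cplus m i (insert i S) * v (insert i S))) = 0"
      by (rule sum.neutral[OF ballI])
    then show ?thesis
      by (simp add: Plus fact_act_simps vscale_def kF_powi kF_power qF_def[symmetric] sum_subtractf sum_distrib_left)
  qed
qed


subsection \<open>The eigenvalues of the \<open>\<psi>\<^sub>r\<close>\<close>

text \<open>The factor of the eigenvalue of \<psi> at \<open>j\<close> is
  \<open>(\<alpha> - \<beta> z_j u) / (1 - z_j u)\<close>; adding \<open>j\<close> to
  \<open>S\<close> exchanges \<open>q\<close> and \<open>q^(-1)\<close>.\<close>

definition \<alpha>F :: "nat set \<Rightarrow> nat \<Rightarrow> lfrac" where
  "\<alpha>F S j = (if j \<in> S then inverse qF else qF)"

definition \<beta>F :: "nat set \<Rightarrow> nat \<Rightarrow> lfrac" where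
  "\<beta>F S j = inverse (\<alpha>F S j)"

lemma \<alpha>F_nonzero [simp]: "\<alpha>F S j \<noteq> 0" "\<beta>F S j \<noteq> 0"
  by (simp_all add: \<alpha>F_def \<beta>F_def)

text \<open>The operators are diagonal in the basis of subsets, with eigenvalue series
  \<open>g S\<close>. Products and exponentials can then be computed on eigenvalues.\<close>

definition diag_fps :: "nat \<Rightarrow> falg fps \<Rightarrow> (nat set \<Rightarrow> lfrac fps) \<Rightarrow> bool" where
  "diag_fps m f g \<longleftrightarrow> (\<forall>n v S. fact_act m (fps_nth f n) v S = fps_nth (g S) n * v S)"

lemma diag_fps_mult: "diag_fps m f g \<Longrightarrow> diag_fps m f' g' \<Longrightarrow> diag_fps m (f * f') (\<lambda>S. g S * g' S)"
  by (simp add: diag_fps_def fps_mult_nth fact_act_sum fact_act_mult sum_distrib_right mult.assoc)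

lemma diag_fps_power: "diag_fps m f g \<Longrightarrow> diag_fps m (f ^ i) (\<lambda>S. g S ^ i)"
proof (induction i)
  case 0
  show ?case by (simp add: diag_fps_def fact_act_1 fact_act_0)
qed (simp add: diag_fps_mult)

lemma diag_fps_alg_exp:
  assumes "diag_fps m f g"
  shows "diag_fps m (alg_exp scal_f f) (\<lambda>S. alg_exp kF (g S))"
  unfolding diag_fps_def
proof (intro allI)
  fix n v S
  have p: "fact_act m (fps_nth (f ^ i) n) v S = fps_nth (g S ^ i) n * v S" for i
    using diag_fps_power[OF assms, of i] by (simp add: diag_fps_def)
  show "fact_act m (fps_nth (alg_exp scal_f f) n) v S = fps_nth (alg_exp kF (g S)) n * v S"
    by (simp add: alg_exp_def fact_act_sum fact_act_mult fact_act_scal vscale_def p sum_distrib_right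
        mult.assoc del: of_nat_fact)
qed

definition psi_log :: "nat \<Rightarrow> pm \<Rightarrow> nat set \<Rightarrow> lfrac fps" where
  "psi_log m e S = fps_const (kF (of_int (pm_sign e) * (qK - inverse qK)))
     * Abs_fps (\<lambda>s. if s = 0 then 0 else hval m (pm_sign e * int s) S)"

definition psi_val :: "nat \<Rightarrow> pm \<Rightarrow> nat set \<Rightarrow> lfrac fps" where
  "psi_val m e S = fps_const (qF powi (pm_sign e * Kval m S)) * alg_exp kF (psi_log m e S)"

lemma diag_psi: "diag_fps m (psi_series e) (psi_val m e)"
proof -
  have K: "diag_fps m (fps_const (K_f e)) (\<lambda>S. fps_const (qF powi (pm_sign e * Kval m S)))"
    by (auto simp: diag_fps_def fact_act_gen fact_act_0)
  have c: "diag_fps m (fps_const (scal_f c)) (\<lambda>S. fps_const (kF c))" for c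
    by (auto simp: diag_fps_def fact_act_scal fact_act_0 vscale_def)
  have h: "diag_fps m (Abs_fps (\<lambda>s. if s = 0 then 0 else h_f (pm_sign e * int s)))
      (\<lambda>S. Abs_fps (\<lambda>s. if s = 0 then 0 else hval m (pm_sign e * int s) S))"
    by (auto simp: diag_fps_def fact_act_gen fact_act_0)
  show ?thesis
    unfolding psi_series_def psi_val_def psi_log_def
    by (intro diag_fps_mult diag_fps_alg_exp K c h)
qed

lemma alg_exp_log_deriv:
  fixes g :: "lfrac fps"
  assumes "fps_nth g 0 = 0"
  shows "has_log_deriv (alg_exp kF g) (\<lambda>i. of_nat i * fps_nth g i)"
  unfolding has_log_deriv_iff
  by (intro allI alg_exp_recursion assms) (simp_all add: mult.commute kF_of_nat)

lemma fps_nth_0_prod: "fps_nth (prod f A) 0 = (\<Prod>i\<in>A. fps_nth (f i :: lfrac fps) 0)"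
  by (induction A rule: infinite_finite_induct) simp_all

text \<open>Both sides have the same constant term and, since \<open>(q - q^(-1)) [i]\<close> is
  \<open>q^i - q^(-i)\<close>, the same logarithmic derivative. For \<open>Minus\<close> the series
  variable is \<open>u^(-1)\<close>, which inverts \<open>z_j\<close> and exchanges \<alpha> and
  \<beta>.\<close>

lemma psi_val_product:
  fixes m e S
  defines "Z \<equiv> \<lambda>j. if e = Plus then zF j else inverse (zF j)"
    and "a \<equiv> \<lambda>j. if e = Plus then \<alpha>F S j else \<beta>F S j"
    and "b \<equiv> \<lambda>j. if e = Plus then \<beta>F S j else \<alpha>F S j"
  shows "psi_val m e S = (\<Prod>j=1..m. (fps_const (a j) - fps_const (b j * Z j) * fps_X) * geo_fps (Z j))"
    (is "_ = ?P")
proof -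
  have a0: "a j \<noteq> 0" for j by (simp add: a_def)
  have P: "has_log_deriv ?P (\<lambda>i. \<Sum>j=1..m. Z j ^ i * (1 - (b j / a j) ^ i))"
    by (intro has_log_deriv_prod has_log_deriv_factor a0) simp
  have "fps_nth (psi_log m e S) 0 = 0" by (simp add: psi_log_def)
  then have L: "has_log_deriv (psi_val m e S) (\<lambda>i. 0 + of_nat i * fps_nth (psi_log m e S) i)"
    unfolding psi_val_def by (intro has_log_deriv_mult has_log_deriv_const alg_exp_log_deriv)
  let ?A = "{1..m} - S" and ?B = "{1..m} \<inter> S"
  have split: "(\<Sum>j=1..m. h j) = (\<Sum>j\<in>?A. h j) + (\<Sum>j\<in>?B. h j)" for h :: "nat \<Rightarrow> lfrac"
    by (subst sum.union_disjoint[symmetric]) (auto intro: sum.cong)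
  have eq: "0 + of_nat i * fps_nth (psi_log m e S) i = (\<Sum>j=1..m. Z j ^ i * (1 - (b j / a j) ^ i))"
    if i: "i \<ge> 1" for i
  proof -
    have i0: "of_nat i \<noteq> (0 :: K)" using i by simp
    have "(qK - inverse qK) * (q_int (int i) / of_nat i) * of_nat i = qK ^ i - inverse qK ^ i"
      using i0 qK_neq_inverse by (simp add: q_int_def power_int_minus power_inverse)
    then have "kF ((qK - inverse qK) * (q_int (int i) / of_nat i) * of_nat i) = kF (qK ^ i - inverse qK ^ i)"
      by simp
    then have q: "kF (qK - inverse qK) * kF (q_int (int i) / of_nat i) * of_nat i = qF ^ i - inverse qF ^ i"
      by (simp only: kF_mult kF_of_nat kF_hom(5) kF_power kF_inverse qF_def)
    show ?thesis
    proof (cases e)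
      case Plus
      have "of_nat i * fps_nth (psi_log m e S) i
          = of_nat i * (kF (qK - inverse qK) * (kF (q_int (int i) / of_nat i)
            * ((\<Sum>j\<in>?A. inverse qF ^ i * zF j ^ i) - (\<Sum>j\<in>?B. qF ^ i * zF j ^ i))))"
        using i Plus by (simp add: psi_log_def hval_def power_int_minus power_inverse)
      also have "\<dots> = (kF (qK - inverse qK) * kF (q_int (int i) / of_nat i) * of_nat i)
          * ((\<Sum>j\<in>?A. inverse qF ^ i * zF j ^ i) - (\<Sum>j\<in>?B. qF ^ i * zF j ^ i))"
        by (simp only: mult_ac)
      also note q
      also have "(qF ^ i - inverse qF ^ i) * ((\<Sum>j\<in>?A. inverse qF ^ i * zF j ^ i) - (\<Sum>j\<in>?B. qF ^ i * zF j ^ i))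
          = (\<Sum>j\<in>?A. zF j ^ i * (1 - (inverse qF * inverse qF) ^ i)) + (\<Sum>j\<in>?B. zF j ^ i * (1 - (qF * qF) ^ i))"
      proof -
        have qq: "qF ^ i * inverse qF ^ i = 1" by (simp flip: power_mult_distrib)
        have gen: "(a - b) * (b * x) = x * (a * b - b * b)" "(a - b) * - (a * x) = x * (a * b - a * a)"
          for a b x :: lfrac by (simp_all add: algebra_simps)
        have f: "(qF ^ i - inverse qF ^ i) * (inverse qF ^ i * x) = x * (1 - (inverse qF * inverse qF) ^ i)"
          "(qF ^ i - inverse qF ^ i) * - (qF ^ i * x) = x * (1 - (qF * qF) ^ i)" for x
          unfolding gen by (simp_all only: qq power_mult_distrib)
        show ?thesis
          unfolding diff_conv_add_uminus[of "sum _ ?A"] sum_negf[symmetric] distrib_left[of "qF ^ i - _"] sum_distrib_left f ..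
      qed
      also have "\<dots> = (\<Sum>j=1..m. Z j ^ i * (1 - (b j / a j) ^ i))"
        unfolding split using Plus
        by (intro arg_cong2[where f = "(+)"] sum.cong)
          (auto simp: Z_def a_def b_def \<alpha>F_def \<beta>F_def divide_inverse)
      finally show ?thesis by simp
    next
      case Minus
      have "of_nat i * fps_nth (psi_log m e S) i
          = of_nat i * (- kF (qK - inverse qK) * (kF (q_int (int i) / of_nat i)
            * ((\<Sum>j\<in>?A. qF ^ i * inverse (zF j) ^ i) - (\<Sum>j\<in>?B. inverse qF ^ i * inverse (zF j) ^ i))))"
        using i Minus by (simp add: psi_log_def hval_def power_int_minus power_inverse q_int_minus)
      also have "\<dots> = (kF (qK - inverse qK) * kF (q_int (int i) / of_nat i) * of_nat i)
          * ((\<Sum>j\<in>?B. inverse qF ^ i * inverse (zF j) ^ i) - (\<Sum>j\<in>?A. qF ^ i * inverse (zF j) ^ i))"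
        by (simp only: minus_diff_eq[of "sum _ ?A" "sum _ ?B", symmetric] mult_minus_left mult_minus_right mult_ac)
      also note q
      also have "(qF ^ i - inverse qF ^ i) * ((\<Sum>j\<in>?B. inverse qF ^ i * inverse (zF j) ^ i) - (\<Sum>j\<in>?A. qF ^ i * inverse (zF j) ^ i))
          = (\<Sum>j\<in>?B. inverse (zF j) ^ i * (1 - (inverse qF * inverse qF) ^ i)) + (\<Sum>j\<in>?A. inverse (zF j) ^ i * (1 - (qF * qF) ^ i))"
      proof -
        have qq: "qF ^ i * inverse qF ^ i = 1" by (simp flip: power_mult_distrib)
        have gen: "(a - b) * (b * x) = x * (a * b - b * b)" "(a - b) * - (a * x) = x * (a * b - a * a)"
          for a b x :: lfrac by (simp_all add: algebra_simps)
        have f: "(qF ^ i - inverse qF ^ i) * (inverse qF ^ i * x) = x * (1 - (inverse qF * inverse qF) ^ i)"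
          "(qF ^ i - inverse qF ^ i) * - (qF ^ i * x) = x * (1 - (qF * qF) ^ i)" for x
          unfolding gen by (simp_all only: qq power_mult_distrib)
        show ?thesis
          unfolding diff_conv_add_uminus[of "sum _ ?B"] sum_negf[symmetric] distrib_left[of "qF ^ i - _"] sum_distrib_left f ..
      qed
      also have "\<dots> = (\<Sum>j\<in>?A. inverse (zF j) ^ i * (1 - (qF * qF) ^ i)) + (\<Sum>j\<in>?B. inverse (zF j) ^ i * (1 - (inverse qF * inverse qF) ^ i))"
        by (rule add.commute)
      also have "\<dots> = (\<Sum>j=1..m. Z j ^ i * (1 - (b j / a j) ^ i))"
        unfolding split using Minus
        by (intro arg_cong2[where f = "(+)"] sum.cong)
          (auto simp: Z_def a_def b_def \<alpha>F_def \<beta>F_def divide_inverse)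
      finally show ?thesis by simp
    qed
  qed
  have P0: "fps_nth ?P 0 = qF powi (pm_sign e * Kval m S)"
  proof -
    have "fps_nth ?P 0 = (\<Prod>j=1..m. a j)"
      by (simp add: fps_nth_0_prod geo_fps_def)
    also have "\<dots> = (\<Prod>j\<in>?A. a j) * (\<Prod>j\<in>?B. a j)"
      by (subst prod.union_disjoint[symmetric]) (auto intro: prod.cong)
    also have "\<dots> = (qF powi pm_sign e) ^ card ?A * (inverse (qF powi pm_sign e)) ^ card ?B"
    proof -
      have "(\<Prod>j\<in>?A. a j) = (\<Prod>j\<in>?A. qF powi pm_sign e)" "(\<Prod>j\<in>?B. a j) = (\<Prod>j\<in>?B. inverse (qF powi pm_sign e))"
        by (cases e; auto simp: a_def \<alpha>F_def \<beta>F_def intro!: prod.cong)+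
      then show ?thesis by simp
    qed
    also have "\<dots> = qF powi (pm_sign e * Kval m S)"
    proof -
    have "card ?A + card ?B = m"
      by (subst card_Un_disjoint[symmetric]) (auto intro!: arg_cong[where f = card] simp: Un_Diff_Int)
    then have K: "int (card ?A) - int (card ?B) = Kval m S" by (simp add: Kval_def)
    have "(qF powi pm_sign e) ^ card ?A * (inverse (qF powi pm_sign e)) ^ card ?B
        = (qF powi pm_sign e) powi int (card ?A) / (qF powi pm_sign e) powi int (card ?B)"
      by (simp add: divide_inverse power_inverse)
    also have "\<dots> = (qF powi pm_sign e) powi (int (card ?A) - int (card ?B))"
      by (rule power_int_diff[symmetric]) simp
    also have "\<dots> = qF powi (pm_sign e * Kval m S)"
      unfolding K by (rule power_int_mult[symmetric])
    finally show ?thesis .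
    qed
    finally show ?thesis .
  qed
  have A0: "fps_nth (psi_val m e S) 0 = qF powi (pm_sign e * Kval m S)"
    by (simp add: psi_val_def)
  show ?thesis
  proof (rule fps_ext)
    fix n
    show "fps_nth (psi_val m e S) n = fps_nth ?P n"
      using has_log_deriv_unique[OF L P eq, of n] unfolding P0 A0 by simp
  qed
qed

definition \<rho>F :: "nat \<Rightarrow> nat set \<Rightarrow> nat \<Rightarrow> lfrac" where
  "\<rho>F m S i = pf_residue zF (\<alpha>F S) (\<beta>F S) {1..m} i"

text \<open>The two series expand one rational function of \<open>u\<close> at 0 and at infinity, so
  their difference consists of the contributions of the poles.\<close>

lemma psi_val_difference:
  "coeff_int (psi_val m Plus S) k - coeff_int (psi_val m Minus S) (- k) = (\<Sum>i=1..m. \<rho>F m S i * zF i powi k)"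
proof -
  have inj: "inj_on zF {1..m}" using zF_inj by (rule inj_on_subset) simp
  have inj': "inj_on (\<lambda>j. inverse (zF j)) {1..m}"
    using zF_inj by (intro inj_onI) (simp add: inj_eq)
  have psiP: "psi_val m Plus S
      = (\<Prod>j=1..m. (fps_const (\<alpha>F S j) - fps_const (\<beta>F S j * zF j) * fps_X) * geo_fps (zF j))"
    using psi_val_product[of m Plus S] by (simp only: simp_thms if_True)
  have psiM: "psi_val m Minus S
      = (\<Prod>j=1..m. (fps_const (\<beta>F S j) - fps_const (\<alpha>F S j * inverse (zF j)) * fps_X) * geo_fps (inverse (zF j)))"
    using psi_val_product[of m Minus S] by (simp only: pm.distinct if_False)
  have plus: "fps_nth (psi_val m Plus S) n = (if n = 0 then (\<Prod>j=1..m. \<beta>F S j) else 0) + (\<Sum>i=1..m. \<rho>F m S i * zF i ^ n)" for n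
    unfolding psiP \<rho>F_def by (rule partial_fractions_fps[OF finite_atLeastAtMost inj])
  have res: "pf_residue (\<lambda>j. inverse (zF j)) (\<beta>F S) (\<alpha>F S) {1..m} i = - \<rho>F m S i" for i
  proof -
    have "(\<Prod>j\<in>{1..m} - {i}. (\<beta>F S j * inverse (zF i) - \<alpha>F S j * inverse (zF j)) / (inverse (zF i) - inverse (zF j)))
        = (\<Prod>j\<in>{1..m} - {i}. (\<alpha>F S j * zF i - \<beta>F S j * zF j) / (zF i - zF j))"
    proof (rule prod.cong[OF refl])
      fix j assume "j \<in> {1..m} - {i}"
      then have "zF i - zF j \<noteq> 0" "zF j - zF i \<noteq> 0" using zF_inj by (auto simp: inj_def)
      then show "(\<beta>F S j * inverse (zF i) - \<alpha>F S j * inverse (zF j)) / (inverse (zF i) - inverse (zF j))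
          = (\<alpha>F S j * zF i - \<beta>F S j * zF j) / (zF i - zF j)"
        by (simp add: divide_simps) (simp add: algebra_simps)
    qed
    then show ?thesis by (simp add: pf_residue_def \<rho>F_def algebra_simps)
  qed
  have minus: "fps_nth (psi_val m Minus S) n = (if n = 0 then (\<Prod>j=1..m. \<alpha>F S j) else 0) - (\<Sum>i=1..m. \<rho>F m S i * inverse (zF i) ^ n)" for n
    unfolding psiM partial_fractions_fps[OF finite_atLeastAtMost inj'] res by (simp add: sum_negf)
  \<comment> \<open>At \<open>k = 0\<close> both series contribute; in this form the constant term
    cancels against the product in the \<open>Minus\<close> series.\<close>
  have zero: "fps_nth (psi_val m Plus S) 0 = (\<Prod>j=1..m. \<alpha>F S j)"
    unfolding psiP by (simp add: fps_nth_0_prod geo_fps_def)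
  consider "k < 0" | "k = 0" | "k > 0" by linarith
  then show ?thesis
  proof cases
    case 1
    then show ?thesis by (simp add: coeff_int_def minus power_int_def power_inverse)
  next
    case 2
    then show ?thesis using zero by (simp add: coeff_int_def minus)
  next
    case 3
    then show ?thesis by (simp add: coeff_int_def plus power_int_def)
  qed
qed

lemma psi_act: "fact_act m (psi_f e k) v S = coeff_int (psi_val m e S) (pm_sign e * k) * v S"
  using diag_psi[of m e] by (auto simp: psi_f_def coeff_int_def diag_fps_def fact_act_0)

text \<open>Each of the \<open>m - 1\<close> factors in the residue is \<open>q\<close> times
  \<open>AF i j\<close> or \<open>AF j i\<close>, according to whether \<open>j\<close> lies in
  \<open>S\<close>. The two groups are \<open>cminus\<close> and \<open>cplus\<close>.\<close>

lemma residue_formula: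
  assumes i: "i \<in> {1..m}"
  shows "\<rho>F m S i = (\<alpha>F S i - \<beta>F S i) * (cminus m i (S - {i}) * cplus m i (insert i S))"
proof -
  have f: "(\<alpha>F S j * zF i - \<beta>F S j * zF j) / (zF i - zF j) = qF * (if j \<in> S then AF i j else AF j i)"
    if "j \<noteq> i" for j
  proof -
    have nz: "zF i - zF j \<noteq> 0" "zF j - zF i \<noteq> 0" using that zF_inj by (auto simp: inj_def)
    then show ?thesis
      by (simp add: \<alpha>F_def \<beta>F_def AF_def power_int_minus power2_eq_square divide_simps) (simp add: algebra_simps)
  qed
  have "{1..m} - {i} = ({1..m} \<inter> (S - {i})) \<union> ({1..m} - insert i S)" by auto
  then have "(\<Prod>j\<in>{1..m} - {i}. if j \<in> S then AF i j else AF j i)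
      = (\<Prod>j\<in>{1..m} \<inter> (S - {i}). if j \<in> S then AF i j else AF j i)
        * (\<Prod>j\<in>{1..m} - insert i S. if j \<in> S then AF i j else AF j i)"
    by (simp only:) (rule prod.union_disjoint, auto)
  also have "\<dots> = (\<Prod>j\<in>{1..m} \<inter> (S - {i}). AF i j) * (\<Prod>j\<in>{1..m} - insert i S. AF j i)"
    by (intro arg_cong2[where f = "(*)"] prod.cong) auto
  finally have p: "(\<Prod>j\<in>{1..m} - {i}. if j \<in> S then AF i j else AF j i)
      = (\<Prod>j\<in>{1..m} \<inter> (S - {i}). AF i j) * (\<Prod>j\<in>{1..m} - insert i S. AF j i)" .
  have "(\<Prod>j\<in>{1..m} - {i}. (\<alpha>F S j * zF i - \<beta>F S j * zF j) / (zF i - zF j))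
      = (\<Prod>j\<in>{1..m} - {i}. qF * (if j \<in> S then AF i j else AF j i))"
    by (rule prod.cong[OF refl]) (use f in auto)
  also have "\<dots> = qF ^ (m - 1) * (\<Prod>j\<in>{1..m} - {i}. if j \<in> S then AF i j else AF j i)"
    unfolding prod.distrib using i by (simp add: card_Diff_singleton)
  finally show ?thesis
    unfolding p \<rho>F_def pf_residue_def cminus_def cplus_def by (simp add: mult_ac)
qed

text \<open>The terms that add \<open>j\<close> to and remove \<open>i\<close> from a basis set
  agree in both orders: the presence of \<open>i\<close> in \<open>cminus\<close> and the absence of
  \<open>j\<close> in \<open>cplus\<close> cost the same factor \<open>AF j i\<close>. The terms
  returning to the same set add up to the difference of the \<psi> through its residues.\<close>

lemma xp_xm_act:
  "fact_act m ((x_f Plus k * x_f Minus l - x_f Minus l * x_f Plus k)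
      - scal_f (1 / (qK - inverse qK)) * (psi_f Plus (k + l) - psi_f Minus (k + l))) v = (\<lambda>S. 0)"
proof (rule ext)
  fix S
  let ?A = "{1..m} - S" and ?B = "{1..m} \<inter> S"
  define Q where "Q i = cminus m i (S - {i}) * cplus m i (insert i S)" for i
  define off where "off i j = zF i powi k * zF j powi l * (cplus m i (insert i S) * cminus m j (insert i S - {j}) * v (insert i S - {j}))" for i j
  have pm: "gact m (GX Plus k) (gact m (GX Minus l) v) S
      = (\<Sum>i\<in>?A. zF i powi (k + l) * Q i * v S) + (\<Sum>i\<in>?A. \<Sum>j\<in>?B. off i j)"
    unfolding sum.distrib[symmetric] gact.simps
  proof (rule sum.cong[OF refl])
    fix i assume i: "i \<in> ?A"
    then have "{1..m} \<inter> insert i S = insert i ?B" "i \<notin> ?B" "insert i S - {i} = S" "S - {i} = S" by auto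
    then show "zF i powi k * cplus m i (insert i S)
        * (\<Sum>j\<in>{1..m} \<inter> insert i S. zF j powi l * cminus m j (insert i S - {j}) * v (insert i S - {j}))
      = zF i powi (k + l) * Q i * v S + (\<Sum>j\<in>?B. off i j)"
      by (simp add: Q_def off_def power_int_add distrib_left sum_distrib_left mult_ac)
  qed
  have mp: "gact m (GX Minus l) (gact m (GX Plus k) v) S
      = (\<Sum>j\<in>?B. zF j powi (k + l) * Q j * v S) + (\<Sum>j\<in>?B. \<Sum>i\<in>?A. off i j)"
    unfolding sum.distrib[symmetric] gact.simps
  proof (rule sum.cong[OF refl])
    fix j assume j: "j \<in> ?B"
    then have 1: "{1..m} - (S - {j}) = insert j ?A" "j \<notin> ?A" "insert j (S - {j}) = S" "insert j S = S" by auto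
    have 2: "zF j powi l * cminus m j (S - {j}) * (zF i powi k * cplus m i (insert i (S - {j})) * v (insert i (S - {j})))
        = off i j" if i: "i \<in> ?A" for i
    proof -
      have s: "insert i (S - {j}) = insert i S - {j}" using i j by auto
      have "{1..m} - (insert i S - {j}) = insert j ({1..m} - insert i S)" using i j by auto
      then have c1: "cplus m i (insert i S - {j}) = AF j i * cplus m i (insert i S)"
        using i j by (simp add: cplus_def)
      have "{1..m} \<inter> (insert i S - {j}) = insert i ({1..m} \<inter> (S - {j}))" using i j by auto
      then have c2: "cminus m j (insert i S - {j}) = AF j i * cminus m j (S - {j})"
        using i j by (simp add: cminus_def)
      show ?thesis unfolding off_def s c1 c2 by (simp add: mult_ac)
    qed
    have s: "(\<Sum>i\<in>?A. zF j powi l * cminus m j (S - {j})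
        * (zF i powi k * cplus m i (insert i (S - {j})) * v (insert i (S - {j})))) = (\<Sum>i\<in>?A. off i j)"
      by (intro sum.cong refl 2)
    show "zF j powi l * cminus m j (S - {j})
        * (\<Sum>i\<in>{1..m} - (S - {j}). zF i powi k * cplus m i (insert i (S - {j})) * v (insert i (S - {j})))
      = zF j powi (k + l) * Q j * v S + (\<Sum>i\<in>?A. off i j)"
      unfolding 1(1) sum.insert[OF finite_Diff[OF finite_atLeastAtMost] 1(2)] distrib_left sum_distrib_left s
      by (simp add: 1(3,4) Q_def power_int_add mult_ac)
  qed
  have \<delta>: "qF - inverse qF \<noteq> 0"
    using qK_neq_inverse by (simp add: qF_def flip: kF_inverse kF_hom(5))
  have "(\<Sum>i=1..m. \<rho>F m S i * zF i powi (k + l)) = (\<Sum>i\<in>?A. \<rho>F m S i * zF i powi (k + l)) + (\<Sum>i\<in>?B. \<rho>F m S i * zF i powi (k + l))"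
    by (subst sum.union_disjoint[symmetric]) (auto intro: sum.cong)
  also have "(\<Sum>i\<in>?A. \<rho>F m S i * zF i powi (k + l)) = (qF - inverse qF) * (\<Sum>i\<in>?A. zF i powi (k + l) * Q i)"
    unfolding sum_distrib_left by (intro sum.cong) (auto simp: residue_formula Q_def \<alpha>F_def \<beta>F_def)
  also have "(\<Sum>i\<in>?B. \<rho>F m S i * zF i powi (k + l)) = - ((qF - inverse qF) * (\<Sum>i\<in>?B. zF i powi (k + l) * Q i))"
    unfolding sum_distrib_left sum_negf[symmetric]
    by (intro sum.cong) (auto simp: residue_formula Q_def \<alpha>F_def \<beta>F_def algebra_simps)
  finally have psi: "coeff_int (psi_val m Plus S) (k + l) - coeff_int (psi_val m Minus S) (- (k + l))
      = (qF - inverse qF) * ((\<Sum>i\<in>?A. zF i powi (k + l) * Q i) - (\<Sum>i\<in>?B. zF i powi (k + l) * Q i))"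
    unfolding psi_val_difference by (simp add: right_diff_distrib)
  have "kF (1 / (qK - inverse qK)) = inverse (qF - inverse qF)"
    by (simp add: kF_divide kF_inverse qF_def divide_inverse)
  then have "kF (1 / (qK - inverse qK)) * ((coeff_int (psi_val m Plus S) (k + l) - coeff_int (psi_val m Minus S) (- (k + l))) * v S)
      = ((\<Sum>i\<in>?A. zF i powi (k + l) * Q i) - (\<Sum>i\<in>?B. zF i powi (k + l) * Q i)) * v S"
    unfolding psi using \<delta> by (simp add: mult.assoc[symmetric])
  moreover have "(\<Sum>i\<in>?A. \<Sum>j\<in>?B. off i j) = (\<Sum>j\<in>?B. \<Sum>i\<in>?A. off i j)"
    by (rule sum.swap)
  ultimately show "fact_act m ((x_f Plus k * x_f Minus l - x_f Minus l * x_f Plus k)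
      - scal_f (1 / (qK - inverse qK)) * (psi_f Plus (k + l) - psi_f Minus (k + l))) v S = 0"
    unfolding fact_act_diff fact_act_mult fact_act_gen pm mp fact_act_scal vscale_def psi_act
    by (simp add: left_diff_distrib sum_distrib_right)
qed

subsection \<open>The action of \<open>U\<^sub>q\<close> and the highest weight vector\<close>

lemma Uq_rels_act:
  assumes "p \<in> Uq_rels"
  shows "fact_act m p v = (\<lambda>S. 0)"
  using assms
proof cases
  case K_inv
  show ?thesis unfolding K_inv by (rule ext) (simp add: fact_act_simps power_int_minus)
next
  case inv_K
  show ?thesis unfolding inv_K by (rule ext) (simp add: fact_act_simps power_int_minus)
next
  case (K_h r)
  show ?thesis unfolding K_h by (rule ext) (simp add: fact_act_simps)
next
  case (K_x e r)
  show ?thesis unfolding K_x by (rule K_x_act)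
next
  case (h_h r s)
  show ?thesis unfolding h_h by (rule ext) (simp add: fact_act_simps)
next
  case (h_x r e s)
  show ?thesis unfolding h_x(1) by (rule h_x_act[OF h_x(2)])
next
  case (x_x e r s)
  show ?thesis unfolding x_x by (rule x_x_act)
next
  case (xp_xm r s)
  show ?thesis unfolding xp_xm by (rule xp_xm_act)
next
  case h_0
  show ?thesis unfolding h_0 by (rule ext) (simp add: fact_act_gen hval_def)
qed

lemma Uq_ideal_act: "p \<in> Uq_ideal \<Longrightarrow> fact_act m p v = (\<lambda>S. 0)"
proof -
  have "Uq_ideal \<subseteq> {p. \<forall>v. fact_act m p v = (\<lambda>S. 0)}"
    unfolding Uq_ideal_def
  proof (rule hull_minimal)
    show "Uq_rels \<subseteq> {p. \<forall>v. fact_act m p v = (\<lambda>S. 0)}" using Uq_rels_act by blast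
    show "two_sided_ideal {p. \<forall>v. fact_act m p v = (\<lambda>S. 0)}"
      by (auto simp: two_sided_ideal_def left_ideal_def fact_act_0 fact_act_add fact_act_mult vadd_def
          vlinearD(3)[OF fact_act_linear])
  qed
  then show "p \<in> Uq_ideal \<Longrightarrow> fact_act m p v = (\<lambda>S. 0)" by blast
qed

lift_definition uact :: "nat \<Rightarrow> uq \<Rightarrow> vec \<Rightarrow> vec" is fact_act
proof (intro ext)
  fix m p p' v S
  assume "Uq_cong p p'"
  then have "fact_act m (p - p') v = (\<lambda>S. 0)"
    unfolding Uq_cong_def by (rule Uq_ideal_act)
  then have "fact_act m (p - p') v S = 0" by simp
  then show "fact_act m p v S = fact_act m p' v S"
    by (simp add: fact_act_diff)
qed

lemma uact_simps:
  "uact m 0 v = (\<lambda>S. 0)" "uact m 1 v = v" "uact m (a + b) v = vadd (uact m a v) (uact m b v)"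
  "uact m (a * b) v = uact m a (uact m b v)" "uact m (a - b) v S = uact m a v S - uact m b v S"
  "uact m (scal c) v = vscale (kF c) v" "uact m (- a) v = vscale (- 1) (uact m a v)"
  unfolding scal_def
  by (transfer; simp add: fact_act_0 fact_act_simps fact_act_uminus)+

lemma uact_gens:
  "uact m (x_el e k) v = gact m (GX e k) v" "uact m (h_el k) v = gact m (GH k) v"
  "uact m (K_el e) v = gact m (GK e) v"
  unfolding x_el_def h_el_def K_el_def by (transfer; simp add: fact_act_gen)+

lemma uact_linear: "vlinear (uact m a)"
  by (transfer fixing: m) (rule fact_act_linear)

lemmas uact_lin = vlinearD[OF uact_linear]

lemma uact_sum: "uact m (sum f A) v S = (\<Sum>i\<in>A. uact m (f i) v S)"
  by (induction A rule: infinite_finite_induct) (simp_all add: uact_simps vadd_def)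

lemma vscale_simps [simp]:
  "vscale a (vscale b v) = vscale (a * b) v" "vscale a (\<lambda>S. 0) = (\<lambda>S. 0)"
  "vadd (vscale a v) (vscale b v) = vscale (a + b) v"
  by (simp_all add: vscale_def vadd_def fun_eq_iff mult.assoc distrib_right)

definition vac :: vec where
  "vac = (\<lambda>S. if S = {} then 1 else 0)"

lemma uact_alg_exp:
  assumes f: "\<And>n. uact m (fps_nth f n) v = vscale (fps_nth g n) v"
  shows "uact m (fps_nth (alg_exp scal f) n) v = vscale (fps_nth (alg_exp kF g) n) v"
proof -
  have p: "uact m (fps_nth (f ^ i) n) v = vscale (fps_nth (g ^ i) n) v" for i n
  proof (induction i arbitrary: n)
    case 0
    show ?case by (cases n) (simp_all add: uact_simps vscale_def)
  next
    case (Suc i)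
    show ?case
      by (rule ext, simp add: fps_mult_nth uact_sum uact_simps Suc uact_lin f)
        (simp add: vscale_def sum_distrib_left sum_distrib_right mult_ac)
  qed
  show ?thesis
    by (rule ext)
      (simp add: alg_exp_def uact_sum uact_simps p vscale_def sum_distrib_left sum_distrib_right mult_ac
        del: of_nat_fact)
qed

lemma hval_empty: "hval m k {} = toF (cst (q_int k / of_int k) * psum m k)"
proof -
  have "qF powi (- k) * zF i powi k = tF i powi k" for i
    by (simp add: zF_def power_int_mult_distrib mult.assoc[symmetric] flip: power_int_add)
  then show ?thesis
    by (simp add: hval_def psum_def toF_sum toF_var kF_def[symmetric])
qed

lemma h_vac: "uact m (h_el k) vac = vscale (hval m k {}) vac"
  by (auto simp: uact_gens vac_def vscale_def fun_eq_iff)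

definition Lambda_val :: "nat \<Rightarrow> int \<Rightarrow> laurent" where
  "Lambda_val m r = (- 1) ^ nat \<bar>r\<bar> * esym (if r \<ge> 0 then 1 else - 1) m (nat \<bar>r\<bar>)"

lemma esym_fps:
  "fps_nth (\<Prod>j=1..m. 1 - fps_const (tF j powi s) * fps_X) n = toF ((- 1) ^ n * esym s m n)"
proof -
  have "(\<Prod>j=1..m. 1 - fps_const (tF j powi s) * fps_X) = (\<Prod>j=1..m. 1 + fps_const (- (tF j powi s)) * fps_X)"
    by (intro prod.cong refl) (simp flip: fps_const_neg)
  then have "fps_nth (\<Prod>j=1..m. 1 - fps_const (tF j powi s) * fps_X) n
      = (\<Sum>S | S \<subseteq> {1..m} \<and> card S = n. \<Prod>j\<in>S. - (tF j powi s))"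
    by (simp only: prod_one_plus_fps_nth[OF finite_atLeastAtMost])
  also have "\<dots> = (\<Sum>S | S \<subseteq> {1..m} \<and> card S = n. (- 1) ^ n * (\<Prod>j\<in>S. tF j powi s))"
  proof (rule sum.cong[OF refl])
    fix S assume "S \<in> {S. S \<subseteq> {1..m} \<and> card S = n}"
    then have n: "card S = n" by simp
    have "(\<Prod>j\<in>S. - (tF j powi s)) = (\<Prod>j\<in>S. - 1 * (tF j powi s))" by simp
    also have "\<dots> = (- 1) ^ n * (\<Prod>j\<in>S. tF j powi s)"
      unfolding prod.distrib prod_constant n ..
    finally show "(\<Prod>j\<in>S. - (tF j powi s)) = (- 1) ^ n * (\<Prod>j\<in>S. tF j powi s)" .
  qed
  also have "\<dots> = toF ((- 1) ^ n * esym s m n)"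
    by (simp add: toF_power esym_def toF_sum toF_prod toF_var sum_distrib_left)
  finally show ?thesis .
qed

text \<open>In the logarithmic derivative the \<open>1/[k]\<close> from the definition of
  \<open>Lambda\<close> cancels the \<open>[k]/k\<close> in the eigenvalue of \<open>h_k\<close>.
  What remains is minus a power sum, as for the product of the \<open>1 - t_j X\<close>, with
  inverted variables when \<open>r < 0\<close>.\<close>

lemma Lambda_vac: "uact m (Lambda r) vac = vscale (toF (Lambda_val m r)) vac"
proof -
  have main: "uact m (fps_nth (Lambda_series e) n) vac = vscale (toF ((- 1) ^ n * esym (pm_sign e) m n)) vac" for e n
  proof -
    define g where "g = Abs_fps (\<lambda>k. if k = 0 then 0 else - (kF (1 / q_int (int k)) * hval m (pm_sign e * int k) {}))"
    have "uact m (fps_nth (- Abs_fps (\<lambda>k. if k = 0 then 0 else scal (1 / q_int (int k)) * h_el (pm_sign e * int k))) n) vac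
        = vscale (fps_nth g n) vac" for n
      by (rule ext) (auto simp: g_def uact_simps h_vac vscale_def)
    then have 1: "uact m (fps_nth (Lambda_series e) n) vac = vscale (fps_nth (alg_exp kF g) n) vac"
      unfolding Lambda_series_def by (rule uact_alg_exp)
    have L: "has_log_deriv (alg_exp kF g) (\<lambda>i. of_nat i * fps_nth g i)"
      by (rule alg_exp_log_deriv) (simp add: g_def)
    have P: "has_log_deriv (\<Prod>j=1..m. 1 - fps_const (tF j powi pm_sign e) * fps_X)
        (\<lambda>i. \<Sum>j=1..m. - ((tF j powi pm_sign e) ^ i))"
      by (intro has_log_deriv_prod has_log_deriv_linear) simp
    have eq: "of_nat i * fps_nth g i = (\<Sum>j=1..m. - ((tF j powi pm_sign e) ^ i))" if "i \<ge> 1" for i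
    proof -
      have i: "of_nat i \<noteq> (0 :: K)" "q_int (int i) \<noteq> 0" using that by (simp_all add: q_int_nonzero)
      have c: "of_nat i * (1 / q_int (int i)) * (q_int (pm_sign e * int i) / of_int (pm_sign e * int i)) = 1"
        using i by (cases e) (simp_all add: q_int_minus)
      have "of_nat i * fps_nth g i = - (kF (of_nat i * (1 / q_int (int i)) * (q_int (pm_sign e * int i) / of_int (pm_sign e * int i)))
          * toF (psum m (pm_sign e * int i)))"
        using that unfolding kF_mult kF_of_nat by (simp add: g_def hval_empty flip: kF_def)
      also have "\<dots> = - toF (psum m (pm_sign e * int i))" unfolding c by simp
      also have "\<dots> = (\<Sum>j=1..m. - ((tF j powi pm_sign e) ^ i))"
        by (simp add: psum_def toF_sum toF_var sum_negf power_int_mult)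
      finally show ?thesis .
    qed
    have "fps_nth (alg_exp kF g) n = fps_nth (\<Prod>j=1..m. 1 - fps_const (tF j powi pm_sign e) * fps_X) n"
      using has_log_deriv_unique[OF L P eq, of n] by (simp add: fps_nth_0_prod)
    then show ?thesis unfolding 1 by (simp only: esym_fps)
  qed
  show ?thesis
    using main[of Plus "nat r"] main[of Minus "nat (- r)"] by (auto simp: Lambda_def Lambda_val_def)
qed

lemma Lambda_val_gt: "\<bar>r\<bar> > int m \<Longrightarrow> Lambda_val m r = 0"
  by (simp add: Lambda_val_def esym_gt)

lemma Lambda_val_mult:
  assumes "1 \<le> r" "r \<le> int m"
  shows "Lambda_val m (int m) * Lambda_val m (- r) = Lambda_val m (int m - r)"
proof -
  define k where "k = nat r"
  have k: "r = int k" "k \<le> m" "k \<ge> 1" using assms by (auto simp: k_def)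
  have "Lambda_val m (int m) * Lambda_val m (- r) = (- 1) ^ m * (- 1) ^ k * (epow m 1 * esym (- 1) m k)"
    using k by (simp add: Lambda_val_def epow_esym mult_ac)
  also have "(- 1 :: laurent) ^ m * (- 1) ^ k = (- 1) ^ (m - k)"
    using k by (simp add: power_add[symmetric] minus_one_power_iff)
  finally show ?thesis using k by (simp add: esym_complement Lambda_val_def nat_diff_distrib of_nat_diff[symmetric] del: of_nat_diff)
qed

text \<open>The values are symmetric because \<open>h_k\<close> acts on \<open>vac\<close> by a
  multiple of a power sum.\<close>

lemma U0_vac:
  assumes "u \<in> U0"
  shows "\<exists>f\<in>sym_laurent m. uact m u vac = vscale (toF f) vac"
proof -
  let ?S = "{u. \<exists>f\<in>sym_laurent m. uact m u vac = vscale (toF f) vac}"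
  have "Uq_subalgebra ?S"
    unfolding Uq_subalgebra_def
  proof (intro conjI ballI)
    show "range scal \<subseteq> ?S"
      by (auto simp: uact_simps kF_def intro: bexI[OF _ sym_laurent_cst])
    fix a b assume "a \<in> ?S" "b \<in> ?S"
    then obtain f g where fg: "f \<in> sym_laurent m" "uact m a vac = vscale (toF f) vac"
      "g \<in> sym_laurent m" "uact m b vac = vscale (toF g) vac" by blast
    have "uact m (a + b) vac = vscale (toF (f + g)) vac"
      by (simp add: uact_simps fg)
    then show "a + b \<in> ?S" using sym_laurent_add[OF fg(1,3)] by blast
    have "uact m (a * b) vac = vscale (toF (f * g)) vac"
      by (simp add: uact_simps fg uact_lin mult.commute)
    then show "a * b \<in> ?S" using sym_laurent_mult[OF fg(1,3)] by blast
  qed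
  then have "U0 \<subseteq> ?S"
  proof (rule U0_minimal)
    fix r :: int
    have "uact m (h_el r) vac = vscale (toF (cst (q_int r / of_int r) * psum m r)) vac"
      by (simp only: h_vac hval_empty)
    then show "h_el r \<in> ?S" using sym_laurent_mult[OF sym_laurent_cst psum_in_sym] by blast
  qed
  then show ?thesis using assms by blast
qed

lemma vscale_vac_inject: "vscale a vac = vscale b vac \<longleftrightarrow> a = b"
  by (auto simp: vscale_def vac_def fun_eq_iff)

definition hw_char :: "nat \<Rightarrow> uq \<Rightarrow> laurent" where
  "hw_char m u = (THE f. uact m u vac = vscale (toF f) vac)"

lemma hw_char_eqI: "uact m u vac = vscale (toF f) vac \<Longrightarrow> hw_char m u = f"
  unfolding hw_char_def by (rule the_equality) (auto simp: vscale_vac_inject)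

lemma hw_char:
  assumes "u \<in> U0"
  shows "hw_char m u \<in> sym_laurent m" "uact m u vac = vscale (toF (hw_char m u)) vac"
proof -
  obtain f where f: "f \<in> sym_laurent m" "uact m u vac = vscale (toF f) vac"
    using U0_vac[OF assms] by blast
  then have "hw_char m u = f" by (intro hw_char_eqI)
  then show "hw_char m u \<in> sym_laurent m" "uact m u vac = vscale (toF (hw_char m u)) vac"
    using f by simp_all
qed

lemma hw_char_hom:
  "hw_char m (scal c) = cst c" "a \<in> U0 \<Longrightarrow> b \<in> U0 \<Longrightarrow> hw_char m (a + b) = hw_char m a + hw_char m b"
  "a \<in> U0 \<Longrightarrow> b \<in> U0 \<Longrightarrow> hw_char m (a * b) = hw_char m a * hw_char m b"
  "hw_char m (Lambda r) = Lambda_val m r"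
proof -
  show "hw_char m (scal c) = cst c" by (intro hw_char_eqI) (simp add: uact_simps kF_def)
  show "a \<in> U0 \<Longrightarrow> b \<in> U0 \<Longrightarrow> hw_char m (a + b) = hw_char m a + hw_char m b"
    by (intro hw_char_eqI) (simp add: uact_simps hw_char(2))
  show "a \<in> U0 \<Longrightarrow> b \<in> U0 \<Longrightarrow> hw_char m (a * b) = hw_char m a * hw_char m b"
    by (intro hw_char_eqI) (simp add: uact_simps hw_char(2) uact_lin mult.commute)
  show "hw_char m (Lambda r) = Lambda_val m r" by (intro hw_char_eqI Lambda_vac)
qed

subsection \<open>The left ideal annihilates the highest weight vector\<close>

lemma Lambda_val_sum:
  "(\<Sum>n\<le>m. toF (Lambda_val m (int n)) * w ^ n) = (\<Prod>j=1..m. 1 - tF j * w)"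
proof -
  have "(\<Prod>j=1..m. - (tF j * w) + 1) = (\<Sum>S\<in>Pow {1..m}. \<Prod>j\<in>S. - (tF j * w))"
    by (subst prod_add) simp_all
  also have "\<dots> = (\<Sum>n\<le>m. \<Sum>S\<in>{S \<in> Pow {1..m}. card S = n}. \<Prod>j\<in>S. - (tF j * w))"
    by (rule sum.group[symmetric]) (auto dest!: card_mono[OF finite_atLeastAtMost])
  also have "\<dots> = (\<Sum>n\<le>m. toF (Lambda_val m (int n)) * w ^ n)"
  proof (intro sum.cong refl)
    fix n
    have "(\<Prod>j\<in>S. - (tF j * w)) = (\<Prod>j\<in>S. - (tF j powi 1)) * w ^ card S" for S
      by (simp add: prod.distrib[symmetric] flip: prod_constant)
    then have "(\<Sum>S\<in>{S \<in> Pow {1..m}. card S = n}. \<Prod>j\<in>S. - (tF j * w))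
        = (\<Sum>S\<in>{S \<in> Pow {1..m}. card S = n}. \<Prod>j\<in>S. - (tF j powi 1)) * w ^ n"
      by (simp add: sum_distrib_right)
    also have "(\<Sum>S\<in>{S \<in> Pow {1..m}. card S = n}. \<Prod>j\<in>S. - (tF j powi 1))
        = fps_nth (\<Prod>j=1..m. 1 + fps_const (- (tF j powi 1)) * fps_X) n"
      by (simp only: prod_one_plus_fps_nth[OF finite_atLeastAtMost] Pow_iff)
    also have "(\<Prod>j=1..m. 1 + fps_const (- (tF j powi 1)) * fps_X) = (\<Prod>j=1..m. 1 - fps_const (tF j powi 1) * fps_X)"
      by (intro prod.cong refl) (simp flip: fps_const_neg)
    also have "fps_nth \<dots> n = toF (Lambda_val m (int n))"
      unfolding esym_fps by (simp add: Lambda_val_def)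
    finally show "(\<Sum>S\<in>{S \<in> Pow {1..m}. card S = n}. \<Prod>j\<in>S. - (tF j * w)) = toF (Lambda_val m (int n)) * w ^ n" .
  qed
  finally show ?thesis by (simp add: add.commute)
qed

text \<open>The sum over \<open>n\<close> evaluates the polynomial with coefficients
  \<open>Lambda_val m n\<close> at \<open>1/t_i\<close>, one of its roots. It is the scaling by
  \<open>q^n\<close> that turns \<open>z_i^(-n)\<close> into \<open>t_i^(-n)\<close>.\<close>

lemma Xtilde_vac: "uact m (Xtilde_coeff m r) vac = (\<lambda>S. 0)"
proof (rule ext)
  fix S
  have "uact m (x_el Minus (r - 1 - int n) * fps_nth Lambda_scaled n) vac S
      = (\<Sum>i\<in>{1..m} \<inter> S. (zF i powi (r - 1) * (cminus m i (S - {i}) * vac (S - {i})))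
        * (toF (Lambda_val m (int n)) * (inverse (tF i)) ^ n))" for n
  proof -
    have "qF ^ n * zF i powi (r - 1 - int n) = zF i powi (r - 1) * (inverse (tF i)) ^ n" for i
    proof -
      have "zF i powi (r - 1 - int n) = zF i powi (r - 1) / zF i ^ n"
        by (simp add: power_int_diff)
      moreover have "zF i ^ n = qF ^ n * tF i ^ n" by (simp add: zF_def power_mult_distrib)
      ultimately show ?thesis by (simp add: field_simps)
    qed
    then have z: "(qF ^ n * (toF (Lambda_val m (int n)) * (zF i powi (r - 1 - int n) * X)))
        = zF i powi (r - 1) * X * (toF (Lambda_val m (int n)) * (inverse (tF i)) ^ n)" for i X
      by (metis (no_types, opaque_lifting) mult.assoc mult.commute)
    have "uact m (x_el Minus (r - 1 - int n) * fps_nth Lambda_scaled n) vac S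
      = qF ^ n * (toF (Lambda_val m (int n)) * gact m (GX Minus (r - 1 - int n)) vac S)"
      by (simp add: Lambda_scaled_def uact_simps Lambda_vac uact_lin kF_power qF_def[symmetric] del: gact.simps)
        (simp add: uact_gens vscale_def mult.assoc del: gact.simps)
    also have "\<dots> = (\<Sum>i\<in>{1..m} \<inter> S. qF ^ n * (toF (Lambda_val m (int n)) * (zF i powi (r - 1 - int n) * (cminus m i (S - {i}) * vac (S - {i})))))"
      by (simp add: sum_distrib_left mult.assoc)
    finally show ?thesis unfolding z .
  qed
  then have "uact m (Xtilde_coeff m r) vac S = (\<Sum>n\<le>m. \<Sum>i\<in>{1..m} \<inter> S. (zF i powi (r - 1) * (cminus m i (S - {i}) * vac (S - {i})))
        * (toF (Lambda_val m (int n)) * (inverse (tF i)) ^ n))"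
    by (simp only: Xtilde_coeff_def uact_sum)
  also have "\<dots> = (\<Sum>i\<in>{1..m} \<inter> S. (zF i powi (r - 1) * (cminus m i (S - {i}) * vac (S - {i})))
        * (\<Prod>j=1..m. 1 - tF j * inverse (tF i)))"
    by (subst sum.swap) (simp only: sum_distrib_left[symmetric] Lambda_val_sum)
  also have "\<dots> = 0"
  proof (intro sum.neutral ballI)
    fix i assume "i \<in> {1..m} \<inter> S"
    then have "(\<Prod>j=1..m. 1 - tF j * inverse (tF i)) = 0"
      by (intro prod_zero bexI[of _ i]) auto
    then show "(zF i powi (r - 1) * (cminus m i (S - {i}) * vac (S - {i}))) * (\<Prod>j=1..m. 1 - tF j * inverse (tF i)) = 0"
      by simp
  qed
  finally show "uact m (Xtilde_coeff m r) vac S = 0" .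
qed

section \<open>Powers of \<open>X_0^-\<close> on the highest weight vector\<close>

definition act_fps :: "nat \<Rightarrow> uq fps \<Rightarrow> nat set \<Rightarrow> lfrac fps" where
  "act_fps m f S = Abs_fps (\<lambda>n. uact m (fps_nth f n) vac S)"

lemma act_fps_X0_mult:
  "act_fps m (X0_series * f) S
    = (\<Sum>i\<in>{1..m} \<inter> S. fps_const (cminus m i (S - {i})) * (fps_X * geo_fps (zF i)) * act_fps m f (S - {i}))"
proof (rule fps_ext)
  fix n
  have X: "uact m (fps_nth X0_series k) v S
      = (\<Sum>i\<in>{1..m} \<inter> S. cminus m i (S - {i}) * fps_nth (fps_X * geo_fps (zF i)) k * v (S - {i}))" for k v
  proof (cases k)
    case (Suc k')
    then show ?thesis by (simp add: X0_series_def uact_gens geo_fps_def mult_ac)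
  qed (simp add: X0_series_def uact_simps)
  have "fps_nth (act_fps m (X0_series * f) S) n
      = (\<Sum>k=0..n. \<Sum>i\<in>{1..m} \<inter> S. cminus m i (S - {i}) * fps_nth (fps_X * geo_fps (zF i)) k
          * uact m (fps_nth f (n - k)) vac (S - {i}))"
    by (simp only: act_fps_def fps_nth_Abs_fps fps_mult_nth[of X0_series] uact_sum uact_simps(4) X)
  also have "\<dots> = (\<Sum>i\<in>{1..m} \<inter> S. cminus m i (S - {i})
      * (\<Sum>k=0..n. fps_nth (fps_X * geo_fps (zF i)) k * fps_nth (act_fps m f (S - {i})) (n - k)))"
    by (subst sum.swap) (simp only: sum_distrib_left mult.assoc act_fps_def fps_nth_Abs_fps)
  also have "\<dots> = fps_nth (\<Sum>i\<in>{1..m} \<inter> S. fps_const (cminus m i (S - {i})) * (fps_X * geo_fps (zF i)) * act_fps m f (S - {i})) n"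
    by (simp only: fps_sum_nth mult.assoc[of "fps_const _"] fps_mult_left_const_nth fps_mult_nth[of "fps_X * geo_fps _"])
  finally show "fps_nth (act_fps m (X0_series * f) S) n = \<dots>" .
qed

text \<open>Only the poles matter for the relations, so the scalar is left implicit. It can be
  nonzero only at sets obtained from the empty set by adding \<open>r\<close> elements of
  \<open>{1..m}\<close>.\<close>

lemma act_fps_X0_power:
  "\<exists>\<kappa>. act_fps m (X0_series ^ r) S = fps_const \<kappa> * (fps_X ^ r * (\<Prod>i\<in>S. geo_fps (zF i)))
     \<and> (\<kappa> \<noteq> 0 \<longrightarrow> S \<subseteq> {1..m} \<and> card S = r)"
proof (induction r arbitrary: S)
  case 0
  have "act_fps m (X0_series ^ 0) S = fps_const (vac S)"
    by (rule fps_ext) (simp add: act_fps_def uact_simps)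
  then show ?case
    by (intro exI[of _ "vac S"]) (auto simp: vac_def)
next
  case (Suc r)
  have "\<forall>i. \<exists>\<kappa>. act_fps m (X0_series ^ r) (S - {i}) = fps_const \<kappa> * (fps_X ^ r * (\<Prod>i\<in>S - {i}. geo_fps (zF i)))
     \<and> (\<kappa> \<noteq> 0 \<longrightarrow> S - {i} \<subseteq> {1..m} \<and> card (S - {i}) = r)"
    using Suc by blast
  then obtain \<kappa> where \<kappa>: "\<And>i. act_fps m (X0_series ^ r) (S - {i}) = fps_const (\<kappa> i) * (fps_X ^ r * (\<Prod>i\<in>S - {i}. geo_fps (zF i)))"
    "\<And>i. \<kappa> i \<noteq> 0 \<Longrightarrow> S - {i} \<subseteq> {1..m} \<and> card (S - {i}) = r"
    by metis
  have t: "fps_const (cminus m i (S - {i})) * (fps_X * geo_fps (zF i)) * act_fps m (X0_series ^ r) (S - {i})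
      = fps_const (cminus m i (S - {i}) * \<kappa> i) * (fps_X ^ Suc r * (\<Prod>i\<in>S. geo_fps (zF i)))"
    if i: "i \<in> {1..m} \<inter> S" for i
  proof (cases "\<kappa> i = 0")
    case True
    then show ?thesis by (simp add: \<kappa>(1))
  next
    case False
    then have "finite S" using \<kappa>(2)[of i] by (metis finite_Diff2 finite_atLeastAtMost finite_insert finite.emptyI finite_subset)
    then have p: "(\<Prod>i\<in>S. geo_fps (zF i)) = geo_fps (zF i) * (\<Prod>i\<in>S - {i}. geo_fps (zF i))"
      using i by (intro prod.remove) auto
    show ?thesis unfolding \<kappa>(1) p by (simp add: mult_ac flip: fps_const_mult)
  qed
  let ?k = "\<Sum>i\<in>{1..m} \<inter> S. cminus m i (S - {i}) * \<kappa> i"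
  have "act_fps m (X0_series ^ Suc r) S = (\<Sum>i\<in>{1..m} \<inter> S. fps_const (cminus m i (S - {i}) * \<kappa> i) * (fps_X ^ Suc r * (\<Prod>i\<in>S. geo_fps (zF i))))"
    unfolding power_Suc[of X0_series] act_fps_X0_mult by (intro sum.cong refl t)
  also have "\<dots> = fps_const ?k * (fps_X ^ Suc r * (\<Prod>i\<in>S. geo_fps (zF i)))"
  proof -
    have "(\<Sum>i\<in>A. fps_const (h i)) = fps_const (sum h A)" for h :: "nat \<Rightarrow> lfrac" and A
      by (induction A rule: infinite_finite_induct) simp_all
    then show ?thesis unfolding sum_distrib_right[symmetric] by simp
  qed
  finally have "act_fps m (X0_series ^ Suc r) S = fps_const ?k * (fps_X ^ Suc r * (\<Prod>i\<in>S. geo_fps (zF i)))" .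
  moreover have "S \<subseteq> {1..m} \<and> card S = Suc r" if "?k \<noteq> 0"
  proof -
    obtain i where i: "i \<in> {1..m} \<inter> S" "cminus m i (S - {i}) * \<kappa> i \<noteq> 0"
      using \<open>?k \<noteq> 0\<close> by (meson sum.not_neutral_contains_not_neutral)
    then have "S - {i} \<subseteq> {1..m}" "card (S - {i}) = r" using \<kappa>(2)[of i] by auto
    moreover have "finite S" using \<open>S - {i} \<subseteq> {1..m}\<close> by (metis finite_Diff2 finite_atLeastAtMost finite_insert finite.emptyI finite_subset)
    ultimately show ?thesis using i(1) card_Suc_Diff1[of S i] by auto
  qed
  ultimately show ?case by blast
qed

text \<open>\<open>Lambda^+(qu)\<close> acts by the product of all \<open>1 - z_j u\<close>. This
  cancels the \<open>r\<close> poles and leaves a polynomial of degree at most \<open>m - r\<close>;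
  with the factor \<open>u^r\<close> no degree above \<open>m\<close> remains.\<close>

lemma X0_Lambda_vac:
  assumes "s > m"
  shows "uact m (fps_nth (X0_series ^ r * Lambda_scaled) s) vac = (\<lambda>S. 0)"
proof (rule ext)
  fix S
  define L where "L = (\<Prod>j=1..m. 1 - fps_const (zF j) * fps_X)"
  have L: "fps_nth L n = qF ^ n * toF (Lambda_val m (int n))" for n
  proof -
    have "(\<Prod>j=1..m. 1 - fps_const (zF j) * fps_X) = (\<Prod>j=1..m. 1 + fps_const (- zF j) * fps_X)"
      by (intro prod.cong refl) (simp flip: fps_const_neg)
    then have "fps_nth L n = (\<Sum>T | T \<subseteq> {1..m} \<and> card T = n. \<Prod>j\<in>T. - zF j)"
      unfolding L_def by (simp only: prod_one_plus_fps_nth[OF finite_atLeastAtMost])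
    also have "\<dots> = (\<Sum>T | T \<subseteq> {1..m} \<and> card T = n. qF ^ n * (\<Prod>j\<in>T. - (tF j powi 1)))"
    proof (rule sum.cong[OF refl])
      fix T assume "T \<in> {T. T \<subseteq> {1..m} \<and> card T = n}"
      then have "card T = n" by simp
      moreover have "(\<Prod>j\<in>T. - zF j) = (\<Prod>j\<in>T. qF * - (tF j powi 1))" by (simp add: zF_def)
      ultimately show "(\<Prod>j\<in>T. - zF j) = qF ^ n * (\<Prod>j\<in>T. - (tF j powi 1))"
        by (simp only: prod.distrib prod_constant)
    qed
    also have "\<dots> = qF ^ n * fps_nth (\<Prod>j=1..m. 1 + fps_const (- (tF j powi 1)) * fps_X) n"
      by (simp only: prod_one_plus_fps_nth[OF finite_atLeastAtMost] sum_distrib_left)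
    also have "(\<Prod>j=1..m. 1 + fps_const (- (tF j powi 1)) * fps_X) = (\<Prod>j=1..m. 1 - fps_const (tF j powi 1) * fps_X)"
      by (intro prod.cong refl) (simp flip: fps_const_neg)
    also have "fps_nth \<dots> n = toF (Lambda_val m (int n))"
      unfolding esym_fps by (simp add: Lambda_val_def)
    finally show ?thesis .
  qed
  have "uact m (fps_nth (X0_series ^ r * Lambda_scaled) s) vac S = fps_nth (act_fps m (X0_series ^ r) S * L) s"
    unfolding fps_mult_nth uact_sum L act_fps_def fps_nth_Abs_fps
    by (intro sum.cong refl)
      (simp add: Lambda_scaled_def uact_simps Lambda_vac uact_lin kF_power qF_def[symmetric],
        simp add: vscale_def mult_ac)
  also have "\<dots> = 0"
  proof -
    obtain \<kappa> where \<kappa>: "act_fps m (X0_series ^ r) S = fps_const \<kappa> * (fps_X ^ r * (\<Prod>i\<in>S. geo_fps (zF i)))"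
      "\<kappa> \<noteq> 0 \<Longrightarrow> S \<subseteq> {1..m} \<and> card S = r"
      using act_fps_X0_power by blast
    show ?thesis
    proof (cases "\<kappa> = 0")
      case False
      then have S: "S \<subseteq> {1..m}" "card S = r" using \<kappa>(2) by auto
      have "L = (\<Prod>j\<in>{1..m} - S. 1 - fps_const (zF j) * fps_X) * (\<Prod>j\<in>S. 1 - fps_const (zF j) * fps_X)"
        unfolding L_def by (rule prod.subset_diff) (use S in auto)
      moreover have "(\<Prod>j\<in>S. 1 - fps_const (zF j) * fps_X) * (\<Prod>i\<in>S. geo_fps (zF i)) = 1"
        by (simp add: geo_fps_inverse flip: prod.distrib)
      moreover have "(\<Prod>j\<in>{1..m} - S. 1 - fps_const (zF j) * fps_X) = (\<Prod>j\<in>{1..m} - S. 1 + fps_const (- zF j) * fps_X)"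
        by (intro prod.cong refl) (simp flip: fps_const_neg)
      ultimately have "act_fps m (X0_series ^ r) S * L
          = fps_const \<kappa> * (fps_X ^ r * (\<Prod>j\<in>{1..m} - S. 1 + fps_const (- zF j) * fps_X))"
        unfolding \<kappa>(1) by (metis (no_types, lifting) mult.assoc mult.commute mult.right_neutral)
      moreover have "fps_nth (\<Prod>j\<in>{1..m} - S. 1 + fps_const (- zF j) * fps_X) (s - r) = 0"
      proof -
        have c: "card T \<le> m - r" if "T \<subseteq> {1..m} - S" for T
          using card_mono[OF _ that] S by (simp add: card_Diff_subset finite_subset)
        have "r \<le> m" using S card_mono[of "{1..m}" S] by simp
        then have lt: "m - r < s - r" using assms by simp
        have "{T. T \<subseteq> {1..m} - S \<and> card T = s - r} = {}"
        proof (rule equals0I)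
          fix T assume "T \<in> {T. T \<subseteq> {1..m} - S \<and> card T = s - r}"
          then show False using c[of T] lt by simp
        qed
        then show ?thesis
          by (simp only: prod_one_plus_fps_nth[OF finite_Diff[OF finite_atLeastAtMost]] sum.empty)
      qed
      ultimately show ?thesis by (simp add: fps_X_power_mult_nth)
    qed (simp add: \<kappa>(1))
  qed
  finally show "uact m (fps_nth (X0_series ^ r * Lambda_scaled) s) vac S = 0" .
qed

lemma Iq_vac: "a \<in> Iq m \<Longrightarrow> uact m a vac = (\<lambda>S. 0)"
proof -
  have y: "uact m (a * y) vac = (\<lambda>S. 0)" if "uact m a vac = (\<lambda>S. 0)" "y \<in> U0" for a y
    using that by (simp add: uact_simps hw_char(2) uact_lin)
  have "Iq m \<subseteq> {a. uact m a vac = (\<lambda>S. 0)}"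
    unfolding Iq_def
  proof (rule hull_minimal)
    show "left_ideal {a. uact m a vac = (\<lambda>S. 0)}"
      by (auto simp: left_ideal_def uact_simps vadd_def uact_lin)
    have 1: "uact m (xp k) vac = (\<lambda>S. 0)" for k
      by (auto simp: uact_gens vac_def fun_eq_iff)
    have 2: "uact m (K_el Plus - scal (qK ^ m)) vac = (\<lambda>S. 0)"
      by (auto simp: uact_simps uact_gens vac_def fun_eq_iff vscale_def Kval_def kF_power qF_def)
    have 3: "uact m g vac = (\<lambda>S. 0)" if "g \<in> Lambda_gens m" for g
    proof -
      have "uact m (Lambda r) vac = (\<lambda>S. 0)" if "\<bar>r\<bar> > int m" for r
        using that by (simp add: Lambda_vac Lambda_val_gt vscale_def)
      moreover have "uact m (Lambda (int m) * Lambda (- r) - Lambda (int m - r)) vac = (\<lambda>S. 0)"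
        if "1 \<le> r" "r \<le> int m" for r
      proof -
        have "uact m (Lambda (int m) * Lambda (- r)) vac = uact m (Lambda (int m - r)) vac"
          using Lambda_val_mult[OF that]
          by (simp add: uact_simps Lambda_vac uact_lin mult.commute flip: toF_hom(4))
        then show ?thesis by (simp add: fun_eq_iff uact_simps(5))
      qed
      ultimately show ?thesis using that unfolding Lambda_gens_def by blast
    qed
    have 4: "uact m (coeff_int (X0_series ^ r * Lambda_scaled) s) vac = (\<lambda>S. 0)" if "\<bar>s\<bar> > int m" for r s
      using that by (auto simp: coeff_int_def uact_simps intro!: X0_Lambda_vac)
    show "range xp \<union> {K_el Plus - scal (qK ^ m)} \<union> Lambda_gens m
      \<union> {Xtilde_coeff m r * y | r y. y \<in> U0}
      \<union> {coeff_int (X0_series ^ r * Lambda_scaled) s * y | r s y. r \<ge> 1 \<and> \<bar>s\<bar> > int m \<and> y \<in> U0}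
      \<subseteq> {a. uact m a vac = (\<lambda>S. 0)}"
      using 1 2 3 y[OF Xtilde_vac] y[OF 4] by auto
  qed
  then show "a \<in> Iq m \<Longrightarrow> uact m a vac = (\<lambda>S. 0)" by blast
qed

subsection \<open>Independence of the spanning family\<close>

definition gen_elt :: "nat \<Rightarrow> nat \<Rightarrow> uq" where
  "gen_elt m k = gen_val (gen_words m ! k)"

lemma gen_decomposition:
  assumes "m \<ge> 1"
  shows "\<exists>y. (\<forall>k. y k \<in> U0) \<and> a - (\<Sum>k<2 ^ m. gen_elt m k * y k) \<in> Iq m"
proof -
  have "a \<in> add_span ({gen_val g * y | g y. g \<in> set (gen_words m) \<and> y \<in> U0} \<union> Iq m)"
    using gen_span_UNIV[OF assms] unfolding gen_span_def .
  then show ?thesis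
  proof induction
    case zero
    show ?case by (intro exI[of _ "\<lambda>k. 0"]) (simp add: U0_closed Iq_closed)
  next
    case (step a b)
    then obtain y where y: "\<And>k. y k \<in> U0" "a - (\<Sum>k<2 ^ m. gen_elt m k * y k) \<in> Iq m" by blast
    show ?case
    proof (cases "b \<in> Iq m")
      case True
      have "a + b - (\<Sum>k<2 ^ m. gen_elt m k * y k) = (a - (\<Sum>k<2 ^ m. gen_elt m k * y k)) + b" by simp
      then have "a + b - (\<Sum>k<2 ^ m. gen_elt m k * y k) \<in> Iq m" using Iq_closed(2)[OF y(2) True] by metis
      then show ?thesis using y(1) by (intro exI[of _ y]) blast
    next
      case False
      then obtain g u where g: "b = gen_val g * u" "g \<in> set (gen_words m)" "u \<in> U0" using step by blast
      then obtain l where l: "l < 2 ^ m" "gen_words m ! l = g"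
        by (auto simp: in_set_conv_nth length_gen_words)
      have "(\<Sum>k<2 ^ m. gen_elt m k * (y k + (if k = l then u else 0)))
          = (\<Sum>k<2 ^ m. gen_elt m k * y k) + (\<Sum>k<2 ^ m. if k = l then gen_elt m k * u else 0)"
        unfolding sum.distrib[symmetric] by (intro sum.cong refl) (simp add: distrib_left)
      also have "(\<Sum>k<2 ^ m. if k = l then gen_elt m k * u else 0) = b"
        using l g by (simp add: gen_elt_def)
      finally have "a + b - (\<Sum>k<2 ^ m. gen_elt m k * (y k + (if k = l then u else 0)))
          = a - (\<Sum>k<2 ^ m. gen_elt m k * y k)" by simp
      then have "a + b - (\<Sum>k<2 ^ m. gen_elt m k * (y k + (if k = l then u else 0))) \<in> Iq m"
        using y(2) by (simp only:)
      moreover have "y k + (if k = l then u else 0) \<in> U0" for k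
        by (cases "k = l") (simp_all add: y(1) U0_closed(2)[OF y(1) g(3)])
      ultimately show ?thesis
        by (intro exI[of _ "\<lambda>k. y k + (if k = l then u else 0)"]) blast
    qed
  qed
qed

section \<open>The span of the generators in the representation\<close>

definition gen_vecs :: "nat \<Rightarrow> vec set" where
  "gen_vecs m = {v. \<exists>c. v = (\<lambda>S. \<Sum>k<2 ^ m. c k * uact m (gen_elt m k) vac S)}"

lemma gen_vecs_closed:
  "(\<lambda>S. 0) \<in> gen_vecs m" "u \<in> gen_vecs m \<Longrightarrow> v \<in> gen_vecs m \<Longrightarrow> vadd u v \<in> gen_vecs m"
  "u \<in> gen_vecs m \<Longrightarrow> vscale c u \<in> gen_vecs m"
proof -
  show "(\<lambda>S. 0) \<in> gen_vecs m"
    unfolding gen_vecs_def by (rule CollectI, rule exI[of _ "\<lambda>k. 0"]) simp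
  show "vadd u v \<in> gen_vecs m" if uv: "u \<in> gen_vecs m" "v \<in> gen_vecs m"
  proof -
    obtain c d where "u = (\<lambda>S. \<Sum>k<2 ^ m. c k * uact m (gen_elt m k) vac S)"
      "v = (\<lambda>S. \<Sum>k<2 ^ m. d k * uact m (gen_elt m k) vac S)" using uv unfolding gen_vecs_def by blast
    then show ?thesis unfolding gen_vecs_def
      by (intro CollectI exI[of _ "\<lambda>k. c k + d k"]) (simp add: vadd_def distrib_right sum.distrib)
  qed
  show "vscale c u \<in> gen_vecs m" if u: "u \<in> gen_vecs m"
  proof -
    obtain d where "u = (\<lambda>S. \<Sum>k<2 ^ m. d k * uact m (gen_elt m k) vac S)"
      using u unfolding gen_vecs_def by blast
    then show ?thesis unfolding gen_vecs_def
      by (intro CollectI exI[of _ "\<lambda>k. c * d k"]) (simp add: vscale_def sum_distrib_left mult.assoc)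
  qed
qed

lemma gen_vecs_sum:
  fixes n :: nat
  assumes "\<And>k. k < n \<Longrightarrow> w k \<in> gen_vecs m"
  shows "(\<lambda>S. \<Sum>k<n. c k * w k S) \<in> gen_vecs m"
  using assms
proof (induction n)
  case 0
  show ?case using gen_vecs_closed(1) by simp
next
  case (Suc n)
  have "vadd (\<lambda>S. \<Sum>k<n. c k * w k S) (vscale (c n) (w n)) \<in> gen_vecs m"
    using Suc by (intro gen_vecs_closed) auto
  then show ?case by (simp add: vadd_def vscale_def)
qed

lemma vlinear_sum:
  assumes "vlinear T"
  shows "T (\<lambda>S. \<Sum>k<(n::nat). c k * w k S) = (\<lambda>S. \<Sum>k<n. c k * T (w k) S)"
proof (induction n)
  case 0
  show ?case using vlinearD(3)[OF assms] by simp
next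
  case (Suc n)
  have "T (vadd (\<lambda>S. \<Sum>k<n. c k * w k S) (vscale (c n) (w n)))
      = vadd (\<lambda>S. \<Sum>k<n. c k * T (w k) S) (vscale (c n) (T (w n)))"
    by (simp add: vlinearD[OF assms] Suc)
  then show ?case by (simp add: vadd_def vscale_def)
qed

lemma uact_gen_sum:
  assumes "\<And>k. y k \<in> U0"
  shows "uact m (\<Sum>k<n. gen_elt m k * y k) vac S
    = (\<Sum>k<n. toF (hw_char m (y k)) * uact m (gen_elt m k) vac S)"
  unfolding uact_sum
  by (intro sum.cong refl) (simp add: uact_simps hw_char(2)[OF assms] uact_lin, simp add: vscale_def)

lemma uact_vac_gen_vecs:
  assumes "m \<ge> 1"
  shows "uact m a vac \<in> gen_vecs m"
proof -
  obtain y where y: "\<And>k. y k \<in> U0" "a - (\<Sum>k<2 ^ m. gen_elt m k * y k) \<in> Iq m"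
    using gen_decomposition[OF assms] by blast
  have "uact m a vac S = uact m (\<Sum>k<2 ^ m. gen_elt m k * y k) vac S" for S
    using fun_cong[OF Iq_vac[OF y(2)], of S] by (simp add: uact_simps)
  then have "uact m a vac = (\<lambda>S. \<Sum>k<2 ^ m. toF (hw_char m (y k)) * uact m (gen_elt m k) vac S)"
    by (simp add: uact_gen_sum[OF y(1)] fun_eq_iff)
  then show ?thesis unfolding gen_vecs_def
    by (intro CollectI exI[of _ "\<lambda>k. toF (hw_char m (y k))"])
qed

lemma uact_gen_vecs:
  assumes "m \<ge> 1" "v \<in> gen_vecs m"
  shows "uact m a v \<in> gen_vecs m"
proof -
  obtain c where c: "v = (\<lambda>S. \<Sum>k<2 ^ m. c k * uact m (gen_elt m k) vac S)"
    using assms(2) unfolding gen_vecs_def by blast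
  show ?thesis unfolding c vlinear_sum[OF uact_linear]
  proof (rule gen_vecs_sum)
    fix k
    show "uact m a (uact m (gen_elt m k) vac) \<in> gen_vecs m"
      using uact_vac_gen_vecs[OF assms(1), of "a * gen_elt m k"] by (simp add: uact_simps)
  qed
qed

definition vbasis :: "nat set \<Rightarrow> vec" where
  "vbasis T = (\<lambda>S. if S = T then 1 else 0)"

text \<open>
  Since the \<open>zF i\<close> are pairwise distinct, Lagrange interpolation isolates the \<open>i\<close>-th summand of
  the action of the \<open>x\<^sup>-\<close>.
\<close>

lemma vbasis_insert_gen_vecs:
  assumes m: "m \<ge> 1" and T: "vbasis T \<in> gen_vecs m" "T \<subseteq> {1..m}" and i: "i \<in> {1..m}" "i \<notin> T"
  shows "vbasis (insert i T) \<in> gen_vecs m"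
proof -
  define p where "p = (\<Prod>j\<in>{1..m} - {i}. [:- zF j, 1:])"
  have p0: "poly p (zF l) = 0" if "l \<in> {1..m}" "l \<noteq> i" for l
    using that by (auto simp: p_def poly_prod)
  have pi: "poly p (zF i) \<noteq> 0"
    using zF_inj by (auto simp: p_def poly_prod inj_def)
  define v where "v = (\<lambda>S. \<Sum>k<Suc (degree p). poly.coeff p k * uact m (x_el Minus (int k)) (vbasis T) S)"
  have "v \<in> gen_vecs m"
    unfolding v_def by (intro gen_vecs_sum uact_gen_vecs m T)
  moreover have "v = vscale (poly p (zF i) * cminus m i T) (vbasis (insert i T))"
  proof (rule ext)
    fix S
    have "v S = (\<Sum>l\<in>{1..m} \<inter> S. \<Sum>k\<le>degree p. poly.coeff p k * (zF l ^ k * cminus m l (S - {l}) * vbasis T (S - {l})))"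
      unfolding v_def lessThan_Suc_atMost uact_gens by (subst sum.swap) (simp add: sum_distrib_left)
    also have "\<dots> = (\<Sum>l\<in>{1..m} \<inter> S. poly p (zF l) * (cminus m l (S - {l}) * vbasis T (S - {l})))"
      unfolding poly_altdef by (simp add: sum_distrib_left sum_distrib_right mult_ac)
    also have "\<dots> = (\<Sum>l\<in>{1..m} \<inter> S. if l = i then poly p (zF i) * (cminus m i (S - {i}) * vbasis T (S - {i})) else 0)"
      by (intro sum.cong refl) (auto simp: p0)
    also have "\<dots> = (if i \<in> S then poly p (zF i) * (cminus m i (S - {i}) * vbasis T (S - {i})) else 0)"
      using i by simp
    also have "\<dots> = vscale (poly p (zF i) * cminus m i T) (vbasis (insert i T)) S"
      using i by (auto simp: vscale_def vbasis_def)
    finally show "v S = vscale (poly p (zF i) * cminus m i T) (vbasis (insert i T)) S" .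
  qed
  moreover have "poly p (zF i) * cminus m i T \<noteq> 0"
  proof -
    have "AF i j \<noteq> 0" if "j \<in> T" for j
      using that i by (intro AF_nonzero) blast
    then have "cminus m i T \<noteq> 0" unfolding cminus_def by simp
    then show ?thesis using pi by simp
  qed
  ultimately have "vscale (inverse (poly p (zF i) * cminus m i T)) v = vscale 1 (vbasis (insert i T))"
    by (simp only: vscale_simps left_inverse not_False_eq_True)
  then show ?thesis
    using gen_vecs_closed(3)[OF \<open>v \<in> gen_vecs m\<close>, of "inverse (poly p (zF i) * cminus m i T)"]
    by (simp add: vscale_def)
qed

lemma vbasis_gen_vecs:
  assumes "m \<ge> 1" "T \<subseteq> {1..m}"
  shows "vbasis T \<in> gen_vecs m"
proof -
  have "finite T" using assms(2) by (rule finite_subset) simp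
  then show ?thesis using assms(2)
  proof (induction T)
    case empty
    have "vbasis {} = uact m 1 vac" by (simp add: uact_simps vbasis_def vac_def)
    then show ?case using uact_vac_gen_vecs[OF assms(1)] by simp
  next
    case (insert i T)
    then show ?case by (intro vbasis_insert_gen_vecs assms) auto
  qed
qed

text \<open>With the vectors as rows of \<open>B\<close> and the expansions of the unit vectors as
  rows of \<open>A\<close>, spanning says \<open>A * B = 1\<close>. For square matrices
  \<open>B * A = 1\<close> follows, which gives independence.\<close>

lemma spanning_square_independent:
  fixes b :: "nat \<Rightarrow> 's \<Rightarrow> 'a::field"
  assumes e: "inj_on e {..<n}"
    and span: "\<And>j. j < n \<Longrightarrow> \<exists>c. \<forall>s. (\<Sum>k<n. c k * b k s) = (if s = e j then 1 else 0)"
    and zero: "\<And>s. (\<Sum>k<n. c k * b k s) = 0" and k: "k < n"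
  shows "c k = 0"
proof -
  obtain C where C: "\<And>j s. j < n \<Longrightarrow> (\<Sum>k<n. C j k * b k s) = (if s = e j then 1 else 0)"
    using span by metis
  define A where "A = mat n n (\<lambda>(j, k). C j k)"
  define B where "B = mat n n (\<lambda>(k, l). b k (e l))"
  have AB: "A \<in> carrier_mat n n" "B \<in> carrier_mat n n" by (simp_all add: A_def B_def)
  have "A * B = 1\<^sub>m n"
  proof (rule eq_matI)
    fix i j assume ij: "i < dim_row (1\<^sub>m n)" "j < dim_col (1\<^sub>m n)"
    then have "(A * B) $$ (i, j) = (\<Sum>k<n. C i k * b k (e j))"
      by (simp add: A_def B_def scalar_prod_def atLeast0LessThan)
    also have "\<dots> = 1\<^sub>m n $$ (i, j)"
      using ij e by (auto simp: C inj_on_def)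
    finally show "(A * B) $$ (i, j) = 1\<^sub>m n $$ (i, j)" .
  qed (simp_all add: A_def B_def)
  then have BA: "B * A = 1\<^sub>m n"
    using mat_mult_left_right_inverse[OF AB] by simp
  have BA_entry: "(\<Sum>l<n. b i (e l) * C l k) = (if i = k then 1 else 0)" if "i < n" for i
  proof -
    have "(B * A) $$ (i, k) = (\<Sum>l<n. b i (e l) * C l k)"
      using that k by (simp add: A_def B_def scalar_prod_def atLeast0LessThan)
    then show ?thesis using that k by (simp add: BA)
  qed
  have "c k = (\<Sum>i<n. c i * (\<Sum>l<n. b i (e l) * C l k))"
    using k by (simp add: BA_entry if_distrib cong: if_cong)
  also have "\<dots> = (\<Sum>l<n. (\<Sum>i<n. c i * b i (e l)) * C l k)"
    unfolding sum_distrib_left sum_distrib_right by (subst sum.swap) (simp add: mult.assoc)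
  also have "\<dots> = 0" by (simp add: zero)
  finally show ?thesis .
qed

text \<open>The images of the generators span the unit vectors of the subsets of
  \<open>{1..m}\<close>, and there are as many of them. Since \<open>y k\<close> acts on
  \<open>vac\<close> through its character, it is the character that is seen to vanish.\<close>

lemma gen_independent:
  assumes m: "m \<ge> 1" and y: "\<And>k. y k \<in> U0"
    and I: "(\<Sum>k<2 ^ m. gen_elt m k * y k) \<in> Iq m" and k: "k < 2 ^ m"
  shows "hw_char m (y k) = 0"
proof -
  have "\<exists>e. bij_betw e {0..<card (Pow {1..m})} (Pow {1..m})"
    by (rule ex_bij_betw_nat_finite) simp
  then obtain e where "bij_betw e {..<(2::nat) ^ m} (Pow {1..m})"
    by (auto simp: card_Pow atLeast0LessThan)
  then have e: "inj_on e {..<2 ^ m}" "\<And>j. j < 2 ^ m \<Longrightarrow> e j \<subseteq> {1..m}"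
    by (auto simp: bij_betw_def)
  have "toF (hw_char m (y k)) = 0"
  proof (rule spanning_square_independent[OF e(1) _ _ k])
    fix j :: nat assume "j < 2 ^ m"
    then have "vbasis (e j) \<in> gen_vecs m" by (intro vbasis_gen_vecs m e)
    then obtain c where c: "vbasis (e j) = (\<lambda>S. \<Sum>k<2 ^ m. c k * uact m (gen_elt m k) vac S)"
      unfolding gen_vecs_def by blast
    show "\<exists>c. \<forall>S. (\<Sum>k<2 ^ m. c k * uact m (gen_elt m k) vac S) = (if S = e j then 1 else 0)"
      by (intro exI[of _ c] allI) (use fun_cong[OF c, symmetric] in \<open>simp only: vbasis_def\<close>)
  next
    fix S
    show "(\<Sum>k<2 ^ m. toF (hw_char m (y k)) * uact m (gen_elt m k) vac S) = 0"
      using fun_cong[OF Iq_vac[OF I], of S] by (simp add: uact_gen_sum[OF y])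
  qed
  then show ?thesis by simp
qed

subsection \<open>The highest weight character identifies the Cartan quotient\<close>

lemma U0_alg_simps [simp]:
  "carrier U0_alg = U0" "mult U0_alg = (*)" "one U0_alg = 1" "zero U0_alg = 0" "add U0_alg = (+)"
  "smult U0_alg = (\<lambda>c a. scal c * a)"
  by (simp_all add: U0_alg_def Uq_alg_def)

lemma cring_U0_alg: "cring U0_alg"
proof (rule cringI)
  show "abelian_group U0_alg"
  proof (rule abelian_groupI)
    fix a assume "a \<in> carrier U0_alg"
    then show "\<exists>b\<in>carrier U0_alg. b \<oplus>\<^bsub>U0_alg\<^esub> a = \<zero>\<^bsub>U0_alg\<^esub>"
      by (intro bexI[of _ "- a"]) (simp_all add: U0_closed)
  qed (simp_all add: U0_closed add_ac)
  show "comm_monoid U0_alg"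
    by (rule comm_monoidI) (simp_all add: U0_closed mult.assoc U0_commute)
qed (simp add: distrib_right)

interpretation U0: cring U0_alg
  by (rule cring_U0_alg)

lemma ideal_U0I:
  assumes "I \<subseteq> U0" "0 \<in> I" "\<And>a b. a \<in> I \<Longrightarrow> b \<in> I \<Longrightarrow> a + b \<in> I"
    "\<And>u a. u \<in> U0 \<Longrightarrow> a \<in> I \<Longrightarrow> u * a \<in> I"
  shows "ideal I U0_alg"
proof (rule idealI[OF U0.ring_axioms])
  have neg: "\<ominus>\<^bsub>U0_alg\<^esub> a = - a" if "a \<in> U0" for a
    using that by (intro U0.minus_equality) (simp_all add: U0_closed)
  show "subgroup I (add_monoid U0_alg)"
  proof (rule group.subgroupI[OF U0.add.is_group])
    fix a assume a: "a \<in> I"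
    have "a \<in> U0" using a assms(1) by blast
    moreover have "- a \<in> I" using assms(4)[of "- 1" a] a U0_closed by simp
    ultimately show "inv\<^bsub>add_monoid U0_alg\<^esub> a \<in> I"
      using neg[of a] by (simp add: a_inv_def)
  qed (use assms in auto)
next
  fix a x assume ax: "a \<in> I" "x \<in> carrier U0_alg"
  then show "x \<otimes>\<^bsub>U0_alg\<^esub> a \<in> I" using assms by simp
  have "a * x = x * a" using ax assms(1) by (intro U0_commute) auto
  then show "a \<otimes>\<^bsub>U0_alg\<^esub> x \<in> I" using ax assms by simp
qed

lemma ideal_Iq0: "ideal (Iq0 m) U0_alg"
  unfolding Iq0_def by (rule U0.genideal_ideal) (auto dest: Lambda_gens_U0)

lemma Iq0_subset_U0: "Iq0 m \<subseteq> U0"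
  using ideal.Icarr[OF ideal_Iq0] by auto

lemma Iq0_gens: "a \<in> Lambda_gens m \<Longrightarrow> a \<in> Iq0 m"
  unfolding Iq0_def using U0.genideal_self[of "Lambda_gens m"] Lambda_gens_U0 by auto

lemma Iq0_minimal:
  assumes "I \<subseteq> U0" "0 \<in> I" "\<And>a b. a \<in> I \<Longrightarrow> b \<in> I \<Longrightarrow> a + b \<in> I"
    "\<And>u a. u \<in> U0 \<Longrightarrow> a \<in> I \<Longrightarrow> u * a \<in> I" "Lambda_gens m \<subseteq> I"
  shows "Iq0 m \<subseteq> I"
  unfolding Iq0_def by (rule U0.genideal_minimal[OF ideal_U0I]) (use assms in auto)

lemma Iq0_closed:
  "0 \<in> Iq0 m" "a \<in> Iq0 m \<Longrightarrow> b \<in> Iq0 m \<Longrightarrow> a + b \<in> Iq0 m" "u \<in> U0 \<Longrightarrow> a \<in> Iq0 m \<Longrightarrow> u * a \<in> Iq0 m"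
  "a \<in> Iq0 m \<Longrightarrow> u \<in> U0 \<Longrightarrow> a * u \<in> Iq0 m" "a \<in> Iq0 m \<Longrightarrow> - a \<in> Iq0 m"
  "a \<in> Iq0 m \<Longrightarrow> b \<in> Iq0 m \<Longrightarrow> a - b \<in> Iq0 m"
proof -
  interpret ideal "Iq0 m" U0_alg by (rule ideal_Iq0)
  show 1: "0 \<in> Iq0 m" "a \<in> Iq0 m \<Longrightarrow> b \<in> Iq0 m \<Longrightarrow> a + b \<in> Iq0 m" "u \<in> U0 \<Longrightarrow> a \<in> Iq0 m \<Longrightarrow> u * a \<in> Iq0 m"
    "a \<in> Iq0 m \<Longrightarrow> u \<in> U0 \<Longrightarrow> a * u \<in> Iq0 m" for a b u
    using additive_subgroup.zero_closed[OF additive_subgroup_axioms] additive_subgroup.a_closed[OF additive_subgroup_axioms, of a b]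
      I_l_closed[of a u] I_r_closed[of a u] by simp_all
  show 2: "a \<in> Iq0 m \<Longrightarrow> - a \<in> Iq0 m" for a
    using 1(3)[of "- 1" a] U0_closed by simp
  show "a \<in> Iq0 m \<Longrightarrow> b \<in> Iq0 m \<Longrightarrow> a - b \<in> Iq0 m"
    using 1(2)[of a "- b"] 2[of b] by simp
qed

lemma Iq0_subset_Iq: "Iq0 m \<subseteq> Iq m"
proof -
  have "Iq0 m \<subseteq> Iq m \<inter> U0"
  proof (rule Iq0_minimal)
    show "Lambda_gens m \<subseteq> Iq m \<inter> U0" using Lambda_gens_U0 Iq_gens by blast
  qed (auto intro: U0_closed Iq_closed)
  then show ?thesis by blast
qed

lemma hw_char_sum:
  "(\<And>i. i \<in> A \<Longrightarrow> f i \<in> U0) \<Longrightarrow> hw_char m (sum f A) = (\<Sum>i\<in>A. hw_char m (f i))"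
proof (induction A rule: infinite_finite_induct)
  case (insert i A)
  have "sum f A \<in> U0" by (rule Uq_subalgebra_sum[OF U0_subalgebra]) (use insert in auto)
  then show ?case using insert by (simp add: hw_char_hom)
qed (use hw_char_hom(1)[of m 0] in simp_all)

lemma hw_char_consts: "hw_char m 0 = 0" "hw_char m 1 = 1"
  using hw_char_hom(1)[of m 0] hw_char_hom(1)[of m 1] by simp_all

lemma hw_char_diff: "a \<in> U0 \<Longrightarrow> b \<in> U0 \<Longrightarrow> hw_char m (a - b) = hw_char m a - hw_char m b"
  using hw_char_hom(2)[where a = "a - b" and b = b and m = m] by (simp add: U0_closed)

lemma hw_char_Iq0: "a \<in> Iq0 m \<Longrightarrow> hw_char m a = 0"
proof -
  have "Iq0 m \<subseteq> {a \<in> U0. hw_char m a = 0}"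
  proof (rule Iq0_minimal)
    have "hw_char m (Lambda (int m) * Lambda (- r) - Lambda (int m - r)) = 0"
      if "1 \<le> r" "r \<le> int m" for r
      using Lambda_val_mult[OF that] by (simp add: hw_char_diff hw_char_hom Lambda_U0 U0_closed)
    then show "Lambda_gens m \<subseteq> {a \<in> U0. hw_char m a = 0}"
      by (auto simp: Lambda_gens_def hw_char_hom Lambda_val_gt intro: Lambda_U0 U0_closed)
  qed (auto simp: hw_char_hom hw_char_consts U0_closed)
  then show "a \<in> Iq0 m \<Longrightarrow> hw_char m a = 0" by blast
qed

section \<open>Normal forms in \<open>U0\<close> modulo \<open>Iq0\<close>\<close>

definition Lpow :: "nat \<Rightarrow> int \<Rightarrow> uq" where
  "Lpow m k = (if k \<ge> 0 then Lambda (int m) ^ nat k else Lambda (- int m) ^ nat (- k))"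

text \<open>A list product, because the type \<open>uq\<close> is not commutative; the factors
  commute as elements of \<open>U0\<close>. Together with \<open>Lpow\<close> it forms
  \<open>Lmono\<close>, the counterpart of \<open>esym_mono\<close>.\<close>

definition Lprod :: "nat \<Rightarrow> (nat \<Rightarrow> nat) \<Rightarrow> uq" where
  "Lprod m n = prod_list (map (\<lambda>j. Lambda (int j) ^ n j) [1..<m])"

definition Lmono :: "nat \<Rightarrow> (nat \<Rightarrow>\<^sub>0 int) \<Rightarrow> uq" where
  "Lmono m a = Lprod m (\<lambda>j. nat (Poly_Mapping.lookup a j - Poly_Mapping.lookup a (Suc j)))
     * Lpow m (Poly_Mapping.lookup a m)"

lemma U0_power: "a \<in> U0 \<Longrightarrow> a ^ n \<in> U0"
  by (induction n) (simp_all add: U0_closed)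

lemma Lmono_U0: "Lpow m k \<in> U0" "Lprod m n \<in> U0" "Lmono m a \<in> U0"
proof -
  show 1: "Lpow m k \<in> U0" for k by (simp add: Lpow_def U0_power Lambda_U0)
  have "prod_list (map (\<lambda>j. Lambda (int j) ^ n j) js) \<in> U0" for js n
    by (induction js) (simp_all add: U0_closed U0_power Lambda_U0)
  then show 2: "Lprod m n \<in> U0" for n by (simp add: Lprod_def)
  show "Lmono m a \<in> U0" unfolding Lmono_def by (intro U0_closed 1 2)
qed

lemma Lambda_inverse_Iq0: "m \<ge> 1 \<Longrightarrow> Lambda (int m) * Lambda (- int m) - 1 \<in> Iq0 m"
  "m \<ge> 1 \<Longrightarrow> Lambda (- int m) * Lambda (int m) - 1 \<in> Iq0 m"
  using Iq0_gens[OF Lambda_inverse_Iq, of m] U0_commute[OF Lambda_U0 Lambda_U0, of "int m" "- int m"]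
  by simp_all

text \<open>\<open>Lambda m\<close> and \<open>Lambda (- m)\<close> are inverse to each other only
  modulo \<open>Iq0\<close>. Steps away from exponent 0 are equalities; steps towards it cancel one
  factor.\<close>

lemma Lpow_step:
  assumes m: "m \<ge> 1"
  shows "Lambda (int m) * Lpow m k - Lpow m (k + 1) \<in> Iq0 m"
    "Lambda (- int m) * Lpow m k - Lpow m (k - 1) \<in> Iq0 m"
proof -
  have cancel: "a * b ^ Suc n - b ^ n \<in> Iq0 m" if "a * b - 1 \<in> Iq0 m" "b \<in> U0" for a b n
  proof -
    have "(a * b - 1) * b ^ n \<in> Iq0 m" by (intro Iq0_closed that U0_power)
    then show ?thesis by (simp add: left_diff_distrib mult.assoc)
  qed
  have pos: "Lpow m (int n) = Lambda (int m) ^ n" for n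
    unfolding Lpow_def by simp
  have neg: "Lpow m (- int n) = Lambda (- int m) ^ n" for n
  proof (cases "n = 0")
    case False
    then have "\<not> - int n \<ge> 0" by simp
    then show ?thesis unfolding Lpow_def minus_minus nat_int by (simp only: if_False)
  qed (simp add: Lpow_def)
  show "Lambda (int m) * Lpow m k - Lpow m (k + 1) \<in> Iq0 m"
  proof (cases k)
    case (nonneg n)
    then have "k + 1 = int (Suc n)" by simp
    then have "Lambda (int m) * Lpow m k = Lpow m (k + 1)" using nonneg by (simp only: pos power_Suc)
    then show ?thesis by (simp add: Iq0_closed(1))
  next
    case neg': (neg n)
    then have "k + 1 = - int n" by simp
    then show ?thesis
      using cancel[OF Lambda_inverse_Iq0(1)[OF m] Lambda_U0, of n] neg' by (simp only: neg)
  qed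
  show "Lambda (- int m) * Lpow m k - Lpow m (k - 1) \<in> Iq0 m"
  proof (cases "k > 0")
    case True
    then obtain n where n: "k = int (Suc n)" by (metis zero_less_imp_eq_int gr0_implies_Suc)
    then have "k - 1 = int n" by simp
    then show ?thesis
      using cancel[OF Lambda_inverse_Iq0(2)[OF m] Lambda_U0, of n] n by (simp only: pos)
  next
    case False
    define n where "n = nat (- k)"
    have n: "k = - int n" "k - 1 = - int (Suc n)" using False by (simp_all add: n_def)
    have "Lambda (- int m) * Lpow m k = Lpow m (k - 1)" unfolding n(2) unfolding n(1) neg by simp
    then show ?thesis by (simp add: Iq0_closed(1))
  qed
qed

lemma prod_list_power_insert:
  fixes x :: "'i \<Rightarrow> 'a::monoid_mult"
  assumes comm: "\<And>i. x j * x i = x i * x j" and js: "distinct js" "j \<in> set js"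
  shows "x j * prod_list (map (\<lambda>i. x i ^ n i) js)
    = prod_list (map (\<lambda>i. x i ^ (n i + (if i = j then 1 else 0))) js)"
  using js
proof (induction js)
  case (Cons i js)
  show ?case
  proof (cases "i = j")
    case True
    have "prod_list (map (\<lambda>i. x i ^ n i) js) = prod_list (map (\<lambda>i. x i ^ (n i + (if i = j then 1 else 0))) js)"
      using True Cons.prems by (intro arg_cong[of _ _ prod_list] map_cong) auto
    then show ?thesis using True by (simp add: mult.assoc)
  next
    case False
    have "x i ^ n i * x j = x j * x i ^ n i"
      by (rule power_commuting_commutes) (simp add: comm)
    then have "x j * (x i ^ n i * y) = x i ^ n i * (x j * y)" for y
      by (simp add: mult.assoc[symmetric])
    then show ?thesis using Cons False by simp
  qed
qed simp

lemma Lprod_insert: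
  assumes "1 \<le> j" "j < m"
  shows "Lambda (int j) * Lprod m n = Lprod m (\<lambda>i. n i + (if i = j then 1 else 0))"
  unfolding Lprod_def
  using assms by (intro prod_list_power_insert U0_commute Lambda_U0) auto

lemma Lprod_cong: "(\<And>j. 1 \<le> j \<Longrightarrow> j < m \<Longrightarrow> n j = n' j) \<Longrightarrow> Lprod m n = Lprod m n'"
  unfolding Lprod_def by (intro arg_cong[of _ _ prod_list] map_cong) auto

text \<open>Multiplication by \<open>Lambda j\<close> adds the indicator of \<open>{1..j}\<close> to
  the exponent vector: it raises the difference \<open>a_j - a_(j+1)\<close> for
  \<open>j < m\<close> and the last exponent for \<open>j = m\<close>. The first case is an
  equality, the second holds modulo \<open>Iq0\<close>.\<close>

lemma Lmono_step:
  assumes m: "m \<ge> 1" and a: "dominant m a" and j: "1 \<le> j" "j \<le> m"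
  shows "\<exists>b. dominant m b \<and> Lambda (int j) * Lmono m a - Lmono m b \<in> Iq0 m"
proof -
  define b where "b = a + ind_exp {1..j} 1"
  have lb: "Poly_Mapping.lookup b i = Poly_Mapping.lookup a i + (if i \<in> {1..j} then 1 else 0)" for i
    by (simp add: b_def lookup_add lookup_ind_exp)
  have keys: "Poly_Mapping.keys b \<subseteq> {1..m}"
    using a j by (auto simp: in_keys_iff lb dominant_def split: if_splits)
  have dom: "dominant m b" using a keys by (auto simp: dominant_def lb)
  show ?thesis
  proof (cases "j < m")
    case True
    have "Poly_Mapping.lookup a (Suc j) \<le> Poly_Mapping.lookup a j"
      using a j True by (simp add: dominant_def)
    then have "Lambda (int j) * Lmono m a = Lmono m b"
      unfolding Lmono_def mult.assoc[symmetric] Lprod_insert[OF j(1) True]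
      using True
      by (intro arg_cong2[of _ _ _ _ "(*)"] Lprod_cong) (auto simp: lb)
    then have "Lambda (int j) * Lmono m a - Lmono m b \<in> Iq0 m" by (simp add: Iq0_closed(1))
    then show ?thesis using dom by blast
  next
    case False
    then have jm: "j = m" using j by simp
    define P where "P = Lprod m (\<lambda>i. nat (Poly_Mapping.lookup a i - Poly_Mapping.lookup a (Suc i)))"
    have P: "P = Lprod m (\<lambda>i. nat (Poly_Mapping.lookup b i - Poly_Mapping.lookup b (Suc i)))"
      unfolding P_def by (rule Lprod_cong) (simp add: lb jm)
    have "P * (Lambda (int m) * Lpow m (Poly_Mapping.lookup a m) - Lpow m (Poly_Mapping.lookup a m + 1)) \<in> Iq0 m"
      unfolding P_def by (intro Iq0_closed Lpow_step m Lmono_U0)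
    moreover have "P * Lambda (int m) = Lambda (int m) * P"
      unfolding P_def by (intro U0_commute Lmono_U0 Lambda_U0)
    moreover have e: "Poly_Mapping.lookup b m = Poly_Mapping.lookup a m + 1" using m by (simp add: lb jm)
    ultimately have "Lambda (int j) * Lmono m a - Lmono m b \<in> Iq0 m"
      unfolding Lmono_def P_def[symmetric] P[symmetric] e
      by (simp add: right_diff_distrib mult.assoc[symmetric] jm)
    then show ?thesis using dom by blast
  qed
qed

lemma Lmono_inverse_step:
  assumes m: "m \<ge> 1" and a: "dominant m a"
  shows "\<exists>b. dominant m b \<and> Lambda (- int m) * Lmono m a - Lmono m b \<in> Iq0 m"
proof -
  define b where "b = a + ind_exp {1..m} (- 1)"
  have lb: "Poly_Mapping.lookup b i = Poly_Mapping.lookup a i + (if i \<in> {1..m} then - 1 else 0)" for i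
    by (simp add: b_def lookup_add lookup_ind_exp)
  have keys: "Poly_Mapping.keys b \<subseteq> {1..m}"
    using a by (auto simp: in_keys_iff lb dominant_def split: if_splits)
  have dom: "dominant m b" using a keys by (auto simp: dominant_def lb)
  define P where "P = Lprod m (\<lambda>i. nat (Poly_Mapping.lookup a i - Poly_Mapping.lookup a (Suc i)))"
  have P: "P = Lprod m (\<lambda>i. nat (Poly_Mapping.lookup b i - Poly_Mapping.lookup b (Suc i)))"
    unfolding P_def by (rule Lprod_cong) (simp add: lb)
  have "P * (Lambda (- int m) * Lpow m (Poly_Mapping.lookup a m) - Lpow m (Poly_Mapping.lookup a m - 1)) \<in> Iq0 m"
    unfolding P_def by (intro Iq0_closed Lpow_step m Lmono_U0)
  moreover have "P * Lambda (- int m) = Lambda (- int m) * P"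
    unfolding P_def by (intro U0_commute Lmono_U0 Lambda_U0)
  moreover have e: "Poly_Mapping.lookup b m = Poly_Mapping.lookup a m - 1" using m by (simp add: lb)
  ultimately have "Lambda (- int m) * Lmono m a - Lmono m b \<in> Iq0 m"
    unfolding Lmono_def P_def[symmetric] P[symmetric] e
    by (simp add: right_diff_distrib mult.assoc[symmetric])
  then show ?thesis using dom by blast
qed

lemma cst_mult: "cst (c * d) = cst c * cst d"
  by (simp add: mult_single)

text \<open>The scalar collects the signs in the values of the \<open>Lambda j\<close>; it enters
  later only through being nonzero.\<close>

lemma hw_char_Lmono: "\<exists>s. s \<noteq> 0 \<and> hw_char m (Lmono m a) = cst s * esym_mono m a"
proof -
  have pw: "hw_char m (u ^ n) = hw_char m u ^ n" if "u \<in> U0" for u n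
    using that by (induction n) (simp_all add: hw_char_hom hw_char_consts U0_power)
  have sgn: "(- 1 :: laurent) = cst (- 1)" by (simp add: single_uminus)
  have cpw: "cst c ^ n = cst (c ^ n)" for c n
    by (induction n) (simp_all add: mult_single)
  have 1: "\<exists>s. s \<noteq> 0 \<and> hw_char m (prod_list (map (\<lambda>j. Lambda (int j) ^ n j) js))
      = cst s * prod_list (map (\<lambda>j. esym 1 m j ^ n j) js)" for js :: "nat list" and n
  proof (induction js)
    case Nil
    show ?case by (intro exI[of _ 1]) (simp add: hw_char_consts)
  next
    case (Cons j js)
    then obtain s where s: "s \<noteq> 0" "hw_char m (prod_list (map (\<lambda>j. Lambda (int j) ^ n j) js))
      = cst s * prod_list (map (\<lambda>j. esym 1 m j ^ n j) js)" by blast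
    have U: "prod_list (map (\<lambda>j. Lambda (int j) ^ n j) js) \<in> U0"
      by (induction js) (simp_all add: U0_closed U0_power Lambda_U0)
    have "hw_char m (Lambda (int j) ^ n j) = cst ((- 1) ^ (j * n j)) * esym 1 m j ^ n j"
      by (simp add: pw Lambda_U0 hw_char_hom Lambda_val_def power_mult_distrib power_mult[symmetric] sgn cpw)
    then show ?case
      using s U by (intro exI[of _ "(- 1) ^ (j * n j) * s"])
        (simp add: hw_char_hom U0_power Lambda_U0 cst_mult mult_ac)
  qed
  have 2: "\<exists>s. s \<noteq> 0 \<and> hw_char m (Lpow m k) = cst s * epow m k" for k
  proof -
    have ep: "epow m s ^ n = epow m (int n * s)" for s n
      by (induction n) (simp_all add: epow_add[symmetric] epow_0 distrib_right)
    show ?thesis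
    proof (cases "k \<ge> 0")
      case True
      have "hw_char m (Lpow m k) = cst ((- 1) ^ (m * nat k)) * epow m k"
        using True by (simp add: Lpow_def pw Lambda_U0 hw_char_hom Lambda_val_def power_mult_distrib power_mult[symmetric]
            sgn cpw epow_esym[symmetric] ep)
      then show ?thesis by (intro exI[of _ "(- 1) ^ (m * nat k)"]) simp
    next
      case False
      then have "hw_char m (Lpow m k) = ((- 1) ^ m * epow m (if m = 0 then 1 else - 1)) ^ nat (- k)"
        by (simp add: Lpow_def pw Lambda_U0 hw_char_hom Lambda_val_def epow_esym)
      also have "epow m (if m = 0 then 1 else - 1) = epow m (- 1)" by (simp add: epow_def)
      also have "((- 1) ^ m * epow m (- 1)) ^ nat (- k) = cst ((- 1) ^ (m * nat (- k))) * epow m k"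
        using False by (simp add: power_mult_distrib power_mult[symmetric] sgn cpw ep)
      finally show ?thesis by (intro exI[of _ "(- 1) ^ (m * nat (- k))"]) simp
    qed
  qed
  obtain s where s: "s \<noteq> 0" "hw_char m (Lprod m (\<lambda>j. nat (Poly_Mapping.lookup a j - Poly_Mapping.lookup a (Suc j))))
      = cst s * prod_list (map (\<lambda>j. esym 1 m j ^ nat (Poly_Mapping.lookup a j - Poly_Mapping.lookup a (Suc j))) [1..<m])"
    using 1[of "\<lambda>j. nat (Poly_Mapping.lookup a j - Poly_Mapping.lookup a (Suc j))" "[1..<m]"]
    unfolding Lprod_def by (elim exE conjE)
  obtain t where t: "t \<noteq> 0" "hw_char m (Lpow m (Poly_Mapping.lookup a m)) = cst t * epow m (Poly_Mapping.lookup a m)"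
    using 2[of "Poly_Mapping.lookup a m"] by (elim exE conjE)
  have prod_upt: "(\<Prod>j=1..<m. f j) = prod_list (map f [1..<m])" for f :: "nat \<Rightarrow> laurent"
    using prod.distinct_set_conv_list[OF distinct_upt, of f 1 m] by (simp only: set_upt)
  have "hw_char m (Lmono m a) = cst (s * t) * esym_mono m a"
    unfolding Lmono_def esym_mono_def hw_char_hom(3)[OF Lmono_U0(2,1)] s t
    unfolding cst_mult prod_upt by (simp only: mult_ac)
  then show ?thesis using s t by (intro exI[of _ "s * t"]) simp
qed

lemma hw_char_surj:
  assumes "f \<in> sym_laurent m"
  obtains u where "u \<in> U0" "hw_char m u = f"
proof -
  have "sym_laurent m \<subseteq> hw_char m ` U0"
  proof (rule sym_laurent_subset)
    show "0 \<in> hw_char m ` U0" by (rule image_eqI[of _ _ 0]) (simp_all add: hw_char_consts U0_closed(4))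
  next
    fix f g assume "f \<in> hw_char m ` U0" "g \<in> hw_char m ` U0"
    then obtain u v where "u \<in> U0" "f = hw_char m u" "v \<in> U0" "g = hw_char m v" by (elim imageE)
    then show "f + g \<in> hw_char m ` U0"
      by (intro image_eqI[of _ _ "u + v"]) (simp_all add: hw_char_hom(2) U0_closed(2))
  next
    fix c a
    obtain s where s: "s \<noteq> 0" "hw_char m (Lmono m a) = cst s * esym_mono m a" using hw_char_Lmono by blast
    have U: "scal (c / s) * Lmono m a \<in> U0" by (intro U0_closed(3) U0_closed(1) Lmono_U0)
    have "hw_char m (scal (c / s) * Lmono m a) = cst (c / s) * cst s * esym_mono m a"
      by (simp add: hw_char_hom U0_closed Lmono_U0 s mult.assoc)
    also have "cst (c / s) * cst s = cst c" using s by (simp add: mult_single)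
    finally show "cst c * esym_mono m a \<in> hw_char m ` U0"
      using imageI[OF U, of "hw_char m"] by (simp only:)
  qed
  then show ?thesis using assms that by blast
qed

definition normal_forms :: "nat \<Rightarrow> uq set" where
  "normal_forms m = add_span ({scal c * Lmono m a | c a. dominant m a} \<union> Iq0 m)"

lemma normal_forms_closed:
  "0 \<in> normal_forms m" "a \<in> normal_forms m \<Longrightarrow> b \<in> normal_forms m \<Longrightarrow> a + b \<in> normal_forms m"
  "a \<in> Iq0 m \<Longrightarrow> a \<in> normal_forms m" "dominant m e \<Longrightarrow> scal c * Lmono m e \<in> normal_forms m"
proof -
  show "0 \<in> normal_forms m" by (simp add: normal_forms_def add_span.zero)
  show "a \<in> normal_forms m \<Longrightarrow> b \<in> normal_forms m \<Longrightarrow> a + b \<in> normal_forms m"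
    unfolding normal_forms_def by (rule add_span_add)
  show "a \<in> Iq0 m \<Longrightarrow> a \<in> normal_forms m"
    unfolding normal_forms_def by (intro add_span_base) blast
  show "dominant m e \<Longrightarrow> scal c * Lmono m e \<in> normal_forms m"
    unfolding normal_forms_def by (intro add_span_base) blast
qed

text \<open>The multipliers that preserve the normal forms are a subalgebra. It contains every
  \<open>Lambda r\<close>, and then every \<open>h_k\<close>, because the recursion of the
  exponential can be solved for \<open>h_k\<close>.\<close>

lemma U0_normal_forms:
  assumes m: "m \<ge> 1" and u: "u \<in> U0"
  shows "u \<in> normal_forms m"
proof -
  define S where "S = {u \<in> U0. \<forall>t\<in>normal_forms m. u * t \<in> normal_forms m}"
  have S_I: "u \<in> S" if u: "u \<in> U0" and g: "\<And>c a. dominant m a \<Longrightarrow> u * (scal c * Lmono m a) \<in> normal_forms m" for u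
    unfolding S_def normal_forms_def
  proof (intro CollectI conjI ballI u)
    fix t assume "t \<in> add_span ({scal c * Lmono m a | c a. dominant m a} \<union> Iq0 m)"
    then show "u * t \<in> add_span ({scal c * Lmono m a | c a. dominant m a} \<union> Iq0 m)"
    proof (rule add_span_image)
      fix b assume b: "b \<in> {scal c * Lmono m a | c a. dominant m a} \<union> Iq0 m"
      have "u * b \<in> normal_forms m"
      proof (cases "b \<in> Iq0 m")
        case True
        then show ?thesis using u by (intro normal_forms_closed(3) Iq0_closed(3))
      next
        case False
        then show ?thesis using b g by blast
      qed
      then show "u * b \<in> add_span ({scal c * Lmono m a | c a. dominant m a} \<union> Iq0 m)"
        unfolding normal_forms_def .
    qed (simp_all add: distrib_left)
  qed
  have step: "u \<in> S" if u: "u \<in> U0"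
    and g: "\<And>a. dominant m a \<Longrightarrow> \<exists>b. dominant m b \<and> u * Lmono m a - Lmono m b \<in> Iq0 m" for u
  proof (rule S_I[OF u])
    fix c a assume "dominant m a"
    then obtain b where b: "dominant m b" "u * Lmono m a - Lmono m b \<in> Iq0 m" using g by blast
    have "scal c * (u * Lmono m a - Lmono m b) + scal c * Lmono m b \<in> normal_forms m"
      using b by (intro normal_forms_closed(2-4) Iq0_closed(3) U0_closed) auto
    then show "u * (scal c * Lmono m a) \<in> normal_forms m"
      by (simp add: right_diff_distrib scal_left_commute[of u])
  qed
  have sub: "Uq_subalgebra S"
    unfolding Uq_subalgebra_def
  proof (intro conjI ballI)
    have "scal c \<in> S" for c
    proof (rule S_I[OF U0_closed(1)])
      fix d a assume "dominant m a"
      then show "scal c * (scal d * Lmono m a) \<in> normal_forms m"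
        unfolding mult.assoc[symmetric] scal_mult[symmetric] by (rule normal_forms_closed)
    qed
    then show "range scal \<subseteq> S" by blast
    fix a b assume ab: "a \<in> S" "b \<in> S"
    then show "a + b \<in> S" by (auto simp: S_def U0_closed distrib_right intro: normal_forms_closed)
    show "a * b \<in> S" using ab by (auto simp: S_def U0_closed mult.assoc)
  qed
  note SD = Uq_subalgebraD[OF sub]
  have J: "u \<in> S" if "u \<in> Iq0 m" for u
  proof (rule S_I)
    show "u \<in> U0" using that Iq0_subset_U0 by blast
    show "u * (scal c * Lmono m a) \<in> normal_forms m" for c a
      by (intro normal_forms_closed(3) Iq0_closed(4) that U0_closed(3) U0_closed(1) Lmono_U0)
  qed
  have inv: "Lambda (- int m) \<in> S"
    using step[OF Lambda_U0] Lmono_inverse_step[OF m] by blast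
  have pos: "Lambda (int j) \<in> S" if "j \<le> m" for j
  proof (cases "j = 0")
    case True
    then show ?thesis by (simp add: Lambda_values SD)
  next
    case False
    then show ?thesis using step[OF Lambda_U0] Lmono_step[OF m] that by (metis One_nat_def Suc_leI neq0_conv)
  qed
  \<comment> \<open>Modulo \<open>Iq0\<close>, \<open>Lambda (- j)\<close> is
    \<open>Lambda (- m) * Lambda (m - j)\<close>.\<close>
  have neg: "Lambda (- int j) \<in> S" if "1 \<le> j" "j \<le> m" for j
  proof -
    have 1: "Lambda (int m) * Lambda (- int j) - Lambda (int m - int j) \<in> S"
      using that by (intro J Iq0_gens) (auto simp: Lambda_gens_def)
    have 2: "(Lambda (- int m) * Lambda (int m) - 1) * Lambda (- int j) \<in> S"
      by (intro J Iq0_closed Lambda_inverse_Iq0 m Lambda_U0)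
    have 3: "Lambda (int m - int j) \<in> S" using pos[of "m - j"] that by (simp add: of_nat_diff)
    have "Lambda (- int m) * (Lambda (int m) * Lambda (- int j) - Lambda (int m - int j))
        + Lambda (- int m) * Lambda (int m - int j) - (Lambda (- int m) * Lambda (int m) - 1) * Lambda (- int j) \<in> S"
      by (intro SD(7) SD(2) SD(3) inv 1 2 3)
    then show ?thesis by (simp add: algebra_simps)
  qed
  have Lam: "Lambda r \<in> S" for r
  proof (cases "\<bar>r\<bar> > int m")
    case True
    then show ?thesis by (intro J Iq0_gens) (auto simp: Lambda_gens_def)
  next
    case False
    show ?thesis
    proof (cases "r \<ge> 0")
      case True
      then show ?thesis using pos[of "nat r"] False by simp
    next
      case F: False
      then show ?thesis using neg[of "nat (- r)"] False by simp
    qed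
  qed
  have h: "h_el (pm_sign e * int k) \<in> S" if "k \<ge> 1" for e k
    using that
  proof (induction k rule: less_induct)
    case (less k)
    let ?f = "- Abs_fps (\<lambda>k. if k = 0 then 0 else scal (1 / q_int (int k)) * h_el (pm_sign e * int k))"
    have Ls: "fps_nth (Lambda_series e) n = Lambda (pm_sign e * int n)" for n
    proof (cases "n = 0")
      case True
      then show ?thesis by (simp add: Lambda_values Lambda_series_def alg_exp_def)
    next
      case False
      then show ?thesis by (cases e) (simp_all add: Lambda_def)
    qed
    define F where "F = (\<lambda>i. fps_nth ?f i)"
    have F: "F i = (if i = 0 then 0 else scal (- (1 / q_int (int i))) * h_el (pm_sign e * int i))" for i
      by (simp add: F_def scal_uminus)
    have FU: "F i \<in> U0" for i
      unfolding F by (cases "i = 0") (simp_all add: U0_closed(1,3,4) h_el_U0)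
    have FS: "F i \<in> S" if "i < k" for i
    proof (cases "i = 0")
      case False
      then show ?thesis unfolding F using SD(1) SD(3) less.IH[of i] that by simp
    qed (simp add: F SD(4))
    have "of_nat k * Lambda (pm_sign e * int k)
        = (\<Sum>i=1..k. of_nat i * F i * Lambda (pm_sign e * int (k - i)))"
      unfolding Ls[symmetric] Lambda_series_def F_def
      by (rule alg_exp_recursion)
        (simp, rule U0_commute[OF FU[unfolded F_def] FU[unfolded F_def]], rule scal_commute, rule scal_mult, rule scal_of_nat)
    also have "\<dots> = of_nat k * F k + (\<Sum>i=1..<k. of_nat i * F i * Lambda (pm_sign e * int (k - i)))"
      using sum.last_plus[OF less.prems, of "\<lambda>i. of_nat i * F i * Lambda (pm_sign e * int (k - i))"]
      by (simp add: Lambda_values)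
    finally have e1: "of_nat k * F k = of_nat k * Lambda (pm_sign e * int k)
        - (\<Sum>i=1..<k. of_nat i * F i * Lambda (pm_sign e * int (k - i)))" by (simp only: add_diff_cancel_right')
    have "of_nat i * F i * Lambda (pm_sign e * int (k - i)) \<in> S" if "i < k" for i
      unfolding scal_of_nat[symmetric] by (intro SD(3) SD(1) Lam FS that)
    then have "(\<Sum>i=1..<k. of_nat i * F i * Lambda (pm_sign e * int (k - i))) \<in> S"
      by (intro Uq_subalgebra_sum[OF sub]) simp
    moreover have "of_nat k * Lambda (pm_sign e * int k) \<in> S"
      unfolding scal_of_nat[symmetric] by (intro SD(3) SD(1) Lam)
    ultimately have "of_nat k * F k \<in> S" unfolding e1 by (rule SD(7)[rotated])
    then have "scal (- q_int (int k) / of_nat k) * (of_nat k * F k) \<in> S"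
      by (rule SD(3)[OF SD(1)])
    also have "scal (- q_int (int k) / of_nat k) * (of_nat k * F k)
        = scal (- q_int (int k) / of_nat k * (of_nat k * (- (1 / q_int (int k))))) * h_el (pm_sign e * int k)"
      unfolding scal_of_nat[symmetric] scal_mult F using less.prems by (simp add: mult.assoc)
    also have "- q_int (int k) / of_nat k * (of_nat k * (- (1 / q_int (int k)))) = 1"
      using less.prems by (simp add: q_int_nonzero)
    finally show ?case by simp
  qed
  have "U0 \<subseteq> S"
  proof (rule U0_minimal[OF sub])
    fix r :: int assume "r \<noteq> 0"
    then show "h_el r \<in> S" using h[of "nat r" Plus] h[of "nat (- r)" Minus] by (cases "r > 0") auto
  qed
  moreover have "1 \<in> normal_forms m"
  proof -
    have "Lprod m (\<lambda>j. 0) = 1" unfolding Lprod_def by (induction m) simp_all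
    then have "Lmono m 0 = 1" by (simp add: Lmono_def Lpow_def)
    moreover have "dominant m 0" by (simp add: dominant_def)
    ultimately show ?thesis using normal_forms_closed(4)[of m 0 1] by simp
  qed
  ultimately show ?thesis using u unfolding S_def by fastforce
qed

text \<open>The type \<open>laurent\<close> is a container here: a finitely supported family of
  coefficients indexed by exponent vectors. It merges equal exponents, so that independence of the
  \<open>esym_mono\<close> can be applied.\<close>

lemma normal_forms_coeffs:
  assumes "t \<in> normal_forms m"
  shows "\<exists>c :: laurent. (\<forall>a\<in>Poly_Mapping.keys c. dominant m a)
    \<and> t - (\<Sum>a\<in>Poly_Mapping.keys c. scal (Poly_Mapping.lookup c a) * Lmono m a) \<in> Iq0 m"
proof -
  define ev where "ev = (\<lambda>c :: laurent. \<Sum>a\<in>Poly_Mapping.keys c. scal (Poly_Mapping.lookup c a) * Lmono m a)"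
  have ev_superset: "ev c = (\<Sum>a\<in>A. scal (Poly_Mapping.lookup c a) * Lmono m a)"
    if "finite A" "Poly_Mapping.keys c \<subseteq> A" for c A
    unfolding ev_def using that by (intro sum.mono_neutral_left) (auto simp: in_keys_iff)
  have ev_add: "ev (c + mon a * cst d) = ev c + scal d * Lmono m a" for c a d
  proof -
    let ?A = "insert a (Poly_Mapping.keys c)"
    have md: "mon a * cst d = Poly_Mapping.single a d" by (simp add: mult_single)
    have "ev (c + mon a * cst d) = (\<Sum>b\<in>?A. scal (Poly_Mapping.lookup (c + Poly_Mapping.single a d) b) * Lmono m b)"
      unfolding md using Poly_Mapping.keys_add[of c "Poly_Mapping.single a d"]
      by (intro ev_superset) (auto split: if_splits)
    also have "\<dots> = (\<Sum>b\<in>?A. scal (Poly_Mapping.lookup c b) * Lmono m b)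
        + (\<Sum>b\<in>?A. if b = a then scal d * Lmono m a else 0)"
      unfolding sum.distrib[symmetric]
      by (intro sum.cong refl) (auto simp: lookup_add lookup_single scal_add distrib_right when_def)
    also have "(\<Sum>b\<in>?A. scal (Poly_Mapping.lookup c b) * Lmono m b) = ev c"
      by (rule ev_superset[symmetric]) auto
    finally show ?thesis by simp
  qed
  have "\<exists>c. (\<forall>a\<in>Poly_Mapping.keys c. dominant m a) \<and> t - ev c \<in> Iq0 m"
    using assms unfolding normal_forms_def
  proof induction
    case zero
    show ?case by (intro exI[of _ 0]) (simp add: ev_def Iq0_closed)
  next
    case (step t b)
    then obtain c where c: "\<forall>a\<in>Poly_Mapping.keys c. dominant m a" "t - ev c \<in> Iq0 m" by blast
    show ?case
    proof (cases "b \<in> Iq0 m")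
      case True
      then have "(t - ev c) + b \<in> Iq0 m" using c by (intro Iq0_closed(2))
      then have "t + b - ev c \<in> Iq0 m" by (simp only: diff_add_eq)
      then show ?thesis using c by blast
    next
      case False
      then obtain d a where a: "b = scal d * Lmono m a" "dominant m a" using step by blast
      have "\<forall>a\<in>Poly_Mapping.keys (c + mon a * cst d). dominant m a"
        using Poly_Mapping.keys_add[of c "mon a * cst d"] c a by (auto simp: mult_single split: if_splits)
      moreover have "t + b - ev (c + mon a * cst d) \<in> Iq0 m"
        unfolding ev_add a using c(2) by simp
      ultimately show ?thesis by blast
    qed
  qed
  then show ?thesis unfolding ev_def .
qed

text \<open>The character of a normal form is the same combination of the \<open>esym_mono\<close>,
  up to nonzero factors in the coefficients, so it vanishes only if all coefficients do.\<close>

lemma hw_char_kernel: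
  assumes m: "m \<ge> 1" and u: "u \<in> U0" "hw_char m u = 0"
  shows "u \<in> Iq0 m"
proof -
  obtain c where c: "\<And>a. a \<in> Poly_Mapping.keys c \<Longrightarrow> dominant m a"
    "u - (\<Sum>a\<in>Poly_Mapping.keys c. scal (Poly_Mapping.lookup c a) * Lmono m a) \<in> Iq0 m"
    using normal_forms_coeffs[OF U0_normal_forms[OF m u(1)]] by blast
  obtain s where s: "\<And>a. s a \<noteq> 0" "\<And>a. hw_char m (Lmono m a) = cst (s a) * esym_mono m a"
    using hw_char_Lmono[of m] by metis
  have tU: "scal (Poly_Mapping.lookup c a) * Lmono m a \<in> U0" for a by (intro U0_closed Lmono_U0)
  have "0 = hw_char m (\<Sum>a\<in>Poly_Mapping.keys c. scal (Poly_Mapping.lookup c a) * Lmono m a)"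
  proof -
    have "(\<Sum>a\<in>Poly_Mapping.keys c. scal (Poly_Mapping.lookup c a) * Lmono m a) \<in> U0"
      by (rule Uq_subalgebra_sum[OF U0_subalgebra tU])
    then show ?thesis using hw_char_Iq0[OF c(2)] u by (simp add: hw_char_diff)
  qed
  also have "\<dots> = (\<Sum>a\<in>Poly_Mapping.keys c. cst (Poly_Mapping.lookup c a * s a) * esym_mono m a)"
    unfolding hw_char_sum[OF tU]
    by (simp add: hw_char_hom U0_closed Lmono_U0 s cst_mult mult.assoc)
  finally have z: "(\<Sum>a\<in>Poly_Mapping.keys c. cst (Poly_Mapping.lookup c a * s a) * esym_mono m a) = 0" by simp
  have "Poly_Mapping.lookup c a * s a = 0" if "a \<in> Poly_Mapping.keys c" for a
    by (rule esym_mono_independent[OF finite_keys c(1) z that])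
  then have "Poly_Mapping.lookup c a = 0" if "a \<in> Poly_Mapping.keys c" for a
    using that s(1) by simp
  then have "c = 0" by (intro poly_mapping_eqI) (metis in_keys_iff lookup_zero)
  then show ?thesis using c(2) by simp
qed

section \<open>The fibre at a maximal ideal\<close>

subsection \<open>Quotients of modules and their dimensions\<close>

lemma quot_mod_simps:
  fixes V :: "('k, 'v) module"
  shows "carrier (V //\<^sub>m N) = a_rcosets\<^bsub>V\<^esub> N" "add (V //\<^sub>m N) = set_add V" "zero (V //\<^sub>m N) = N"
    "mult (V //\<^sub>m N) = rcoset_mult V N" "one (V //\<^sub>m N) = N +>\<^bsub>V\<^esub> \<one>\<^bsub>V\<^esub>"
    "smult (V //\<^sub>m N) = (\<lambda>c X. \<Union>v\<in>X. N +>\<^bsub>V\<^esub> (c \<odot>\<^bsub>V\<^esub> v))"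
  by (simp_all add: quot_mod_def FactRing_def ring.defs module.defs)

text \<open>The axioms transfer along a surjection without prior knowledge that the target is a
  group, so they need not be verified on cosets.\<close>

lemma module_surj_image:
  fixes V :: "('k, 'v, 'm) module_scheme" and V' :: "('k, 'w, 'n) module_scheme"
  assumes V: "module R V" and carrier: "f ` carrier V = carrier V'"
    and add: "\<And>x y. x \<in> carrier V \<Longrightarrow> y \<in> carrier V \<Longrightarrow> f (x \<oplus>\<^bsub>V\<^esub> y) = f x \<oplus>\<^bsub>V'\<^esub> f y"
    and zero: "f \<zero>\<^bsub>V\<^esub> = \<zero>\<^bsub>V'\<^esub>"
    and smult: "\<And>c x. c \<in> carrier R \<Longrightarrow> x \<in> carrier V \<Longrightarrow> f (c \<odot>\<^bsub>V\<^esub> x) = c \<odot>\<^bsub>V'\<^esub> f x"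
  shows "module R V'"
proof -
  interpret module R V by (rule V)
  note s = add[symmetric] zero[symmetric] smult[symmetric]
  have "abelian_group V'"
  proof (rule abelian_groupI, unfold carrier[symmetric])
    fix X assume "X \<in> f ` carrier V"
    then obtain x where x: "x \<in> carrier V" "X = f x" by blast
    show "\<exists>Y\<in>f ` carrier V. Y \<oplus>\<^bsub>V'\<^esub> X = \<zero>\<^bsub>V'\<^esub>"
      using x by (intro bexI[of _ "f (\<ominus>\<^bsub>V\<^esub> x)"]) (simp_all add: s M.l_neg)
  qed ((elim imageE)?; simp add: s M.a_ac)+
  then show ?thesis
  proof (rule moduleI[OF is_cring], unfold carrier[symmetric])
  qed (elim imageE; simp add: s smult_l_distr smult_r_distr smult_assoc1)+
qed

locale module_quotient =
  fixes V :: "('k::field, 'v) module" and N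
  assumes module: "module class_ring V"
    and N: "N \<subseteq> carrier V" "\<zero>\<^bsub>V\<^esub> \<in> N" "\<And>x y. x \<in> N \<Longrightarrow> y \<in> N \<Longrightarrow> x \<oplus>\<^bsub>V\<^esub> y \<in> N"
      "\<And>c x. x \<in> N \<Longrightarrow> c \<odot>\<^bsub>V\<^esub> x \<in> N"
begin

sublocale module class_ring V
  by (rule module)

lemma neg_smult: "x \<in> carrier V \<Longrightarrow> \<ominus>\<^bsub>V\<^esub> x = (- 1) \<odot>\<^bsub>V\<^esub> x"
proof (rule M.minus_equality)
  assume x: "x \<in> carrier V"
  have "(- 1) \<odot>\<^bsub>V\<^esub> x \<oplus>\<^bsub>V\<^esub> 1 \<odot>\<^bsub>V\<^esub> x = (- 1 + 1) \<odot>\<^bsub>V\<^esub> x"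
    using smult_l_distr[of "- 1" 1 x] x by simp
  then show "(- 1) \<odot>\<^bsub>V\<^esub> x \<oplus>\<^bsub>V\<^esub> x = \<zero>\<^bsub>V\<^esub>"
    using smult_one[OF x] smult_l_null[OF x] by simp
qed simp_all

sublocale sub: abelian_subgroup N V
proof (rule abelian_subgroupI3)
  show "additive_subgroup N V"
  proof (rule additive_subgroup.intro, rule group.subgroupI[OF M.a_group])
    fix x assume x: "x \<in> N"
    have "\<ominus>\<^bsub>V\<^esub> x \<in> N"
      using neg_smult[of x] N(4)[OF x, of "- 1"] N(1) x by (simp add: subset_iff)
    then show "inv\<^bsub>add_monoid V\<^esub> x \<in> N" by (simp add: a_inv_def)
  qed (use N in auto)
qed (rule M.abelian_group_axioms)

lemma coset_zero_iff: "x \<in> carrier V \<Longrightarrow> N +>\<^bsub>V\<^esub> x = N \<longleftrightarrow> x \<in> N"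
  using sub.a_rcos_self[of x] sub.a_rcos_const[of x] by auto

lemma coset_smult: "x \<in> carrier V \<Longrightarrow> c \<odot>\<^bsub>V //\<^sub>m N\<^esub> (N +>\<^bsub>V\<^esub> x) = N +>\<^bsub>V\<^esub> (c \<odot>\<^bsub>V\<^esub> x)"
proof -
  assume x: "x \<in> carrier V"
  have "N +>\<^bsub>V\<^esub> (c \<odot>\<^bsub>V\<^esub> v) = N +>\<^bsub>V\<^esub> (c \<odot>\<^bsub>V\<^esub> x)" if v: "v \<in> N +>\<^bsub>V\<^esub> x" for v
  proof -
    obtain n where n: "n \<in> N" "v = n \<oplus>\<^bsub>V\<^esub> x" using v by (auto simp: a_r_coset_def')
    then have "c \<odot>\<^bsub>V\<^esub> v = c \<odot>\<^bsub>V\<^esub> n \<oplus>\<^bsub>V\<^esub> c \<odot>\<^bsub>V\<^esub> x" "c \<odot>\<^bsub>V\<^esub> n \<in> N"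
      using x N by (auto simp: smult_r_distr)
    then have "c \<odot>\<^bsub>V\<^esub> v \<in> N +>\<^bsub>V\<^esub> (c \<odot>\<^bsub>V\<^esub> x)" by (auto simp: a_r_coset_def')
    then show ?thesis using sub.a_repr_independence' x by (metis UNIV_I partial_object.select_convs(1) smult_closed)
  qed
  moreover have "x \<in> N +>\<^bsub>V\<^esub> x" using x by (rule sub.a_rcos_self)
  ultimately show ?thesis unfolding quot_mod_simps by blast
qed

lemma coset_add:
  "x \<in> carrier V \<Longrightarrow> y \<in> carrier V \<Longrightarrow> (N +>\<^bsub>V\<^esub> x) \<oplus>\<^bsub>V //\<^sub>m N\<^esub> (N +>\<^bsub>V\<^esub> y) = N +>\<^bsub>V\<^esub> (x \<oplus>\<^bsub>V\<^esub> y)"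
  unfolding quot_mod_simps by (rule sub.a_rcos_sum)

lemma coset_carrier: "(\<lambda>x. N +>\<^bsub>V\<^esub> x) ` carrier V = carrier (V //\<^sub>m N)"
  unfolding quot_mod_simps A_RCOSETS_def' by blast

lemma module_quot: "module class_ring (V //\<^sub>m N)"
proof (rule module_surj_image[OF module coset_carrier])
  show "N +>\<^bsub>V\<^esub> \<zero>\<^bsub>V\<^esub> = \<zero>\<^bsub>V //\<^sub>m N\<^esub>"
    using coset_zero_iff[of "\<zero>\<^bsub>V\<^esub>"] N by (simp add: quot_mod_simps)
qed (simp_all add: coset_add coset_smult)

end

text \<open>Sums of cosets are handled through sums of representatives, which are ordinary sums in a
  type. The operation \<open>sc\<close> acts on representatives and becomes the scalar
  multiplication after applying \<open>p\<close>.\<close>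

locale linear_surjection =
  fixes V :: "('k::field, 'v) module" and p :: "'a::ab_group_add \<Rightarrow> 'v" and S :: "'a set"
    and sc :: "'k \<Rightarrow> 'a \<Rightarrow> 'a"
  assumes module: "module class_ring V"
    and S: "0 \<in> S" "\<And>a b. a \<in> S \<Longrightarrow> b \<in> S \<Longrightarrow> a + b \<in> S" "\<And>c a. a \<in> S \<Longrightarrow> sc c a \<in> S"
    and sc_0: "\<And>a. sc 0 a = 0"
    and surj: "p ` S = carrier V"
    and p_add: "\<And>a b. a \<in> S \<Longrightarrow> b \<in> S \<Longrightarrow> p (a + b) = p a \<oplus>\<^bsub>V\<^esub> p b"
    and p_smult: "\<And>c a. a \<in> S \<Longrightarrow> p (sc c a) = c \<odot>\<^bsub>V\<^esub> p a"
    and p_0: "p 0 = \<zero>\<^bsub>V\<^esub>"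
begin

sublocale vectorspace class_ring V
  using module class_field by (rule vectorspace.intro)

definition spans :: "'i set \<Rightarrow> ('i \<Rightarrow> 'a) \<Rightarrow> bool" where
  "spans I b \<longleftrightarrow> b ` I \<subseteq> S \<and> (\<forall>x\<in>S. \<exists>c. p x = p (\<Sum>i\<in>I. sc (c i) (b i)))"

definition indep :: "'i set \<Rightarrow> ('i \<Rightarrow> 'a) \<Rightarrow> bool" where
  "indep I b \<longleftrightarrow> (\<forall>c. p (\<Sum>i\<in>I. sc (c i) (b i)) = \<zero>\<^bsub>V\<^esub> \<longrightarrow> (\<forall>i\<in>I. c i = 0))"

lemma p_closed: "a \<in> S \<Longrightarrow> p a \<in> carrier V"
  using surj by blast

lemma p_sum:
  assumes "finite I" "b ` I \<subseteq> S"
  shows "(\<Sum>i\<in>I. sc (c i) (b i)) \<in> S \<and> p (\<Sum>i\<in>I. sc (c i) (b i)) = finsum V (\<lambda>i. c i \<odot>\<^bsub>V\<^esub> p (b i)) I"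
  using assms
proof (induction I)
  case (insert i I)
  have "(\<lambda>i. c i \<odot>\<^bsub>V\<^esub> p (b i)) \<in> insert i I \<rightarrow> carrier V"
    using insert by (auto intro!: smult_closed p_closed)
  then have "finsum V (\<lambda>i. c i \<odot>\<^bsub>V\<^esub> p (b i)) (insert i I)
      = c i \<odot>\<^bsub>V\<^esub> p (b i) \<oplus>\<^bsub>V\<^esub> finsum V (\<lambda>i. c i \<odot>\<^bsub>V\<^esub> p (b i)) I"
    using insert by (intro M.finsum_insert) auto
  then show ?case using insert by (simp add: p_add p_smult S)
qed (simp add: S p_0)

lemma fin_dim_if_spans:
  assumes "finite I" "spans I b"
  shows fin_dim
proof -
  have b: "b ` I \<subseteq> S" using assms by (simp add: spans_def)
  let ?A = "p ` b ` I"
  have A: "?A \<subseteq> carrier V" using b p_closed by blast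
  interpret sub: LinearCombinations.submodule class_ring "span ?A" V using A by (rule span_is_submodule)
  have fin: "finsum V (\<lambda>i. c i \<odot>\<^bsub>V\<^esub> p (b i)) J \<in> span ?A" if "J \<subseteq> I" for c J
  proof -
    have "finite J" using that assms(1) finite_subset by blast
    then show ?thesis using that
    proof (induction J)
      case empty
      then show ?case by (simp add: sub.zero_closed)
    next
      case (insert i J)
      have *: "(\<lambda>i. c i \<odot>\<^bsub>V\<^esub> p (b i)) \<in> insert i J \<rightarrow> carrier V"
        using insert b by (auto intro!: smult_closed p_closed)
      have "p (b i) \<in> span ?A" using in_own_span[OF A] insert by blast
      then have "c i \<odot>\<^bsub>V\<^esub> p (b i) \<in> span ?A" by (intro sub.smult_closed) simp_all
      then have "c i \<odot>\<^bsub>V\<^esub> p (b i) \<oplus>\<^bsub>V\<^esub> finsum V (\<lambda>i. c i \<odot>\<^bsub>V\<^esub> p (b i)) J \<in> span ?A"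
        using insert by (intro sub.m_closed) auto
      also have "c i \<odot>\<^bsub>V\<^esub> p (b i) \<oplus>\<^bsub>V\<^esub> finsum V (\<lambda>i. c i \<odot>\<^bsub>V\<^esub> p (b i)) J
          = finsum V (\<lambda>i. c i \<odot>\<^bsub>V\<^esub> p (b i)) (insert i J)"
        using insert * by (intro M.finsum_insert[symmetric]) auto
      finally show ?case .
    qed
  qed
  have "carrier V \<subseteq> span ?A"
  proof
    fix X assume "X \<in> carrier V"
    then obtain x where x: "x \<in> S" "X = p x" using surj by blast
    then obtain c where "X = p (\<Sum>i\<in>I. sc (c i) (b i))" using assms(2) by (auto simp: spans_def)
    then show "X \<in> span ?A" using p_sum[OF assms(1) b, of c] fin[of I c] by simp
  qed
  moreover have "span ?A \<subseteq> carrier V" using A by (rule span_is_subset2)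
  ultimately have "span ?A = carrier V" by (rule equalityI[rotated])
  then show ?thesis unfolding fin_dim_def using A assms(1) by (intro exI[of _ ?A] conjI) simp_all
qed

lemma indep_inj:
  assumes "finite I" "b ` I \<subseteq> S" "indep I b"
  shows "inj_on (\<lambda>i. p (b i)) I"
proof (rule inj_onI, rule ccontr)
  fix i j assume ij: "i \<in> I" "j \<in> I" "p (b i) = p (b j)" "i \<noteq> j"
  define c :: "'b \<Rightarrow> 'k" where "c = (\<lambda>k. if k = i then 1 else if k = j then - 1 else 0)"
  have "(\<Sum>k\<in>I. sc (c k) (b k)) = (\<Sum>k\<in>I. (if k = i then sc 1 (b i) else 0) + (if k = j then sc (- 1) (b j) else 0))"
    using ij by (intro sum.cong) (auto simp: c_def sc_0)
  also have "\<dots> = sc 1 (b i) + sc (- 1) (b j)"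
    using ij assms(1) by (simp add: sum.distrib)
  also have "p \<dots> = 1 \<odot>\<^bsub>V\<^esub> p (b j) \<oplus>\<^bsub>V\<^esub> (- 1) \<odot>\<^bsub>V\<^esub> p (b j)"
    using ij assms(2) by (simp add: p_add p_smult S image_subset_iff)
  also have "\<dots> = (1 + - 1) \<odot>\<^bsub>V\<^esub> p (b j)"
    using smult_l_distr[of 1 "- 1" "p (b j)"] p_closed ij assms(2) by (simp add: image_subset_iff)
  also have "\<dots> = \<zero>\<^bsub>V\<^esub>"
    using smult_l_null[of "p (b j)"] p_closed ij assms(2) by (simp add: image_subset_iff)
  finally have "c i = 0" using assms(3) ij by (simp add: indep_def)
  then show False by (simp add: c_def)
qed

lemma lincomb_image:
  assumes "finite I" "b ` I \<subseteq> S" "inj_on (\<lambda>i. p (b i)) I"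
  shows "lincomb a ((\<lambda>i. p (b i)) ` I) = p (\<Sum>i\<in>I. sc (a (p (b i))) (b i))"
proof -
  have "lincomb a ((\<lambda>i. p (b i)) ` I) = finsum V (\<lambda>i. a (p (b i)) \<odot>\<^bsub>V\<^esub> p (b i)) I"
    unfolding lincomb_def using assms
    by (intro M.finsum_reindex) (auto intro!: smult_closed p_closed)
  then show ?thesis using p_sum[OF assms(1,2), of "\<lambda>i. a (p (b i))"] by simp
qed

lemma vdim_eqI:
  assumes I: "finite I" and b: "spans I b" "indep I b"
  shows "vdim V = enat (card I)"
proof -
  have bS: "b ` I \<subseteq> S" using b by (simp add: spans_def)
  have inj: "inj_on (\<lambda>i. p (b i)) I" by (rule indep_inj[OF I bS b(2)])
  let ?A = "(\<lambda>i. p (b i)) ` I"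
  have A: "?A \<subseteq> carrier V" "finite ?A" using bS p_closed I by auto
  have "basis ?A"
    unfolding basis_def
  proof (intro conjI A)
    show "lin_indpt ?A"
    proof (rule finite_lin_indpt2[OF A(2,1)])
      fix a assume "lincomb a ?A = \<zero>\<^bsub>V\<^esub>"
      then have "\<forall>i\<in>I. a (p (b i)) = 0"
        using spec[OF b(2)[unfolded indep_def], of "\<lambda>i. a (p (b i))"]
        unfolding lincomb_image[OF I bS inj] by simp
      then show "\<forall>v\<in>?A. a v = \<zero>\<^bsub>class_ring\<^esub>" by simp
    qed
    show "span ?A = carrier V"
    proof (rule equalityI[OF span_is_subset2[OF A(1)]], rule subsetI)
      fix X assume "X \<in> carrier V"
      then obtain x where x: "x \<in> S" "X = p x" using surj by blast
      then obtain c where c: "X = p (\<Sum>i\<in>I. sc (c i) (b i))" using b(1) by (auto simp: spans_def)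
      define a where "a = (\<lambda>v. c (inv_into I (\<lambda>i. p (b i)) v))"
      have "lincomb a ?A = p (\<Sum>i\<in>I. sc (a (p (b i))) (b i))" by (rule lincomb_image[OF I bS inj])
      also have "(\<Sum>i\<in>I. sc (a (p (b i))) (b i)) = (\<Sum>i\<in>I. sc (c i) (b i))"
        by (intro sum.cong refl) (simp add: a_def inv_into_f_f[OF inj])
      finally have "X = lincomb a ?A" using c by simp
      then show "X \<in> span ?A" unfolding finite_span[OF A(2,1)] by auto
    qed
  qed
  then have "dim = card ?A" "fin_dim"
    using dim_basis[OF A(2)] fin_dim_if_spans[OF I b(1)] by auto
  then show ?thesis using card_image[OF inj] by (simp add: vdim_def)
qed

lemma ex_basis_family:
  assumes fin_dim
  obtains n b where "spans {..<n::nat} b" "indep {..<n} b"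
proof -
  obtain B where B: "finite B" "basis B" using finite_basis_exists[OF assms] by blast
  then have BV: "lin_indpt B" "span B = carrier V" "B \<subseteq> carrier V" by (simp_all add: basis_def)
  obtain e where e: "bij_betw e {..<card B} B"
    using ex_bij_betw_nat_finite[OF B(1)] by (auto simp: atLeast0LessThan)
  have "\<forall>v\<in>B. \<exists>x\<in>S. p x = v"
  proof
    fix v assume "v \<in> B"
    then have "v \<in> p ` S" using BV(3) surj by auto
    then show "\<exists>x\<in>S. p x = v" by auto
  qed
  then obtain r where r: "\<And>v. v \<in> B \<Longrightarrow> r v \<in> S" "\<And>v. v \<in> B \<Longrightarrow> p (r v) = v" by metis
  define b where "b = (\<lambda>i. r (e i))"
  let ?n = "card B"
  have eB: "e i \<in> B" if "i < ?n" for i using e that by (auto simp: bij_betw_def)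
  have bS: "b ` {..<?n} \<subseteq> S" using r eB by (auto simp: b_def)
  have pb: "p (b i) = e i" if "i < ?n" for i using r eB that by (simp add: b_def)
  have inj: "inj_on (\<lambda>i. p (b i)) {..<?n}" using e pb by (simp add: bij_betw_def inj_on_def)
  have im: "(\<lambda>i. p (b i)) ` {..<?n} = B" using e pb by (auto simp: bij_betw_def)
  note lc = lincomb_image[OF finite_lessThan bS inj, unfolded im]
  have "spans {..<?n} b"
    unfolding spans_def
  proof (intro conjI ballI bS)
    fix x assume "x \<in> S"
    then have "p x \<in> span B" using p_closed BV by simp
    then obtain a where "p x = lincomb a B" unfolding finite_span[OF B(1) BV(3)] by blast
    then show "\<exists>c. p x = p (\<Sum>i<?n. sc (c i) (b i))" unfolding lc by (intro exI[of _ "\<lambda>i. a (p (b i))"])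
  qed
  moreover have "indep {..<?n} b"
    unfolding indep_def
  proof (intro allI impI ballI)
    fix c i assume c: "p (\<Sum>i<?n. sc (c i) (b i)) = \<zero>\<^bsub>V\<^esub>" and i: "i \<in> {..<?n}"
    define a where "a = (\<lambda>v. c (inv_into {..<?n} (\<lambda>i. p (b i)) v))"
    have a: "a (p (b i)) = c i" if "i < ?n" for i
      using that by (simp add: a_def inv_into_f_f[OF inj])
    have "lincomb a B = \<zero>\<^bsub>V\<^esub>" unfolding lc c[symmetric] by (intro arg_cong[of _ _ p] sum.cong) (simp_all add: a)
    moreover have "p (b i) \<in> B" using im i by blast
    ultimately have "a (p (b i)) = 0"
      using lin_dep_crit[OF B(1) subset_refl, of a "p (b i)"] BV(1) by auto
    then show "c i = 0" using a i by simp
  qed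
  ultimately show ?thesis using that by blast
qed

end

section \<open>The modules and their coset spaces\<close>

lemma KP_sym_simps [simp]:
  "carrier (KP_sym m) = sym_laurent m" "mult (KP_sym m) = (*)" "one (KP_sym m) = 1"
  "zero (KP_sym m) = 0" "add (KP_sym m) = (+)" "smult (KP_sym m) = (\<lambda>c f. cst c * f)"
  by (simp_all add: KP_sym_def)

lemma Uq_alg_simps [simp]:
  "carrier Uq_alg = UNIV" "zero Uq_alg = 0" "add Uq_alg = (+)" "smult Uq_alg = (\<lambda>c a. scal c * a)"
  by (simp_all add: Uq_alg_def)

lemma cring_class_ring: "cring (class_ring :: 'a::field ring)"
  using class_field unfolding field_def domain_def by blast

lemma module_KP_sym: "module class_ring (KP_sym m)"
proof (rule moduleI[OF cring_class_ring])
  show "abelian_group (KP_sym m)"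
  proof (rule abelian_groupI)
    fix f assume "f \<in> carrier (KP_sym m)"
    then show "\<exists>g\<in>carrier (KP_sym m). g \<oplus>\<^bsub>KP_sym m\<^esub> f = \<zero>\<^bsub>KP_sym m\<^esub>"
      by (intro bexI[of _ "- f"]) (simp_all add: sym_laurent_uminus)
  qed (simp_all add: sym_laurent_add sym_laurent_0 add_ac)
qed (simp_all add: sym_laurent_mult sym_laurent_cst distrib_right distrib_left single_add cst_mult mult.assoc)

lemma module_U0_alg: "module class_ring U0_alg"
  by (rule moduleI[OF cring_class_ring U0.abelian_group_axioms])
    (simp_all add: U0_closed distrib_right distrib_left scal_add scal_mult mult.assoc)

lemma module_Uq_alg: "module class_ring Uq_alg"
proof (rule moduleI[OF cring_class_ring])
  show "abelian_group Uq_alg"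
  proof (rule abelian_groupI)
    fix a assume "a \<in> carrier Uq_alg"
    show "\<exists>b\<in>carrier Uq_alg. b \<oplus>\<^bsub>Uq_alg\<^esub> a = \<zero>\<^bsub>Uq_alg\<^esub>"
      by (intro bexI[of _ "- a"]) simp_all
  qed (simp_all add: add_ac)
qed (simp_all add: distrib_right distrib_left scal_add scal_mult mult.assoc)

interpretation U0q: module_quotient U0_alg "Iq0 m" for m
  by (rule module_quotient.intro[OF module_U0_alg])
    (simp_all add: Iq0_subset_U0 Iq0_closed(1,2) Iq0_closed(3)[OF U0_closed(1)])

interpretation Uqq: module_quotient Uq_alg "Iq m" for m
  by (rule module_quotient.intro[OF module_Uq_alg]) (simp_all add: Iq_closed(1,2,3))

lemma Iq_coset_eq_iff: "Iq m +>\<^bsub>Uq_alg\<^esub> a = Iq m +>\<^bsub>Uq_alg\<^esub> b \<longleftrightarrow> a - b \<in> Iq m"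
proof
  assume "Iq m +>\<^bsub>Uq_alg\<^esub> a = Iq m +>\<^bsub>Uq_alg\<^esub> b"
  then have "a \<in> Iq m +>\<^bsub>Uq_alg\<^esub> b" using Uqq.sub.a_rcos_self[of a m] by simp
  then show "a - b \<in> Iq m" by (auto simp: a_r_coset_def')
next
  assume "a - b \<in> Iq m"
  then have "a \<in> Iq m +>\<^bsub>Uq_alg\<^esub> b" by (auto simp: a_r_coset_def' intro!: bexI[of _ "a - b"])
  then show "Iq m +>\<^bsub>Uq_alg\<^esub> a = Iq m +>\<^bsub>Uq_alg\<^esub> b"
    using Uqq.sub.a_repr_independence'[of a m b] by simp
qed

subsection \<open>The identification of the Cartan quotient\<close>

lemma hw_char_coset:
  assumes "u \<in> U0"
  shows "hw_char m (SOME v. v \<in> Iq0 m +>\<^bsub>U0_alg\<^esub> u) = hw_char m u"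
proof -
  have "u \<in> Iq0 m +>\<^bsub>U0_alg\<^esub> u" using U0q.sub.a_rcos_self[of u m] assms by simp
  then have "(SOME v. v \<in> Iq0 m +>\<^bsub>U0_alg\<^esub> u) \<in> Iq0 m +>\<^bsub>U0_alg\<^esub> u" by (rule someI)
  then obtain a where a: "a \<in> Iq0 m" "(SOME v. v \<in> Iq0 m +>\<^bsub>U0_alg\<^esub> u) = a + u"
    by (auto simp: a_r_coset_def')
  have "hw_char m (a + u) = hw_char m a + hw_char m u"
    using a(1) Iq0_subset_U0 assms by (intro hw_char_hom) auto
  then show ?thesis using a hw_char_Iq0 by simp
qed

text \<open>\<open>Lambda_iso\<close> is a choice, so a witness is required: \<open>hw_char\<close>
  on representatives, injective by \<open>hw_char_kernel\<close>. Afterwards only the specification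
  of the choice is used.\<close>

lemma Lambda_iso_spec:
  assumes m: "m \<ge> 1"
  shows "Lambda_iso m \<in> ring_iso (U0_alg //\<^sub>m Iq0 m) (KP_sym m) \<and>
     Lambda_iso m \<in> module_hom class_ring (U0_alg //\<^sub>m Iq0 m) (KP_sym m) \<and>
     (\<forall>r\<in>{1..m}. Lambda_iso m (Iq0 m +>\<^bsub>U0_alg\<^esub> Lambda (int r)) = (- 1) ^ r * elem_sym m r)"
proof -
  let ?Q = "U0_alg //\<^sub>m Iq0 m" and ?c = "\<lambda>u. Iq0 m +>\<^bsub>U0_alg\<^esub> u"
  define \<phi> where "\<phi> = (\<lambda>X. hw_char m (SOME u. u \<in> X))"
  have \<phi>: "\<phi> (?c u) = hw_char m u" if "u \<in> U0" for u
    using hw_char_coset[OF that] by (simp add: \<phi>_def)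
  have car: "carrier ?Q = ?c ` U0" using U0q.coset_carrier[of m] by simp
  have add: "?c u \<oplus>\<^bsub>?Q\<^esub> ?c v = ?c (u + v)" if "u \<in> U0" "v \<in> U0" for u v
    using U0q.coset_add[of u v m] that by simp
  have mult: "?c u \<otimes>\<^bsub>?Q\<^esub> ?c v = ?c (u * v)" if "u \<in> U0" "v \<in> U0" for u v
    using ideal.rcoset_mult_add[OF ideal_Iq0, of u v m] that by (simp add: quot_mod_simps)
  have smult: "c \<odot>\<^bsub>?Q\<^esub> ?c u = ?c (scal c * u)" if "u \<in> U0" for c u
    using U0q.coset_smult[where x = u and c = c and m = m] that by simp
  have one: "\<one>\<^bsub>?Q\<^esub> = ?c 1" by (simp add: quot_mod_simps)
  have hom: "\<phi> \<in> Ring.ring_hom ?Q (KP_sym m)"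
    by (rule ring_hom_memI; unfold car one; (elim imageE)?)
      (simp_all add: \<phi> add mult U0_closed hw_char hw_char_hom hw_char_consts)
  have "inj_on \<phi> (carrier ?Q)"
    unfolding car
  proof (rule inj_onI, elim imageE)
    fix X Y u v assume XY: "\<phi> X = \<phi> Y" "X = ?c u" "u \<in> U0" "Y = ?c v" "v \<in> U0"
    then have "hw_char m (u - v) = 0" by (simp add: \<phi> hw_char_diff)
    then have "u - v \<in> Iq0 m" using XY by (intro hw_char_kernel m U0_closed) auto
    then have "u \<in> ?c v" by (auto simp: a_r_coset_def' intro!: bexI[of _ "u - v"])
    then show "X = Y" using U0q.sub.a_repr_independence'[of u m v] XY by simp
  qed
  moreover have "\<phi> ` carrier ?Q = sym_laurent m"
  proof -
    have "sym_laurent m \<subseteq> hw_char m ` U0" by (rule subsetI, erule hw_char_surj) auto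
    moreover have "hw_char m ` U0 \<subseteq> sym_laurent m" using hw_char(1) by auto
    ultimately have "hw_char m ` U0 = sym_laurent m" by (rule equalityI[rotated])
    then show ?thesis unfolding car image_image using \<phi> by (simp cong: image_cong_simp)
  qed
  ultimately have iso: "\<phi> \<in> ring_iso ?Q (KP_sym m)"
    using hom by (simp add: ring_iso_def bij_betw_def)
  have mod: "\<phi> \<in> module_hom class_ring ?Q (KP_sym m)"
    unfolding module_hom_def car
    by (auto simp: \<phi> add smult U0_closed hw_char hw_char_hom)
  have val: "\<phi> (?c (Lambda (int r))) = (- 1) ^ r * elem_sym m r" for r
    by (simp add: \<phi> Lambda_U0 hw_char_hom Lambda_val_def elem_sym_esym)
  have "\<exists>\<phi>. \<phi> \<in> ring_iso ?Q (KP_sym m) \<and> \<phi> \<in> module_hom class_ring ?Q (KP_sym m) \<and>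
     (\<forall>r\<in>{1..m}. \<phi> (?c (Lambda (int r))) = (- 1) ^ r * elem_sym m r)"
    by (intro exI[of _ \<phi>] conjI ballI iso mod val)
  from someI_ex[OF this] show ?thesis unfolding Lambda_iso_def .
qed

text \<open>Defined by the chosen \<open>Lambda_iso\<close>. The link with \<open>hw_char\<close>
  goes through kernels: an element of \<open>U0\<close> with zero character lies in
  \<open>Iq0\<close>, where this map vanishes.\<close>

definition Cartan_proj :: "nat \<Rightarrow> uq \<Rightarrow> laurent" where
  "Cartan_proj m u = Lambda_iso m (Iq0 m +>\<^bsub>U0_alg\<^esub> u)"

lemma Cartan_proj:
  assumes m: "m \<ge> 1"
  shows "u \<in> U0 \<Longrightarrow> Cartan_proj m u \<in> sym_laurent m"
    and "u \<in> U0 \<Longrightarrow> v \<in> U0 \<Longrightarrow> Cartan_proj m (u + v) = Cartan_proj m u + Cartan_proj m v"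
    and "u \<in> U0 \<Longrightarrow> v \<in> U0 \<Longrightarrow> Cartan_proj m (u * v) = Cartan_proj m u * Cartan_proj m v"
    and "u \<in> U0 \<Longrightarrow> Cartan_proj m (scal c * u) = cst c * Cartan_proj m u"
    and "u \<in> Iq0 m \<Longrightarrow> Cartan_proj m u = 0"
    and "f \<in> sym_laurent m \<Longrightarrow> \<exists>u\<in>U0. Cartan_proj m u = f"
    and "u \<in> U0 \<Longrightarrow> inv_into (carrier (U0_alg //\<^sub>m Iq0 m)) (Lambda_iso m) (Cartan_proj m u)
      = Iq0 m +>\<^bsub>U0_alg\<^esub> u"
proof -
  let ?Q = "U0_alg //\<^sub>m Iq0 m" and ?c = "\<lambda>u. Iq0 m +>\<^bsub>U0_alg\<^esub> u"
  have L: "Lambda_iso m \<in> Ring.ring_hom ?Q (KP_sym m)" "bij_betw (Lambda_iso m) (carrier ?Q) (sym_laurent m)"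
    "Lambda_iso m \<in> module_hom class_ring ?Q (KP_sym m)"
    using Lambda_iso_spec[OF m] by (auto simp: ring_iso_def)
  have car: "carrier ?Q = ?c ` U0" using U0q.coset_carrier[of m] by simp
  have mult: "?c u \<otimes>\<^bsub>?Q\<^esub> ?c v = ?c (u * v)" if "u \<in> U0" "v \<in> U0" for u v
    using ideal.rcoset_mult_add[OF ideal_Iq0, of u v m] that by (simp add: quot_mod_simps)
  show 1: "u \<in> U0 \<Longrightarrow> Cartan_proj m u \<in> sym_laurent m" for u
    unfolding Cartan_proj_def using L(2) car by (auto simp: bij_betw_def)
  show 2: "u \<in> U0 \<Longrightarrow> v \<in> U0 \<Longrightarrow> Cartan_proj m (u + v) = Cartan_proj m u + Cartan_proj m v" for u v
    unfolding Cartan_proj_def using ring_hom_add[OF L(1), of "?c u" "?c v"] U0q.coset_add[of u v m]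
    by (simp add: car)
  show "u \<in> U0 \<Longrightarrow> v \<in> U0 \<Longrightarrow> Cartan_proj m (u * v) = Cartan_proj m u * Cartan_proj m v"
    unfolding Cartan_proj_def using ring_hom_mult[OF L(1), of "?c u" "?c v"] mult[of u v]
    by (simp add: car)
  show "u \<in> U0 \<Longrightarrow> Cartan_proj m (scal c * u) = cst c * Cartan_proj m u"
    unfolding Cartan_proj_def using module_hom_smult[OF L(3), of c "?c u"] U0q.coset_smult[where x = u and c = c and m = m]
    by (simp add: car)
  show "Cartan_proj m u = 0" if u: "u \<in> Iq0 m"
  proof -
    have U: "u \<in> U0" "0 \<in> U0" using u Iq0_subset_U0 U0_closed by auto
    have "?c u = ?c 0"
      using U0q.coset_zero_iff[of u m] U0q.coset_zero_iff[of 0 m] U u by (simp add: Iq0_closed)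
    moreover have "Cartan_proj m (0 + 0) = Cartan_proj m 0 + Cartan_proj m 0" by (rule 2[OF U(2,2)])
    ultimately show ?thesis by (simp add: Cartan_proj_def)
  qed
  show "\<exists>u\<in>U0. Cartan_proj m u = f" if "f \<in> sym_laurent m"
  proof -
    have "f \<in> Lambda_iso m ` ?c ` U0" using that L(2) car by (simp add: bij_betw_def)
    then show ?thesis by (auto simp: Cartan_proj_def)
  qed
  show "u \<in> U0 \<Longrightarrow> inv_into (carrier ?Q) (Lambda_iso m) (Cartan_proj m u) = ?c u"
    unfolding Cartan_proj_def using L(2) car by (intro inv_into_f_f) (auto simp: bij_betw_def)
qed

text \<open>The unions in \<open>W_act\<close> collapse to one coset because \<open>Iq\<close> is
  stable under right multiplication by \<open>U0\<close> and contains \<open>Iq0\<close>.\<close>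

lemma W_act_coset:
  assumes m: "m \<ge> 1" and u: "u \<in> U0"
  shows "W_act m (Iq m +>\<^bsub>Uq_alg\<^esub> a) (Cartan_proj m u) = Iq m +>\<^bsub>Uq_alg\<^esub> (a * u)"
proof -
  have eq: "Iq m +>\<^bsub>Uq_alg\<^esub> (b * v) = Iq m +>\<^bsub>Uq_alg\<^esub> (a * u)"
    if bv: "b \<in> Iq m +>\<^bsub>Uq_alg\<^esub> a" "v \<in> Iq0 m +>\<^bsub>U0_alg\<^esub> u" for b v
  proof -
    obtain i j where ij: "i \<in> Iq m" "b = i + a" "j \<in> Iq0 m" "v = j + u"
      using bv by (auto simp: a_r_coset_def')
    have "v \<in> U0" using ij u Iq0_subset_U0 by (auto intro!: U0_closed(2))
    then have "i * v + a * j \<in> Iq m"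
      using ij Iq0_subset_Iq by (intro Iq_closed(2) Iq_closed(3) Iq_mult_U0) auto
    also have "i * v + a * j = b * v - a * u" by (simp add: ij algebra_simps)
    finally show ?thesis by (simp add: Iq_coset_eq_iff)
  qed
  have "a \<in> Iq m +>\<^bsub>Uq_alg\<^esub> a" "u \<in> Iq0 m +>\<^bsub>U0_alg\<^esub> u"
    using Uqq.sub.a_rcos_self[of a m] U0q.sub.a_rcos_self[of u m] u by simp_all
  then show ?thesis
    unfolding W_act_def Cartan_proj(7)[OF m u] using eq by blast
qed

subsection \<open>Bases of the fibre\<close>

lemma (in linear_surjection) p_eq_iff:
  assumes "a \<in> S" "b \<in> S" "a - b \<in> S"
  shows "p a = p b \<longleftrightarrow> p (a - b) = \<zero>\<^bsub>V\<^esub>"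
proof -
  have "p a = p (a - b) \<oplus>\<^bsub>V\<^esub> p b" using p_add[OF assms(3,2)] by simp
  then show ?thesis using p_closed assms M.add.l_cancel_one[of "p b" "p (a - b)"] M.add.r_cancel_one by simp
qed

locale maximal_fibre =
  fixes m :: nat and M :: "laurent set"
  assumes m: "m \<ge> 1" and M: "maximalideal M (KP_sym m)"
begin

lemma M_closed:
  "M \<subseteq> sym_laurent m" "0 \<in> M" "f \<in> M \<Longrightarrow> g \<in> M \<Longrightarrow> f + g \<in> M" "f \<in> M \<Longrightarrow> g \<in> sym_laurent m \<Longrightarrow> g * f \<in> M"
proof -
  interpret maximalideal M "KP_sym m" by (rule M)
  show "M \<subseteq> sym_laurent m" "0 \<in> M" "f \<in> M \<Longrightarrow> g \<in> M \<Longrightarrow> f + g \<in> M"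
    "f \<in> M \<Longrightarrow> g \<in> sym_laurent m \<Longrightarrow> g * f \<in> M"
    using Icarr additive_subgroup.zero_closed[OF additive_subgroup_axioms]
      additive_subgroup.a_closed[OF additive_subgroup_axioms, of f g] I_l_closed[of f g] by auto
qed

sublocale K: module_quotient "KP_sym m" M
  by (rule module_quotient.intro[OF module_KP_sym]) (simp_all add: M_closed sym_laurent_cst)

sublocale K: linear_surjection "KP_sym m //\<^sub>m M" "\<lambda>f. M +>\<^bsub>KP_sym m\<^esub> f" "sym_laurent m" "\<lambda>c f. cst c * f"
proof (rule linear_surjection.intro)
  show "module class_ring (KP_sym m //\<^sub>m M)" by (rule K.module_quot)
  show "(\<lambda>f. M +>\<^bsub>KP_sym m\<^esub> f) ` sym_laurent m = carrier (KP_sym m //\<^sub>m M)"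
    using K.coset_carrier by simp
  show "M +>\<^bsub>KP_sym m\<^esub> 0 = \<zero>\<^bsub>KP_sym m //\<^sub>m M\<^esub>"
    using K.coset_zero_iff[of 0] by (simp add: quot_mod_simps sym_laurent_0 M_closed)
qed (use K.coset_add K.coset_smult in \<open>simp_all add: sym_laurent_0 sym_laurent_add sym_laurent_mult sym_laurent_cst\<close>)

lemma M_coset_zero_iff: "f \<in> sym_laurent m \<Longrightarrow> M +>\<^bsub>KP_sym m\<^esub> f = \<zero>\<^bsub>KP_sym m //\<^sub>m M\<^esub> \<longleftrightarrow> f \<in> M"
  using K.coset_zero_iff[of f] by (simp add: quot_mod_simps)

abbreviation wcl :: "uq \<Rightarrow> uq set" where
  "wcl a \<equiv> Iq m +>\<^bsub>Uq_alg\<^esub> a"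

abbreviation proj :: "uq \<Rightarrow> laurent" where
  "proj u \<equiv> Cartan_proj m u"

lemma Wq_class:
  "carrier (Wq m) = range wcl" "wcl a \<oplus>\<^bsub>Wq m\<^esub> wcl b = wcl (a + b)" "c \<odot>\<^bsub>Wq m\<^esub> wcl a = wcl (scal c * a)"
  "\<zero>\<^bsub>Wq m\<^esub> = wcl 0"
  unfolding Wq_def
  using Uqq.coset_carrier[of m] Uqq.coset_add[of a b m] Uqq.coset_smult[where x = a and c = c and m = m]
    Uqq.coset_zero_iff[of 0 m] Iq_closed(1)[of m]
  by (simp_all add: quot_mod_simps)

text \<open>The preimage in \<open>U_q\<close> of \<open>W_times m M\<close>, described by
  coefficients with respect to the generators.\<close>

definition fibre_ideal :: "uq set" where
  "fibre_ideal = {a. \<exists>y. (\<forall>k. y k \<in> U0 \<and> proj (y k) \<in> M) \<and> a - (\<Sum>k<2 ^ m. gen_elt m k * y k) \<in> Iq m}"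

lemma proj_0: "proj 0 = 0"
  by (rule Cartan_proj(5)[OF m Iq0_closed(1)])

lemma fibre_idealI:
  "(\<And>k. y k \<in> U0) \<Longrightarrow> (\<And>k. proj (y k) \<in> M) \<Longrightarrow> a - (\<Sum>k<2 ^ m. gen_elt m k * y k) \<in> Iq m \<Longrightarrow> a \<in> fibre_ideal"
  unfolding fibre_ideal_def by blast

lemma fibre_idealE:
  assumes "a \<in> fibre_ideal"
  obtains y where "\<And>k. y k \<in> U0" "\<And>k. proj (y k) \<in> M" "a - (\<Sum>k<2 ^ m. gen_elt m k * y k) \<in> Iq m"
  using assms unfolding fibre_ideal_def by blast

text \<open>For the last clause, where \<open>a\<close> is arbitrary, expand \<open>a\<close> in the
  generators and move \<open>u\<close> into the coefficients.\<close>

lemma fibre_ideal_closed: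
  "a \<in> Iq m \<Longrightarrow> a \<in> fibre_ideal" "a \<in> fibre_ideal \<Longrightarrow> b \<in> fibre_ideal \<Longrightarrow> a + b \<in> fibre_ideal"
  "a \<in> fibre_ideal \<Longrightarrow> scal c * a \<in> fibre_ideal" "u \<in> U0 \<Longrightarrow> proj u \<in> M \<Longrightarrow> a * u \<in> fibre_ideal"
proof -
  show "a \<in> fibre_ideal" if "a \<in> Iq m"
    using that by (intro fibre_idealI[of "\<lambda>k. 0"]) (simp_all add: U0_closed(4) proj_0 M_closed(2))
  show "a + b \<in> fibre_ideal" if a: "a \<in> fibre_ideal" and b: "b \<in> fibre_ideal"
  proof -
    obtain y where y: "\<And>k. y k \<in> U0" "\<And>k. proj (y k) \<in> M" "a - (\<Sum>k<2 ^ m. gen_elt m k * y k) \<in> Iq m"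
      using a by (rule fibre_idealE) blast
    obtain z where z: "\<And>k. z k \<in> U0" "\<And>k. proj (z k) \<in> M" "b - (\<Sum>k<2 ^ m. gen_elt m k * z k) \<in> Iq m"
      using b by (rule fibre_idealE) blast
    have "(a - (\<Sum>k<2 ^ m. gen_elt m k * y k)) + (b - (\<Sum>k<2 ^ m. gen_elt m k * z k)) \<in> Iq m"
      by (intro Iq_closed(2) y z)
    then have "a + b - (\<Sum>k<2 ^ m. gen_elt m k * (y k + z k)) \<in> Iq m"
      by (simp add: distrib_left sum.distrib add_diff_add)
    then show ?thesis
      by (rule fibre_idealI[rotated 2])
        (simp_all add: y z U0_closed(2) Cartan_proj(2)[OF m] M_closed(3))
  qed
  show "scal c * a \<in> fibre_ideal" if a: "a \<in> fibre_ideal"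
  proof -
    obtain y where y: "\<And>k. y k \<in> U0" "\<And>k. proj (y k) \<in> M" "a - (\<Sum>k<2 ^ m. gen_elt m k * y k) \<in> Iq m"
      using a by (rule fibre_idealE) blast
    have "scal c * (a - (\<Sum>k<2 ^ m. gen_elt m k * y k)) \<in> Iq m" by (intro Iq_closed(3) y)
    then have "scal c * a - (\<Sum>k<2 ^ m. gen_elt m k * (scal c * y k)) \<in> Iq m"
      by (simp add: right_diff_distrib sum_distrib_left scal_left_commute[of "gen_elt m _"])
    then show ?thesis
      by (rule fibre_idealI[rotated 2])
        (simp_all add: y U0_closed(1,3) Cartan_proj(4)[OF m] M_closed(4) sym_laurent_cst)
  qed
  show "a * u \<in> fibre_ideal" if u: "u \<in> U0" "proj u \<in> M"
  proof -
    obtain y where y: "\<And>k. y k \<in> U0" "a - (\<Sum>k<2 ^ m. gen_elt m k * y k) \<in> Iq m"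
      using gen_decomposition[OF m] by blast
    have "(a - (\<Sum>k<2 ^ m. gen_elt m k * y k)) * u \<in> Iq m" by (intro Iq_mult_U0 y u)
    then have "a * u - (\<Sum>k<2 ^ m. gen_elt m k * (y k * u)) \<in> Iq m"
      by (simp add: left_diff_distrib sum_distrib_right mult.assoc)
    then show ?thesis
      by (rule fibre_idealI[rotated 2])
        (simp_all add: y u U0_closed(3) Cartan_proj(3)[OF m] Cartan_proj(1)[OF m] M_closed(4))
  qed
qed

lemma W_times_gens:
  "{W_act m X f | X f. X \<in> carrier (Wq m) \<and> f \<in> M} = {wcl (a * u) | a u. u \<in> U0 \<and> proj u \<in> M}"
proof (intro equalityI subsetI)
  fix Y assume "Y \<in> {W_act m X f | X f. X \<in> carrier (Wq m) \<and> f \<in> M}"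
  then obtain a f where Y: "Y = W_act m (wcl a) f" "f \<in> M" unfolding Wq_class(1) by blast
  then obtain u where "u \<in> U0" "proj u = f" using Cartan_proj(6)[OF m, of f] M_closed(1) by blast
  then show "Y \<in> {wcl (a * u) | a u. u \<in> U0 \<and> proj u \<in> M}"
    using Y W_act_coset[OF m, of u a] by blast
next
  fix Y assume "Y \<in> {wcl (a * u) | a u. u \<in> U0 \<and> proj u \<in> M}"
  then obtain a u where "Y = wcl (a * u)" "u \<in> U0" "proj u \<in> M" by blast
  then show "Y \<in> {W_act m X f | X f. X \<in> carrier (Wq m) \<and> f \<in> M}"
    using W_act_coset[OF m, of u a] Wq_class(1) by blast
qed

lemma W_gens_carrier: "{wcl (a * u) | a u. u \<in> U0 \<and> proj u \<in> M} \<subseteq> carrier (Wq m)"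
  unfolding Wq_class(1) by blast

sublocale W: module class_ring "Wq m"
  unfolding Wq_def by (rule Uqq.module_quot)

lemma W_times_submodule: "LinearCombinations.submodule class_ring (W_times m M) (Wq m)"
  unfolding W_times_def W_times_gens by (rule W.span_is_submodule[OF W_gens_carrier])

text \<open>The image of \<open>fibre_ideal\<close> is a submodule containing the generators of
  \<open>W_times\<close>, which gives one inclusion. Each element of it is a sum of such generators,
  which gives the other.\<close>

lemma wcl_W_times_iff: "wcl a \<in> W_times m M \<longleftrightarrow> a \<in> fibre_ideal"
proof
  have "W_times m M \<subseteq> wcl ` fibre_ideal"
    unfolding W_times_def W_times_gens
  proof (rule W.span_is_subset)
    show "{wcl (a * u) | a u. u \<in> U0 \<and> proj u \<in> M} \<subseteq> wcl ` fibre_ideal"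
      using fibre_ideal_closed(4) by blast
    show "LinearCombinations.submodule class_ring (wcl ` fibre_ideal) (Wq m)"
    proof (rule LinearCombinations.submodule.intro[OF W.module_axioms])
      show "wcl ` fibre_ideal \<subseteq> carrier (Wq m)" unfolding Wq_class(1) by blast
      show "\<zero>\<^bsub>Wq m\<^esub> \<in> wcl ` fibre_ideal"
        unfolding Wq_class(4) by (intro imageI fibre_ideal_closed(1) Iq_closed(1))
    next
      fix v w assume "v \<in> wcl ` fibre_ideal" "w \<in> wcl ` fibre_ideal"
      then show "v \<oplus>\<^bsub>Wq m\<^esub> w \<in> wcl ` fibre_ideal"
        by (elim imageE) (simp only: Wq_class(2), intro imageI fibre_ideal_closed(2))
    next
      fix c :: K and v assume "v \<in> wcl ` fibre_ideal"
      then show "c \<odot>\<^bsub>Wq m\<^esub> v \<in> wcl ` fibre_ideal"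
        by (elim imageE) (simp only: Wq_class(3), intro imageI fibre_ideal_closed(3))
    qed
  qed
  moreover assume "wcl a \<in> W_times m M"
  ultimately obtain t where t: "t \<in> fibre_ideal" "wcl a = wcl t" by blast
  then have "a - t \<in> Iq m" by (simp add: Iq_coset_eq_iff)
  from fibre_ideal_closed(2)[OF fibre_ideal_closed(1)[OF this] t(1)] show "a \<in> fibre_ideal" by simp
next
  assume "a \<in> fibre_ideal"
  then obtain y where y: "\<And>k. y k \<in> U0" "\<And>k. proj (y k) \<in> M" "a - (\<Sum>k<2 ^ m. gen_elt m k * y k) \<in> Iq m"
    by (rule fibre_idealE) blast
  interpret S: LinearCombinations.submodule class_ring "W_times m M" "Wq m" by (rule W_times_submodule)
  have g: "wcl (b * u) \<in> W_times m M" if "u \<in> U0" "proj u \<in> M" for b u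
    using W.in_own_span[OF W_gens_carrier] that unfolding W_times_def W_times_gens by blast
  have "wcl (\<Sum>k<n. gen_elt m k * y k) \<in> W_times m M" for n :: nat
  proof (induction n)
    case 0
    show ?case using S.zero_closed by (simp add: Wq_class(4))
  next
    case (Suc n)
    have "wcl (\<Sum>k<n. gen_elt m k * y k) \<oplus>\<^bsub>Wq m\<^esub> wcl (gen_elt m n * y n) \<in> W_times m M"
      by (intro S.m_closed Suc g y)
    then show ?case by (simp add: Wq_class(2))
  qed
  moreover have "wcl a = wcl (\<Sum>k<2 ^ m. gen_elt m k * y k)" using y(3) by (simp add: Iq_coset_eq_iff)
  ultimately show "wcl a \<in> W_times m M" by simp
qed

sublocale WQ: module_quotient "Wq m" "W_times m M"
proof -
  interpret S: LinearCombinations.submodule class_ring "W_times m M" "Wq m" by (rule W_times_submodule)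
  show "module_quotient (Wq m) (W_times m M)"
    by (rule module_quotient.intro[OF W.module_axioms])
      (use S.subset S.zero_closed S.m_closed S.smult_closed in auto)
qed

abbreviation fcl :: "uq \<Rightarrow> uq set set" where
  "fcl a \<equiv> W_times m M +>\<^bsub>Wq m\<^esub> wcl a"

sublocale F: linear_surjection "Wq m //\<^sub>m W_times m M" fcl UNIV "\<lambda>c a. scal c * a"
proof (rule linear_surjection.intro)
  show "module class_ring (Wq m //\<^sub>m W_times m M)" by (rule WQ.module_quot)
  have w: "wcl a \<in> carrier (Wq m)" for a by (simp add: Wq_class(1))
  show "range fcl = carrier (Wq m //\<^sub>m W_times m M)"
    using WQ.coset_carrier unfolding Wq_class(1) image_image .
  show "fcl (a + b) = fcl a \<oplus>\<^bsub>Wq m //\<^sub>m W_times m M\<^esub> fcl b" for a b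
    unfolding WQ.coset_add[OF w w] Wq_class(2) ..
  show "fcl (scal c * a) = c \<odot>\<^bsub>Wq m //\<^sub>m W_times m M\<^esub> fcl a" for c a
    unfolding WQ.coset_smult[OF w] Wq_class(3) ..
  show "fcl 0 = \<zero>\<^bsub>Wq m //\<^sub>m W_times m M\<^esub>"
    using WQ.coset_zero_iff[OF w, of 0] by (simp add: quot_mod_simps wcl_W_times_iff fibre_ideal_closed(1) Iq_closed(1))
qed simp_all

lemma fcl_zero_iff: "fcl a = \<zero>\<^bsub>Wq m //\<^sub>m W_times m M\<^esub> \<longleftrightarrow> a \<in> fibre_ideal"
  using WQ.coset_zero_iff[of "wcl a"] by (simp add: quot_mod_simps wcl_W_times_iff Wq_class(1))

lemma fcl_eq_iff: "fcl a = fcl b \<longleftrightarrow> a - b \<in> fibre_ideal"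
  using F.p_eq_iff[of a b] by (simp add: fcl_zero_iff)

lemma mcl_eq_iff:
  "f \<in> sym_laurent m \<Longrightarrow> g \<in> sym_laurent m \<Longrightarrow> M +>\<^bsub>KP_sym m\<^esub> f = M +>\<^bsub>KP_sym m\<^esub> g \<longleftrightarrow> f - g \<in> M"
  using K.p_eq_iff[of f g] by (simp add: M_coset_zero_iff sym_laurent_diff)

lemma proj_scal_sum:
  assumes "finite I" "\<And>i. i \<in> I \<Longrightarrow> u i \<in> U0"
  shows "(\<Sum>i\<in>I. scal (c i) * u i) \<in> U0 \<and> proj (\<Sum>i\<in>I. scal (c i) * u i) = (\<Sum>i\<in>I. cst (c i) * proj (u i))"
  using assms
  by (induction I) (simp_all add: U0_closed proj_0 Cartan_proj(2)[OF m] Cartan_proj(4)[OF m])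

lemma proj_diff: "u \<in> U0 \<Longrightarrow> v \<in> U0 \<Longrightarrow> proj (u - v) = proj u - proj v"
  using Cartan_proj(2)[OF m, of "u - v" v] by (simp add: U0_closed)

text \<open>Freeness of \<open>W_q(m)\<close> over the Cartan quotient, in the form used for the
  fibre.\<close>

lemma gen_sum_Iq_proj:
  assumes "\<And>k. y k \<in> U0" "(\<Sum>k<2 ^ m. gen_elt m k * y k) \<in> Iq m" "k < 2 ^ m"
  shows "proj (y k) = 0"
  using gen_independent[OF m assms] assms(1) by (intro Cartan_proj(5) hw_char_kernel m)

text \<open>The basis consists of the generators times lifts to \<open>U0\<close> of a basis of the
  residue field. By freeness a relation in the fibre splits into one relation modulo the maximal
  ideal for each generator.\<close>

lemma vdim_finite:
  assumes b: "K.spans {..<n::nat} b" "K.indep {..<n} b"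
  shows "vdim (Wq m //\<^sub>m W_times m M) = enat (2 ^ m * n)"
proof -
  have bS: "b i \<in> sym_laurent m" if "i < n" for i using b(1) that by (auto simp: K.spans_def)
  have "\<exists>u\<in>U0. i < n \<longrightarrow> proj u = b i" for i
    using Cartan_proj(6)[OF m bS] U0_closed(4) by blast
  then obtain u where u: "\<And>i. u i \<in> U0" "\<And>i. i < n \<Longrightarrow> proj (u i) = b i" by metis
  define B where "B = (\<lambda>(k, i). gen_elt m k * u i)"
  define I where "I = {..<(2::nat) ^ m} \<times> {..<n}"
  define w where "w = (\<lambda>(c :: nat \<times> nat \<Rightarrow> K) k. \<Sum>i<n. scal (c (k, i)) * u i)"
  have wU: "w c k \<in> U0" and wp: "proj (w c k) = (\<Sum>i<n. cst (c (k, i)) * b i)" for c :: "nat \<times> nat \<Rightarrow> K" and k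
    using proj_scal_sum[of "{..<n}" u "\<lambda>i. c (k, i)"] u by (simp_all add: w_def)
  have sumB: "(\<Sum>x\<in>I. scal (c x) * B x) = (\<Sum>k<2 ^ m. gen_elt m k * w c k)" for c
  proof -
    have "(\<Sum>x\<in>I. scal (c x) * B x) = (\<Sum>k<2 ^ m. \<Sum>i<n. scal (c (k, i)) * (gen_elt m k * u i))"
      unfolding I_def B_def sum.cartesian_product[symmetric]
      by (simp add: sum.cartesian_product case_prod_beta)
    then show ?thesis
      by (simp add: w_def sum_distrib_left scal_left_commute[of "gen_elt m _"])
  qed
  have fin: "finite I" by (simp add: I_def)
  have "F.spans I B"
    unfolding F.spans_def
  proof (intro conjI ballI subset_UNIV)
    fix x
    obtain y where y: "\<And>k. y k \<in> U0" "x - (\<Sum>k<2 ^ m. gen_elt m k * y k) \<in> Iq m"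
      using gen_decomposition[OF m] by blast
    have "\<exists>c. proj (y k) - (\<Sum>i<n. cst (c i) * b i) \<in> M" for k
    proof -
      have yk: "proj (y k) \<in> sym_laurent m" by (rule Cartan_proj(1)[OF m y(1)])
      then obtain c where c: "M +>\<^bsub>KP_sym m\<^esub> proj (y k) = M +>\<^bsub>KP_sym m\<^esub> (\<Sum>i<n. cst (c i) * b i)"
        using b(1) unfolding K.spans_def by blast
      have "(\<Sum>i<n. cst (c i) * b i) \<in> sym_laurent m"
        by (intro sym_laurent_sum sym_laurent_mult sym_laurent_cst bS) simp
      then show ?thesis using c yk by (auto simp: mcl_eq_iff)
    qed
    then obtain c where c: "\<And>k. proj (y k) - (\<Sum>i<n. cst (c k i) * b i) \<in> M" by metis
    define c' where "c' = (\<lambda>(k, i). c k i)"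
    have "x - (\<Sum>a\<in>I. scal (c' a) * B a) \<in> fibre_ideal"
    proof (rule fibre_idealI)
      show "y k - w c' k \<in> U0" for k by (intro U0_closed(7) y wU)
      show "proj (y k - w c' k) \<in> M" for k
        using c[of k] by (simp add: proj_diff y wU wp c'_def)
      show "x - (\<Sum>a\<in>I. scal (c' a) * B a) - (\<Sum>k<2 ^ m. gen_elt m k * (y k - w c' k)) \<in> Iq m"
        using y(2) by (simp add: sumB right_diff_distrib sum_subtractf)
    qed
    then show "\<exists>c. fcl x = fcl (\<Sum>a\<in>I. scal (c a) * B a)" unfolding fcl_eq_iff by blast
  qed
  moreover have "F.indep I B"
    unfolding F.indep_def fcl_zero_iff
  proof (intro allI impI ballI)
    fix c x assume c: "(\<Sum>a\<in>I. scal (c a) * B a) \<in> fibre_ideal" and x: "x \<in> I"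
    obtain y where y: "\<And>k. y k \<in> U0" "\<And>k. proj (y k) \<in> M"
      "(\<Sum>k<2 ^ m. gen_elt m k * w c k) - (\<Sum>k<2 ^ m. gen_elt m k * y k) \<in> Iq m"
      using c unfolding sumB by (rule fibre_idealE) blast
    obtain k i where ki: "x = (k, i)" "k < 2 ^ m" "i < n" using x by (auto simp: I_def)
    have "proj (w c k - y k) = 0"
    proof (rule gen_sum_Iq_proj)
      show "w c k - y k \<in> U0" for k by (intro U0_closed(7) wU y)
      show "(\<Sum>k<2 ^ m. gen_elt m k * (w c k - y k)) \<in> Iq m"
        using y(3) by (simp add: right_diff_distrib sum_subtractf)
    qed (rule ki)
    then have "(\<Sum>i<n. cst (c (k, i)) * b i) = proj (y k)" by (simp add: proj_diff wU y wp)
    then have "(\<Sum>i<n. cst (c (k, i)) * b i) \<in> M" using y(2) by simp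
    then have "M +>\<^bsub>KP_sym m\<^esub> (\<Sum>i<n. cst (c (k, i)) * b i) = \<zero>\<^bsub>KP_sym m //\<^sub>m M\<^esub>"
      using M_closed(1) M_coset_zero_iff by blast
    then have "\<forall>i\<in>{..<n}. c (k, i) = 0"
      by (rule mp[OF spec[OF b(2)[unfolded K.indep_def], of "\<lambda>i. c (k, i)"]])
    then show "c x = 0" using ki(1,3) by blast
  qed
  ultimately have "vdim (Wq m //\<^sub>m W_times m M) = enat (card I)" by (rule F.vdim_eqI[OF fin])
  then show ?thesis by (simp add: I_def card_cartesian_product)
qed

text \<open>Expand \<open>gen_elt m 0 * u\<close> in a finite spanning family of the fibre and
  compare the coefficients of generator 0: those of the family span the residue field. By
  contraposition this settles residue fields of infinite degree.\<close>

lemma fin_dim_if_fibre_fin_dim: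
  assumes F.fin_dim
  shows K.fin_dim
proof -
  obtain n :: nat and B where B: "F.spans {..<n} B" by (rule F.ex_basis_family[OF assms])
  have "\<exists>y. (\<forall>k. y k \<in> U0) \<and> B i - (\<Sum>k<2 ^ m. gen_elt m k * y k) \<in> Iq m" for i
    by (rule gen_decomposition[OF m])
  then obtain y where y: "\<And>i k. y i k \<in> U0" "\<And>i. B i - (\<Sum>k<2 ^ m. gen_elt m k * y i k) \<in> Iq m" by metis
  have "K.spans {..<n} (\<lambda>i. proj (y i 0))"
    unfolding K.spans_def
  proof (intro conjI ballI)
    show "(\<lambda>i. proj (y i 0)) ` {..<n} \<subseteq> sym_laurent m" using Cartan_proj(1)[OF m y(1)] by blast
    fix f assume f: "f \<in> sym_laurent m"
    then obtain u where u: "u \<in> U0" "proj u = f" using Cartan_proj(6)[OF m] by blast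
    obtain c where c: "gen_elt m 0 * u - (\<Sum>i<n. scal (c i) * B i) \<in> fibre_ideal"
      using B unfolding F.spans_def fcl_eq_iff by blast
    obtain z where z: "\<And>k. z k \<in> U0" "\<And>k. proj (z k) \<in> M"
      "gen_elt m 0 * u - (\<Sum>i<n. scal (c i) * B i) - (\<Sum>k<2 ^ m. gen_elt m k * z k) \<in> Iq m"
      using c by (rule fibre_idealE) blast
    define v where "v = (\<lambda>k. \<Sum>i<n. scal (c i) * y i k)"
    have vU: "v k \<in> U0" and vp: "proj (v k) = (\<Sum>i<n. cst (c i) * proj (y i k))" for k
      using proj_scal_sum[of "{..<n}" "\<lambda>i. y i k" c] y(1) by (simp_all add: v_def)
    \<comment> \<open>The coefficients of a relation among the generators modulo \<open>Iq\<close>.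
      By freeness they project to 0; the case \<open>k = 0\<close> expresses
      \<open>f\<close>.\<close>
    define t where "t = (\<lambda>k. (if k = 0 then u else 0) - v k - z k)"
    have tU: "t k \<in> U0" for k
      unfolding t_def using u vU z U0_closed by (cases "k = 0") simp_all
    have sc: "(\<Sum>i<n. scal (c i) * (B i - (\<Sum>k<2 ^ m. gen_elt m k * y i k))) \<in> Iq m" for n
      by (induction n) (simp_all add: Iq_closed(1) Iq_closed(2) Iq_closed(3) y(2))
    have "(\<Sum>i<n. \<Sum>k<2 ^ m. scal (c i) * (gen_elt m k * y i k)) = (\<Sum>k<2 ^ m. gen_elt m k * v k)"
      unfolding v_def sum_distrib_left
      by (subst sum.swap) (simp add: scal_left_commute[of "gen_elt m _"])
    then have e: "(\<Sum>i<n. scal (c i) * (B i - (\<Sum>k<2 ^ m. gen_elt m k * y i k)))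
        = (\<Sum>i<n. scal (c i) * B i) - (\<Sum>k<2 ^ m. gen_elt m k * v k)"
      by (simp add: right_diff_distrib sum_subtractf sum_distrib_left)
    have d: "(\<Sum>k<(2::nat) ^ m. gen_elt m k * (if k = 0 then u else 0)) = gen_elt m 0 * u"
      by (simp add: if_distrib cong: if_cong)
    have "(\<Sum>k<2 ^ m. gen_elt m k * t k) = gen_elt m 0 * u - (\<Sum>k<2 ^ m. gen_elt m k * v k) - (\<Sum>k<2 ^ m. gen_elt m k * z k)"
      unfolding t_def right_diff_distrib sum_subtractf d ..
    also have "\<dots> = (gen_elt m 0 * u - (\<Sum>i<n. scal (c i) * B i) - (\<Sum>k<2 ^ m. gen_elt m k * z k))
        + (\<Sum>i<n. scal (c i) * (B i - (\<Sum>k<2 ^ m. gen_elt m k * y i k)))"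
      unfolding e by simp
    also have "\<dots> \<in> Iq m" by (intro Iq_closed(2) z sc)
    finally have "proj (t 0) = 0" by (intro gen_sum_Iq_proj tU) simp_all
    then have "f - (\<Sum>i<n. cst (c i) * proj (y i 0)) = proj (z 0)"
      using u vU z by (simp add: t_def proj_diff U0_closed(7) vp)
    then have "f - (\<Sum>i<n. cst (c i) * proj (y i 0)) \<in> M" using z by simp
    moreover have "(\<Sum>i<n. cst (c i) * proj (y i 0)) \<in> sym_laurent m"
      by (intro sym_laurent_sum sym_laurent_mult sym_laurent_cst Cartan_proj(1)[OF m] y)
    ultimately have "M +>\<^bsub>KP_sym m\<^esub> f = M +>\<^bsub>KP_sym m\<^esub> (\<Sum>i<n. cst (c i) * proj (y i 0))"
      using f by (simp add: mcl_eq_iff)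
    then show "\<exists>c. M +>\<^bsub>KP_sym m\<^esub> f = M +>\<^bsub>KP_sym m\<^esub> (\<Sum>i<n. cst (c i) * proj (y i 0))" by blast
  qed
  then show ?thesis by (rule K.fin_dim_if_spans[OF finite_lessThan])
qed

end

theorem lemma3p1:
  fixes m :: nat and M :: "laurent set" and d :: enat
  assumes "m \<ge> 1"
    and "maximalideal M (KP_sym m)"
    and "d = vdim (KP_sym m //\<^sub>m M)"
  shows "vdim (Wq m //\<^sub>m W_times m M) = 2 ^ m * d"
proof -
  interpret maximal_fibre m M using assms(1,2) by (rule maximal_fibre.intro)
  have two: "(2 :: enat) ^ m = enat (2 ^ m)" by (induction m) (simp_all add: one_enat_def numeral_eq_enat)
  show ?thesis
  proof (cases K.fin_dim)
    case True
    then obtain n :: nat and b where b: "K.spans {..<n} b" "K.indep {..<n} b" by (rule K.ex_basis_family)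
    have "d = enat n" using K.vdim_eqI[OF finite_lessThan b] assms(3) by simp
    then show ?thesis using vdim_finite[OF b] by (simp add: two)
  next
    case False
    then have "\<not> F.fin_dim" using fin_dim_if_fibre_fin_dim by blast
    then show ?thesis using False assms(3) by (simp add: vdim_def two)
  qed
qed

end
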